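(* Let $F(x;\tau,\gamma)$ be the limiting one-point distribution function of the periodic TASEP with periodic step initial condition, defined in the context. For each fixed $x\in\mathbb R$ and $\gamma\in\mathbb R$, $$\lim_{\tau\to\infty}F\left(-\tau+\frac{\pi^{1/4}}{\sqrt2}\,x\,\tau^{1/2};\tau,\gamma\right)=\frac1{\sqrt{2\pi}}\int_{-\infty}^xe^{-y^2/2}\,dy .$$
   Context: Roots and logarithms are principal. $\mathrm{Li}_s(z)=\sum_{k\ge1}z^k/k^s$ for $|z|<1$, continued analytically to $\mathbb C\setminus[1,\infty)$. For $|z|<1$: $A_1(z)=-\frac1{\sqrt{2\pi}}\mathrm{Li}_{3/2}(z)$, $A_2(z)=-\frac1{\sqrt{2\pi}}\mathrm{Li}_{5/2}(z)$, $B(z)=\frac1{4\pi}\int_0^z\frac{(\mathrm{Li}_{1/2}(y))^2}{y}dy$. For $0<|z|<1$, $\mathcal S_-=\{\xi\in\mathbb C:e^{-\xi^2/2}=z,\ \mathrm{Re}\,\xi<0\}$, a subset of the sector $3\pi/4<\arg\xi<5\pi/4$; in that sector $Q(\xi)=\sqrt{2/\pi}\int_{-\infty}^\xi\mathrm{Li}_{1/2}(e^{-s^2/2})ds$ (path in the sector) and $\Phi(\xi)=\Phi(\xi;\tau,x)=-\frac13\tau\xi^3+x\xi-Q(\xi)$. $\mathbf K_z$ is the trace class operator on $\ell^2(\mathcal S_-)$ with kernel $$\mathbf K_z(\xi_1,\xi_2)=\sum_{\eta\in\mathcal S_-}\frac{e^{\frac12\Phi(\xi_1)+\Phi(\eta)+\frac12\Phi(\xi_2)+\frac\gamma4(\xi_1^2-2\eta^2+\xi_2^2)}}{\sqrt{-\xi_1}(-\eta)(\xi_1+\eta)(\eta+\xi_2)\sqrt{-\xi_2}}.$$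 For $\tau>0$, $x,\gamma\in\mathbb R$, $$F(x;\tau,\gamma)=\oint_{|z|=R}e^{xA_1(z)+\tau A_2(z)+2B(z)}\det(\mathbf I-\mathbf K_z)\frac{dz}{2\pi iz},$$ with any $0<R<1$, counterclockwise. *)

theory Defs
  imports
    "HOL-Complex_Analysis.Complex_Analysis"
    "Jordan_Normal_Form.Determinant"
begin

(* Inside the unit disc the value is the power series itself; outside it is the value of the
   unique holomorphic extension of the series to the plane cut along [1, \<infinity>). *)
definition polylog :: "real \<Rightarrow> complex \<Rightarrow> complex" where
  "polylog s z =
     (let Li = (\<lambda>w. \<Sum>k. w ^ Suc k / of_real (real (Suc k) powr s)) in
      if norm z < 1 then Li z
      else (THE w. \<exists>f. f holomorphic_on (- (of_real ` {1..})) \<and>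
                       (\<forall>y\<in>ball 0 1. f y = Li y) \<and> f z = w))"

definition A1 :: "complex \<Rightarrow> complex" where
  "A1 z = - (1 / of_real (sqrt (2 * pi))) * polylog (3 / 2) z"

definition A2 :: "complex \<Rightarrow> complex" where
  "A2 z = - (1 / of_real (sqrt (2 * pi))) * polylog (5 / 2) z"

(* The integrand has a removable singularity at 0, where its limit 0 agrees with 0 / 0 = 0. *)
definition B :: "complex \<Rightarrow> complex" where
  "B z = 1 / of_real (4 * pi) *
     contour_integral (linepath 0 z) (\<lambda>y. (polylog (1 / 2) y)\<^sup>2 / y)"

definition S_minus :: "complex \<Rightarrow> complex set" where
  "S_minus z = {\<xi>. exp (- (\<xi>\<^sup>2 / 2)) = z \<and> Re \<xi> < 0}"

(* The path from -\<infinity> to \<xi> is the horizontal ray \<xi> + u, u \<le> 0, which stays in the sector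
   3 \<pi> / 4 < arg < 5 \<pi> / 4 whenever \<xi> lies in it. *)
definition Q :: "complex \<Rightarrow> complex" where
  "Q \<xi> = of_real (sqrt (2 / pi)) *
     integral {..0::real} (\<lambda>u. polylog (1 / 2) (exp (- ((\<xi> + of_real u)\<^sup>2 / 2))))"

definition Phi :: "real \<Rightarrow> real \<Rightarrow> complex \<Rightarrow> complex" where
  "Phi \<tau> x \<xi> = - (1 / 3) * of_real \<tau> * \<xi> ^ 3 + of_real x * \<xi> - Q \<xi>"

definition K_kernel ::
  "real \<Rightarrow> real \<Rightarrow> real \<Rightarrow> complex \<Rightarrow> complex \<Rightarrow> complex \<Rightarrow> complex" where
  "K_kernel \<tau> x \<gamma> z \<xi>1 \<xi>2 =
     (\<Sum>\<^sub>\<infinity>\<eta>\<in>S_minus z.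
        exp (1 / 2 * Phi \<tau> x \<xi>1 + Phi \<tau> x \<eta> + 1 / 2 * Phi \<tau> x \<xi>2
             + of_real (\<gamma> / 4) * (\<xi>1\<^sup>2 - 2 * \<eta>\<^sup>2 + \<xi>2\<^sup>2))
        / (csqrt (- \<xi>1) * (- \<eta>) * (\<xi>1 + \<eta>) * (\<eta> + \<xi>2) * csqrt (- \<xi>2)))"

(* det (I - K) = \<Sum>n. (-1)^n Tr (\<Lambda>^n K) for the operator on l^2(S) with kernel K. In the canonical
   basis, Tr (\<Lambda>^n K) is the sum of det (K (\<xi>_i, \<xi>_j)) over all n-tuples in S, divided by n!.
   All the sums converge absolutely when K is trace class. *)
definition fredholm_det :: "'a set \<Rightarrow> ('a \<Rightarrow> 'a \<Rightarrow> complex) \<Rightarrow> complex" where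
  "fredholm_det S K =
     (\<Sum>n. (- 1) ^ n / fact n *
        (\<Sum>\<^sub>\<infinity>\<xi>\<in>{\<xi>. length \<xi> = n \<and> set \<xi> \<subseteq> S}.
           Determinant.det (Matrix.mat n n (\<lambda>(i, j). K (\<xi> ! i) (\<xi> ! j)))))"

(* R is the radius of the integration contour; for 0 < R < 1 the value does not depend on it. *)
definition F :: "real \<Rightarrow> real \<Rightarrow> real \<Rightarrow> real \<Rightarrow> complex" where
  "F R x \<tau> \<gamma> =
     contour_integral (circlepath 0 R)
       (\<lambda>z. exp (of_real x * A1 z + of_real \<tau> * A2 z + 2 * B z)
            * fredholm_det (S_minus z) (K_kernel \<tau> x \<gamma> z)
            / (2 * of_real pi * \<i> * z))"

end

theory Submission
  imports Defs "HOL-Probability.Probability" "HOL-Real_Asymp.Real_Asymp"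
begin

text \<open>
  Put \<open>z = exp (- w / 2)\<close> and move the contour close to the imaginary \<open>w\<close>-axis. There, all terms of the
  Fredholm series are exponentially small except two: the term of order 0, which integrates to 1, and the contribution of the
  single root \<open>\<xi> = - sqrt w\<close> to the trace. So \<open>F\<close> tends to 1 minus the integral of the latter.

  In the variable \<open>s\<close> with \<open>w = s\<^sup>2\<close> that trace term on \<open>Re s < 0\<close> and the weight \<open>exp (x A1 + \<tau> A2 + 2 B)\<close> on
  \<open>Re s > 0\<close> are, up to elementary factors, one holomorphic function \<open>exp (\<tau> H + \<dots>) G\<close>, since
  the half-order polylogarithm continues through the imaginary axis. Its end points can be moved through the region \<open>Re H < 0\<close>
  into the unit disc of the right sheet, on to \<open>z = - i / 4\<close> and \<open>z = i / 4\<close>. What remains is \<open>1 / 2\<close> from the simple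
  pole at \<open>z = 0\<close> and a principal value integral along the imaginary axis of a function with a Gaussian saddle at 0.
  After the rescaling \<open>z \<mapsto> z / sqrt \<tau>\<close> it becomes the sine transform of
  \<open>exp (- t\<^sup>2 / 2) / t\<close>, that is, the error function.
\<close>

section \<open>Polylogarithms and holomorphic sums and integrals\<close>

text \<open>The centring at \<open>- \<tau>\<close> is forced by the first coefficients:
  \<open>A2 - A1\<close> has no linear term at z = 0, so the exponent is quadratic there and z lives
  on the scale 1 / sqrt \<tau>. On the vertical line the weight is controlled only by a growing
  exponential, so the trace integral cannot be estimated by absolute values; its limit comes from
  continuation. The obstacle to continuation is s = 0, that is z = 1: there
  \<open>exp (2 * B)\<close> behaves like 1 / s and \<open>Q s\<close> like - 2 ln (- s) - ln 2.
  Hence \<open>exp (- 2 * Q s)\<close> contributes 4 s^4, which cancels the 1 / (4 w^2) of the trace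
  term. The two sheets match with the right constant only because ln 2 is known exactly, and a
  double integral is evaluated for this purpose. The second obstacle is the sign of Re H, for which
  there is no closed form. Its integral representation carries the weight y^2 - y^4 / 3; on the
  curve Re (1 / z) = exp (- 3 / 2) the remaining factor changes sign at the same place y^2 = 3, so
  the sign is evident there, and only short connecting pieces need numerical estimates.\<close>

lemma polylog_eq:
  "norm z < 1 \<Longrightarrow> polylog s z = (\<Sum>k. z ^ Suc k / of_real (real (Suc k) powr s))"
  by (simp add: polylog_def Let_def)

lemma norm_polylog_term:
  assumes "s \<ge> 0"
  shows "norm (z ^ Suc k / of_real (real (Suc k) powr s)) \<le> norm (z::complex) ^ Suc k"
proof -
  have "real (Suc k) powr s \<ge> 1" using assms by (intro ge_one_powr_ge_zero) auto
  then have "norm z ^ Suc k / real (Suc k) powr s \<le> norm z ^ Suc k / 1"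
    by (intro divide_left_mono) auto
  then show ?thesis by (simp add: norm_divide norm_power norm_mult)
qed

lemma sums_power_Suc: "norm (z::'a::real_normed_field) < 1 \<Longrightarrow> (\<lambda>k. z ^ Suc k) sums (z / (1 - z))"
  using sums_mult[OF geometric_sums, of z z] by simp

lemma summable_polylog:
  assumes "norm z < 1" "s \<ge> 0"
  shows "summable (\<lambda>k. norm (z ^ Suc k / complex_of_real (real (Suc k) powr s)))"
  using norm_polylog_term[OF assms(2)]
  by (intro summable_comparison_test'[OF sums_summable[OF sums_power_Suc[of "norm z"]]]) (use assms in auto)

lemma polylog_sums:
  assumes "norm z < 1" "s \<ge> 0"
  shows "(\<lambda>k. z ^ Suc k / complex_of_real (real (Suc k) powr s)) sums polylog s z"
  using summable_norm_cancel[OF summable_polylog[OF assms]] polylog_eq[OF assms(1)]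
  by (simp add: sums_iff)

lemma norm_polylog_le:
  assumes "norm z < 1" "s \<ge> 0"
  shows "norm (polylog s z) \<le> norm z / (1 - norm z)"
proof -
  have S: "(\<lambda>k. norm z ^ Suc k) sums (norm z / (1 - norm z))"
    using sums_power_Suc[of "norm z"] assms by simp
  have "norm (polylog s z) \<le> (\<Sum>k. norm (z ^ Suc k / complex_of_real (real (Suc k) powr s)))"
    unfolding polylog_eq[OF assms(1)] by (intro summable_norm summable_polylog assms)
  also have "\<dots> \<le> (\<Sum>k. norm z ^ Suc k)"
    by (intro suminf_le norm_polylog_term summable_polylog assms sums_summable[OF S])
  finally show ?thesis using S by (simp add: sums_iff)
qed

lemma polylog_0 [simp]: "polylog s 0 = 0"
  by (simp add: polylog_def Let_def)

lemma DERIV_polylog: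
  assumes "norm z < 1" "s \<ge> 0" "z \<noteq> 0"
  shows "(polylog s has_field_derivative polylog (s - 1) z / z) (at z)"
proof -
  define c where "c n = (if n = 0 then 0 else 1 / complex_of_real (real n powr s))" for n
  obtain r where r: "norm z < r" "r < 1" using assms(1) dense by blast
  have rpos: "r > 0" using r(1) norm_ge_zero[of z] by linarith
  have ser: "polylog s x = (\<Sum>n. c n * x ^ n)" if "norm x < 1" for x
  proof -
    have "(\<lambda>k. c (Suc k) * x ^ Suc k) sums polylog s x"
      using polylog_sums[OF that assms(2)] by (simp add: c_def divide_simps mult.commute)
    then have "(\<lambda>k. c k * x ^ k) sums polylog s x"
      by (subst (asm) sums_Suc_iff) (simp add: c_def)
    then show ?thesis by (simp add: sums_iff)
  qed
  have summ: "summable (\<lambda>n. c n * complex_of_real r ^ n)"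
  proof -
    have "(\<lambda>k. c (Suc k) * of_real r ^ Suc k) sums polylog s (of_real r)"
      using polylog_sums[of "of_real r", OF _ assms(2)] r rpos by (simp add: c_def divide_simps mult.commute)
    then show ?thesis
      by (subst summable_Suc_iff[symmetric]) (rule sums_summable)
  qed
  have D: "((\<lambda>x. \<Sum>n. c n * x ^ n) has_field_derivative (\<Sum>n. diffs c n * z ^ n)) (at z)"
    using termdiffs_strong[OF summ] r rpos by simp
  have S: "summable (\<lambda>n. diffs c n * z ^ n)"
  proof (rule termdiff_converges[where K=r])
    show "norm z < r" by (fact r(1))
    fix x :: complex assume "norm x < r"
    then have "norm x < norm (complex_of_real r)" using rpos by simp
    then show "summable (\<lambda>n. c n * x ^ n)" by (rule powser_inside[OF summ])
  qed
  \<comment> \<open>The order \<open>s - 1\<close> may be negative (it is - 1 / 2 when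
    \<open>s\<close> is 1 / 2), where \<open>polylog_sums\<close> says nothing; summability comes
    from \<open>termdiff_converges\<close> instead.\<close>
  have eq: "polylog (s - 1) z / z = (\<Sum>n. diffs c n * z ^ n)"
  proof -
    have "z * (diffs c n * z ^ n) = z ^ Suc n / complex_of_real (real (Suc n) powr (s - 1))" for n
    proof -
      have "real (Suc n) powr (s - 1) = real (Suc n) powr s / real (Suc n)"
        using powr_diff[of "real (Suc n)" s 1] by simp
      then have "complex_of_real (real (Suc n) powr (s - 1)) = of_real (real (Suc n) powr s) / of_nat (Suc n)"
        by (simp del: of_nat_Suc)
      then show ?thesis by (simp add: diffs_def c_def del: of_nat_Suc)
    qed
    then have "(\<lambda>n. z ^ Suc n / complex_of_real (real (Suc n) powr (s - 1))) sums (z * (\<Sum>n. diffs c n * z ^ n))"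
      using sums_mult[OF summable_sums[OF S], of z] by simp
    then show ?thesis using polylog_eq[OF assms(1), of "s-1"] assms(3) by (simp add: sums_iff)
  qed
  have "eventually (\<lambda>x. x \<in> ball 0 1) (nhds z)"
    using assms by (intro eventually_nhds_in_open) auto
  then have "eventually (\<lambda>x. polylog s x = (\<Sum>n. c n * x ^ n)) (nhds z)"
    by eventually_elim (auto intro: ser)
  then show ?thesis
    unfolding eq using D by (subst DERIV_cong_ev) auto
qed

text \<open>The derivative formula divides by z. So 0 is treated as an isolated singularity,
  removable because \<open>norm_polylog_le\<close> gives continuity there.\<close>

lemma holomorphic_polylog:
  assumes "s \<ge> 0"
  shows "polylog s holomorphic_on ball 0 1"
proof -
  have "continuous_on (ball 0 1) (polylog s)"
  proof -
    have "isCont (polylog s) z" if "z \<in> ball 0 1" for z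
    proof (cases "z = 0")
      case True
      have "((\<lambda>w::complex. norm w / (1 - norm w)) \<longlongrightarrow> norm (0::complex) / (1 - norm (0::complex))) (at 0)"
        using tendsto_norm[OF tendsto_ident_at[of "0::complex" UNIV]]
        by (intro tendsto_divide tendsto_diff tendsto_const) auto
      then have lim: "((\<lambda>w::complex. norm w / (1 - norm w)) \<longlongrightarrow> 0) (at 0)" by simp
      have "eventually (\<lambda>w. w \<in> ball 0 1) (at (0::complex))"
        by (intro eventually_at_in_open') auto
      then have "eventually (\<lambda>w. norm (polylog s w) \<le> norm w / (1 - norm w)) (at 0)"
        by eventually_elim (auto intro!: norm_polylog_le assms)
      from Lim_null_comparison[OF this lim] have "(polylog s \<longlongrightarrow> 0) (at 0)" .
      then show ?thesis by (simp add: True isCont_def)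
    next
      case False
      then show ?thesis using that assms by (intro DERIV_isCont[OF DERIV_polylog]) auto
    qed
    then show ?thesis by (simp add: continuous_at_imp_continuous_on)
  qed
  moreover have "polylog s holomorphic_on (ball 0 1 - {0})"
    unfolding holomorphic_on_open[OF open_delete[OF open_ball]]
    using DERIV_polylog[OF _ assms] by (metis DiffD1 DiffD2 dist_0_norm insertI1 mem_ball)
  ultimately show ?thesis
    by (rule no_isolated_singularity) simp_all
qed

text \<open>Weierstrass M-test along the net of finite subsets. Kernel entries and the traces of
  exterior powers are unordered sums over \<open>int\<close> and over lists, so the sequential
  version does not cover them.\<close>

lemma holomorphic_infsum:
  assumes "open A" and holo: "\<And>i. i \<in> I \<Longrightarrow> f i holomorphic_on A"
    and bd: "\<And>i z. i \<in> I \<Longrightarrow> z \<in> A \<Longrightarrow> norm (f i z) \<le> M i" and M: "M summable_on I"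
  shows "(\<lambda>z. \<Sum>\<^sub>\<infinity>i\<in>I. f i z) holomorphic_on A"
proof -
  define S where "S z = (\<Sum>\<^sub>\<infinity>i\<in>I. f i z)" for z
  have "\<exists>f'. (S has_field_derivative f') (at z)" if "z \<in> A" for z
  proof -
    obtain r where r: "0 < r" "cball z r \<subseteq> A"
      using \<open>open A\<close> \<open>z \<in> A\<close> open_contains_cball by blast
    have ul: "uniform_limit (cball z r) (\<lambda>X y. \<Sum>x\<in>X. f x y) S (finite_subsets_at_top I)"
      unfolding S_def by (rule Weierstrass_m_test_general[OF bd M]) (use r in auto)
    have "\<forall>\<^sub>F X in finite_subsets_at_top I. continuous_on (cball z r) (\<lambda>y. \<Sum>x\<in>X. f x y) \<and>
            (\<lambda>y. \<Sum>x\<in>X. f x y) holomorphic_on ball z r"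
    proof (rule eventually_finite_subsets_at_top_weakI)
      fix X assume "finite X" "X \<subseteq> I"
      then have "(\<lambda>y. \<Sum>x\<in>X. f x y) holomorphic_on A"
        by (intro holomorphic_on_sum holo) auto
      then show "continuous_on (cball z r) (\<lambda>y. \<Sum>x\<in>X. f x y) \<and>
            (\<lambda>y. \<Sum>x\<in>X. f x y) holomorphic_on ball z r"
        using r by (meson holomorphic_on_imp_continuous_on holomorphic_on_subset ball_subset_cball subset_trans)
    qed
    from holomorphic_uniform_limit[OF this ul] have "S holomorphic_on ball z r" by auto
    then show ?thesis using r by (auto simp: holomorphic_on_open)
  qed
  then show ?thesis unfolding S_def[abs_def] by (simp add: holomorphic_on_open[OF \<open>open A\<close>])
qed

lemma holomorphic_suminf:
  assumes "open A" and holo: "\<And>n. f n holomorphic_on A"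
    and bd: "\<And>n z. z \<in> A \<Longrightarrow> norm (f n z) \<le> M n" and M: "summable M"
  shows "(\<lambda>z. \<Sum>n. f n z) holomorphic_on A"
proof (rule holomorphic_uniform_sequence[OF \<open>open A\<close>, of "\<lambda>N z. \<Sum>n<N. f n z"])
  show "(\<lambda>z. \<Sum>n<N. f n z) holomorphic_on A" for N
    by (intro holomorphic_on_sum holo)
  fix x assume "x \<in> A"
  then obtain r where r: "0 < r" "cball x r \<subseteq> A"
    using \<open>open A\<close> open_contains_cball by blast
  moreover have "uniform_limit (cball x r) (\<lambda>N z. \<Sum>n<N. f n z) (\<lambda>z. \<Sum>n. f n z) sequentially"
    by (rule Weierstrass_m_test[OF bd M]) (use r in auto)
  ultimately show "\<exists>d>0. cball x d \<subseteq> A \<and> uniform_limit (cball x d) (\<lambda>N z. \<Sum>n<N. f n z) (\<lambda>z. \<Sum>n. f n z) sequentially"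
    by blast
qed

text \<open>The integrals over [-n, n] are holomorphic by the Leibniz rule on compact intervals.
  Locally they converge uniformly, because their error is at most the tail of the integral of one
  majorant \<open>g\<close>.\<close>

lemma holomorphic_integral_real_line:
  fixes f :: "complex \<Rightarrow> real \<Rightarrow> complex"
  assumes "open A"
    and der: "\<And>s y. s \<in> A \<Longrightarrow> ((\<lambda>s. f s y) has_field_derivative f' s y) (at s)"
    and cont: "continuous_on (A \<times> UNIV) (\<lambda>(s, y). f s y)"
    and cont': "continuous_on (A \<times> UNIV) (\<lambda>(s, y). f' s y)"
    and bd: "\<And>s. s \<in> A \<Longrightarrow> \<exists>r>0. \<exists>g. g integrable_on UNIV \<and> (\<forall>s'\<in>cball s r \<inter> A. \<forall>y. norm (f s' y) \<le> g y)"
  shows "(\<lambda>s. integral UNIV (f s)) holomorphic_on A"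
    and "\<And>s. s \<in> A \<Longrightarrow> f s integrable_on UNIV"
proof -
  have contf: "continuous_on X (f s)" if "s \<in> A" for s X
  proof -
    have "continuous_on X (\<lambda>y. (\<lambda>(s, y). f s y) (s, y))"
      by (intro continuous_on_compose2[OF cont] continuous_intros) (use that in auto)
    then show ?thesis by simp
  qed
  show int: "f s integrable_on UNIV" if "s \<in> A" for s
  proof -
    obtain r g where rg: "r > 0" "g integrable_on UNIV" "\<forall>s'\<in>cball s r \<inter> A. \<forall>y. norm (f s' y) \<le> g y"
      using bd[OF \<open>s \<in> A\<close>] by metis
    have "s \<in> cball s r \<inter> A" using rg(1) that by simp
    then have "norm (f s y) \<le> g y" for y using rg(3) by blast
    moreover have "(\<lambda>x. if x \<in> UNIV then f s x else 0) integrable_on cbox a b" for a b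
      using integrable_continuous[OF contf[OF that], of a b] by simp
    ultimately show ?thesis
      using integrable_on_all_intervals_integrable_bound[of UNIV "f s" g] rg(2) by blast
  qed
  have "\<exists>f'. ((\<lambda>s. integral UNIV (f s)) has_field_derivative f') (at z)" if "z \<in> A" for z
  proof -
    obtain r1 where r1: "0 < r1" "cball z r1 \<subseteq> A"
      using \<open>open A\<close> \<open>z \<in> A\<close> open_contains_cball by blast
    obtain r2 g where r2: "r2 > 0" and gi: "g integrable_on UNIV"
      and gb: "\<forall>s'\<in>cball z r2 \<inter> A. \<forall>y. norm (f s' y) \<le> g y"
      using bd[OF \<open>z \<in> A\<close>] by metis
    define r where "r = min r1 r2"
    have r: "r > 0" "cball z r \<subseteq> A" "\<And>s y. s \<in> cball z r \<Longrightarrow> norm (f s y) \<le> g y"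
      using r1 r2 gb by (auto simp: r_def)
    have gpos: "g y \<ge> 0" for y using r(3)[of z y] r(1) norm_ge_zero[of "f z y"] by (simp del: norm_ge_zero)
    define F where "F n s = integral (cbox (- real n) (real n)) (f s)" for n s
    have holoF: "F n holomorphic_on cball z r" for n
      unfolding F_def
    proof (rule leibniz_rule_holomorphic[of _ _ _ _ f'])
      show "((\<lambda>s. f s t) has_field_derivative f' x t) (at x within cball z r)" if "x \<in> cball z r" for x t
        using der[of x t] that r(2) by (meson has_field_derivative_at_within subsetD)
      show "f x integrable_on cbox (- real n) (real n)" if "x \<in> cball z r" for x
        using that r(2) by (intro integrable_continuous contf) auto
      show "continuous_on (cball z r \<times> cbox (- real n) (real n)) (\<lambda>(x, t). f' x t)"
        by (rule continuous_on_subset[OF cont']) (use r in auto)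
    qed auto
    have gint: "(\<lambda>n. integral (cbox (- real n) (real n)) g) \<longlonglongrightarrow> integral UNIV g"
    proof -
      have "g absolutely_integrable_on UNIV"
        using gi gpos by (intro nonnegative_absolutely_integrable_1) auto
      then have i: "set_integrable lebesgue UNIV g" .
      have UN: "(\<Union>n. {- real n..real n}) = UNIV"
      proof -
        have "\<exists>n. x \<in> {- real n..real n}" for x :: real
          using real_arch_simple[of "\<bar>x\<bar>"] by (force simp: abs_le_iff)
        then show ?thesis by blast
      qed
      have "(\<lambda>n. set_lebesgue_integral lebesgue {- real n..real n} g) \<longlonglongrightarrow> set_lebesgue_integral lebesgue (\<Union>n. {- real n..real n}) g"
      proof (rule set_integral_cont_up)
        show "set_integrable lebesgue (\<Union>n. {- real n..real n}) g"
          using i unfolding UN .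
      qed (auto simp: incseq_def)
      moreover have "set_lebesgue_integral lebesgue {- real n..real n} g = integral (cbox (- real n) (real n)) g" for n
        using i by (subst set_lebesgue_integral_eq_integral(2)) (auto intro: set_integrable_subset)
      moreover have "set_lebesgue_integral lebesgue UNIV g = integral UNIV g"
        using i by (subst set_lebesgue_integral_eq_integral(2)) auto
      ultimately show ?thesis unfolding UN by simp
    qed
    have ul: "uniform_limit (cball z r) F (\<lambda>s. integral UNIV (f s)) sequentially"
    proof (rule uniform_limitI)
      fix e :: real assume "e > 0"
      then have "\<forall>\<^sub>F n in sequentially. dist (integral (cbox (- real n) (real n)) g) (integral UNIV g) < e"
        using gint by (auto simp: tendsto_iff)
      then show "\<forall>\<^sub>F n in sequentially. \<forall>s\<in>cball z r. dist (F n s) (integral UNIV (f s)) < e"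
      proof eventually_elim
        case (elim n)
        show ?case
        proof
          fix s assume s: "s \<in> cball z r"
          let ?C = "cbox (- real n) (real n)"
          have fi: "f s integrable_on UNIV" using int r(2) s by blast
          have fc: "f s integrable_on ?C" using r(2) s by (intro integrable_continuous contf) auto
          have gc: "g integrable_on ?C" using gi by (rule integrable_on_subcbox) auto
          have "((\<lambda>y. if y \<in> ?C then f s y else 0) has_integral F n s) UNIV"
            using fc unfolding F_def has_integral_restrict_UNIV by (rule integrable_integral)
          with fi have A: "((\<lambda>y. f s y - (if y \<in> ?C then f s y else 0)) has_integral (integral UNIV (f s) - F n s)) UNIV"
            by (intro has_integral_diff integrable_integral)
          have "((\<lambda>y. if y \<in> ?C then g y else 0) has_integral integral ?C g) UNIV"
            using gc unfolding has_integral_restrict_UNIV by (rule integrable_integral)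
          with gi have B: "((\<lambda>y. g y - (if y \<in> ?C then g y else 0)) has_integral (integral UNIV g - integral ?C g)) UNIV"
            by (intro has_integral_diff integrable_integral)
          \<comment> \<open>The difference is the integral of \<open>f s\<close> outside the box,
            where \<open>g\<close> dominates it; inside the box both integrands of \<open>A\<close>
            and \<open>B\<close> vanish.\<close>
          have "norm (integral UNIV (f s) - F n s) \<le> integral UNIV g - integral ?C g"
            using integral_norm_bound_integral[OF has_integral_integrable[OF A] has_integral_integrable[OF B]]
              integral_unique[OF A] integral_unique[OF B] r(3)[OF s] gpos by (auto split: if_splits)
          also have "\<dots> < e" using elim by (simp add: dist_real_def)
          finally show "dist (F n s) (integral UNIV (f s)) < e"
            by (simp add: dist_norm norm_minus_commute)
        qed
      qed
    qed
    have "\<forall>\<^sub>F n in sequentially. continuous_on (cball z r) (F n) \<and> F n holomorphic_on ball z r"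
      using holoF by (intro always_eventually allI)
        (meson holomorphic_on_imp_continuous_on holomorphic_on_subset ball_subset_cball)
    from holomorphic_uniform_limit[OF this ul] have "(\<lambda>s. integral UNIV (f s)) holomorphic_on ball z r" by auto
    then show ?thesis using r by (auto simp: holomorphic_on_open)
  qed
  then show "(\<lambda>s. integral UNIV (f s)) holomorphic_on A"
    by (simp add: holomorphic_on_open[OF \<open>open A\<close>])
qed

section \<open>The functions \<open>A1\<close>, \<open>A2\<close>, \<open>B\<close> and \<open>Q\<close>\<close>

text \<open>The squared polylogarithm vanishes to second order at 0, so the quotient tends to 0,
  which is also its value there by the convention 0 / 0 = 0.\<close>

lemma holomorphic_polylog_sq_over:
  "(\<lambda>y. (polylog (1 / 2) y)\<^sup>2 / y) holomorphic_on ball 0 1"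
proof -
  let ?g = "\<lambda>y::complex. (polylog (1 / 2) y)\<^sup>2 / y"
  have h: "?g holomorphic_on (ball 0 1 - {0})"
    by (intro holomorphic_intros holomorphic_on_subset[OF holomorphic_polylog]) auto
  have "isCont ?g z" if z: "z \<in> ball 0 1" for z
  proof (cases "z = 0")
    case True
    have "((\<lambda>w::complex. norm w / (1 - norm w)^2) \<longlongrightarrow> norm (0::complex) / (1 - norm (0::complex))^2) (at 0)"
      using tendsto_norm[OF tendsto_ident_at[of "0::complex" UNIV]]
      by (intro tendsto_divide tendsto_diff tendsto_power tendsto_const) auto
    then have lim: "((\<lambda>w::complex. norm w / (1 - norm w)^2) \<longlongrightarrow> 0) (at 0)" by simp
    have bd: "norm (?g w) \<le> norm w / (1 - norm w)^2" if "w \<in> ball 0 1" for w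
    proof (cases "w = 0")
      case False
      have "norm (polylog (1/2) w) ^ 2 \<le> (norm w / (1 - norm w)) ^ 2"
        using that by (intro power_mono norm_polylog_le) auto
      then have "norm (?g w) \<le> (norm w / (1 - norm w)) ^ 2 / norm w"
        unfolding norm_divide norm_power by (intro divide_right_mono) auto
      also have "\<dots> = norm w / (1 - norm w)^2"
        using False by (simp add: power_divide power2_eq_square)
      finally show ?thesis .
    qed simp
    have "eventually (\<lambda>w. w \<in> ball 0 1) (at (0::complex))"
      by (intro eventually_at_in_open') auto
    then have "eventually (\<lambda>w. norm (?g w) \<le> norm w / (1 - norm w)^2) (at 0)"
      by eventually_elim (rule bd)
    from Lim_null_comparison[OF this lim] have "(?g \<longlongrightarrow> 0) (at 0)" .
    then show ?thesis by (simp add: True isCont_def)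
  next
    case False
    have "open (ball 0 1 - {0::complex})" by (intro open_delete open_ball)
    with holomorphic_on_imp_continuous_on[OF h] show ?thesis
      using False z by (simp add: continuous_on_eq_continuous_at)
  qed
  then have c: "continuous_on (ball 0 1) ?g" by (simp add: continuous_at_imp_continuous_on)
  show ?thesis by (rule no_isolated_singularity[OF c h]) simp_all
qed

text \<open>The integrand is holomorphic on the whole disc, so the integral along the radial segment
  is a difference of values of a single primitive.\<close>

lemma DERIV_B:
  assumes "norm z < 1"
  shows "(B has_field_derivative (polylog (1 / 2) z)\<^sup>2 / (of_real (4 * pi) * z)) (at z)"
proof -
  let ?g = "\<lambda>y::complex. (polylog (1 / 2) y)\<^sup>2 / y"
  obtain P where P: "\<And>x. x \<in> ball 0 1 \<Longrightarrow> (P has_field_derivative ?g x) (at x)"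
    using holomorphic_convex_primitive'[OF convex_ball open_ball holomorphic_polylog_sq_over]
    by (metis at_within_open open_ball)
  have BP: "B x = 1 / of_real (4 * pi) * (P x - P 0)" if "x \<in> ball 0 1" for x
  proof -
    have "closed_segment 0 x \<subseteq> ball 0 1"
      using that by (intro closed_segment_subset convex_ball) auto
    then have im: "path_image (linepath 0 x) \<subseteq> ball 0 1" by (simp only: path_image_linepath)
    have "(?g has_contour_integral (P (pathfinish (linepath 0 x)) - P (pathstart (linepath 0 x)))) (linepath 0 x)"
      by (rule contour_integral_primitive[OF has_field_derivative_at_within[OF P] valid_path_linepath im])
    then show ?thesis unfolding B_def by (simp add: contour_integral_unique)
  qed
  have "((\<lambda>x. 1 / of_real (4 * pi) * (P x - P 0)) has_field_derivative 1 / of_real (4 * pi) * ?g z) (at z)"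
    using P[of z] assms by (auto intro!: derivative_eq_intros)
  moreover have "eventually (\<lambda>x. x \<in> ball 0 1) (nhds z)"
    using assms by (intro eventually_nhds_in_open) auto
  then have "eventually (\<lambda>x. B x = 1 / of_real (4 * pi) * (P x - P 0)) (nhds z)"
    by eventually_elim (rule BP)
  ultimately have "(B has_field_derivative 1 / of_real (4 * pi) * ?g z) (at z)"
    by (subst DERIV_cong_ev) auto
  then show ?thesis by simp
qed

lemma B_0 [simp]: "B 0 = 0" by (simp add: B_def)

lemma holomorphic_B: "B holomorphic_on ball 0 1"
  unfolding holomorphic_on_open[OF open_ball] using DERIV_B by (metis dist_0_norm mem_ball)

lemma holomorphic_A1: "A1 holomorphic_on ball 0 1"
  unfolding A1_def by (intro holomorphic_intros holomorphic_polylog) auto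

lemma holomorphic_A2: "A2 holomorphic_on ball 0 1"
  unfolding A2_def by (intro holomorphic_intros holomorphic_polylog) auto

lemma A1_0 [simp]: "A1 0 = 0" and A2_0 [simp]: "A2 0 = 0"
  by (simp_all add: A1_def A2_def)

text \<open>With z = exp (- s^2 / 2), the s-derivatives of \<open>A1\<close>, \<open>B\<close> and
  \<open>Q\<close> are polynomials in s and this one even function, and that of \<open>A2\<close> is
  - s \<open>A1\<close>. Continuing \<open>Lihalf\<close> therefore continues everything.\<close>

definition Lihalf :: "complex \<Rightarrow> complex" where
  "Lihalf s = polylog (1 / 2) (exp (- (s\<^sup>2 / 2)))"

definition left_sector :: "complex set" where
  "left_sector = {\<xi>. \<bar>Im \<xi>\<bar> < - Re \<xi>}"

definition right_sector :: "complex set" where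
  "right_sector = {\<xi>. \<bar>Im \<xi>\<bar> < Re \<xi>}"

lemma uminus_left_sector: "\<xi> \<in> left_sector \<longleftrightarrow> - \<xi> \<in> right_sector"
  by (simp add: left_sector_def right_sector_def)

lemma open_right_sector: "open right_sector"
  unfolding right_sector_def by (intro open_Collect_less continuous_intros)

lemma convex_right_sector: "convex right_sector"
proof -
  have "right_sector = {x. inner (Complex 1 (-1)) x > 0} \<inter> {x. inner (Complex 1 1) x > 0}"
    by (auto simp: right_sector_def inner_complex_def)
  then show ?thesis by (metis convex_Int convex_halfspace_gt)
qed

lemma left_sector_image: "left_sector = uminus ` right_sector"
  using uminus_left_sector by force

lemma open_left_sector: "open left_sector"
  by (simp add: left_sector_image open_right_sector open_negations)

lemma convex_left_sector: "convex left_sector"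
  by (simp add: left_sector_image convex_right_sector convex_negations)

lemma Re_power2_pos_iff: "Re (s\<^sup>2) > 0 \<longleftrightarrow> s \<in> left_sector \<or> s \<in> right_sector"
proof -
  have "Re (s\<^sup>2) > 0 \<longleftrightarrow> (Im s)\<^sup>2 < (Re s)\<^sup>2" by (simp add: power2_eq_square)
  also have "\<dots> \<longleftrightarrow> \<bar>Im s\<bar> < \<bar>Re s\<bar>" by (metis abs_le_square_iff linorder_not_le)
  finally show ?thesis by (auto simp: left_sector_def right_sector_def)
qed

lemma norm_exp_neg_half_sq: "norm (exp (- (s\<^sup>2 / 2))) = exp (- Re (s\<^sup>2) / 2)"
  by (simp add: norm_exp_eq_Re)

lemma norm_exp_neg_half_sq_less:
  "s \<in> left_sector \<or> s \<in> right_sector \<Longrightarrow> norm (exp (- (s\<^sup>2 / 2))) < 1"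
  unfolding norm_exp_neg_half_sq using Re_power2_pos_iff[of s] by simp

lemma holomorphic_Lihalf: "Lihalf holomorphic_on left_sector \<union> right_sector"
proof -
  have "(polylog (1/2) \<circ> (\<lambda>s. exp (- (s\<^sup>2 / 2)))) holomorphic_on left_sector \<union> right_sector"
    using norm_exp_neg_half_sq_less
    by (intro holomorphic_on_compose_gen[OF _ holomorphic_polylog[of "1/2"]] holomorphic_intros) (auto simp: dist_norm)
  then show ?thesis by (simp add: o_def Lihalf_def[abs_def])
qed

text \<open>The lower bound on Re (s^2) is split in two: \<open>e\<close> keeps the denominator 1 -
  |z| away from 0, and \<open>v\<close> supplies the decay.\<close>

lemma norm_Lihalf_le:
  assumes "Re (s\<^sup>2) \<ge> e + v" "e > 0" "v \<ge> 0"
  shows "norm (Lihalf s) \<le> exp (- v / 2) / (1 - exp (- e / 2))"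
proof -
  let ?z = "exp (- (s\<^sup>2 / 2))"
  have n: "norm ?z \<le> exp (- v / 2)" "norm ?z \<le> exp (- e / 2)"
    unfolding norm_exp_neg_half_sq using assms by auto
  have e1: "exp (- e / 2) < 1" using assms by simp
  have "norm (Lihalf s) \<le> norm ?z / (1 - norm ?z)"
    unfolding Lihalf_def using n e1 by (intro norm_polylog_le) auto
  also have "\<dots> \<le> exp (- v / 2) / (1 - exp (- e / 2))"
    using n e1 by (intro frac_le) auto
  finally show ?thesis .
qed

lemma integrable_gauss: "(\<lambda>u::real. exp (- (u\<^sup>2 / 2))) integrable_on UNIV"
proof -
  have "integrable lborel std_normal_density"
    using integrable_std_normal_moment[of 0] by simp
  then have "integrable lborel (\<lambda>u. sqrt (2 * pi) * std_normal_density u)" by simp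
  moreover have "(\<lambda>u. sqrt (2 * pi) * std_normal_density u) = (\<lambda>u. exp (- (u\<^sup>2 / 2)))"
    by (auto simp: std_normal_density_def)
  ultimately show ?thesis by (metis integrable_on_lborel)
qed

text \<open>The cross term 2 u Re \<xi> is nonnegative, since both factors are nonpositive. This
  gives the integrand of \<open>Q\<close> Gaussian decay along the ray.\<close>

lemma Re_shift_sq:
  assumes "\<xi> \<in> left_sector" "u \<le> 0"
  shows "Re ((\<xi> + of_real u)\<^sup>2) \<ge> Re (\<xi>\<^sup>2) + u\<^sup>2"
proof -
  have "Re \<xi> * u \<ge> 0" using assms by (intro mult_nonpos_nonpos) (auto simp: left_sector_def)
  then show ?thesis by (simp add: power2_eq_square algebra_simps)
qed

lemma shift_left_sector:
  "\<xi> \<in> left_sector \<Longrightarrow> u \<le> 0 \<Longrightarrow> \<xi> + of_real u \<in> left_sector"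
  by (simp add: left_sector_def)

lemma Lihalf_shift:
  assumes "\<xi> \<in> left_sector"
  shows "(\<lambda>u. Lihalf (\<xi> + of_real u)) integrable_on {..0::real}"
    and "Re (\<xi>\<^sup>2) \<ge> e \<Longrightarrow> e > 0 \<Longrightarrow>
      norm (integral {..0::real} (\<lambda>u. Lihalf (\<xi> + of_real u))) \<le> integral UNIV (\<lambda>u::real. exp (- (u\<^sup>2 / 2))) / (1 - exp (- e / 2))"
proof -
  have bd: "norm (Lihalf (\<xi> + of_real u)) \<le> exp (- (u\<^sup>2 / 2)) / (1 - exp (- e / 2))"
    if "Re (\<xi>\<^sup>2) \<ge> e" "e > 0" "u \<le> 0" for e u
    using norm_Lihalf_le[of e "u\<^sup>2" "\<xi> + of_real u"] Re_shift_sq[OF assms \<open>u \<le> 0\<close>] that by simp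
  have gi: "(\<lambda>u::real. exp (- (u\<^sup>2 / 2)) / (1 - exp (- e / 2))) integrable_on X" if "X \<in> sets lebesgue" for e X
  proof -
    have "(\<lambda>u::real. exp (- (u\<^sup>2 / 2))) absolutely_integrable_on UNIV"
      using integrable_gauss by (intro nonnegative_absolutely_integrable_1) auto
    then have "(\<lambda>u::real. exp (- (u\<^sup>2 / 2))) absolutely_integrable_on X"
      using that by (rule set_integrable_subset) auto
    then show ?thesis
      by (intro integrable_on_divide set_lebesgue_integral_eq_integral(1))
  qed
  have pos: "Re (\<xi>\<^sup>2) > 0" using assms unfolding Re_power2_pos_iff by simp
  have cont: "continuous_on {..0::real} (\<lambda>u. Lihalf (\<xi> + of_real u))"
    by (intro continuous_on_compose2[OF holomorphic_on_imp_continuous_on[OF holomorphic_Lihalf]] continuous_intros)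
       (use shift_left_sector[OF assms] in auto)
  have "(\<lambda>u. Lihalf (\<xi> + of_real u)) absolutely_integrable_on {..0::real}"
  proof (rule measurable_bounded_by_integrable_imp_absolutely_integrable)
    show "(\<lambda>u. Lihalf (\<xi> + of_real u)) \<in> borel_measurable (lebesgue_on {..0})"
      by (rule continuous_imp_measurable_on_sets_lebesgue[OF cont]) auto
    show "norm (Lihalf (\<xi> + of_real u)) \<le> exp (- (u\<^sup>2 / 2)) / (1 - exp (- Re (\<xi>\<^sup>2) / 2))" if "u \<in> {..0}" for u
      using bd[of "Re (\<xi>\<^sup>2)" u] pos that by auto
    show "(\<lambda>u::real. exp (- (u\<^sup>2 / 2)) / (1 - exp (- Re (\<xi>\<^sup>2) / 2))) integrable_on {..0}"
      by (rule gi) simp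
  qed simp
  then show int: "(\<lambda>u. Lihalf (\<xi> + of_real u)) integrable_on {..0::real}"
    by (rule set_lebesgue_integral_eq_integral(1))
  show "norm (integral {..0::real} (\<lambda>u. Lihalf (\<xi> + of_real u))) \<le> integral UNIV (\<lambda>u::real. exp (- (u\<^sup>2 / 2))) / (1 - exp (- e / 2))"
    if e: "Re (\<xi>\<^sup>2) \<ge> e" "e > 0"
  proof -
    have g0: "(\<lambda>u::real. exp (- (u\<^sup>2 / 2)) / (1 - exp (- e / 2))) integrable_on {..0}" by (rule gi) auto
    have "norm (integral {..0::real} (\<lambda>u. Lihalf (\<xi> + of_real u))) \<le> integral {..0} (\<lambda>u::real. exp (- (u\<^sup>2 / 2)) / (1 - exp (- e / 2)))"
      by (rule integral_norm_bound_integral[OF int g0]) (use bd e in auto)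
    also have "\<dots> \<le> integral UNIV (\<lambda>u::real. exp (- (u\<^sup>2 / 2)) / (1 - exp (- e / 2)))"
      using e by (intro integral_subset_le g0 gi) auto
    finally show ?thesis by simp
  qed
qed

lemma Q_eq: "Q \<xi> = of_real (sqrt (2 / pi)) * integral {..0::real} (\<lambda>u. Lihalf (\<xi> + of_real u))"
  by (simp add: Q_def Lihalf_def)

text \<open>The bound is uniform in \<xi> as long as Re (\<xi>^2) stays above \<open>e\<close>. On a
  vertical line Re w = e the function \<open>Q\<close> thus costs only a constant factor, for all
  roots at once.\<close>

lemma norm_Q_le:
  assumes "e > 0"
  obtains C where "C \<ge> 0" "\<And>\<xi>. \<xi> \<in> left_sector \<Longrightarrow> Re (\<xi>\<^sup>2) \<ge> e \<Longrightarrow> norm (Q \<xi>) \<le> C"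
proof
  let ?I = "integral UNIV (\<lambda>u::real. exp (- (u\<^sup>2 / 2)))"
  let ?C = "sqrt (2 / pi) * (?I / (1 - exp (- e / 2)))"
  show "?C \<ge> 0"
    using assms by (intro mult_nonneg_nonneg divide_nonneg_nonneg integral_nonneg integrable_gauss) auto
  show "norm (Q \<xi>) \<le> ?C" if "\<xi> \<in> left_sector" "Re (\<xi>\<^sup>2) \<ge> e" for \<xi>
    unfolding Q_eq norm_mult norm_of_real
    using mult_left_mono[OF Lihalf_shift(2)[OF that assms], of "sqrt (2 / pi)"] by simp
qed

text \<open>With a primitive \<open>P\<close> of \<open>Lihalf\<close> on the convex left sector,
  the improper integral at x is the limit of P x - P (x - n). Differences P (x - n) - P (\<xi> - n)
  tend to 0 by the Gaussian decay of \<open>Lihalf\<close>, so \<open>Q\<close> and the multiple of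
  \<open>P\<close> differ by a constant.\<close>

lemma DERIV_Q:
  assumes "\<xi> \<in> left_sector"
  shows "(Q has_field_derivative of_real (sqrt (2 / pi)) * Lihalf \<xi>) (at \<xi>)"
proof -
  have "Lihalf holomorphic_on left_sector"
    using holomorphic_Lihalf by (rule holomorphic_on_subset) auto
  then obtain P where P: "\<And>x. x \<in> left_sector \<Longrightarrow> (P has_field_derivative Lihalf x) (at x)"
    using holomorphic_convex_primitive' open_left_sector convex_left_sector
    by (metis at_within_open)
  have lim: "(\<lambda>n. P x - P (x - of_nat n)) \<longlonglongrightarrow> integral {..0::real} (\<lambda>u. Lihalf (x + of_real u))"
    if x: "x \<in> left_sector" for x
  proof -
    have ai: "(\<lambda>u. Lihalf (x + of_real u)) absolutely_integrable_on {..0::real}"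
    proof (rule measurable_bounded_by_integrable_imp_absolutely_integrable)
      have pos: "Re (x\<^sup>2) > 0" using x unfolding Re_power2_pos_iff by simp
      show "(\<lambda>u. Lihalf (x + of_real u)) \<in> borel_measurable (lebesgue_on {..0})"
        by (intro integrable_imp_measurable Lihalf_shift x)
      show "norm (Lihalf (x + of_real u)) \<le> exp (- (u\<^sup>2 / 2)) / (1 - exp (- Re (x\<^sup>2) / 2))" if "u \<in> {..0}" for u
        using norm_Lihalf_le[of "Re (x\<^sup>2)" "u\<^sup>2" "x + of_real u"] Re_shift_sq[OF x, of u] pos that by simp
      have "(\<lambda>u::real. exp (- (u\<^sup>2 / 2))) absolutely_integrable_on UNIV"
        using integrable_gauss by (intro nonnegative_absolutely_integrable_1) auto
      then have "(\<lambda>u::real. exp (- (u\<^sup>2 / 2))) absolutely_integrable_on {..0}"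
        by (rule set_integrable_subset) auto
      then show "(\<lambda>u::real. exp (- (u\<^sup>2 / 2)) / (1 - exp (- Re (x\<^sup>2) / 2))) integrable_on {..0}"
        by (intro integrable_on_divide set_lebesgue_integral_eq_integral(1))
    qed auto
    have UN: "(\<Union>n. {- real n..0}) = {..0}"
    proof -
      have "\<exists>n. x \<in> {- real n..0}" if "x \<le> 0" for x :: real
        using real_arch_simple[of "- x"] that by (simp add: minus_le_iff)
      then show ?thesis by fastforce
    qed
    have "(\<lambda>n. set_lebesgue_integral lebesgue {- real n..0} (\<lambda>u. Lihalf (x + of_real u)))
        \<longlonglongrightarrow> set_lebesgue_integral lebesgue (\<Union>n. {- real n..0}) (\<lambda>u. Lihalf (x + of_real u))"
    proof (rule set_integral_cont_up)
      show "set_integrable lebesgue (\<Union>n. {- real n..0}) (\<lambda>u. Lihalf (x + of_real u))"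
        unfolding UN by (rule ai)
    qed (auto simp: incseq_def)
    moreover have "set_lebesgue_integral lebesgue {- real n..0} (\<lambda>u. Lihalf (x + of_real u)) = P x - P (x - of_nat n)" for n
    proof -
      have "set_integrable lebesgue {- real n..0} (\<lambda>u. Lihalf (x + of_real u))"
        using ai by (rule set_integrable_subset) auto
      then have "set_lebesgue_integral lebesgue {- real n..0} (\<lambda>u. Lihalf (x + of_real u)) = integral {- real n..0} (\<lambda>u. Lihalf (x + of_real u))"
        by (rule set_lebesgue_integral_eq_integral(2))
      also have "((\<lambda>u. Lihalf (x + of_real u)) has_integral (P (x + of_real 0) - P (x + of_real (- real n)))) {- real n..0}"
      proof (rule fundamental_theorem_of_calculus)
        fix u assume u: "u \<in> {- real n..0}"
        have "((\<lambda>u. P (x + of_real u)) has_vector_derivative (1 * Lihalf (x + of_real u))) (at u)"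
          by (rule field_vector_diff_chain_at[where f="\<lambda>u. x + of_real u", unfolded o_def])
             (use u in \<open>auto intro!: derivative_eq_intros P shift_left_sector[OF x]\<close>)
        then show "((\<lambda>u. P (x + of_real u)) has_vector_derivative Lihalf (x + of_real u)) (at u within {- real n..0})"
          by (simp add: has_vector_derivative_at_within)
      qed simp
      then have "integral {- real n..0} (\<lambda>u. Lihalf (x + of_real u)) = P x - P (x - of_nat n)"
        by (simp add: integral_unique)
      finally show ?thesis .
    qed
    moreover have "set_lebesgue_integral lebesgue {..0} (\<lambda>u. Lihalf (x + of_real u)) = integral {..0} (\<lambda>u. Lihalf (x + of_real u))"
      by (rule set_lebesgue_integral_eq_integral(2)[OF ai])
    ultimately show ?thesis unfolding UN by simp
  qed
  have Qx: "Q x = of_real (sqrt (2 / pi)) * (P x - P \<xi>) + Q \<xi>" if x: "x \<in> left_sector" for x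
  proof -
    have "(\<lambda>n. P (x - of_nat n) - P (\<xi> - of_nat n)) \<longlonglongrightarrow> 0"
    proof (rule Lim_null_comparison)
      show "\<forall>\<^sub>F n in sequentially. norm (P (x - of_nat n) - P (\<xi> - of_nat n)) \<le> exp (- ((real n)\<^sup>2 - 1) / 2) / (1 - exp (- 1 / 2)) * norm (x - \<xi>)"
      proof (rule eventually_sequentiallyI[of 1])
        fix n :: nat assume n: "n \<ge> 1"
        let ?S = "closed_segment (\<xi> - of_nat n) (x - of_nat n)"
        have "\<xi> - of_nat n \<in> left_sector" "x - of_nat n \<in> left_sector"
          using shift_left_sector[OF x, of "- real n"] shift_left_sector[OF assms, of "- real n"] by simp_all
        then have "norm (P (x - of_nat n) - P (\<xi> - of_nat n)) \<le> exp (- ((real n)\<^sup>2 - 1) / 2) / (1 - exp (- 1 / 2)) * norm ((x - of_nat n) - (\<xi> - of_nat n))"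
        proof (intro field_differentiable_bound[of ?S P Lihalf])
          fix z assume z: "z \<in> ?S"
          have "closed_segment \<xi> x \<subseteq> left_sector"
            using x assms by (intro closed_segment_subset convex_left_sector)
          moreover have "z + of_nat n \<in> closed_segment \<xi> x"
            using z closed_segment_translation[of "of_nat n" "\<xi> - of_nat n" "x - of_nat n"] by (force simp: add.commute)
          ultimately have zn: "z + of_nat n \<in> left_sector" by blast
          then have zl: "z \<in> left_sector" using shift_left_sector[of "z + of_nat n" "- real n"] by simp
          then show "(P has_field_derivative Lihalf z) (at z within ?S)"
            by (rule has_field_derivative_at_within[OF P])
          have "Re (z\<^sup>2) \<ge> Re ((z + of_nat n)\<^sup>2) + (real n)\<^sup>2"
            using Re_shift_sq[OF zn, of "- real n"] by simp
          moreover have "Re ((z + of_nat n)\<^sup>2) > 0" using zn unfolding Re_power2_pos_iff by simp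
          moreover have "(real n)\<^sup>2 \<ge> 1" using n by simp
          ultimately show "norm (Lihalf z) \<le> exp (- ((real n)\<^sup>2 - 1) / 2) / (1 - exp (- 1 / 2))"
            by (intro norm_Lihalf_le) auto
        qed auto
        then show "norm (P (x - of_nat n) - P (\<xi> - of_nat n)) \<le> exp (- ((real n)\<^sup>2 - 1) / 2) / (1 - exp (- 1 / 2)) * norm (x - \<xi>)"
          by simp
      qed
      show "(\<lambda>n. exp (- ((real n)\<^sup>2 - 1) / 2) / (1 - exp (- 1 / 2)) * norm (x - \<xi>)) \<longlonglongrightarrow> 0"
        by (intro tendsto_mult_left_zero tendsto_divide_zero) real_asymp
    qed
    moreover have "(\<lambda>n. (P x - P (x - of_nat n)) - (P \<xi> - P (\<xi> - of_nat n)) - (P x - P \<xi>))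
      \<longlonglongrightarrow> integral {..0::real} (\<lambda>u. Lihalf (x + of_real u)) - integral {..0::real} (\<lambda>u. Lihalf (\<xi> + of_real u)) - (P x - P \<xi>)"
      by (intro tendsto_diff lim x assms tendsto_const)
    then have "(\<lambda>n. - (P (x - of_nat n) - P (\<xi> - of_nat n)))
      \<longlonglongrightarrow> integral {..0::real} (\<lambda>u. Lihalf (x + of_real u)) - integral {..0::real} (\<lambda>u. Lihalf (\<xi> + of_real u)) - (P x - P \<xi>)"
      by (simp add: algebra_simps)
    ultimately have "integral {..0::real} (\<lambda>u. Lihalf (x + of_real u)) - integral {..0::real} (\<lambda>u. Lihalf (\<xi> + of_real u)) - (P x - P \<xi>) = 0"
      using LIMSEQ_unique tendsto_minus[of "\<lambda>n. P (x - of_nat n) - P (\<xi> - of_nat n)" 0 sequentially] by fastforce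
    then have "integral {..0::real} (\<lambda>u. Lihalf (x + of_real u)) = (P x - P \<xi>) + integral {..0::real} (\<lambda>u. Lihalf (\<xi> + of_real u))"
      by (simp add: algebra_simps)
    then show ?thesis unfolding Q_eq by (simp only: distrib_left)
  qed
  have "((\<lambda>x. of_real (sqrt (2 / pi)) * (P x - P \<xi>) + Q \<xi>) has_field_derivative of_real (sqrt (2 / pi)) * Lihalf \<xi>) (at \<xi>)"
    using P[OF assms] by (auto intro!: derivative_eq_intros)
  moreover have "eventually (\<lambda>x. x \<in> left_sector) (nhds \<xi>)"
    using assms open_left_sector by (intro eventually_nhds_in_open)
  then have "eventually (\<lambda>x. Q x = of_real (sqrt (2 / pi)) * (P x - P \<xi>) + Q \<xi>) (nhds \<xi>)"
    by eventually_elim (rule Qx)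
  ultimately show ?thesis
    by (subst DERIV_cong_ev) auto
qed

section \<open>Fredholm series over the integers\<close>

text \<open>Induction by removing an element k of largest absolute value: the set lies in
  [-|k|, |k|], so its cardinality is at most 2 |k| + 1 \<le> (1 + |k|)^2. With distinct indices,
  this lets polynomial decay of the weights pay for the factorial in the expansion of a determinant,
  in place of Hadamard's inequality.\<close>

lemma fact_card_le_prod_int:
  fixes A :: "int set"
  assumes "finite A"
  shows "fact (card A) \<le> (\<Prod>k\<in>A. (1 + real_of_int \<bar>k\<bar>)\<^sup>2)"
  using assms
proof (induction "card A" arbitrary: A)
  case 0
  then show ?case by simp
next
  case (Suc n)
  then have "A \<noteq> {}" by auto
  then obtain k where k: "k \<in> A" "\<And>l. l \<in> A \<Longrightarrow> \<bar>l\<bar> \<le> \<bar>k\<bar>"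
    using Max_in[of "abs ` A"] Max_ge[of "abs ` A"] Suc.prems
    by (smt (verit, ccfv_threshold) finite_imageI image_iff image_is_empty)
  have "card A \<le> card {-\<bar>k\<bar>..\<bar>k\<bar>}" using k(2) by (intro card_mono) force+
  then have "real (card A) \<le> 2 * real_of_int \<bar>k\<bar> + 1" by simp
  also have "\<dots> \<le> (1 + real_of_int \<bar>k\<bar>)\<^sup>2" by (simp add: power2_eq_square algebra_simps)
  finally have c: "real (card A) \<le> (1 + real_of_int \<bar>k\<bar>)\<^sup>2" .
  have cA: "card A = Suc (card (A - {k}))"
    using k(1) Suc.prems by (metis card_Suc_Diff1)
  have "fact (card A) = real (card A) * fact (card (A - {k}))"
    unfolding cA by simp
  also have "\<dots> \<le> (1 + real_of_int \<bar>k\<bar>)\<^sup>2 * (\<Prod>l\<in>A - {k}. (1 + real_of_int \<bar>l\<bar>)\<^sup>2)"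
    using c Suc cA by (intro mult_mono Suc.hyps(1)) auto
  also have "\<dots> = (\<Prod>l\<in>A. (1 + real_of_int \<bar>l\<bar>)\<^sup>2)"
    by (rule prod.remove[OF Suc.prems k(1), symmetric])
  finally show ?case .
qed

lemma has_sum_prod_list:
  fixes c :: "'a \<Rightarrow> real"
  assumes nn: "\<And>k. c k \<ge> 0" and S: "(c has_sum S) UNIV"
  shows "((\<lambda>\<kappa>. prod_list (map c \<kappa>)) has_sum S ^ n) {\<kappa>. length \<kappa> = n}"
proof (induction n)
  case 0
  then show ?case by (auto simp: has_sum_finite_iff)
next
  case (Suc n)
  let ?T = "{\<kappa>::'a list. length \<kappa> = n}"
  have nnl: "prod_list (map c \<kappa>) \<ge> 0" for \<kappa> by (induction \<kappa>) (auto intro: mult_nonneg_nonneg nn)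
  have img: "{\<kappa>::'a list. length \<kappa> = Suc n} = (\<lambda>(k, \<kappa>). k # \<kappa>) ` (UNIV \<times> ?T)"
    by (force simp: length_Suc_conv)
  have inj: "inj_on (\<lambda>(k, \<kappa>). k # \<kappa>) (UNIV \<times> ?T)" by (auto simp: inj_on_def)
  let ?f = "\<lambda>(k, \<kappa>). c k * prod_list (map c \<kappa>)"
  have row: "((\<lambda>\<kappa>. ?f (k, \<kappa>)) has_sum c k * S ^ n) ?T" for k
    using has_sum_cmult_right[OF Suc.IH] by simp
  have col: "((\<lambda>k. c k * S ^ n) has_sum S * S ^ n) UNIV"
    by (rule has_sum_cmult_left[OF S])
  have "?f summable_on UNIV \<times> ?T"
    by (rule summable_on_SigmaI[OF row has_sum_imp_summable[OF col]]) (auto intro: mult_nonneg_nonneg nn nnl)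
  then have "(?f has_sum S * S ^ n) (UNIV \<times> ?T)"
    using has_sum_SigmaI[OF row col] by simp
  then show ?case
    unfolding img has_sum_reindex[OF inj] by (simp add: o_def case_prod_unfold)
qed

lemma det_mat_eq_sum:
  "Determinant.det (Matrix.mat n n (\<lambda>(i, j). a i j)) =
    (\<Sum>p\<in>{p. p permutes {0..<n}}. signof p * (\<Prod>i=0..<n. a i (p i) :: 'a :: comm_ring_1))"
proof -
  have "(\<Prod>i=0..<n. (Matrix.mat n n (\<lambda>(i, j). a i j)) $$ (i, p i)) = (\<Prod>i=0..<n. a i (p i))"
    if "p \<in> {p. p permutes {0..<n}}" for p
    using that permutes_in_image[of p "{0..<n}"] by (intro prod.cong) auto
  then have "(\<Sum>p\<in>{p. p permutes {0..<n}}. signof p * (\<Prod>i=0..<n. (Matrix.mat n n (\<lambda>(i, j). a i j)) $$ (i, p i)))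
      = (\<Sum>p\<in>{p. p permutes {0..<n}}. signof p * (\<Prod>i=0..<n. a i (p i)))"
    by (intro sum.cong) simp_all
  then show ?thesis by (subst det_def'[of _ n]) auto
qed

text \<open>For a majorant of product form every permutation gives the same product of squares,
  since the column factors are only a rearrangement of the row factors.\<close>

lemma norm_det_le_prod:
  assumes K: "\<And>k l. norm (K k l :: complex) \<le> f k * f l" and f: "\<And>k. f k \<ge> 0"
  shows "norm (Determinant.det (Matrix.mat n n (\<lambda>(i, j). K (\<kappa> ! i) (\<kappa> ! j)))) \<le> fact n * (\<Prod>i<n. (f (\<kappa> ! i))\<^sup>2)"
proof -
  let ?P = "{p. p permutes {0..<n}}"
  have "norm (Determinant.det (Matrix.mat n n (\<lambda>(i, j). K (\<kappa> ! i) (\<kappa> ! j))))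
      = norm (\<Sum>p\<in>?P. signof p * (\<Prod>i=0..<n. K (\<kappa> ! i) (\<kappa> ! p i)))"
    by (subst det_mat_eq_sum) simp
  also have "\<dots> \<le> (\<Sum>p\<in>?P. (\<Prod>i<n. (f (\<kappa> ! i))\<^sup>2))"
  proof (rule sum_norm_le)
    fix p assume p: "p \<in> ?P"
    have "norm (signof p * (\<Prod>i=0..<n. K (\<kappa> ! i) (\<kappa> ! p i))) = (\<Prod>i=0..<n. norm (K (\<kappa> ! i) (\<kappa> ! p i)))"
      by (cases p rule: sign_cases) (simp_all add: norm_mult prod_norm norm_minus_cancel)
    also have "\<dots> \<le> (\<Prod>i=0..<n. f (\<kappa> ! i) * f (\<kappa> ! p i))"
      by (intro prod_mono) (auto intro: K)
    also have "\<dots> = (\<Prod>i=0..<n. f (\<kappa> ! i)) * (\<Prod>i=0..<n. f (\<kappa> ! p i))"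
      by (rule prod.distrib)
    also have "(\<Prod>i=0..<n. f (\<kappa> ! p i)) = (\<Prod>i=0..<n. f (\<kappa> ! i))"
      using p prod.permute[of p "{0..<n}" "\<lambda>i. f (\<kappa> ! i)"] by (simp add: o_def)
    finally show "norm (signof p * (\<Prod>i=0..<n. K (\<kappa> ! i) (\<kappa> ! p i))) \<le> (\<Prod>i<n. (f (\<kappa> ! i))\<^sup>2)"
      by (simp add: power2_eq_square prod.distrib atLeast0LessThan)
  qed
  also have "\<dots> = fact n * (\<Prod>i<n. (f (\<kappa> ! i))\<^sup>2)"
    using card_permutations[of "{0..<n}" n] by simp
  finally show ?thesis .
qed

lemma det_not_distinct:
  assumes "\<not> distinct \<kappa>" "length \<kappa> = n"
  shows "Determinant.det (Matrix.mat n n (\<lambda>(i, j). K (\<kappa> ! i) (\<kappa> ! j))) = (0::complex)"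
proof -
  obtain i j where ij: "i < n" "j < n" "i \<noteq> j" "\<kappa> ! i = \<kappa> ! j"
    using assms by (auto simp: distinct_conv_nth)
  show ?thesis
    by (rule det_identical_rows[OF _ ij(3) ij(1) ij(2)]) (use ij in \<open>auto intro!: eq_vecI\<close>)
qed

text \<open>Repeated indices contribute nothing to the Fredholm series, so that the factor
  \<open>fact n\<close> from the expansion of the determinant is absorbed by the product of weights.\<close>

lemma norm_det_le_prod_list:
  assumes K: "\<And>k l. norm (K k l :: complex) \<le> f k * f l" and f: "\<And>k. f k \<ge> 0"
    and c: "\<And>\<kappa>. distinct \<kappa> \<Longrightarrow> length \<kappa> = n \<Longrightarrow> fact n * prod_list (map (\<lambda>k. (f k)\<^sup>2) \<kappa>) \<le> D * prod_list (map c \<kappa>)"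
    and c0: "\<And>k. c k \<ge> 0" and D: "D \<ge> 0" and l: "length \<kappa> = n"
  shows "norm (Determinant.det (Matrix.mat n n (\<lambda>(i, j). K (\<kappa> ! i) (\<kappa> ! j)))) \<le> D * prod_list (map c \<kappa>)"
proof (cases "distinct \<kappa>")
  case True
  have "norm (Determinant.det (Matrix.mat n n (\<lambda>(i, j). K (\<kappa> ! i) (\<kappa> ! j)))) \<le> fact n * (\<Prod>i<n. (f (\<kappa> ! i))\<^sup>2)"
    by (rule norm_det_le_prod[of K f n \<kappa>, OF K f])
  also have "\<dots> \<le> D * prod_list (map c \<kappa>)"
    using l c[OF True l] by (simp add: prod.list_conv_set_nth atLeast0LessThan)
  finally show ?thesis .
next
  case False
  have "prod_list (map c \<kappa>) \<ge> 0" by (induction \<kappa>) (auto intro: mult_nonneg_nonneg c0)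
  then show ?thesis using det_not_distinct[OF False l, of K] D by simp
qed

lemma has_sum_inverse_square_int:
  obtains S where "((\<lambda>k::int. 1 / (1 + real_of_int \<bar>k\<bar>)\<^sup>2) has_sum S) UNIV"
proof -
  let ?f = "\<lambda>k::int. 1 / (1 + real_of_int \<bar>k\<bar>)\<^sup>2"
  have "summable (\<lambda>n. 1 / (real (Suc n))\<^sup>2)"
    using inverse_power_summable[of 2, where 'a=real] summable_Suc_iff[of "\<lambda>n. inverse (real n ^ 2)"]
    by (simp add: field_simps del: of_nat_Suc)
  then have "(\<lambda>n. 1 / (real (Suc n))\<^sup>2) summable_on UNIV"
    by (intro norm_summable_imp_summable_on) simp
  then have s: "(\<lambda>n::nat. 1 / (1 + real n)\<^sup>2) summable_on UNIV" by simp
  have "(?f \<circ> int) summable_on UNIV" using s by (simp add: o_def)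
  then have 1: "?f summable_on range int"
    by (subst summable_on_reindex) (auto simp: inj_on_def)
  have "(?f \<circ> (\<lambda>n. - int n)) summable_on UNIV" using s by (simp add: o_def)
  then have 2: "?f summable_on range (\<lambda>n. - int n)"
    by (subst summable_on_reindex) (auto simp: inj_on_def)
  have "(UNIV::int set) = range int \<union> range (\<lambda>n. - int n)"
    by (auto simp: image_iff) (metis int_cases2)
  then have "?f summable_on UNIV" using summable_on_union[OF 1 2] by simp
  then show ?thesis using that has_sum_infsum by blast
qed

definition fredholm_term :: "(int \<Rightarrow> int \<Rightarrow> complex) \<Rightarrow> nat \<Rightarrow> complex" where
  "fredholm_term K n = (- 1) ^ n / fact n *
     (\<Sum>\<^sub>\<infinity>\<kappa>\<in>{\<kappa>. length \<kappa> = n}. Determinant.det (Matrix.mat n n (\<lambda>(i, j). K (\<kappa> ! i) (\<kappa> ! j))))"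

lemma fredholm_det_int: "fredholm_det UNIV K = (\<Sum>n. fredholm_term K n)"
  by (simp add: fredholm_det_def fredholm_term_def)

text \<open>The pair \<open>D\<close>, \<open>c\<close> leaves open how the factorial is treated.
  For holomorphy it is absorbed into \<open>c\<close> with \<open>D\<close> equal to 1; for the
  approximation it is kept in \<open>D\<close> and cancels against the denominator.\<close>

lemma norm_fredholm_term_le:
  assumes K: "\<And>k l. norm (K k l :: complex) \<le> f k * f l" and f: "\<And>k. f k \<ge> 0"
    and c: "\<And>\<kappa>. distinct \<kappa> \<Longrightarrow> length \<kappa> = n \<Longrightarrow> fact n * prod_list (map (\<lambda>k. (f k)\<^sup>2) \<kappa>) \<le> D * prod_list (map c \<kappa>)"
    and c0: "\<And>k. c k \<ge> 0" and D: "D \<ge> 0" and S: "(c has_sum S) UNIV"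
  shows "norm (fredholm_term K n) \<le> D * S ^ n / fact n"
proof -
  let ?d = "\<lambda>\<kappa>. Determinant.det (Matrix.mat n n (\<lambda>(i, j). K (\<kappa> ! i) (\<kappa> ! j)))"
  have hs: "((\<lambda>\<kappa>. D * prod_list (map c \<kappa>)) has_sum D * S ^ n) {\<kappa>. length \<kappa> = n}"
    by (intro has_sum_cmult_right has_sum_prod_list c0 S)
  have le: "norm (?d \<kappa>) \<le> D * prod_list (map c \<kappa>)" if "length \<kappa> = n" for \<kappa>
    by (rule norm_det_le_prod_list[OF K f c c0 D that])
  have summ: "(\<lambda>\<kappa>. norm (?d \<kappa>)) summable_on {\<kappa>. length \<kappa> = n}"
    by (rule summable_on_comparison_test[OF has_sum_imp_summable[OF hs]]) (use le in auto)
  then have "norm (\<Sum>\<^sub>\<infinity>\<kappa>\<in>{\<kappa>. length \<kappa> = n}. ?d \<kappa>) \<le> (\<Sum>\<^sub>\<infinity>\<kappa>\<in>{\<kappa>. length \<kappa> = n}. norm (?d \<kappa>))"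
    by (rule norm_infsum_bound)
  also have "\<dots> \<le> D * S ^ n"
    by (rule has_sum_mono[OF has_sum_infsum hs]) (use le summ in auto)
  finally show ?thesis
    by (simp add: fredholm_term_def norm_mult norm_divide norm_power divide_right_mono)
qed

text \<open>Of the four powers of decay, two pay for \<open>fact n\<close> through
  \<open>fact_card_le_prod_int\<close>, and two remain to make the sum over the indices
  converge.\<close>

lemma prod_list_weight_bound:
  fixes g :: "int \<Rightarrow> real"
  assumes d: "distinct \<kappa>" "length \<kappa> = n" and g: "\<And>k. 0 \<le> g k" "\<And>k. g k \<le> M / (1 + real_of_int \<bar>k\<bar>) ^ 4"
    and M: "M \<ge> 0"
  shows "fact n * prod_list (map g \<kappa>) \<le> 1 * prod_list (map (\<lambda>k. M * (1 / (1 + real_of_int \<bar>k\<bar>)\<^sup>2)) \<kappa>)"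
proof -
  have c: "card (set \<kappa>) = n" using d by (simp add: distinct_card)
  have pl: "prod_list (map h \<kappa>) = (\<Prod>k\<in>set \<kappa>. h k)" for h :: "int \<Rightarrow> real"
    using d(1) by (simp add: prod.distinct_set_conv_list)
  have "fact n * prod_list (map g \<kappa>) \<le> (\<Prod>k\<in>set \<kappa>. (1 + real_of_int \<bar>k\<bar>)\<^sup>2) * (\<Prod>k\<in>set \<kappa>. g k)"
    unfolding pl using fact_card_le_prod_int[of "set \<kappa>"] c g by (intro mult_right_mono prod_nonneg) auto
  also have "\<dots> = (\<Prod>k\<in>set \<kappa>. (1 + real_of_int \<bar>k\<bar>)\<^sup>2 * g k)" by (simp add: prod.distrib)
  also have "\<dots> \<le> (\<Prod>k\<in>set \<kappa>. M * (1 / (1 + real_of_int \<bar>k\<bar>)\<^sup>2))"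
  proof (intro prod_mono conjI)
    fix k assume "k \<in> set \<kappa>"
    show "0 \<le> (1 + real_of_int \<bar>k\<bar>)\<^sup>2 * g k" using g by simp
    have p: "(1 + real_of_int \<bar>k\<bar>)\<^sup>2 > 0" by (simp add: add_pos_nonneg)
    have "(1 + real_of_int \<bar>k\<bar>)\<^sup>2 * g k \<le> (1 + real_of_int \<bar>k\<bar>)\<^sup>2 * (M / (1 + real_of_int \<bar>k\<bar>) ^ 4)"
      using g by (intro mult_left_mono) auto
    also have "\<dots> = M * (1 / (1 + real_of_int \<bar>k\<bar>)\<^sup>2)"
    proof -
      have "(1 + real_of_int \<bar>k\<bar>) ^ 4 = (1 + real_of_int \<bar>k\<bar>)\<^sup>2 * (1 + real_of_int \<bar>k\<bar>)\<^sup>2"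
        by (simp flip: power_add)
      with p show ?thesis by (simp only:) (simp add: divide_simps)
    qed
    finally show "(1 + real_of_int \<bar>k\<bar>)\<^sup>2 * g k \<le> M * (1 / (1 + real_of_int \<bar>k\<bar>)\<^sup>2)" .
  qed
  finally show ?thesis by (simp add: pl)
qed

lemma holomorphic_fredholm_det:
  assumes A: "open A" and holo: "\<And>k l. (\<lambda>w. K w k l) holomorphic_on A"
    and K: "\<And>w k l. w \<in> A \<Longrightarrow> norm (K w k l :: complex) \<le> f k * f l" and f: "\<And>k. f k \<ge> 0"
    and fM: "\<And>k. (f k)\<^sup>2 \<le> M / (1 + real_of_int \<bar>k\<bar>) ^ 4" and M: "M \<ge> 0"
  shows "(\<lambda>w. fredholm_det UNIV (K w)) holomorphic_on A"
proof -
  obtain S where S: "((\<lambda>k::int. 1 / (1 + real_of_int \<bar>k\<bar>)\<^sup>2) has_sum S) UNIV"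
    by (rule has_sum_inverse_square_int)
  let ?c = "\<lambda>k::int. M * (1 / (1 + real_of_int \<bar>k\<bar>)\<^sup>2)"
  have cS: "(?c has_sum M * S) UNIV" by (rule has_sum_cmult_right[OF S])
  have c0: "?c k \<ge> 0" for k using M by simp
  have cb: "fact n * prod_list (map (\<lambda>k. (f k)\<^sup>2) \<kappa>) \<le> 1 * prod_list (map ?c \<kappa>)"
    if "distinct \<kappa>" "length \<kappa> = n" for \<kappa> n
    by (rule prod_list_weight_bound[OF that _ fM M]) auto
  have "(\<lambda>w. \<Sum>\<^sub>\<infinity>\<kappa>\<in>{\<kappa>. length \<kappa> = n}. Determinant.det (Matrix.mat n n (\<lambda>(i, j). K w (\<kappa> ! i) (\<kappa> ! j)))) holomorphic_on A" for n
  proof (rule holomorphic_infsum[OF A])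
    fix \<kappa> :: "int list" assume \<kappa>: "\<kappa> \<in> {\<kappa>. length \<kappa> = n}"
    show "(\<lambda>w. Determinant.det (Matrix.mat n n (\<lambda>(i, j). K w (\<kappa> ! i) (\<kappa> ! j)))) holomorphic_on A"
      unfolding det_mat_eq_sum by (intro holomorphic_intros holo)
    show "norm (Determinant.det (Matrix.mat n n (\<lambda>(i, j). K w (\<kappa> ! i) (\<kappa> ! j)))) \<le> 1 * prod_list (map ?c \<kappa>)"
      if "w \<in> A" for w
      by (rule norm_det_le_prod_list[of "K w" f, OF K[OF that] f cb c0]) (use \<kappa> in auto)
  next
    show "(\<lambda>\<kappa>. 1 * prod_list (map ?c \<kappa>)) summable_on {\<kappa>. length \<kappa> = n}"
      using has_sum_imp_summable[OF has_sum_prod_list[OF c0 cS]] by simp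
  qed
  then have holo_term: "(\<lambda>w. fredholm_term (K w) n) holomorphic_on A" for n
    unfolding fredholm_term_def by (intro holomorphic_intros)
  show ?thesis
    unfolding fredholm_det_int
  proof (rule holomorphic_suminf[OF A holo_term])
    show "norm (fredholm_term (K w) n) \<le> 1 * (M * S) ^ n / fact n" if "w \<in> A" for w n
      by (rule norm_fredholm_term_le[of "K w" f, OF K[OF that] f cb c0 _ cS]) auto
    show "summable (\<lambda>n. 1 * (M * S) ^ n / fact n)"
      using summable_exp[of "M * S"] by (simp add: divide_inverse mult.commute)
  qed
qed

lemma fredholm_term_0: "fredholm_term K 0 = 1"
  by (simp add: fredholm_term_def)

lemma fredholm_term_1: "fredholm_term K 1 = - (\<Sum>\<^sub>\<infinity>k. K k k)"
proof -
  have img: "{\<kappa>::int list. length \<kappa> = 1} = (\<lambda>k. [k]) ` UNIV"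
    by (auto simp: length_Suc_conv)
  have "(\<Sum>\<^sub>\<infinity>\<kappa>\<in>{\<kappa>::int list. length \<kappa> = 1}. Determinant.det (Matrix.mat 1 1 (\<lambda>(i, j). K (\<kappa> ! i) (\<kappa> ! j)))) = (\<Sum>\<^sub>\<infinity>k. K k k)"
    unfolding img by (subst infsum_reindex) (auto simp: inj_on_def o_def det_single)
  then show ?thesis by (simp add: fredholm_term_def)
qed

text \<open>Here \<open>d 0\<close> may be large and the other \<open>d k\<close> are small.  Since a list of distinct
  indices contains \<open>0\<close> at most once, its weight is at most \<open>D / \<delta>\<close> times the
  weight in which \<open>d 0\<close> is replaced by \<open>\<delta>\<close>.\<close>

lemma prod_list_one_large:
  fixes d :: "int \<Rightarrow> real"
  assumes "distinct \<kappa>" and d: "\<And>k. d k \<ge> 0" "d 0 \<le> D" and l: "0 < \<delta>" "\<delta> \<le> D"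
  shows "prod_list (map d \<kappa>) \<le> D / \<delta> * prod_list (map (d(0 := \<delta>)) \<kappa>)"
proof -
  have pl: "prod_list (map h \<kappa>) = (\<Prod>k\<in>set \<kappa>. h k)" for h :: "int \<Rightarrow> real"
    using assms(1) by (simp add: prod.distinct_set_conv_list)
  have 1: "(\<Prod>k\<in>X. (d(0 := \<delta>)) k) = (\<Prod>k\<in>X. d k)" if "0 \<notin> X" for X
    using that by (intro prod.cong) auto
  have nn: "(\<Prod>k\<in>X. d k) \<ge> 0" for X by (intro prod_nonneg) (auto intro: d)
  show ?thesis
  proof (cases "0 \<in> set \<kappa>")
    case True
    have "(\<Prod>k\<in>set \<kappa>. d k) = d 0 * (\<Prod>k\<in>set \<kappa> - {0}. d k)"
      using True by (simp add: prod.remove)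
    also have "\<dots> \<le> D * (\<Prod>k\<in>set \<kappa> - {0}. d k)" by (intro mult_right_mono d nn)
    also have "\<dots> = D / \<delta> * (\<delta> * (\<Prod>k\<in>set \<kappa> - {0}. (d(0 := \<delta>)) k))"
      using l 1[of "set \<kappa> - {0}"] by simp
    also have "\<delta> * (\<Prod>k\<in>set \<kappa> - {0}. (d(0 := \<delta>)) k) = (\<Prod>k\<in>set \<kappa>. (d(0 := \<delta>)) k)"
      using True prod.remove[of "set \<kappa>" 0 "d(0 := \<delta>)"] by simp
    finally show ?thesis by (simp add: pl)
  next
    case False
    have "1 * (\<Prod>k\<in>set \<kappa>. d k) \<le> D / \<delta> * (\<Prod>k\<in>set \<kappa>. d k)"
      using l by (intro mult_right_mono nn) auto
    then show ?thesis using 1[OF False] by (simp add: pl)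
  qed
qed

text \<open>Once the large weight at index 0 is traded for \<delta>, the total weight is \<delta> +
  s \<le> 2 \<delta>, so the term of order n is at most (D / \<delta>) (2 \<delta>)^n. From n = 2 on
  this sums to 4 D \<delta> / (1 - 2 \<delta>) \<le> 8 D \<delta>; orders 0 and 1 are 1 and minus
  the trace.\<close>

lemma fredholm_det_approx:
  fixes K :: "int \<Rightarrow> int \<Rightarrow> complex"
  assumes K: "\<And>k l. norm (K k l :: complex) \<le> f k * f l" and f: "\<And>k. f k \<ge> 0"
    and f0: "(f 0)\<^sup>2 \<le> D" and s: "((\<lambda>k. (f k)\<^sup>2) has_sum s) (- {0})" "s \<le> \<delta>"
    and l: "0 < \<delta>" "\<delta> \<le> D" "\<delta> \<le> 1 / 4"
  shows "norm (fredholm_det UNIV K - (1 - (\<Sum>\<^sub>\<infinity>k. K k k))) \<le> 8 * D * \<delta>"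
proof -
  let ?c = "(\<lambda>k. (f k)\<^sup>2)(0 := \<delta>)"
  have "(?c has_sum s) (- {0})"
    using s(1) by (subst has_sum_cong[where g="\<lambda>k. (f k)\<^sup>2"]) auto
  then have "(?c has_sum (?c 0 + s)) (insert 0 (- {0}))"
    by (intro has_sum_insert) auto
  moreover have "insert (0::int) (- {0}) = UNIV" by auto
  ultimately have cS: "(?c has_sum (\<delta> + s)) UNIV" by (simp only: fun_upd_same)
  have s0: "s \<ge> 0" by (rule has_sum_nonneg[OF s(1)]) simp
  have D: "D > 0" using l by linarith
  have bd: "norm (fredholm_term K n) \<le> D / \<delta> * (2 * \<delta>) ^ n" for n
  proof -
    have "norm (fredholm_term K n) \<le> (fact n * (D / \<delta>)) * (\<delta> + s) ^ n / fact n"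
    proof (rule norm_fredholm_term_le[OF K f _ _ _ cS])
      show "fact n * prod_list (map (\<lambda>k. (f k)\<^sup>2) \<kappa>) \<le> fact n * (D / \<delta>) * prod_list (map ?c \<kappa>)"
        if "distinct \<kappa>" for \<kappa>
        unfolding mult.assoc
        by (intro mult_left_mono prod_list_one_large[OF that]) (use f0 l in auto)
      show "?c k \<ge> 0" for k using l by simp
      show "fact n * (D / \<delta>) \<ge> 0" using l D by simp
    qed
    also have "\<dots> = D / \<delta> * (\<delta> + s) ^ n" by simp
    also have "\<dots> \<le> D / \<delta> * (2 * \<delta>) ^ n"
      using l D s0 s(2) by (intro mult_left_mono power_mono) auto
    finally show ?thesis .
  qed
  have geo: "(\<lambda>n. D / \<delta> * (2 * \<delta>) ^ n) sums (D / \<delta> * (1 / (1 - 2 * \<delta>)))"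
    using l by (intro sums_mult geometric_sums) auto
  have summ: "summable (\<lambda>n. norm (fredholm_term K n))"
    by (rule summable_comparison_test'[OF sums_summable[OF geo]]) (use bd in auto)
  have "fredholm_det UNIV K = (\<Sum>n. fredholm_term K (n + 2)) + (\<Sum>n<2. fredholm_term K n)"
    unfolding fredholm_det_int by (rule suminf_split_initial_segment[OF summable_norm_cancel[OF summ]])
  also have "(\<Sum>n<2. fredholm_term K n) = 1 - (\<Sum>\<^sub>\<infinity>k. K k k)"
    using fredholm_term_1[of K] by (simp add: numeral_2_eq_2 fredholm_term_0)
  finally have "norm (fredholm_det UNIV K - (1 - (\<Sum>\<^sub>\<infinity>k. K k k))) = norm (\<Sum>n. fredholm_term K (n + 2))"
    by simp
  also have "\<dots> \<le> (\<Sum>n. norm (fredholm_term K (n + 2)))"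
    using summable_ignore_initial_segment[OF summ, of 2] by (intro summable_norm)
  also have "\<dots> \<le> (\<Sum>n. D / \<delta> * (2 * \<delta>) ^ (n + 2))"
  proof (rule suminf_le)
    show "norm (fredholm_term K (n + 2)) \<le> D / \<delta> * (2 * \<delta>) ^ (n + 2)" for n by (rule bd)
    show "summable (\<lambda>n. norm (fredholm_term K (n + 2)))"
      using summ summable_iff_shift[of "\<lambda>n. norm (fredholm_term K n)" 2] by simp
    show "summable (\<lambda>n. D / \<delta> * (2 * \<delta>) ^ (n + 2))"
      using sums_summable[OF geo] summable_iff_shift[of "\<lambda>n. D / \<delta> * (2 * \<delta>) ^ n" 2] by simp
  qed
  also have "\<dots> = 4 * D * \<delta> * (1 / (1 - 2 * \<delta>))"
  proof -
    have "(\<lambda>n. 4 * D * \<delta> * (2 * \<delta>) ^ n) sums (4 * D * \<delta> * (1 / (1 - 2 * \<delta>)))"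
      using l by (intro sums_mult geometric_sums) auto
    moreover have "(\<lambda>n. 4 * D * \<delta> * (2 * \<delta>) ^ n) = (\<lambda>n. D / \<delta> * (2 * \<delta>) ^ (n + 2))"
      using l by (auto simp: power_add power2_eq_square)
    ultimately show ?thesis by (simp add: sums_iff)
  qed
  also have "\<dots> \<le> 4 * D * \<delta> * 2"
    using l D by (intro mult_left_mono) (auto simp: divide_simps)
  finally show ?thesis by simp
qed

section \<open>The kernel in the half plane\<close>

text \<open>With \<open>z = exp (- w / 2)\<close>, the set \<open>S_minus z\<close> consists of the points \<open>- rt k w\<close>.\<close>

definition rt :: "int \<Rightarrow> complex \<Rightarrow> complex" where
  "rt k w = csqrt (w + 4 * of_real pi * \<i> * of_int k)"

lemma rt_power2: "(rt k w)\<^sup>2 = w + 4 * of_real pi * \<i> * of_int k"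
  by (simp add: rt_def)

lemma rt_sq_parts:
  shows "(Re (rt k w))\<^sup>2 = (norm (w + 4 * of_real pi * \<i> * of_int k) + Re w) / 2"
    and "(Im (rt k w))\<^sup>2 = (norm (w + 4 * of_real pi * \<i> * of_int k) - Re w) / 2"
proof -
  have 1: "(Re (rt k w))\<^sup>2 - (Im (rt k w))\<^sup>2 = Re w"
    using arg_cong[OF rt_power2[of k w], of Re] by (simp add: power2_eq_square)
  have "(Re (rt k w))\<^sup>2 + (Im (rt k w))\<^sup>2 = norm ((rt k w)\<^sup>2)"
    unfolding norm_power cmod_power2 ..
  then have 2: "(Re (rt k w))\<^sup>2 + (Im (rt k w))\<^sup>2 = norm (w + 4 * of_real pi * \<i> * of_int k)"
    unfolding rt_power2 .
  show "(Re (rt k w))\<^sup>2 = (norm (w + 4 * of_real pi * \<i> * of_int k) + Re w) / 2"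
    "(Im (rt k w))\<^sup>2 = (norm (w + 4 * of_real pi * \<i> * of_int k) - Re w) / 2"
    using 1 2 by simp_all
qed

lemma Re_rt_pos:
  assumes "Re w > 0"
  shows "Re (rt k w) > 0"
proof -
  have "(Re (rt k w))\<^sup>2 > 0"
    unfolding rt_sq_parts by (intro divide_pos_pos add_nonneg_pos assms) auto
  moreover have "Re (rt k w) \<ge> 0"
    using csqrt_principal[of "w + 4 * of_real pi * \<i> * of_int k"] by (auto simp: rt_def)
  ultimately show ?thesis by (metis order_le_less zero_eq_power2 less_irrefl)
qed

lemma rt_right_sector: "Re w > 0 \<Longrightarrow> rt k w \<in> right_sector"
proof -
  assume w: "Re w > 0"
  have "Re ((rt k w)\<^sup>2) > 0" unfolding rt_power2 using w by simp
  then show ?thesis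
    using Re_rt_pos[OF w, of k] unfolding Re_power2_pos_iff by (auto simp: left_sector_def)
qed

lemma minus_rt_left_sector: "Re w > 0 \<Longrightarrow> - rt k w \<in> left_sector"
  using rt_right_sector by (simp add: uminus_left_sector)

lemma holomorphic_rt: "rt k holomorphic_on {w. Re w > 0}"
proof -
  have "(\<lambda>w. csqrt (w + 4 * of_real pi * \<i> * of_int k)) holomorphic_on {w. Re w > 0}"
    by (intro holomorphic_intros) (auto simp: complex_nonpos_Reals_iff)
  then show ?thesis by (simp add: rt_def[abs_def])
qed

lemma S_minus_exp:
  assumes "Re w > 0"
  shows "bij_betw (\<lambda>k. - rt k w) UNIV (S_minus (exp (- (w / 2))))"
proof -
  have inj: "inj (\<lambda>k. - rt k w)"
  proof
    fix k l assume "- rt k w = - rt l w"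
    then have "(rt k w)\<^sup>2 = (rt l w)\<^sup>2" by simp
    then show "k = l" unfolding rt_power2 by simp
  qed
  have "\<xi> \<in> S_minus (exp (- (w / 2))) \<longleftrightarrow> \<xi> \<in> range (\<lambda>k. - rt k w)" for \<xi>
  proof
    assume "\<xi> \<in> S_minus (exp (- (w / 2)))"
    then have e: "exp (- (\<xi>\<^sup>2 / 2)) = exp (- (w / 2))" and neg: "Re \<xi> < 0"
      by (auto simp: S_minus_def)
    from e obtain n :: int where n: "- (\<xi>\<^sup>2 / 2) = - (w / 2) + (of_int (2 * n) * pi) * \<i>"
      unfolding exp_eq by blast
    have "\<xi>\<^sup>2 = - 2 * (- (\<xi>\<^sup>2 / 2))" by simp
    also have "\<dots> = w + 4 * of_real pi * \<i> * of_int (- n)" unfolding n by (simp add: algebra_simps)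
    finally have "rt (- n) w = csqrt ((- \<xi>)\<^sup>2)" by (simp add: rt_def)
    also have "\<dots> = - \<xi>" using neg by (intro csqrt_square) auto
    finally show "\<xi> \<in> range (\<lambda>k. - rt k w)" by (intro image_eqI[of _ _ "- n"]) simp_all
  next
    assume "\<xi> \<in> range (\<lambda>k. - rt k w)"
    then obtain k where k: "\<xi> = - rt k w" by blast
    have sq: "\<xi>\<^sup>2 = w + 4 * of_real pi * \<i> * of_int k" unfolding k power2_minus rt_power2 ..
    have "- (\<xi>\<^sup>2 / 2) = - (w / 2) + (of_int (2 * (- k)) * pi) * \<i>"
      unfolding sq by (simp add: add_divide_distrib)
    then have "exp (- (\<xi>\<^sup>2 / 2)) = exp (- (w / 2))"
      by (metis exp_eq)
    then show "\<xi> \<in> S_minus (exp (- (w / 2)))"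
      using Re_rt_pos[OF assms, of k] by (simp add: S_minus_def k)
  qed
  then show ?thesis using inj by (auto simp: bij_betw_def)
qed

lemma fredholm_det_reindex:
  fixes f :: "'b \<Rightarrow> 'a"
  assumes "bij_betw f UNIV S"
  shows "fredholm_det S K = fredholm_det UNIV (\<lambda>k l. K (f k) (f l))"
proof -
  have inj: "inj f" and S: "S = range f" using assms by (auto simp: bij_betw_def)
  have "(\<Sum>\<^sub>\<infinity>\<xi>\<in>{\<xi>. length \<xi> = n \<and> set \<xi> \<subseteq> S}. Determinant.det (Matrix.mat n n (\<lambda>(i, j). K (\<xi> ! i) (\<xi> ! j))))
      = (\<Sum>\<^sub>\<infinity>\<kappa>\<in>{\<kappa>::'b list. length \<kappa> = n \<and> set \<kappa> \<subseteq> UNIV}. Determinant.det (Matrix.mat n n (\<lambda>(i, j). K (f (\<kappa> ! i)) (f (\<kappa> ! j)))))" for n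
  proof -
    have img: "{\<xi>. length \<xi> = n \<and> set \<xi> \<subseteq> S} = map f ` {\<kappa>::'b list. length \<kappa> = n \<and> set \<kappa> \<subseteq> UNIV}"
    proof (intro equalityI subsetI)
      fix \<xi> assume "\<xi> \<in> {\<xi>. length \<xi> = n \<and> set \<xi> \<subseteq> S}"
      then have "\<xi> = map f (map (inv_into UNIV f) \<xi>)" "length \<xi> = n"
        by (auto simp: S f_inv_into_f intro!: map_idI[symmetric])
      then show "\<xi> \<in> map f ` {\<kappa>::'b list. length \<kappa> = n \<and> set \<kappa> \<subseteq> UNIV}"
        by (intro image_eqI[of _ _ "map (inv_into UNIV f) \<xi>"]) auto
    qed (auto simp: S)
    have "inj_on (map f) {\<kappa>. length \<kappa> = n \<and> set \<kappa> \<subseteq> UNIV}"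
      using inj by (simp add: inj_on_def inj_map_eq_map)
    then show ?thesis
      unfolding img
    proof (subst infsum_reindex, assumption, intro infsum_cong)
      fix \<kappa> :: "'b list" assume "\<kappa> \<in> {\<kappa>. length \<kappa> = n \<and> set \<kappa> \<subseteq> UNIV}"
      then have l: "length \<kappa> = n" by simp
      show "((\<lambda>\<xi>. Determinant.det (Matrix.mat n n (\<lambda>(i, j). K (\<xi> ! i) (\<xi> ! j)))) \<circ> map f) \<kappa>
        = Determinant.det (Matrix.mat n n (\<lambda>(i, j). K (f (\<kappa> ! i)) (f (\<kappa> ! j))))"
        unfolding o_def by (intro arg_cong[of _ _ Determinant.det] eq_matI) (use l in auto)
    qed
  qed
  then show ?thesis by (simp add: fredholm_det_def)
qed

text \<open>In the combination \<xi>1^2 - 2 \<eta>^2 + \<xi>2^2 the variable w cancels, and \<gamma>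
  enters only through a factor of modulus 1. It therefore affects no norm estimate, and at k = l = m
  = 0 the factor is 1: this is why the limit does not depend on \<gamma>.\<close>

definition kterm :: "real \<Rightarrow> real \<Rightarrow> real \<Rightarrow> int \<Rightarrow> int \<Rightarrow> int \<Rightarrow> complex \<Rightarrow> complex" where
  "kterm \<tau> x \<gamma> k l m w =
     exp (1 / 2 * Phi \<tau> x (- rt k w) + Phi \<tau> x (- rt m w) + 1 / 2 * Phi \<tau> x (- rt l w)
          + of_real (\<gamma> * pi * of_int (k - 2 * m + l)) * \<i>)
     / (csqrt (rt k w) * rt m w * (rt k w + rt m w) * (rt m w + rt l w) * csqrt (rt l w))"

definition Kmat :: "real \<Rightarrow> real \<Rightarrow> real \<Rightarrow> complex \<Rightarrow> int \<Rightarrow> int \<Rightarrow> complex" where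
  "Kmat \<tau> x \<gamma> w k l = (\<Sum>\<^sub>\<infinity>m. kterm \<tau> x \<gamma> k l m w)"

lemma K_kernel_eq:
  assumes "Re w > 0"
  shows "K_kernel \<tau> x \<gamma> (exp (- (w / 2))) (- rt k w) (- rt l w) = Kmat \<tau> x \<gamma> w k l"
  unfolding K_kernel_def Kmat_def
proof (subst infsum_reindex_bij_betw[OF S_minus_exp[OF assms], symmetric], intro infsum_cong)
  fix m
  have e: "of_real (\<gamma> / 4) * ((- rt k w)\<^sup>2 - 2 * (- rt m w)\<^sup>2 + (- rt l w)\<^sup>2) = of_real (\<gamma> * pi * of_int (k - 2 * m + l)) * \<i>"
    unfolding power2_minus rt_power2 by (simp add: algebra_simps)
  have d: "(- rt k w + - rt m w) * (- rt m w + - rt l w) = (rt k w + rt m w) * (rt m w + rt l w)"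
    by (simp add: algebra_simps)
  have d2: "csqrt (- (- rt k w)) * - (- rt m w) * (- rt k w + - rt m w) * (- rt m w + - rt l w) * csqrt (- (- rt l w))
      = csqrt (rt k w) * rt m w * (rt k w + rt m w) * (rt m w + rt l w) * csqrt (rt l w)"
    using d by (simp add: mult.assoc)
  show "exp (1 / 2 * Phi \<tau> x (- rt k w) + Phi \<tau> x (- rt m w) + 1 / 2 * Phi \<tau> x (- rt l w)
       + of_real (\<gamma> / 4) * ((- rt k w)\<^sup>2 - 2 * (- rt m w)\<^sup>2 + (- rt l w)\<^sup>2))
      / (csqrt (- (- rt k w)) * - (- rt m w) * (- rt k w + - rt m w) * (- rt m w + - rt l w) * csqrt (- (- rt l w)))
    = kterm \<tau> x \<gamma> k l m w"
    unfolding e d2 kterm_def ..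
qed

lemma fredholm_det_eq:
  assumes "Re w > 0"
  shows "fredholm_det (S_minus (exp (- (w / 2)))) (K_kernel \<tau> x \<gamma> (exp (- (w / 2)))) = fredholm_det UNIV (Kmat \<tau> x \<gamma> w)"
  unfolding fredholm_det_reindex[OF S_minus_exp[OF assms]] K_kernel_eq[OF assms] ..

text \<open>Up to a constant, \<open>sqrt (wt k * wt l)\<close> bounds the entry \<open>(k, l)\<close> of the kernel.\<close>

definition wt :: "real \<Rightarrow> real \<Rightarrow> complex \<Rightarrow> int \<Rightarrow> real" where
  "wt \<tau> x w k = exp (Re (Phi \<tau> x (- rt k w)))"

lemma wt_pos: "wt \<tau> x w k > 0" by (simp add: wt_def)

text \<open>Every root has real part at least sqrt d, so the sums of roots in the denominator cannot
  cancel. The five factors contribute d to the powers 1/4, 1/2, 1/2, 1/2 and 1/4, in all d^2, and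
  the two sums contribute the 4.\<close>

lemma norm_kterm_le:
  assumes w: "Re w \<ge> d" "d > 0"
  shows "norm (kterm \<tau> x \<gamma> k l m w) \<le> sqrt (wt \<tau> x w k) * wt \<tau> x w m * sqrt (wt \<tau> x w l) / (4 * d\<^sup>2)"
proof -
  have w0: "Re w > 0" using w by simp
  have r: "Re (rt k w) \<ge> sqrt d" for k
  proof -
    have "norm (w + 4 * of_real pi * \<i> * of_int k) \<ge> Re w"
      using complex_Re_le_cmod[of "w + 4 * of_real pi * \<i> * of_int k"] by simp
    then have "(Re (rt k w))\<^sup>2 \<ge> d" using rt_sq_parts(1)[of k w] w by simp
    then show ?thesis using Re_rt_pos[OF w0, of k] by (simp add: real_le_lsqrt)
  qed
  have n1: "norm (rt k w) \<ge> sqrt d" for k using r[of k] complex_Re_le_cmod[of "rt k w"] by linarith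
  have n2: "norm (rt k w + rt m w) \<ge> 2 * sqrt d" for k m
    using r[of k] r[of m] complex_Re_le_cmod[of "rt k w + rt m w"] by simp
  have n3: "norm (csqrt (rt k w)) \<ge> sqrt (sqrt d)" for k
    using n1[of k] by (simp add: norm_csqrt)
  have s: "sqrt (exp (a::real)) = exp (a / 2)" for a
    by (rule real_sqrt_unique) (auto simp: power2_eq_square simp flip: exp_add)
  have "norm (exp (1 / 2 * Phi \<tau> x (- rt k w) + Phi \<tau> x (- rt m w) + 1 / 2 * Phi \<tau> x (- rt l w)
          + of_real (\<gamma> * pi * of_int (k - 2 * m + l)) * \<i>)) = sqrt (wt \<tau> x w k) * wt \<tau> x w m * sqrt (wt \<tau> x w l)"
    unfolding wt_def s by (simp add: norm_exp_eq_Re flip: exp_add)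
  moreover have "norm (csqrt (rt k w) * rt m w * (rt k w + rt m w) * (rt m w + rt l w) * csqrt (rt l w))
     \<ge> sqrt (sqrt d) * sqrt d * (2 * sqrt d) * (2 * sqrt d) * sqrt (sqrt d)"
    unfolding norm_mult using w by (intro mult_mono n1 n2 n3 mult_nonneg_nonneg) auto
  moreover have "sqrt (sqrt d) * sqrt d * (2 * sqrt d) * (2 * sqrt d) * sqrt (sqrt d) = 4 * d\<^sup>2"
  proof -
    have "sqrt (sqrt d) * sqrt d * (2 * sqrt d) * (2 * sqrt d) * sqrt (sqrt d)
       = 4 * (sqrt (sqrt d) * sqrt (sqrt d)) * sqrt d * (sqrt d * sqrt d)" by (simp only: mult_ac)
    also have "\<dots> = 4 * (sqrt d * sqrt d) * (sqrt d * sqrt d)" using w by (simp add: mult_ac)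
    finally show ?thesis using w by (simp add: power2_eq_square)
  qed
  ultimately show ?thesis
    unfolding kterm_def norm_divide using w wt_pos[of \<tau> x w]
    by (intro frac_le) (auto intro!: mult_nonneg_nonneg less_imp_le)
qed

text \<open>Re (r^3) = u (u^2 - 3 v^2) for r = u + i v, and \<open>rt_sq_parts\<close> makes the
  bracket linear in the modulus of w + 4 \<pi> i k. The exponent is thus increasingly negative as
  |k| grows.\<close>

lemma Re_Phi:
  assumes "Re w > 0"
  shows "Re (Phi \<tau> x (- rt k w)) =
    Re (rt k w) * (\<tau> * (2 * Re w - norm (w + 4 * of_real pi * \<i> * of_int k)) / 3 - x) - Re (Q (- rt k w))"
proof -
  let ?u = "Re (rt k w)" and ?v = "Im (rt k w)"
  have "Re ((rt k w)^3) = ?u * (?u\<^sup>2 - 3 * ?v\<^sup>2)"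
    by (simp add: power3_eq_cube power2_eq_square algebra_simps)
  also have "?u\<^sup>2 - 3 * ?v\<^sup>2 = 2 * Re w - norm (w + 4 * of_real pi * \<i> * of_int k)"
    unfolding rt_sq_parts by (simp add: field_simps)
  finally have c: "Re ((rt k w)^3) = ?u * (2 * Re w - norm (w + 4 * of_real pi * \<i> * of_int k))" .
  have "Phi \<tau> x (- rt k w) = of_real (\<tau> / 3) * (rt k w)^3 - of_real x * rt k w - Q (- rt k w)"
    by (simp add: Phi_def power3_eq_cube)
  then have "Re (Phi \<tau> x (- rt k w)) = (\<tau> / 3) * Re ((rt k w)^3) - x * ?u - Re (Q (- rt k w))"
    by simp
  then show ?thesis unfolding c by (simp add: algebra_simps)
qed

text \<open>With y the square root of |w + 4 \<pi> i k|, the exponent is at most a constant minus y.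
  Since y^2 grows linearly in |k|, this beats every power of |k|; the fourth is the one that
  \<open>holomorphic_fredholm_det\<close> asks for.\<close>

lemma wt_bound_locally:
  assumes "\<tau> > 0" "d > 0"
  obtains M where "M \<ge> 0"
    "\<And>w k. Re w \<ge> d \<Longrightarrow> norm w \<le> N \<Longrightarrow> wt \<tau> x w k \<le> M / (1 + real_of_int \<bar>k\<bar>) ^ 4"
proof -
  obtain C where C: "C \<ge> 0" "\<And>\<xi>. \<xi> \<in> left_sector \<Longrightarrow> Re (\<xi>\<^sup>2) \<ge> d \<Longrightarrow> norm (Q \<xi>) \<le> C"
    using norm_Q_le[OF \<open>d > 0\<close>] by blast
  define c1 where "c1 = 2 * \<tau> * \<bar>N\<bar> / 3 + \<bar>x\<bar>"
  define Y where "Y = sqrt (3 * (c1 + sqrt 2) / \<tau>)"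
  define c3 where "c3 = Y * (c1 + 1)"
  have c1: "c1 \<ge> 0" using assms by (simp add: c1_def)
  have Y: "Y \<ge> 0" using assms c1 by (simp add: Y_def)
  \<comment> \<open>Since (1 + y / 8)^8 \<le> exp y, also (1 + y)^8 \<le> 8^8 exp y, and (1 + y^2)^4
    \<le> (1 + y)^8.\<close>
  obtain C8 :: real where C8: "C8 \<ge> 0" "\<And>y::real. y \<ge> 0 \<Longrightarrow> exp (- y) * (1 + y\<^sup>2) ^ 4 \<le> C8"
  proof -
    have "exp (- y) * (1 + y\<^sup>2) ^ 4 \<le> 8 ^ 8" if "y \<ge> 0" for y :: real
    proof -
      have "(1 + y\<^sup>2) ^ 4 \<le> ((1 + y)\<^sup>2) ^ 4"
        using that by (intro power_mono) (auto simp: power2_eq_square algebra_simps)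
      also have "\<dots> = (1 + y) ^ 8" by (simp flip: power_mult)
      also have "\<dots> \<le> (8 * (1 + y / real 8)) ^ 8" using that by (intro power_mono) auto
      also have "\<dots> = 8 ^ 8 * (1 + y / real 8) ^ 8" by (rule power_mult_distrib)
      also have "\<dots> \<le> 8 ^ 8 * exp y"
        using that exp_ge_one_plus_x_over_n_power_n[of 8 y] by (intro mult_left_mono) auto
      finally show ?thesis by (simp add: exp_minus field_simps)
    qed
    then show ?thesis using that[of "8 ^ 8 :: real"] by force
  qed
  define P where "P = (1 + \<bar>N\<bar>) ^ 4"
  show ?thesis
  proof (rule that[of "exp (C + c3) * (C8 * P)"])
    show "0 \<le> exp (C + c3) * (C8 * P)" using C8 by (simp add: P_def)
    fix w k assume w: "Re w \<ge> d" "norm w \<le> N"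
    then have w0: "Re w > 0" using assms by simp
    define D where "D = norm (w + 4 * of_real pi * \<i> * of_int k)"
    define y where "y = sqrt D"
    have D0: "D \<ge> 0" by (simp add: D_def)
    have y0: "y \<ge> 0" and y2: "y\<^sup>2 = D" using D0 by (simp_all add: y_def)
    let ?u = "Re (rt k w)"
    have ReD: "Re w \<le> D" using complex_Re_le_cmod[of "w + 4 * of_real pi * \<i> * of_int k"] by (simp add: D_def)
    have u2: "?u\<^sup>2 = (D + Re w) / 2" using rt_sq_parts(1)[of k w] by (simp add: D_def)
    have u0: "?u > 0" by (rule Re_rt_pos[OF w0])
    have uy: "?u \<le> y"
      using u2 ReD y2 u0 y0 by (intro power2_le_imp_le[OF _ y0]) auto
    have yu: "y \<le> sqrt 2 * ?u"
    proof (rule power2_le_imp_le)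
      show "y\<^sup>2 \<le> (sqrt 2 * ?u)\<^sup>2" using u2 w0 y2 by (simp add: power_mult_distrib)
    qed (use u0 in simp)
    have b1: "?u * (\<tau> * (2 * Re w - D) / 3 - x) \<le> ?u * (c1 - \<tau> / 3 * D)"
    proof (intro mult_left_mono)
      have "Re w \<le> \<bar>N\<bar>" using w complex_Re_le_cmod[of w] by linarith
      then have "\<tau> * Re w \<le> \<tau> * \<bar>N\<bar>" using assms by simp
      then show "\<tau> * (2 * Re w - D) / 3 - x \<le> c1 - \<tau> / 3 * D"
        unfolding c1_def by (simp add: field_simps)
    qed (use u0 in simp)
    \<comment> \<open>If the bracket is at most - sqrt 2, then \<open>yu\<close> turns it into - y.
      Otherwise D is bounded in terms of \<tau> and N, so y \<le> Y, and \<open>c3\<close> is chosen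
      to cover this case.\<close>
    have b2: "?u * (c1 - \<tau> / 3 * D) \<le> c3 - y"
    proof (cases "c1 - \<tau> / 3 * D \<le> - sqrt 2")
      case True
      then have "?u * (c1 - \<tau> / 3 * D) \<le> ?u * (- sqrt 2)" using u0 by (intro mult_left_mono) auto
      also have "\<dots> \<le> - y" using yu by (simp add: mult.commute)
      also have "\<dots> \<le> c3 - y" using Y c1 by (simp add: c3_def)
      finally show ?thesis .
    next
      case False
      then have "D < 3 * (c1 + sqrt 2) / \<tau>" using assms by (simp add: field_simps)
      then have yY: "y \<le> Y" by (simp add: y_def Y_def)
      have "?u * (c1 - \<tau> / 3 * D) \<le> ?u * c1" using u0 D0 assms by (intro mult_left_mono) auto
      also have "\<dots> \<le> Y * c1" using uy yY c1 by (intro mult_right_mono) auto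
      also have "\<dots> \<le> c3 - y" using yY by (simp add: c3_def algebra_simps)
      finally show ?thesis .
    qed
    have "norm (Q (- rt k w)) \<le> C"
    proof (rule C(2)[OF minus_rt_left_sector[OF w0]])
      show "d \<le> Re ((- rt k w)\<^sup>2)" unfolding power2_minus rt_power2 using w by simp
    qed
    then have "Re (Phi \<tau> x (- rt k w)) \<le> C + c3 - y"
      using b1 b2 abs_Re_le_cmod[of "Q (- rt k w)"] unfolding Re_Phi[OF w0] D_def by linarith
    then have "wt \<tau> x w k \<le> exp (C + c3) * exp (- y)"
      unfolding wt_def by (simp flip: exp_add)
    also have "\<dots> \<le> exp (C + c3) * (C8 / (1 + D) ^ 4)"
    proof -
      have p: "(1 + y\<^sup>2) ^ 4 > 0" by (intro zero_less_power add_pos_nonneg) auto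
      have "exp (- y) \<le> C8 / (1 + y\<^sup>2) ^ 4"
        using C8(2)[OF y0] unfolding pos_le_divide_eq[OF p] .
      then show ?thesis unfolding y2 by (intro mult_left_mono) auto
    qed
    also have "C8 / (1 + D) ^ 4 \<le> C8 * P / (1 + real_of_int \<bar>k\<bar>) ^ 4"
    proof -
      have "4 * pi * \<bar>real_of_int k\<bar> = norm (4 * of_real pi * \<i> * (of_int k :: complex))"
        by (simp add: norm_mult)
      also have "\<dots> \<le> D + norm w"
        using norm_triangle_ineq4[of "w + 4 * of_real pi * \<i> * of_int k" w] by (simp add: D_def)
      finally have "4 * pi * \<bar>real_of_int k\<bar> \<le> D + \<bar>N\<bar>" using w by simp
      moreover have "1 * \<bar>real_of_int k\<bar> \<le> 4 * pi * \<bar>real_of_int k\<bar>"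
        using pi_gt3 by (intro mult_right_mono) auto
      ultimately have "1 + real_of_int \<bar>k\<bar> \<le> 1 + \<bar>N\<bar> + D" by simp
      also have "\<dots> \<le> (1 + \<bar>N\<bar>) * (1 + D)" using D0 by (simp add: algebra_simps)
      finally have "(1 + real_of_int \<bar>k\<bar>) ^ 4 \<le> ((1 + \<bar>N\<bar>) * (1 + D)) ^ 4"
        by (intro power_mono) auto
      then have "(1 + real_of_int \<bar>k\<bar>) ^ 4 \<le> P * (1 + D) ^ 4"
        by (simp add: P_def power_mult_distrib)
      then have "C8 * (1 + real_of_int \<bar>k\<bar>) ^ 4 \<le> C8 * P * (1 + D) ^ 4"
        using C8(1) by (simp add: mult.assoc mult_left_mono)
      moreover have "(1 + D) ^ 4 > 0" "(1 + real_of_int \<bar>k\<bar>) ^ 4 > 0" using D0 by (auto intro!: zero_less_power add_pos_nonneg)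
      ultimately show ?thesis by (simp add: divide_simps mult_ac)
    qed
    finally show "wt \<tau> x w k \<le> exp (C + c3) * (C8 * P) / (1 + real_of_int \<bar>k\<bar>) ^ 4"
      by simp
  qed
qed

lemma holomorphic_Phi_rt: "(\<lambda>w. Phi \<tau> x (- rt k w)) holomorphic_on {w. Re w > 0}"
proof -
  have "Q holomorphic_on left_sector"
    using DERIV_Q by (metis holomorphic_on_open open_left_sector)
  then have "(Q \<circ> (\<lambda>w. - rt k w)) holomorphic_on {w. Re w > 0}"
    using minus_rt_left_sector
    by (intro holomorphic_on_compose_gen[where t=left_sector] holomorphic_intros holomorphic_rt) auto
  then have "(\<lambda>w. Q (- rt k w)) holomorphic_on {w. Re w > 0}" by (simp add: o_def)
  then show ?thesis
    unfolding Phi_def by (intro holomorphic_intros holomorphic_rt)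
qed

lemma holomorphic_kterm: "kterm \<tau> x \<gamma> k l m holomorphic_on {w. Re w > 0}"
proof -
  have c: "(\<lambda>w. csqrt (rt k w)) holomorphic_on {w. Re w > 0}" for k
    using Re_rt_pos[of _ k]
    by (intro holomorphic_on_csqrt' holomorphic_rt) (auto simp: complex_nonpos_Reals_iff not_le intro!: order.strict_implies_order)
  have nz: "rt k w \<noteq> 0" "rt k w + rt l w \<noteq> 0" if "Re w > 0" for k l w
    using Re_rt_pos[OF that, of k] Re_rt_pos[OF that, of l] by (auto simp: complex_eq_iff)
  show ?thesis
    unfolding kterm_def[abs_def]
    by (intro holomorphic_intros holomorphic_Phi_rt holomorphic_rt c) (use nz in auto)
qed

text \<open>Local statement: on a small ball both Re w and |w| are controlled, which is what the
  uniform majorants of \<open>wt_bound_locally\<close> and \<open>norm_kterm_le\<close>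
  require.\<close>

lemma holomorphic_fredholm_det_Kmat:
  assumes "\<tau> > 0"
  shows "(\<lambda>w. fredholm_det UNIV (Kmat \<tau> x \<gamma> w)) holomorphic_on {w. Re w > 0}"
proof -
  have "\<exists>A. open A \<and> w0 \<in> A \<and> (\<lambda>w. fredholm_det UNIV (Kmat \<tau> x \<gamma> w)) holomorphic_on A" if w0: "Re w0 > 0" for w0
  proof -
    define d where "d = Re w0 / 2"
    define N where "N = norm w0 + d"
    have d: "d > 0" using w0 by (simp add: d_def)
    define A where "A = ball w0 d"
    have A: "Re w \<ge> d" "norm w \<le> N" if "w \<in> A" for w
    proof -
      have "norm (w0 - w) < d" using that by (simp add: A_def dist_norm)
      then show "Re w \<ge> d" "norm w \<le> N"
        using abs_Re_le_cmod[of "w0 - w"] norm_triangle_ineq4[of w0 "w0 - w"] by (auto simp: d_def N_def)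
    qed
    have Asub: "A \<subseteq> {w. Re w > 0}" using A(1) d by fastforce
    obtain M where M: "M \<ge> 0" "\<And>w k. Re w \<ge> d \<Longrightarrow> norm w \<le> N \<Longrightarrow> wt \<tau> x w k \<le> M / (1 + real_of_int \<bar>k\<bar>) ^ 4"
      using wt_bound_locally[OF assms d, of N x] by blast
    obtain S where S: "((\<lambda>k::int. 1 / (1 + real_of_int \<bar>k\<bar>)\<^sup>2) has_sum S) UNIV"
      by (rule has_sum_inverse_square_int)
    have S0: "S \<ge> 0" by (rule has_sum_nonneg[OF S]) simp
    define g where "g k = M / (1 + real_of_int \<bar>k\<bar>) ^ 4" for k
    have g0: "g k \<ge> 0" for k using M by (simp add: g_def)
    have g2: "g k \<le> M * (1 / (1 + real_of_int \<bar>k\<bar>)\<^sup>2)" for k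
    proof -
      have "(1 + real_of_int \<bar>k\<bar>)\<^sup>2 \<le> (1 + real_of_int \<bar>k\<bar>) ^ 4" by (intro power_increasing) auto
      then show ?thesis unfolding g_def using M by (simp add: frac_le add_pos_nonneg)
    qed
    define c where "c k l m = sqrt (g k) * (M * (1 / (1 + real_of_int \<bar>m\<bar>)\<^sup>2)) * sqrt (g l) / (4 * d\<^sup>2)" for k l m
    have kb: "norm (kterm \<tau> x \<gamma> k l m w) \<le> c k l m" if "w \<in> A" for k l m w
    proof -
      have wg: "wt \<tau> x w k \<le> g k" for k unfolding g_def by (rule M(2)[OF A[OF that]])
      have "norm (kterm \<tau> x \<gamma> k l m w) \<le> sqrt (wt \<tau> x w k) * wt \<tau> x w m * sqrt (wt \<tau> x w l) / (4 * d\<^sup>2)"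
        by (rule norm_kterm_le[OF A(1)[OF that] d])
      also have "\<dots> \<le> c k l m"
        unfolding c_def
        by (intro divide_right_mono mult_mono real_sqrt_le_mono wg order_trans[OF wg g2] mult_nonneg_nonneg)
           (use wt_pos[of \<tau> x w] g0 M in \<open>auto intro: less_imp_le\<close>)
      finally show ?thesis .
    qed
    have hs: "((\<lambda>m. c k l m) has_sum sqrt (g k) * (M * S) * sqrt (g l) / (4 * d\<^sup>2)) UNIV" for k l
      unfolding c_def divide_inverse[of _ "4 * d\<^sup>2"]
      by (intro has_sum_cmult_left has_sum_cmult_right S)
    have holoK: "(\<lambda>w. Kmat \<tau> x \<gamma> w k l) holomorphic_on A" for k l
      unfolding Kmat_def
      by (rule holomorphic_infsum[where M="c k l", OF _ _ kb has_sum_imp_summable[OF hs]])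
         (use holomorphic_on_subset[OF holomorphic_kterm Asub] in \<open>auto simp: A_def\<close>)
    have "(\<lambda>w. fredholm_det UNIV (Kmat \<tau> x \<gamma> w)) holomorphic_on A"
    proof (rule holomorphic_fredholm_det)
      \<comment> \<open>Summing the majorant over the inner index m leaves a constant times sqrt (g
        k) sqrt (g l). This already has product form, with half of the constant's exponent going to
        each side.\<close>
      define f where "f k = sqrt (M * S / (4 * d\<^sup>2) * g k)" for k
      show "norm (Kmat \<tau> x \<gamma> w k l) \<le> f k * f l" if "w \<in> A" for w k l
      proof -
        have ns: "(\<lambda>m. norm (kterm \<tau> x \<gamma> k l m w)) summable_on UNIV"
          by (rule summable_on_comparison_test[OF has_sum_imp_summable[OF hs]]) (use kb that in auto)
        have "norm (Kmat \<tau> x \<gamma> w k l) \<le> (\<Sum>\<^sub>\<infinity>m. norm (kterm \<tau> x \<gamma> k l m w))"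
          unfolding Kmat_def by (rule norm_infsum_bound[OF ns])
        also have "\<dots> \<le> sqrt (g k) * (M * S) * sqrt (g l) / (4 * d\<^sup>2)"
          by (rule has_sum_mono[OF has_sum_infsum[OF ns] hs]) (use kb that in auto)
        also have "\<dots> = f k * f l"
        proof -
          have "sqrt (M * S / (4 * d\<^sup>2)) * sqrt (M * S / (4 * d\<^sup>2)) = M * S / (4 * d\<^sup>2)"
            using mult_nonneg_nonneg[OF M(1) S0] by simp
          moreover have "f k * f l = (sqrt (M * S / (4 * d\<^sup>2)) * sqrt (M * S / (4 * d\<^sup>2))) * (sqrt (g k) * sqrt (g l))"
            unfolding f_def real_sqrt_mult by (simp only: mult_ac)
          ultimately show ?thesis by (simp only:) simp
        qed
        finally show ?thesis .
      qed
      show "f k \<ge> 0" for k using M S0 g0 by (simp add: f_def)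
      show "(f k)\<^sup>2 \<le> M * S / (4 * d\<^sup>2) * M / (1 + real_of_int \<bar>k\<bar>) ^ 4" for k
      proof -
        have "(f k)\<^sup>2 = M * S / (4 * d\<^sup>2) * g k" unfolding f_def using M S0 g0[of k] by (intro real_sqrt_pow2) simp
        then show ?thesis by (simp add: g_def)
      qed
      show "M * S / (4 * d\<^sup>2) * M \<ge> 0" using M S0 by simp
    qed (auto simp: A_def intro: holoK[unfolded A_def])
    then show ?thesis using d by (intro exI[of _ A]) (simp add: A_def)
  qed
  then show ?thesis
    unfolding holomorphic_on_open[OF open_halfspace_Re_gt] field_differentiable_def[symmetric]
    using holomorphic_on_imp_differentiable_at by blast
qed

section \<open>The integrand of the contour integral in the variable w\<close>

definition FF :: "real \<Rightarrow> real \<Rightarrow> real \<Rightarrow> complex \<Rightarrow> complex" where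
  "FF \<tau> x \<gamma> w = (let z = exp (- (w / 2)) in
     exp (of_real x * A1 z + of_real \<tau> * A2 z + 2 * B z) * fredholm_det (S_minus z) (K_kernel \<tau> x \<gamma> z))"

lemma norm_exp_half_less: "Re w > 0 \<Longrightarrow> norm (exp (- (w / 2))) < 1"
  by (simp add: norm_exp_eq_Re)

lemma holomorphic_FF:
  assumes "\<tau> > 0"
  shows "FF \<tau> x \<gamma> holomorphic_on {w. Re w > 0}"
proof -
  have c: "(\<lambda>w. f (exp (- (w / 2)))) holomorphic_on {w. Re w > 0}" if "f holomorphic_on ball 0 1" for f
  proof -
    have "(f \<circ> (\<lambda>w. exp (- (w / 2)))) holomorphic_on {w. Re w > 0}"
      using norm_exp_half_less
      by (intro holomorphic_on_compose_gen[OF _ that] holomorphic_intros) auto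
    then show ?thesis by (simp add: o_def)
  qed
  have "(\<lambda>w. exp (of_real x * A1 (exp (- (w / 2))) + of_real \<tau> * A2 (exp (- (w / 2))) + 2 * B (exp (- (w / 2))))
          * fredholm_det UNIV (Kmat \<tau> x \<gamma> w)) holomorphic_on {w. Re w > 0}"
    by (intro holomorphic_intros c holomorphic_A1 holomorphic_A2 holomorphic_B holomorphic_fredholm_det_Kmat assms)
  then show ?thesis
    by (rule holomorphic_transform) (simp add: FF_def Let_def fredholm_det_eq)
qed

lemma FF_periodic: "FF \<tau> x \<gamma> (w - 4 * of_real pi * \<i>) = FF \<tau> x \<gamma> w"
proof -
  have "exp (- ((w - 4 * of_real pi * \<i>) / 2)) = exp (- (w / 2) + (of_int (2 * 1) * pi) * \<i>)"
    by (rule arg_cong[where f=exp]) (simp add: diff_divide_distrib)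
  also have "\<dots> = exp (- (w / 2))" unfolding exp_eq by (rule exI) (rule refl)
  finally show ?thesis by (simp add: FF_def)
qed

text \<open>With w = - 2 Ln z the counterclockwise circle of radius R becomes a vertical segment of
  length 4 \<pi> run downwards, and dz / (2 \<pi> i z) becomes - dw / (4 \<pi> i).\<close>

lemma F_eq_contour:
  assumes R: "0 < R" "R < 1" and "\<tau> > 0"
  shows "F R x \<tau> \<gamma> = contour_integral (linepath (complex_of_real (- 2 * ln R)) (complex_of_real (- 2 * ln R) - 4 * of_real pi * \<i>)) (FF \<tau> x \<gamma>) / (- 4 * of_real pi * \<i>)"
proof -
  let ?w = "\<lambda>t::real. linepath (complex_of_real (- 2 * ln R)) (complex_of_real (- 2 * ln R) - 4 * of_real pi * \<i>) t"
  have wt: "?w t = complex_of_real (- 2 * ln R) - 4 * of_real (pi * t) * \<i>" for t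
    by (simp add: linepath_def algebra_simps scaleR_conv_of_real)
  have ez: "exp (- (?w t / 2)) = circlepath 0 R t" for t
  proof -
    have "- (?w t / 2) = of_real (ln R) + 2 * of_real pi * \<i> * of_real t"
      unfolding wt by (simp add: diff_divide_distrib)
    then show ?thesis
      using R by (simp add: exp_add circlepath mult_ac exp_of_real)
  qed
  have "F R x \<tau> \<gamma> = contour_integral (circlepath 0 R) (\<lambda>z. exp (of_real x * A1 z + of_real \<tau> * A2 z + 2 * B z)
            * fredholm_det (S_minus z) (K_kernel \<tau> x \<gamma> z) / (2 * of_real pi * \<i> * z))"
    by (simp add: F_def)
  also have "\<dots> = integral {0..1} (\<lambda>t. FF \<tau> x \<gamma> (?w t))"
    unfolding contour_integral_integral
  proof (rule integral_cong)
    fix t :: real assume "t \<in> {0..1}"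
    then have vd: "vector_derivative (circlepath 0 R) (at t) = 2 * pi * \<i> * circlepath 0 R t"
      by (subst vector_derivative_circlepath) (simp add: circlepath mult_ac)
    have nz: "circlepath 0 R t \<noteq> 0" using R by (simp add: circlepath)
    show "exp (of_real x * A1 (circlepath 0 R t) + of_real \<tau> * A2 (circlepath 0 R t) + 2 * B (circlepath 0 R t))
            * fredholm_det (S_minus (circlepath 0 R t)) (K_kernel \<tau> x \<gamma> (circlepath 0 R t)) / (2 * of_real pi * \<i> * circlepath 0 R t) * vector_derivative (circlepath 0 R) (at t)
        = FF \<tau> x \<gamma> (?w t)"
      unfolding vd FF_def Let_def ez using nz by simp
  qed
  also have "\<dots> = contour_integral (linepath (complex_of_real (- 2 * ln R)) (complex_of_real (- 2 * ln R) - 4 * of_real pi * \<i>)) (FF \<tau> x \<gamma>) / (- 4 * of_real pi * \<i>)"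
    unfolding contour_integral_integral vector_derivative_linepath_at by (simp add: integral_mult_left)
  finally show ?thesis .
qed

text \<open>Periodicity of the integrand makes the integral over a full period independent of the
  position of the line, which is the independence of \<open>F\<close> from the radius.\<close>

lemma F_eq_period_integral:
  assumes R: "0 < R" "R < 1" and \<tau>: "\<tau> > 0" and w: "Re w > 0"
  shows "F R x \<tau> \<gamma> = contour_integral (linepath (w - 2 * of_real pi * \<i>) (w + 2 * of_real pi * \<i>)) (FF \<tau> x \<gamma>) / (4 * of_real pi * \<i>)"
proof -
  let ?H = "{w. Re w > 0}"
  let ?p = "4 * of_real pi * \<i> :: complex"
  have oH: "open ?H" by (rule open_halfspace_Re_gt)
  have cH: "convex ?H" by (rule convex_halfspace_Re_gt)
  obtain T where T: "\<And>x'. x' \<in> ?H \<Longrightarrow> (T has_field_derivative FF \<tau> x \<gamma> x') (at x')"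
    using holomorphic_convex_primitive'[OF cH oH holomorphic_FF[OF \<tau>]] at_within_open[OF _ oH] by metis
  have ci: "contour_integral (linepath a b) (FF \<tau> x \<gamma>) = T b - T a" if "a \<in> ?H" "b \<in> ?H" for a b
  proof -
    have im: "path_image (linepath a b) \<subseteq> ?H"
      unfolding path_image_linepath by (intro closed_segment_subset that cH)
    show ?thesis
      using contour_integral_primitive[OF has_field_derivative_at_within[OF T] valid_path_linepath im]
      by (simp add: contour_integral_unique)
  qed
  have const: "\<exists>c. \<forall>v\<in>?H. T v - T (v - ?p) = c"
  proof (rule has_field_derivative_zero_constant[OF cH])
    fix v assume v: "v \<in> ?H"
    then have vp: "v - ?p \<in> ?H" by simp
    have "((\<lambda>v. T (v - ?p)) has_field_derivative FF \<tau> x \<gamma> (v - ?p) * 1) (at v)"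
      by (rule DERIV_chain2[where f=T and g="\<lambda>v. v - ?p", OF T[OF vp]]) (auto intro!: derivative_eq_intros)
    then have "((\<lambda>v. T v - T (v - ?p)) has_field_derivative (FF \<tau> x \<gamma> v - FF \<tau> x \<gamma> (v - ?p) * 1)) (at v)"
      by (intro DERIV_diff T v)
    then show "((\<lambda>v. T v - T (v - ?p)) has_field_derivative 0) (at v within ?H)"
      unfolding FF_periodic by (simp add: has_field_derivative_at_within)
  qed
  then obtain c where c: "\<And>v. v \<in> ?H \<Longrightarrow> T v - T (v - ?p) = c" by blast
  let ?e = "complex_of_real (- 2 * ln R)"
  have e: "?e \<in> ?H" "?e - ?p \<in> ?H" using R by simp_all
  have "F R x \<tau> \<gamma> = (T (?e - ?p) - T ?e) / (- ?p)"
    using F_eq_contour[OF R \<tau>, of x \<gamma>] ci[OF e] by simp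
  also have "T (?e - ?p) - T ?e = - c" using c[OF e(1)] by (simp add: algebra_simps)
  also have "c = T (w + 2 * of_real pi * \<i>) - T (w - 2 * of_real pi * \<i>)"
    using c[of "w + 2 * of_real pi * \<i>"] w by (simp add: algebra_simps)
  also have "\<dots> = contour_integral (linepath (w - 2 * of_real pi * \<i>) (w + 2 * of_real pi * \<i>)) (FF \<tau> x \<gamma>)"
    using w by (intro ci[symmetric]) auto
  finally show ?thesis by (simp add: field_simps)
qed

section \<open>The leading terms\<close>

text \<open>With n = |k| - 1, squaring 1 + n / 2 \<le> exp (n / 2) gives (1 + |k|)^2 / 4 \<le> exp
  n. One factor exp (- t) is kept in front as the small quantity, and the rest becomes a summable
  weight.\<close>

lemma exp_decay_le_inverse_square:
  assumes "k \<noteq> (0::int)" "t \<ge> 1"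
  shows "exp (- t * real_of_int \<bar>k\<bar>) \<le> exp (- t) * (4 * (1 / (1 + real_of_int \<bar>k\<bar>)\<^sup>2))"
proof -
  let ?n = "real_of_int \<bar>k\<bar> - 1"
  have n: "?n \<ge> 0" using assms(1) by simp
  have "(1 + ?n / 2)\<^sup>2 \<le> exp (?n / 2) ^ 2"
    using n exp_ge_add_one_self[of "?n / 2"] by (intro power_mono) auto
  also have "\<dots> = exp ?n" by (simp flip: exp_double)
  also have "\<dots> \<le> exp (t * ?n)" using n assms(2) by (simp add: mult_le_cancel_right1)
  finally have a: "(1 + real_of_int \<bar>k\<bar>)\<^sup>2 / 4 \<le> exp (t * ?n)"
    by (simp add: power2_eq_square field_simps)
  have p: "(1 + real_of_int \<bar>k\<bar>)\<^sup>2 > 0" by (intro zero_less_power add_pos_nonneg) auto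
  have "inverse (exp (t * ?n)) \<le> inverse ((1 + real_of_int \<bar>k\<bar>)\<^sup>2 / 4)"
    using a p by (intro le_imp_inverse_le) auto
  then have b: "exp (- (t * ?n)) \<le> 4 * (1 / (1 + real_of_int \<bar>k\<bar>)\<^sup>2)"
    unfolding exp_minus inverse_divide by simp
  have "exp (- t * real_of_int \<bar>k\<bar>) = exp (- t) * exp (- (t * ?n))"
    by (simp add: algebra_simps flip: exp_add)
  also have "\<dots> \<le> exp (- t) * (4 * (1 / (1 + real_of_int \<bar>k\<bar>)\<^sup>2))"
    using b by (intro mult_left_mono) auto
  finally show ?thesis .
qed

text \<open>Here \<open>a\<close> is the growth rate of the weight at the root 0 and
  \<open>b\<close> the decay rate at the others. Then \<open>fredholm_det_approx\<close> applies
  with D of order exp (2 a \<tau>) and \<delta> of order exp ((a - b) \<tau>), whence the rate 3 a -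
  b. In the trace, the diagonal entries with k \<noteq> 0, and the summands m \<noteq> 0 of the
  entry (0, 0), cost at most \<delta> each. \<open>K\<close> depends on \<open>e\<close> and
  \<open>C\<close> only.\<close>

lemma fredholm_main_term:
  assumes e: "e > 0" and C: "C \<ge> 1"
  obtains K where "K \<ge> 1"
    "\<And>\<tau> x \<gamma> w a b. Re w = e \<Longrightarrow> \<tau> \<ge> 1 \<Longrightarrow> a \<ge> 0 \<Longrightarrow> b \<ge> 1 \<Longrightarrow>
       wt \<tau> x w 0 \<le> C * exp (a * \<tau>) \<Longrightarrow>
       (\<And>k. k \<noteq> 0 \<Longrightarrow> wt \<tau> x w k \<le> C * exp (- (b * \<tau>) * real_of_int \<bar>k\<bar>)) \<Longrightarrow>
       K * exp ((a - b) * \<tau>) \<le> 1 / 4 \<Longrightarrow>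
       norm (fredholm_det UNIV (Kmat \<tau> x \<gamma> w) - (1 - kterm \<tau> x \<gamma> 0 0 0 w)) \<le> K * exp ((3 * a - b) * \<tau>)"
proof -
  obtain S where S: "((\<lambda>k::int. 1 / (1 + real_of_int \<bar>k\<bar>)\<^sup>2) has_sum S) UNIV"
    by (rule has_sum_inverse_square_int)
  have S0: "S \<ge> 0" by (rule has_sum_nonneg[OF S]) simp
  define c where "c = 4 * e\<^sup>2"
  have c: "c > 0" using e by (simp add: c_def)
  define K1 where "K1 = C\<^sup>2 * (1 + 4 * S)\<^sup>2 / c + 1"
  have K1: "K1 \<ge> 1" using c by (simp add: K1_def)
  show ?thesis
  proof (rule that[of "8 * K1\<^sup>2 + 2 * K1"])
    show "8 * K1\<^sup>2 + 2 * K1 \<ge> 1" using K1 zero_le_power2[of K1] by linarith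
  next
    fix \<tau> x \<gamma> w a b
    assume w: "Re w = e" and \<tau>: "\<tau> \<ge> 1" and a: "a \<ge> 0" and b: "b \<ge> 1"
      and w0: "wt \<tau> x w 0 \<le> C * exp (a * \<tau>)"
      and wk: "\<And>k. k \<noteq> 0 \<Longrightarrow> wt \<tau> x w k \<le> C * exp (- (b * \<tau>) * real_of_int \<bar>k\<bar>)"
      and sm: "(8 * K1\<^sup>2 + 2 * K1) * exp ((a - b) * \<tau>) \<le> 1 / 4"
    have sm': "K1 * exp ((a - b) * \<tau>) \<le> 1 / 4"
    proof -
      have "K1 * exp ((a - b) * \<tau>) \<le> (8 * K1\<^sup>2 + 2 * K1) * exp ((a - b) * \<tau>)"
        using K1 by (intro mult_right_mono) auto
      then show ?thesis using sm by linarith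
    qed
    have bt: "b * \<tau> \<ge> 1" using mult_mono[of 1 b 1 \<tau>] b \<tau> by simp
    let ?W = "wt \<tau> x w"
    let ?g = "\<lambda>k::int. C * exp (- (b * \<tau>)) * 4 * (1 / (1 + real_of_int \<bar>k\<bar>)\<^sup>2)"
    have Wg: "?W k \<le> ?g k" if "k \<noteq> 0" for k
    proof -
      have "?W k \<le> C * (exp (- (b * \<tau>)) * (4 * (1 / (1 + real_of_int \<bar>k\<bar>)\<^sup>2)))"
        using C by (intro order_trans[OF wk[OF that]] mult_left_mono exp_decay_le_inverse_square[OF that bt]) auto
      then show ?thesis by (simp add: mult.assoc)
    qed
    have gS: "(?g has_sum C * exp (- (b * \<tau>)) * 4 * S) UNIV" by (intro has_sum_cmult_right S)
    have gs: "?g summable_on - {0}"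
      by (rule summable_on_subset_banach[OF has_sum_imp_summable[OF gS]]) auto
    have Ws: "?W summable_on - {0}"
      by (rule summable_on_comparison_test[OF gs]) (use Wg wt_pos[of \<tau> x w] in \<open>auto intro: less_imp_le\<close>)
    define S1 where "S1 = infsum ?W (- {0})"
    have S1: "(?W has_sum S1) (- {0})" unfolding S1_def by (rule has_sum_infsum[OF Ws])
    have S10: "S1 \<ge> 0" by (rule has_sum_nonneg[OF S1]) (use wt_pos[of \<tau> x w] in \<open>auto intro: less_imp_le\<close>)
    have S1le: "S1 \<le> 4 * S * C * exp (- (b * \<tau>))"
    proof -
      have "S1 \<le> infsum ?g (- {0})"
        unfolding S1_def by (rule infsum_mono[OF Ws gs]) (use Wg in auto)
      also have "\<dots> \<le> infsum ?g UNIV"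
        using C by (intro infsum_mono2 gs has_sum_imp_summable[OF gS]) auto
      also have "\<dots> = C * exp (- (b * \<tau>)) * 4 * S" by (rule infsumI[OF gS])
      finally show ?thesis by (simp add: mult_ac)
    qed
    have U: "insert (0::int) (- {0}) = UNIV" by auto
    have A: "(?W has_sum (?W 0 + S1)) UNIV"
      using has_sum_insert[of 0 "- {0}" ?W S1] S1 unfolding U by simp
    define A where "A = ?W 0 + S1"
    have A0: "A > 0" using wt_pos[of \<tau> x w 0] S10 by (simp add: A_def)
    have eb: "exp (- (b * \<tau>)) \<le> exp (a * \<tau>)" using a \<tau> bt by (simp add: mult_nonneg_nonneg order_trans[of _ 0])
    have Ale: "A \<le> C * (1 + 4 * S) * exp (a * \<tau>)"
    proof -
      have "4 * S * C * exp (- (b * \<tau>)) \<le> 4 * S * C * exp (a * \<tau>)"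
        using S0 C eb by (intro mult_left_mono) auto
      then show ?thesis using w0 S1le by (simp add: A_def algebra_simps)
    qed
    have S1le': "S1 \<le> C * (1 + 4 * S) * exp (- (b * \<tau>))"
      using S1le C S0 by (simp add: algebra_simps add_increasing)
    have w0': "?W 0 \<le> C * (1 + 4 * S) * exp (a * \<tau>)" using Ale S10 by (simp add: A_def)
    have prodb: "p * q / c \<le> K1 * exp (s + t)"
      if "0 \<le> p" "0 \<le> q" "p \<le> C * (1 + 4 * S) * exp s" "q \<le> C * (1 + 4 * S) * exp t" for p q s t
    proof -
      have "p * q \<le> (C * (1 + 4 * S) * exp s) * (C * (1 + 4 * S) * exp t)"
        using that S0 C by (intro mult_mono) auto
      also have "\<dots> = C\<^sup>2 * (1 + 4 * S)\<^sup>2 * exp (s + t)" by (simp add: power2_eq_square exp_add)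
      finally have "p * q / c \<le> C\<^sup>2 * (1 + 4 * S)\<^sup>2 * exp (s + t) / c"
        using c by (intro divide_right_mono) auto
      also have "\<dots> \<le> K1 * exp (s + t)" by (simp add: K1_def algebra_simps)
      finally show ?thesis .
    qed
    have kt: "norm (kterm \<tau> x \<gamma> k l m w) \<le> sqrt (?W k) * ?W m * sqrt (?W l) / c" for k l m
      unfolding c_def by (rule norm_kterm_le) (use w e in auto)
    define f where "f k = sqrt (A / c * ?W k)" for k
    have f0: "f k \<ge> 0" for k
      unfolding f_def using A0 c less_imp_le[OF wt_pos[of \<tau> x w k]] by simp
    have f2: "(f k)\<^sup>2 = A / c * ?W k" for k
    proof -
      have "A / c \<ge> 0" using A0 c by simp
      then have "A / c * ?W k \<ge> 0" by (intro mult_nonneg_nonneg less_imp_le[OF wt_pos])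
      then show ?thesis unfolding f_def by (rule real_sqrt_pow2)
    qed
    have hsW: "((\<lambda>m. sqrt (?W k) * ?W m * sqrt (?W l) / c) has_sum sqrt (?W k) * A * sqrt (?W l) / c) UNIV" for k l
      unfolding A_def divide_inverse by (intro has_sum_cmult_left has_sum_cmult_right A)
    have ns: "(\<lambda>m. norm (kterm \<tau> x \<gamma> k l m w)) summable_on UNIV" for k l
      by (rule summable_on_comparison_test[OF has_sum_imp_summable[OF hsW]]) (use kt in auto)
    have Kf: "norm (Kmat \<tau> x \<gamma> w k l) \<le> f k * f l" for k l
    proof -
      have "norm (Kmat \<tau> x \<gamma> w k l) \<le> (\<Sum>\<^sub>\<infinity>m. norm (kterm \<tau> x \<gamma> k l m w))"
        unfolding Kmat_def by (rule norm_infsum_bound[OF ns])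
      also have "\<dots> \<le> sqrt (?W k) * A * sqrt (?W l) / c"
        by (rule has_sum_mono[OF has_sum_infsum[OF ns] hsW]) (use kt in auto)
      also have "\<dots> = f k * f l"
      proof -
        have "f k * f l = (sqrt (A / c) * sqrt (A / c)) * (sqrt (?W k) * sqrt (?W l))"
          unfolding f_def real_sqrt_mult by (simp only: mult_ac)
        also have "sqrt (A / c) * sqrt (A / c) = A / c" using A0 c by simp
        finally show ?thesis by simp
      qed
      finally show ?thesis .
    qed
    let ?D = "K1 * exp (2 * a * \<tau>)" and ?d = "K1 * exp ((a - b) * \<tau>)"
    have D1: "(f 0)\<^sup>2 \<le> ?D"
      using prodb[of A "?W 0" "a * \<tau>" "a * \<tau>"] A0 Ale w0' wt_pos[of \<tau> x w 0]
      unfolding f2 by (simp add: algebra_simps)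
    have hs1: "((\<lambda>k. (f k)\<^sup>2) has_sum A / c * S1) (- {0})"
      unfolding f2 by (rule has_sum_cmult_right[OF S1])
    have d1: "A / c * S1 \<le> ?d"
      using prodb[of A S1 "a * \<tau>" "- (b * \<tau>)"] A0 Ale S1le' S10 by (simp add: algebra_simps)
    have d2: "?W 0 * S1 / c \<le> ?d"
      using prodb[of "?W 0" S1 "a * \<tau>" "- (b * \<tau>)"] w0' S1le' S10 wt_pos[of \<tau> x w 0] by (simp add: algebra_simps)
    have dD: "?d \<le> ?D"
    proof -
      have "(a - b) * \<tau> \<le> 2 * a * \<tau>" using a b \<tau> by (intro mult_right_mono) auto
      then show ?thesis using K1 by simp
    qed
    have main: "norm (fredholm_det UNIV (Kmat \<tau> x \<gamma> w) - (1 - (\<Sum>\<^sub>\<infinity>k. Kmat \<tau> x \<gamma> w k k))) \<le> 8 * ?D * ?d"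
      by (rule fredholm_det_approx[where f=f, OF Kf f0 D1 hs1 d1 _ dD sm']) (use K1 in simp)
    have trb: "norm ((\<Sum>\<^sub>\<infinity>k. Kmat \<tau> x \<gamma> w k k) - kterm \<tau> x \<gamma> 0 0 0 w) \<le> 2 * ?d"
    proof -
      let ?k = "\<lambda>k. Kmat \<tau> x \<gamma> w k k"
      have nk: "(\<lambda>k. norm (?k k)) summable_on - {0}"
        by (rule summable_on_comparison_test[OF has_sum_imp_summable[OF hs1]])
           (use Kf in \<open>auto simp: power2_eq_square\<close>)
      have k1: "(?k has_sum infsum ?k (- {0})) (- {0})"
        using abs_summable_summable[OF nk] by (rule has_sum_infsum)
      have "(?k has_sum (?k 0 + infsum ?k (- {0}))) UNIV"
        using has_sum_insert[of 0 "- {0}" ?k] k1 unfolding U by simp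
      then have e1: "(\<Sum>\<^sub>\<infinity>k. ?k k) = ?k 0 + infsum ?k (- {0})" by (rule infsumI)
      have n1: "norm (infsum ?k (- {0})) \<le> ?d"
      proof -
        have "norm (infsum ?k (- {0})) \<le> infsum (\<lambda>k. norm (?k k)) (- {0})" by (rule norm_infsum_bound[OF nk])
        also have "\<dots> \<le> A / c * S1"
          by (rule has_sum_mono[OF has_sum_infsum[OF nk] hs1]) (use Kf in \<open>auto simp: power2_eq_square\<close>)
        finally show ?thesis using d1 by linarith
      qed
      let ?t = "\<lambda>m. kterm \<tau> x \<gamma> 0 0 m w"
      have nt: "(\<lambda>m. norm (?t m)) summable_on - {0}"
        by (rule summable_on_subset_banach[OF ns]) auto
      have t1: "(?t has_sum infsum ?t (- {0})) (- {0})"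
        using abs_summable_summable[OF nt] by (rule has_sum_infsum)
      have "(?t has_sum (?t 0 + infsum ?t (- {0}))) UNIV"
        using has_sum_insert[of 0 "- {0}" ?t] t1 unfolding U by simp
      then have e2: "?k 0 = ?t 0 + infsum ?t (- {0})" unfolding Kmat_def by (rule infsumI)
      have n2: "norm (infsum ?t (- {0})) \<le> ?d"
      proof -
        have hw: "((\<lambda>m. sqrt (?W 0) * ?W m * sqrt (?W 0) / c) has_sum sqrt (?W 0) * S1 * sqrt (?W 0) / c) (- {0})"
          unfolding divide_inverse by (intro has_sum_cmult_left has_sum_cmult_right S1)
        have "norm (infsum ?t (- {0})) \<le> infsum (\<lambda>k. norm (?t k)) (- {0})" by (rule norm_infsum_bound[OF nt])
        also have "\<dots> \<le> sqrt (?W 0) * S1 * sqrt (?W 0) / c"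
          by (rule has_sum_mono[OF has_sum_infsum[OF nt] hw]) (use kt in auto)
        also have "\<dots> = (sqrt (?W 0) * sqrt (?W 0)) * S1 / c" by (simp only: mult_ac)
        also have "sqrt (?W 0) * sqrt (?W 0) = ?W 0" using wt_pos[of \<tau> x w 0] by simp
        finally show ?thesis using d2 by linarith
      qed
      have "(\<Sum>\<^sub>\<infinity>k. ?k k) - ?t 0 = infsum ?k (- {0}) + infsum ?t (- {0})" unfolding e1 e2 by simp
      then show ?thesis using norm_triangle_ineq[of "infsum ?k (- {0})" "infsum ?t (- {0})"] n1 n2 by simp
    qed
    have "norm (fredholm_det UNIV (Kmat \<tau> x \<gamma> w) - (1 - kterm \<tau> x \<gamma> 0 0 0 w)) \<le> 8 * ?D * ?d + 2 * ?d"
      using norm_triangle_ineq4[of "fredholm_det UNIV (Kmat \<tau> x \<gamma> w) - (1 - (\<Sum>\<^sub>\<infinity>k. Kmat \<tau> x \<gamma> w k k))"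
          "(\<Sum>\<^sub>\<infinity>k. Kmat \<tau> x \<gamma> w k k) - kterm \<tau> x \<gamma> 0 0 0 w"] main trb by (simp add: algebra_simps)
    also have "8 * ?D * ?d = 8 * K1\<^sup>2 * exp ((3 * a - b) * \<tau>)"
      by (simp add: power2_eq_square algebra_simps flip: exp_add)
    also have "2 * ?d \<le> 2 * K1 * exp ((3 * a - b) * \<tau>)"
      using a \<tau> K1 by (simp add: mult_right_mono)
    finally show "norm (fredholm_det UNIV (Kmat \<tau> x \<gamma> w) - (1 - kterm \<tau> x \<gamma> 0 0 0 w)) \<le> (8 * K1\<^sup>2 + 2 * K1) * exp ((3 * a - b) * \<tau>)"
      by (simp add: algebra_simps)
  qed
qed

text \<open>Coefficients of Li_{3/2} - Li_{5/2}, which is sqrt (2 \<pi>) times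
  \<open>A2 - A1\<close>. The first one vanishes, so the phase has a critical point at z =
  0.\<close>

definition cdiff :: "nat \<Rightarrow> real" where
  "cdiff k = 1 / real (Suc k) powr (3 / 2) - 1 / real (Suc k) powr (5 / 2)"

lemma cdiff_bounds: "0 \<le> cdiff k" "cdiff k \<le> 1 / real (Suc k) powr (3 / 2)"
proof -
  have "real (Suc k) powr (3 / 2) \<le> real (Suc k) powr (5 / 2)" by (intro powr_mono) auto
  then have "1 / real (Suc k) powr (5 / 2) \<le> 1 / real (Suc k) powr (3 / 2)"
    by (intro divide_left_mono) auto
  then show "0 \<le> cdiff k" "cdiff k \<le> 1 / real (Suc k) powr (3 / 2)" by (auto simp: cdiff_def)
qed

lemma cdiff_0 [simp]: "cdiff 0 = 0" by (simp add: cdiff_def)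

lemma cdiff_sums:
  assumes "norm z < 1"
  shows "(\<lambda>k. of_real (cdiff k) * z ^ Suc k) sums (of_real (sqrt (2 * pi)) * (A2 z - A1 z))"
proof -
  have "(\<lambda>k. z ^ Suc k / of_real (real (Suc k) powr (3/2)) - z ^ Suc k / of_real (real (Suc k) powr (5/2)))
      sums (polylog (3/2) z - polylog (5/2) z)"
    using assms by (intro sums_diff polylog_sums) auto
  moreover have "polylog (3/2) z - polylog (5/2) z = of_real (sqrt (2 * pi)) * (A2 z - A1 z)"
    by (simp add: A1_def A2_def field_simps)
  moreover have "z ^ Suc k / of_real (real (Suc k) powr (3/2)) - z ^ Suc k / of_real (real (Suc k) powr (5/2))
      = of_real (cdiff k) * z ^ Suc k" for k
    by (simp add: cdiff_def algebra_simps)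
  ultimately show ?thesis by simp
qed

text \<open>A telescoping majorant: for a = sqrt n and b = sqrt (n + 1), 1 / a - 1 / b = 1 / ((a +
  b) a b), which is at least 1 / (2 b^3).\<close>

lemma cdiff_Suc_le: "cdiff (Suc k) \<le> 2 * (1 / sqrt (real (Suc k)) - 1 / sqrt (real (Suc (Suc k))))"
proof -
  define a b where "a = sqrt (real (Suc k))" and "b = sqrt (real (Suc (Suc k)))"
  have ab: "a > 0" "a \<le> b" by (auto simp: a_def b_def)
  have sq: "a * a = real (Suc k)" "b * b = real (Suc (Suc k))"
    by (simp_all add: a_def b_def del: of_nat_Suc)
  then have d: "b * b - a * a = 1" by simp
  have "real (Suc (Suc k)) powr (3 / 2) = real (Suc (Suc k)) powr (1 + 1 / 2)" by simp
  also have "\<dots> = (b * b) * b"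
    unfolding powr_add sq by (simp add: b_def powr_half_sqrt del: of_nat_Suc)
  finally have p: "real (Suc (Suc k)) powr (3 / 2) = b * b * b" .
  have "1 / (b * b * b) \<le> 2 * (1 / a - 1 / b)"
  proof -
    have "(b - a) * (b + a) = 1" using d by (simp add: algebra_simps)
    then have ba: "b - a = 1 / (b + a)" using ab by (simp add: field_simps)
    have "1 / a - 1 / b = (b - a) / (a * b)" using ab by (simp add: field_simps)
    also have "\<dots> = 1 / ((b + a) * (a * b))" unfolding ba by simp
    also have "\<dots> \<ge> 1 / ((b + b) * (b * b))"
      using ab by (intro divide_left_mono mult_mono) auto
    finally show ?thesis using ab by (simp add: field_simps)
  qed
  then show ?thesis using cdiff_bounds(2)[of "Suc k"] unfolding p a_def b_def by linarith
qed

text \<open>The telescoping majorant sums to 2, and sqrt (2 \<pi>) \<ge> 5 / 2. An explicit number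
  is needed, since this growth rate has to lose against the decay rate of the Fredholm
  remainder.\<close>

lemma norm_A2_minus_A1_le:
  assumes "norm z < 1"
  shows "norm (A2 z - A1 z) \<le> 4 / 5"
proof -
  let ?g = "\<lambda>k. 2 * (1 / sqrt (real (Suc k)) - 1 / sqrt (real (Suc (Suc k))))"
  have "(\<lambda>k. 1 / sqrt (real (Suc k)) - 1 / sqrt (real (Suc (Suc k)))) sums (1 / sqrt (real (Suc 0)) - 0)"
    by (rule telescope_sums') real_asymp
  from sums_mult[OF this, of 2] have g: "?g sums 2" by simp
  have "(\<lambda>k. of_real (cdiff (Suc k)) * z ^ Suc (Suc k)) sums (of_real (sqrt (2 * pi)) * (A2 z - A1 z))"
    using cdiff_sums[OF assms] by (subst sums_Suc_iff) simp
  then have e: "of_real (sqrt (2 * pi)) * (A2 z - A1 z) = (\<Sum>k. of_real (cdiff (Suc k)) * z ^ Suc (Suc k))"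
    by (simp add: sums_iff)
  have bd: "norm (of_real (cdiff (Suc k)) * z ^ Suc (Suc k)) \<le> ?g k" for k
  proof -
    have "norm z ^ Suc (Suc k) \<le> 1" using assms by (intro power_le_one) auto
    then have "norm (of_real (cdiff (Suc k)) * z ^ Suc (Suc k)) \<le> cdiff (Suc k) * 1"
      unfolding norm_mult norm_power norm_of_real using cdiff_bounds(1)[of "Suc k"]
      by (intro mult_mono) auto
    then show ?thesis using cdiff_Suc_le[of k] by linarith
  qed
  have "norm (of_real (sqrt (2 * pi)) * (A2 z - A1 z)) \<le> (\<Sum>k. ?g k)"
    unfolding e by (rule norm_suminf_le[OF bd sums_summable[OF g]])
  also have "\<dots> = 2" using g by (simp add: sums_iff)
  finally have "sqrt (2 * pi) * norm (A2 z - A1 z) \<le> 2" by (simp add: norm_mult)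
  moreover have "5 / 2 \<le> sqrt (2 * pi)"
  proof (rule real_le_rsqrt)
    have "(25 / 4) \<le> 2 * pi" using pi_approx by simp
    then show "(5 / 2)\<^sup>2 \<le> 2 * pi" by (simp add: power2_eq_square)
  qed
  then have "5 / 2 * norm (A2 z - A1 z) \<le> sqrt (2 * pi) * norm (A2 z - A1 z)"
    by (intro mult_right_mono) auto
  ultimately show ?thesis by simp
qed

definition expE :: "real \<Rightarrow> real \<Rightarrow> complex \<Rightarrow> complex" where
  "expE \<tau> y z = exp (of_real (- \<tau> + y * sqrt \<tau>) * A1 z + of_real \<tau> * A2 z + 2 * B z)"

lemma holomorphic_expE: "expE \<tau> y holomorphic_on ball 0 1"
  unfolding expE_def by (intro holomorphic_intros holomorphic_A1 holomorphic_A2 holomorphic_B)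

lemma bounded_on_cball_unit:
  assumes "f holomorphic_on ball 0 1" "r < 1"
  obtains M where "M \<ge> 0" "\<And>z. norm z \<le> r \<Longrightarrow> norm (f z :: complex) \<le> M"
proof -
  have "continuous_on (cball 0 r) f"
    using assms by (intro holomorphic_on_imp_continuous_on holomorphic_on_subset[OF assms(1)]) auto
  then have "compact (f ` cball 0 r)" by (intro compact_continuous_image) auto
  then have "bounded (f ` cball 0 r)" by (rule compact_imp_bounded)
  then obtain M where M: "\<forall>x\<in>f ` cball 0 r. norm x \<le> M" unfolding bounded_iff by blast
  show ?thesis
  proof (rule that[of "\<bar>M\<bar>"])
    show "norm (f z) \<le> \<bar>M\<bar>" if "norm z \<le> r" for z
    proof -
      have "f z \<in> f ` cball 0 r" using that by simp
      then have "norm (f z) \<le> M" using M by blast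
      then show ?thesis by linarith
    qed
  qed simp
qed

text \<open>The rate 17 / 20 is 4 / 5 from \<open>norm_A2_minus_A1_le\<close> plus 1 / 20 for the
  term of order sqrt \<tau>; the threshold on \<tau> makes the latter fit.\<close>

lemma norm_expE_le:
  assumes "r < 1"
  obtains C T where "C \<ge> 1" "T \<ge> 1" "\<And>\<tau> z. \<tau> \<ge> T \<Longrightarrow> norm z \<le> r \<Longrightarrow> norm (expE \<tau> y z) \<le> C * exp ((17 / 20) * \<tau>)"
proof -
  obtain a where a: "a \<ge> 0" "\<And>z. norm z \<le> r \<Longrightarrow> norm (A1 z) \<le> a"
    using bounded_on_cball_unit[OF holomorphic_A1 assms] by blast
  obtain b where b: "b \<ge> 0" "\<And>z. norm z \<le> r \<Longrightarrow> norm (B z) \<le> b"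
    using bounded_on_cball_unit[OF holomorphic_B assms] by blast
  show ?thesis
  proof (rule that[of "exp (2 * b)" "max 1 ((20 * \<bar>y\<bar> * a)\<^sup>2)"])
    fix \<tau> :: real and z :: complex assume \<tau>: "\<tau> \<ge> max 1 ((20 * \<bar>y\<bar> * a)\<^sup>2)" and z: "norm z \<le> r"
    have t0: "\<tau> \<ge> 0" using \<tau> by simp
    have "20 * \<bar>y\<bar> * a \<le> sqrt \<tau>" using \<tau> by (intro real_le_rsqrt) simp
    then have "sqrt \<tau> * (20 * \<bar>y\<bar> * a) \<le> sqrt \<tau> * sqrt \<tau>" using t0 by (intro mult_left_mono) auto
    then have sy: "\<bar>y\<bar> * sqrt \<tau> * a \<le> (1 / 20) * \<tau>" using t0 by (simp add: mult_ac)
    have e: "of_real (- \<tau> + y * sqrt \<tau>) * A1 z + of_real \<tau> * A2 z + 2 * B z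
      = of_real \<tau> * (A2 z - A1 z) + of_real (y * sqrt \<tau>) * A1 z + 2 * B z"
      by (simp add: algebra_simps)
    have "Re (of_real (- \<tau> + y * sqrt \<tau>) * A1 z + of_real \<tau> * A2 z + 2 * B z)
       \<le> norm (of_real \<tau> * (A2 z - A1 z)) + norm (of_real (y * sqrt \<tau>) * A1 z) + norm (2 * B z)"
      unfolding e
      by (intro order_trans[OF complex_Re_le_cmod] order_trans[OF norm_triangle_ineq] add_right_mono norm_triangle_ineq)
    also have "norm (of_real \<tau> * (A2 z - A1 z)) \<le> \<tau> * (4 / 5)"
      unfolding norm_mult using mult_left_mono[OF norm_A2_minus_A1_le[of z] t0] z assms t0 by simp
    also have "norm (of_real (y * sqrt \<tau>) * A1 z) \<le> (1 / 20) * \<tau>"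
    proof -
      have "norm (of_real (y * sqrt \<tau>) * A1 z) = \<bar>y\<bar> * sqrt \<tau> * norm (A1 z)"
        using t0 by (simp add: norm_mult abs_mult)
      also have "\<dots> \<le> \<bar>y\<bar> * sqrt \<tau> * a" using a(2)[OF z] t0 by (intro mult_left_mono) auto
      finally show ?thesis using sy by linarith
    qed
    also have "norm (2 * B z) \<le> 2 * b" using b(2)[OF z] by (simp add: norm_mult)
    finally have "Re (of_real (- \<tau> + y * sqrt \<tau>) * A1 z + of_real \<tau> * A2 z + 2 * B z) \<le> 2 * b + (17 / 20) * \<tau>"
      by simp
    then show "norm (expE \<tau> y z) \<le> exp (2 * b) * exp ((17 / 20) * \<tau>)"
      unfolding expE_def norm_exp_eq_Re by (simp flip: exp_add)
  qed (use b in auto)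
qed

text \<open>The real part of the line of integration in the variable w. It stays fixed as \<tau>
  grows; the numerical rates in \<open>wt_eps_bounds\<close> are computed for this value.\<close>

definition eps :: real where "eps = 1 / 100"

text \<open>A single pair of rates would not do: the remainder rate 3 a - b is positive for a = 3 /
  5 and b = 8 / 5. In the middle, |Im w| \<le> \<pi>, the other roots are far away and b = 4 holds.
  Near the ends they come closer and b drops to 8 / 5, but there the root 0 has |w| \<ge> \<pi>, so
  that a drops to 1 / 20.\<close>

lemma wt_eps_bounds:
  obtains C T where "C \<ge> 1" "T \<ge> 1"
    "\<And>\<tau> w. \<tau> \<ge> T \<Longrightarrow> Re w = eps \<Longrightarrow> \<bar>Im w\<bar> \<le> pi \<Longrightarrow> wt \<tau> (- \<tau> + y * sqrt \<tau>) w 0 \<le> C * exp ((3 / 5) * \<tau>)"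
    "\<And>\<tau> w k. \<tau> \<ge> T \<Longrightarrow> Re w = eps \<Longrightarrow> \<bar>Im w\<bar> \<le> pi \<Longrightarrow> k \<noteq> 0 \<Longrightarrow>
        wt \<tau> (- \<tau> + y * sqrt \<tau>) w k \<le> C * exp (- (4 * \<tau>) * real_of_int \<bar>k\<bar>)"
    "\<And>\<tau> w. \<tau> \<ge> T \<Longrightarrow> Re w = eps \<Longrightarrow> pi \<le> \<bar>Im w\<bar> \<Longrightarrow> \<bar>Im w\<bar> \<le> 2 * pi \<Longrightarrow>
        wt \<tau> (- \<tau> + y * sqrt \<tau>) w 0 \<le> C * exp ((1 / 20) * \<tau>)"
    "\<And>\<tau> w k. \<tau> \<ge> T \<Longrightarrow> Re w = eps \<Longrightarrow> \<bar>Im w\<bar> \<le> 2 * pi \<Longrightarrow> k \<noteq> 0 \<Longrightarrow>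
        wt \<tau> (- \<tau> + y * sqrt \<tau>) w k \<le> C * exp (- ((8 / 5) * \<tau>) * real_of_int \<bar>k\<bar>)"
proof -
  have eps0: "eps > 0" by (simp add: eps_def)
  obtain CQ where CQ: "CQ \<ge> 0" "\<And>\<xi>. \<xi> \<in> left_sector \<Longrightarrow> Re (\<xi>\<^sup>2) \<ge> eps \<Longrightarrow> norm (Q \<xi>) \<le> CQ"
    using norm_Q_le[OF eps0] by blast
  define T where "T = max 1 ((200 * \<bar>y\<bar>)\<^sup>2)"
  define D where "D w k = norm (w + 4 * of_real pi * \<i> * of_int k)" for w k
  define u where "u w k = Re (rt k w)" for w k
  \<comment> \<open>The number 253 / 250 exceeds 1 + 2 eps / 3 + 1 / 200, where 1 / 200 absorbs the
    term y sqrt \<tau> for \<tau> \<ge> T.\<close>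
  have gen: "wt \<tau> (- \<tau> + y * sqrt \<tau>) w k \<le> exp CQ * exp (\<tau> * (u w k * ((253 / 250) - D w k / 3)))"
    and upos: "u w k > 0" and u2: "2 * (u w k)\<^sup>2 = D w k + eps"
    if \<tau>: "\<tau> \<ge> T" and w: "Re w = eps" for \<tau> w k
  proof -
    have w0: "Re w > 0" using w eps0 by simp
    show u0: "u w k > 0" unfolding u_def by (rule Re_rt_pos[OF w0])
    show "2 * (u w k)\<^sup>2 = D w k + eps" unfolding u_def D_def rt_sq_parts w by simp
    have t0: "\<tau> \<ge> 0" using \<tau> by (simp add: T_def)
    have "200 * \<bar>y\<bar> \<le> sqrt \<tau>" using \<tau> by (intro real_le_rsqrt) (simp add: T_def)
    then have "sqrt \<tau> * (200 * \<bar>y\<bar>) \<le> sqrt \<tau> * sqrt \<tau>" using t0 by (intro mult_left_mono) auto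
    then have "\<bar>y\<bar> * sqrt \<tau> \<le> (1 / 200) * \<tau>" using t0 by (simp add: mult_ac)
    moreover have "- (y * sqrt \<tau>) \<le> \<bar>y\<bar> * sqrt \<tau>"
      using abs_ge_minus_self[of "y * sqrt \<tau>"] t0 by (simp add: abs_mult)
    ultimately have ny: "- (y * sqrt \<tau>) \<le> (1 / 200) * \<tau>" by linarith
    have "\<tau> * (2 * Re w - D w k) / 3 - (- \<tau> + y * sqrt \<tau>) = \<tau> * (1 + 2 * eps / 3) - \<tau> * D w k / 3 - y * sqrt \<tau>"
      unfolding w by (simp add: field_simps)
    also have "\<tau> * (1 + 2 * eps / 3) = 151 / 150 * \<tau>" unfolding eps_def by simp
    also have "151 / 150 * \<tau> - \<tau> * D w k / 3 - y * sqrt \<tau> \<le> (253 / 250) * \<tau> - \<tau> * D w k / 3"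
      using ny t0 by simp
    also have "\<dots> = \<tau> * ((253 / 250) - D w k / 3)" by (simp add: field_simps)
    finally have "\<tau> * (2 * Re w - D w k) / 3 - (- \<tau> + y * sqrt \<tau>) \<le> \<tau> * ((253 / 250) - D w k / 3)" .
    then have "u w k * (\<tau> * (2 * Re w - D w k) / 3 - (- \<tau> + y * sqrt \<tau>)) \<le> u w k * (\<tau> * ((253 / 250) - D w k / 3))"
      using u0 by (intro mult_left_mono) auto
    moreover have "norm (Q (- rt k w)) \<le> CQ"
    proof (rule CQ(2)[OF minus_rt_left_sector[OF w0]])
      show "eps \<le> Re ((- rt k w)\<^sup>2)" unfolding power2_minus rt_power2 using w by simp
    qed
    ultimately have "Re (Phi \<tau> (- \<tau> + y * sqrt \<tau>) (- rt k w)) \<le> CQ + u w k * (\<tau> * ((253 / 250) - D w k / 3))"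
      using abs_Re_le_cmod[of "Q (- rt k w)"] unfolding Re_Phi[OF w0] D_def u_def by linarith
    also have "\<dots> = CQ + \<tau> * (u w k * ((253 / 250) - D w k / 3))" by (simp only: mult_ac)
    finally show "wt \<tau> (- \<tau> + y * sqrt \<tau>) w k \<le> exp CQ * exp (\<tau> * (u w k * ((253 / 250) - D w k / 3)))"
      unfolding wt_def by (simp flip: exp_add)
  qed
  have Dk: "D w k \<ge> 4 * pi * real_of_int \<bar>k\<bar> - \<bar>Im w\<bar>" for w k
  proof -
    have "\<bar>Im w + 4 * pi * real_of_int k\<bar> \<le> D w k"
      using abs_Im_le_cmod[of "w + 4 * of_real pi * \<i> * of_int k"] by (simp add: D_def)
    moreover have "\<bar>4 * pi * real_of_int k\<bar> = 4 * pi * real_of_int \<bar>k\<bar>" by (simp add: abs_mult)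
    ultimately show ?thesis by linarith
  qed
  \<comment> \<open>D / 3 is split into (1 / 3 - \<beta>) D, which outweighs 253 / 250 because D
    \<ge> m, and \<beta> D, which with u \<ge> v and D \<ge> m |k| leaves the decay rate \<beta> v m
    \<ge> b. The numbers m, v, \<beta> supplied below are chosen for b = 4 and b = 8 / 5.\<close>
  have kk: "wt \<tau> (- \<tau> + y * sqrt \<tau>) w k \<le> exp CQ * exp (- (b * \<tau>) * real_of_int \<bar>k\<bar>)"
    if \<tau>: "\<tau> \<ge> T" and w: "Re w = eps" and k: "k \<noteq> 0" and m: "D w k \<ge> m * real_of_int \<bar>k\<bar>" "m > 0"
      and v: "v \<ge> 0" "2 * v\<^sup>2 \<le> m" and be: "\<beta> \<ge> 0" "(253 / 250) \<le> m * (1 / 3 - \<beta>)" and b: "b \<le> \<beta> * v * m"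
      and b3: "\<beta> \<le> 1 / 3"
    for \<tau> w k m v \<beta> b
  proof -
    have t0: "\<tau> \<ge> 0" using \<tau> by (simp add: T_def)
    have k1: "real_of_int \<bar>k\<bar> \<ge> 1" using k by linarith
    have Dm: "D w k \<ge> m" using m k1 mult_left_mono[of 1 "real_of_int \<bar>k\<bar>" m] by linarith
    have "(253 / 250) \<le> D w k * (1 / 3 - \<beta>)" using be(2) mult_right_mono[OF Dm, of "1 / 3 - \<beta>"] b3 by linarith
    then have "(253 / 250) - D w k / 3 \<le> - (\<beta> * D w k)" by (simp add: algebra_simps)
    then have "u w k * ((253 / 250) - D w k / 3) \<le> u w k * (- (\<beta> * D w k))"
      using upos[OF \<tau> w, of k] by (intro mult_left_mono) auto
    also have "\<dots> \<le> - (b * real_of_int \<bar>k\<bar>)"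
    proof -
      have "v\<^sup>2 \<le> (u w k)\<^sup>2" using v(2) u2[OF \<tau> w, of k] Dm eps0 by linarith
      then have "v \<le> u w k" by (rule power2_le_imp_le) (use upos[OF \<tau> w, of k] in simp)
      then have "v * (m * real_of_int \<bar>k\<bar>) \<le> u w k * D w k"
        using v m k1 by (intro mult_mono) auto
      then have "\<beta> * (v * (m * real_of_int \<bar>k\<bar>)) \<le> \<beta> * (u w k * D w k)"
        using be by (intro mult_left_mono)
      moreover have "b * real_of_int \<bar>k\<bar> \<le> \<beta> * v * m * real_of_int \<bar>k\<bar>"
        using b k1 by (intro mult_right_mono) auto
      ultimately show ?thesis by (simp add: mult_ac)
    qed
    finally have "\<tau> * (u w k * ((253 / 250) - D w k / 3)) \<le> \<tau> * (- (b * real_of_int \<bar>k\<bar>))"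
      using t0 by (rule mult_left_mono)
    then have "exp (\<tau> * (u w k * ((253 / 250) - D w k / 3))) \<le> exp (- (b * \<tau>) * real_of_int \<bar>k\<bar>)"
      by (simp add: mult_ac)
    then have "exp CQ * exp (\<tau> * (u w k * ((253 / 250) - D w k / 3))) \<le> exp CQ * exp (- (b * \<tau>) * real_of_int \<bar>k\<bar>)"
      by (intro mult_left_mono) auto
    then show ?thesis using gen[OF \<tau> w, of k] by linarith
  qed
  show ?thesis
  proof (rule that[of "exp CQ" T])
    show "exp CQ \<ge> 1" using CQ by simp
    show "T \<ge> 1" by (simp add: T_def)
  next
    fix \<tau> w k assume \<tau>: "\<tau> \<ge> T" and w: "Re w = eps" and k: "(k::int) \<noteq> 0"
    have k1: "real_of_int \<bar>k\<bar> \<ge> 1" using k by linarith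
    have pk: "3 * real_of_int \<bar>k\<bar> \<le> pi * real_of_int \<bar>k\<bar>" "pi \<le> pi * real_of_int \<bar>k\<bar>"
      using pi_gt3 k1 by (auto intro!: mult_right_mono)
    show "wt \<tau> (- \<tau> + y * sqrt \<tau>) w k \<le> exp CQ * exp (- (4 * \<tau>) * real_of_int \<bar>k\<bar>)" if "\<bar>Im w\<bar> \<le> pi"
    proof (rule kk[OF \<tau> w k, of 9 "53 / 25" "43 / 200"])
      show "9 * real_of_int \<bar>k\<bar> \<le> D w k" using Dk[of k w] pk that by linarith
    qed (simp_all add: power2_eq_square)
    show "wt \<tau> (- \<tau> + y * sqrt \<tau>) w k \<le> exp CQ * exp (- ((8 / 5) * \<tau>) * real_of_int \<bar>k\<bar>)" if "\<bar>Im w\<bar> \<le> 2 * pi"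
    proof (rule kk[OF \<tau> w k, of 6 "173 / 100" "4 / 25"])
      show "6 * real_of_int \<bar>k\<bar> \<le> D w k" using Dk[of k w] pk that by linarith
    qed (simp_all add: power2_eq_square)
  next
    fix \<tau> w assume \<tau>: "\<tau> \<ge> T" and w: "Re w = eps"
    have t0: "\<tau> \<ge> 0" using \<tau> by (simp add: T_def)
    let ?u = "u w 0"
    have u0: "?u > 0" and uu: "D w 0 = 2 * ?u\<^sup>2 - eps" using upos[OF \<tau> w, of 0] u2[OF \<tau> w, of 0] by auto
    have fin: "wt \<tau> (- \<tau> + y * sqrt \<tau>) w 0 \<le> exp CQ * exp (a * \<tau>)" if "?u * ((253 / 250) - D w 0 / 3) \<le> a" for a
    proof -
      have "\<tau> * (?u * ((253 / 250) - D w 0 / 3)) \<le> a * \<tau>" using that t0 by (simp add: mult_left_mono mult.commute)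
      then have "exp CQ * exp (\<tau> * (?u * ((253 / 250) - D w 0 / 3))) \<le> exp CQ * exp (a * \<tau>)"
        by (intro mult_left_mono) auto
      then show ?thesis using gen[OF \<tau> w, of 0] by linarith
    qed
    show "wt \<tau> (- \<tau> + y * sqrt \<tau>) w 0 \<le> exp CQ * exp ((3 / 5) * \<tau>)"
    proof (rule fin)
      \<comment> \<open>The exponent is a cubic in u, since D = 2 u^2 - eps. Its maximum is bounded
        by replacing u^3 by its tangent at 18 / 25, a point close to the maximiser.\<close>
      have "(?u - 18 / 25)\<^sup>2 * (?u + 36 / 25) = ?u ^ 3 - 972 / 625 * ?u + 11664 / 15625"
        by (simp add: power2_eq_square power3_eq_cube field_simps)
      moreover have "0 \<le> (?u - 18 / 25)\<^sup>2 * (?u + 36 / 25)" using u0 by simp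
      ultimately have "972 / 625 * ?u - 11664 / 15625 \<le> ?u ^ 3" by linarith
      moreover have "?u * ((253 / 250) - D w 0 / 3) = ((253 / 250) + eps / 3) * ?u - 2 / 3 * ?u ^ 3"
        unfolding uu by (simp add: power2_eq_square power3_eq_cube field_simps)
      moreover have "((253 / 250) + eps / 3) * ?u = 1523 / 1500 * ?u" by (simp add: eps_def)
      ultimately show "?u * ((253 / 250) - D w 0 / 3) \<le> (3 / 5)" using u0 by simp
    qed
    show "wt \<tau> (- \<tau> + y * sqrt \<tau>) w 0 \<le> exp CQ * exp ((1 / 20) * \<tau>)" if im: "pi \<le> \<bar>Im w\<bar>" "\<bar>Im w\<bar> \<le> 2 * pi"
    proof (rule fin)
      \<comment> \<open>D \<ge> \<pi> > 3 leaves at most 253 / 250 - 1 = 3 / 250 in the bracket, and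
        u is at most 21 / 10.\<close>
      have D3: "D w 0 \<ge> 3" using abs_Im_le_cmod[of w] im pi_gt3 by (simp add: D_def)
      have "D w 0 \<le> eps + 2 * pi" using cmod_le[of w] im w eps0 by (simp add: D_def)
      then have "D w 0 + eps \<le> (401 / 50)" using pi_less_4 by (simp add: eps_def)
      then have "?u\<^sup>2 \<le> (21 / 10)\<^sup>2" using uu by (simp add: power2_eq_square)
      then have "?u \<le> (21 / 10)" by (rule power2_le_imp_le) simp
      moreover have "(253 / 250) - D w 0 / 3 \<le> (3 / 250)" using D3 by simp
      ultimately have "?u * ((253 / 250) - D w 0 / 3) \<le> ?u * (3 / 250)" "?u * (3 / 250) \<le> 21 / 10 * (3 / 250)"
        using u0 by (auto intro: mult_left_mono)
      then show "?u * ((253 / 250) - D w 0 / 3) \<le> (1 / 20)" by simp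
    qed
  qed
qed

lemma kterm_000:
  assumes "Re w > 0"
  shows "kterm \<tau> x \<gamma> 0 0 0 w = exp (2 * Phi \<tau> x (- csqrt w)) / (4 * w\<^sup>2)"
proof -
  have r: "rt 0 w = csqrt w" by (simp add: rt_def)
  have "q * r * (r + r) * (r + r) * q = 4 * (q\<^sup>2 * r) * r\<^sup>2" for q r :: complex
    by (simp add: power2_eq_square algebra_simps)
  from this[of "csqrt (csqrt w)" "csqrt w"]
  have "csqrt (csqrt w) * csqrt w * (csqrt w + csqrt w) * (csqrt w + csqrt w) * csqrt (csqrt w)
     = 4 * ((csqrt (csqrt w))\<^sup>2 * csqrt w) * (csqrt w)\<^sup>2" .
  also have "(csqrt (csqrt w))\<^sup>2 * csqrt w = (csqrt w)\<^sup>2" by (metis power2_csqrt power2_eq_square)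
  also have "4 * (csqrt w)\<^sup>2 * (csqrt w)\<^sup>2 = 4 * w\<^sup>2" unfolding power2_csqrt by (simp add: power2_eq_square)
  finally show ?thesis by (simp add: kterm_def r)
qed

definition mainterm :: "real \<Rightarrow> real \<Rightarrow> complex \<Rightarrow> complex" where
  "mainterm \<tau> y w = expE \<tau> y (exp (- (w / 2))) * (exp (2 * Phi \<tau> (- \<tau> + y * sqrt \<tau>) (- csqrt w)) / (4 * w\<^sup>2))"

text \<open>The pairs (3/5, 4) and (1/20, 8/5) give the remainder rates - 11 / 5 and - 29 / 20, both
  below - 27 / 20. Multiplied by a weight of rate 17 / 20, this leaves exp (- \<tau> / 2).\<close>

lemma FF_approx:
  obtains C T where "\<And>\<tau> w. \<tau> \<ge> T \<Longrightarrow> Re w = eps \<Longrightarrow> \<bar>Im w\<bar> \<le> 2 * pi \<Longrightarrow>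
    norm (FF \<tau> (- \<tau> + y * sqrt \<tau>) \<gamma> w - (expE \<tau> y (exp (- (w / 2))) - mainterm \<tau> y w)) \<le> C * exp (- \<tau> / 2)"
proof -
  have eps0: "eps > 0" by (simp add: eps_def)
  obtain C1 T1 where 1: "C1 \<ge> 1" "T1 \<ge> 1"
    "\<And>\<tau> w. \<tau> \<ge> T1 \<Longrightarrow> Re w = eps \<Longrightarrow> \<bar>Im w\<bar> \<le> pi \<Longrightarrow> wt \<tau> (- \<tau> + y * sqrt \<tau>) w 0 \<le> C1 * exp (3 / 5 * \<tau>)"
    "\<And>\<tau> w k. \<tau> \<ge> T1 \<Longrightarrow> Re w = eps \<Longrightarrow> \<bar>Im w\<bar> \<le> pi \<Longrightarrow> k \<noteq> 0 \<Longrightarrow>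
        wt \<tau> (- \<tau> + y * sqrt \<tau>) w k \<le> C1 * exp (- (4 * \<tau>) * real_of_int \<bar>k\<bar>)"
    "\<And>\<tau> w. \<tau> \<ge> T1 \<Longrightarrow> Re w = eps \<Longrightarrow> pi \<le> \<bar>Im w\<bar> \<Longrightarrow> \<bar>Im w\<bar> \<le> 2 * pi \<Longrightarrow>
        wt \<tau> (- \<tau> + y * sqrt \<tau>) w 0 \<le> C1 * exp (1 / 20 * \<tau>)"
    "\<And>\<tau> w k. \<tau> \<ge> T1 \<Longrightarrow> Re w = eps \<Longrightarrow> \<bar>Im w\<bar> \<le> 2 * pi \<Longrightarrow> k \<noteq> 0 \<Longrightarrow>
        wt \<tau> (- \<tau> + y * sqrt \<tau>) w k \<le> C1 * exp (- (8 / 5 * \<tau>) * real_of_int \<bar>k\<bar>)"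
    by (rule wt_eps_bounds[of y]) (rule that; (assumption | simp))
  show ?thesis
  proof (rule fredholm_main_term[OF eps0 1(1)])
  fix K :: real assume K: "K \<ge> 1"
    "\<And>\<tau> x \<gamma> w a b. Re w = eps \<Longrightarrow> \<tau> \<ge> 1 \<Longrightarrow> a \<ge> 0 \<Longrightarrow> b \<ge> 1 \<Longrightarrow>
       wt \<tau> x w 0 \<le> C1 * exp (a * \<tau>) \<Longrightarrow>
       (\<And>k. k \<noteq> 0 \<Longrightarrow> wt \<tau> x w k \<le> C1 * exp (- (b * \<tau>) * real_of_int \<bar>k\<bar>)) \<Longrightarrow>
       K * exp ((a - b) * \<tau>) \<le> 1 / 4 \<Longrightarrow>
       norm (fredholm_det UNIV (Kmat \<tau> x \<gamma> w) - (1 - kterm \<tau> x \<gamma> 0 0 0 w)) \<le> K * exp ((3 * a - b) * \<tau>)"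
  have r1: "exp (- eps / 2) < 1" using eps0 by simp
  obtain C2 T2 where 2: "C2 \<ge> 1" "T2 \<ge> 1"
    "\<And>\<tau> z. \<tau> \<ge> T2 \<Longrightarrow> norm z \<le> exp (- eps / 2) \<Longrightarrow> norm (expE \<tau> y z) \<le> C2 * exp (17 / 20 * \<tau>)"
    by (rule norm_expE_le[OF r1, of y]) (rule that; (assumption | simp))
  \<comment> \<open>The bound \<tau> \<ge> ln (4 K) ensures K exp (- \<tau>) \<le> 1 / 4, the
    smallness condition of \<open>fredholm_main_term\<close>; both pairs of rates satisfy a - b
    \<le> - 1.\<close>
  define T where "T = max (max T1 T2) (ln (4 * K))"
  show ?thesis
  proof (rule that[of T "C2 * K"])
    fix \<tau> w assume \<tau>: "\<tau> \<ge> T" and w: "Re w = eps" and im: "\<bar>Im w\<bar> \<le> 2 * pi"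
    have t: "\<tau> \<ge> T1" "\<tau> \<ge> T2" "\<tau> \<ge> 1" "ln (4 * K) \<le> \<tau>" using \<tau> 1(2) by (auto simp: T_def)
    have w0: "Re w > 0" using w eps0 by simp
    let ?x = "- \<tau> + y * sqrt \<tau>"
    have "exp (ln (4 * K)) \<le> exp \<tau>" using t(4) by (simp only: exp_le_cancel_iff)
    moreover have "exp (ln (4 * K)) = 4 * K" using K(1) by (intro exp_ln) simp
    ultimately have "4 * K \<le> exp \<tau>" by simp
    then have Kt: "K * exp (- \<tau>) \<le> 1 / 4" by (simp add: exp_minus field_simps)
    have small: "K * exp ((a - b) * \<tau>) \<le> 1 / 4" if "a - b \<le> - 1" for a b
    proof -
      have "(a - b) * \<tau> \<le> (- 1) * \<tau>" using that t by (intro mult_right_mono) auto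
      then have "K * exp ((a - b) * \<tau>) \<le> K * exp (- \<tau>)" using K(1) by simp
      then show ?thesis using Kt by linarith
    qed
    have det: "norm (fredholm_det UNIV (Kmat \<tau> ?x \<gamma> w) - (1 - kterm \<tau> ?x \<gamma> 0 0 0 w)) \<le> K * exp (- (27 / 20) * \<tau>)"
    proof (cases "\<bar>Im w\<bar> \<le> pi")
      case True
      have "norm (fredholm_det UNIV (Kmat \<tau> ?x \<gamma> w) - (1 - kterm \<tau> ?x \<gamma> 0 0 0 w)) \<le> K * exp ((3 * (3 / 5) - 4) * \<tau>)"
        by (rule K(2)[OF w t(3)]) (use 1(3)[OF t(1) w True] 1(4)[OF t(1) w True] small[of "3/5" 4] in auto)
      also have "\<dots> \<le> K * exp (- (27 / 20) * \<tau>)" using K(1) t(3) by simp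
      finally show ?thesis .
    next
      case False
      have "norm (fredholm_det UNIV (Kmat \<tau> ?x \<gamma> w) - (1 - kterm \<tau> ?x \<gamma> 0 0 0 w)) \<le> K * exp ((3 * (1 / 20) - 8 / 5) * \<tau>)"
        by (rule K(2)[OF w t(3)]) (use 1(5)[OF t(1) w _ im] 1(6)[OF t(1) w im] False small[of "1/20" "8/5"] in auto)
      also have "\<dots> \<le> K * exp (- (27 / 20) * \<tau>)" using K(1) t(3) by simp
      finally show ?thesis .
    qed
    have nz: "norm (exp (- (w / 2))) \<le> exp (- eps / 2)" using w by (simp add: norm_exp_eq_Re)
    have "FF \<tau> ?x \<gamma> w = expE \<tau> y (exp (- (w / 2))) * fredholm_det UNIV (Kmat \<tau> ?x \<gamma> w)"
      unfolding FF_def Let_def fredholm_det_eq[OF w0] expE_def ..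
    moreover have "mainterm \<tau> y w = expE \<tau> y (exp (- (w / 2))) * kterm \<tau> ?x \<gamma> 0 0 0 w"
      unfolding mainterm_def kterm_000[OF w0] ..
    ultimately have "FF \<tau> ?x \<gamma> w - (expE \<tau> y (exp (- (w / 2))) - mainterm \<tau> y w)
      = expE \<tau> y (exp (- (w / 2))) * (fredholm_det UNIV (Kmat \<tau> ?x \<gamma> w) - (1 - kterm \<tau> ?x \<gamma> 0 0 0 w))"
      by (simp add: algebra_simps)
    then have "norm (FF \<tau> ?x \<gamma> w - (expE \<tau> y (exp (- (w / 2))) - mainterm \<tau> y w))
      = norm (expE \<tau> y (exp (- (w / 2)))) * norm (fredholm_det UNIV (Kmat \<tau> ?x \<gamma> w) - (1 - kterm \<tau> ?x \<gamma> 0 0 0 w))"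
      by (simp only: norm_mult)
    also have "\<dots> \<le> (C2 * exp (17 / 20 * \<tau>)) * (K * exp (- (27 / 20) * \<tau>))"
      by (intro mult_mono 2(3)[OF t(2) nz] det) (use 2 in auto)
    also have "\<dots> = C2 * K * exp (17 / 20 * \<tau> + - (27 / 20) * \<tau>)" unfolding exp_add by simp
    also have "17 / 20 * \<tau> + - (27 / 20) * \<tau> = - \<tau> / 2" by simp
    finally show "norm (FF \<tau> ?x \<gamma> w - (expE \<tau> y (exp (- (w / 2))) - mainterm \<tau> y w)) \<le> C2 * K * exp (- \<tau> / 2)" .
  qed
  qed
qed

text \<open>A primitive of f z / z with its simple pole removed. It is single valued on the disc, so
  the pole at 0 can be accounted for separately by a logarithm.\<close>

lemma divided_difference_primitive:
  assumes "f holomorphic_on ball 0 1"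
  obtains P where "\<And>z. norm z < 1 \<Longrightarrow> P field_differentiable (at z)"
    "\<And>z. norm z < 1 \<Longrightarrow> z \<noteq> 0 \<Longrightarrow> (P has_field_derivative (f z - f 0) / z) (at z)"
proof -
  let ?g = "\<lambda>z. if z = 0 then deriv f 0 else (f z - f 0) / (z - 0)"
  have "?g holomorphic_on ball 0 1" by (rule pole_lemma_open[OF assms open_ball])
  then obtain P where P: "\<And>x. x \<in> ball 0 1 \<Longrightarrow> (P has_field_derivative ?g x) (at x within ball 0 1)"
    using holomorphic_convex_primitive'[OF convex_ball open_ball] by blast
  have P': "(P has_field_derivative ?g x) (at x)" if "norm x < 1" for x
    using P[of x] at_within_open[OF _ open_ball, of x 0 1] that by simp
  show ?thesis
  proof (rule that)
    show "P field_differentiable (at z)" if "norm z < 1" for z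
      using P'[OF that] field_differentiable_def by blast
    show "(P has_field_derivative (f z - f 0) / z) (at z)" if "norm z < 1" "z \<noteq> 0" for z
      using P'[OF that(1)] that(2) by simp
  qed
qed

section \<open>Integrals along the vertical line Re w = eps\<close>

lemma expE_0 [simp]: "expE \<tau> y 0 = 1" by (simp add: expE_def)

lemma path_image_eps_line:
  assumes "w \<in> path_image (linepath (of_real eps - 2 * of_real pi * \<i>) (of_real eps + 2 * of_real pi * \<i>))"
  shows "Re w = eps" "\<bar>Im w\<bar> \<le> 2 * pi"
proof -
  obtain u where u: "0 \<le> u" "u \<le> 1" "w = (1 - u) *\<^sub>R (of_real eps - 2 * of_real pi * \<i>) + u *\<^sub>R (of_real eps + 2 * of_real pi * \<i>)"
    using assms by (auto simp: in_segment)
  show "Re w = eps" using arg_cong[OF u(3), of Re] by (simp add: algebra_simps)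
  have "Im w = (2 * u - 1) * (2 * pi)" using arg_cong[OF u(3), of Im] by (simp add: algebra_simps)
  moreover have "\<bar>2 * u - 1\<bar> \<le> 1" using u by auto
  ultimately show "\<bar>Im w\<bar> \<le> 2 * pi"
    using mult_right_mono[of "\<bar>2 * u - 1\<bar>" 1 "2 * pi"] by (simp add: abs_mult)
qed

lemma path_image_eps_line_subset:
  "path_image (linepath (of_real eps - 2 * of_real pi * \<i>) (of_real eps + 2 * of_real pi * \<i>)) \<subseteq> {w. Re w > 0}"
proof
  fix w assume "w \<in> path_image (linepath (of_real eps - 2 * of_real pi * \<i>) (of_real eps + 2 * of_real pi * \<i>))"
  then have "Re w = eps" by (rule path_image_eps_line)
  then show "w \<in> {w. Re w > 0}" by (simp add: eps_def)
qed

text \<open>Up to the factor - 1 / 2 the integrand is \<open>expE\<close> times dz / z. The regular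
  part has a primitive that is a function of z, hence periodic in w, and only the increment of w
  itself survives, which is the residue 1 at z = 0.\<close>

lemma expE_period_integral:
  "((\<lambda>w. expE \<tau> y (exp (- (w / 2)))) has_contour_integral 4 * of_real pi * \<i>)
     (linepath (of_real eps - 2 * of_real pi * \<i>) (of_real eps + 2 * of_real pi * \<i>))"
proof -
  let ?l = "linepath (of_real eps - 2 * of_real pi * \<i>) (of_real eps + 2 * of_real pi * \<i>)"
  let ?H = "{w. Re w > 0}"
  obtain P where P: "\<And>z. norm z < 1 \<Longrightarrow> z \<noteq> 0 \<Longrightarrow> (P has_field_derivative (expE \<tau> y z - expE \<tau> y 0) / z) (at z)"
    using divided_difference_primitive[OF holomorphic_expE] by metis
  let ?G = "\<lambda>w. w - 2 * P (exp (- (w / 2)))"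
  have G: "(?G has_field_derivative expE \<tau> y (exp (- (w / 2)))) (at w within ?H)" if "w \<in> ?H" for w
  proof -
    let ?z = "exp (- (w / 2))"
    have "norm ?z < 1" using that norm_exp_half_less by simp
    from P[OF this] have "((\<lambda>w. P (exp (- (w / 2)))) has_field_derivative (expE \<tau> y ?z - 1) / ?z * (?z * (- (1 / 2)))) (at w within ?H)"
      by (intro DERIV_chain2[where f=P and g="\<lambda>w. exp (- (w / 2))"]) (auto intro!: derivative_eq_intros)
    then have "(?G has_field_derivative (1 - 2 * ((expE \<tau> y ?z - 1) / ?z * (?z * (- (1 / 2)))))) (at w within ?H)"
      by (rule DERIV_diff[OF DERIV_ident DERIV_cmult])
    moreover have "1 - 2 * ((expE \<tau> y ?z - 1) / ?z * (?z * (- (1 / 2)))) = expE \<tau> y ?z"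
      by (simp add: field_simps)
    ultimately show ?thesis by (simp only:)
  qed
  have im: "path_image ?l \<subseteq> ?H" by (rule path_image_eps_line_subset)
  have "((\<lambda>w. expE \<tau> y (exp (- (w / 2)))) has_contour_integral (?G (pathfinish ?l) - ?G (pathstart ?l))) ?l"
    by (rule contour_integral_primitive[OF G valid_path_linepath im])
  moreover have "exp (- ((of_real eps + 2 * of_real pi * \<i>) / 2)) = exp (- ((of_real eps - 2 * of_real pi * \<i>) / 2))"
  proof -
    have "- ((of_real eps + 2 * of_real pi * \<i>) / 2) = - ((of_real eps - 2 * of_real pi * \<i>) / 2) + of_int (2 * (-1)) * pi * \<i>"
      by (simp add: field_simps)
    then show ?thesis unfolding exp_eq by (rule exI)
  qed
  ultimately show ?thesis by (simp add: algebra_simps)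
qed

lemma holomorphic_mainterm: "mainterm \<tau> y holomorphic_on {w. Re w > 0}"
proof -
  have "(expE \<tau> y \<circ> (\<lambda>w. exp (- (w / 2)))) holomorphic_on {w. Re w > 0}"
    using norm_exp_half_less
    by (intro holomorphic_on_compose_gen[OF _ holomorphic_expE] holomorphic_intros) auto
  then have e: "(\<lambda>w. expE \<tau> y (exp (- (w / 2)))) holomorphic_on {w. Re w > 0}" by (simp add: o_def)
  have "rt 0 = csqrt" by (auto simp: rt_def)
  then have p: "(\<lambda>w. Phi \<tau> x (- csqrt w)) holomorphic_on {w. Re w > 0}" for x
    using holomorphic_Phi_rt[of \<tau> x 0] by simp
  show ?thesis
    unfolding mainterm_def[abs_def] by (intro holomorphic_intros e p) auto
qed

lemma F_minus_mainterm_tendsto_0: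
  assumes R: "0 < R" "R < 1"
  shows "((\<lambda>\<tau>. F R (- \<tau> + y * sqrt \<tau>) \<tau> \<gamma> -
      (1 - contour_integral (linepath (of_real eps - 2 * of_real pi * \<i>) (of_real eps + 2 * of_real pi * \<i>)) (mainterm \<tau> y) / (4 * of_real pi * \<i>))) \<longlongrightarrow> 0) at_top"
proof -
  let ?l = "linepath (of_real eps - 2 * of_real pi * \<i>) (of_real eps + 2 * of_real pi * \<i>)"
  let ?H = "{w. Re w > 0}"
  have eps0: "eps > 0" by (simp add: eps_def)
  have im: "path_image ?l \<subseteq> ?H" by (rule path_image_eps_line_subset)
  obtain C T where CT: "\<And>\<tau> w. \<tau> \<ge> T \<Longrightarrow> Re w = eps \<Longrightarrow> \<bar>Im w\<bar> \<le> 2 * pi \<Longrightarrow>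
    norm (FF \<tau> (- \<tau> + y * sqrt \<tau>) \<gamma> w - (expE \<tau> y (exp (- (w / 2))) - mainterm \<tau> y w)) \<le> C * exp (- \<tau> / 2)"
    by (rule FF_approx[of y \<gamma>]) (rule that; (assumption | simp))
  have bound: "norm (F R (- \<tau> + y * sqrt \<tau>) \<tau> \<gamma> - (1 - contour_integral ?l (mainterm \<tau> y) / (4 * of_real pi * \<i>))) \<le> C * exp (- \<tau> / 2)"
    if \<tau>: "\<tau> \<ge> max T 1" for \<tau>
  proof -
    let ?x = "- \<tau> + y * sqrt \<tau>"
    have t0: "\<tau> > 0" "\<tau> \<ge> T" using \<tau> by auto
    have ci: "f contour_integrable_on ?l" if "f holomorphic_on ?H" for f
      using im by (intro contour_integrable_continuous_linepath continuous_on_subset[OF holomorphic_on_imp_continuous_on[OF that]])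
        (simp add: path_image_linepath)
    have F: "F R ?x \<tau> \<gamma> = contour_integral ?l (FF \<tau> ?x \<gamma>) / (4 * of_real pi * \<i>)"
      by (rule F_eq_period_integral[OF R t0(1)]) (use eps0 in simp)
    have d: "((\<lambda>w. FF \<tau> ?x \<gamma> w - (expE \<tau> y (exp (- (w / 2))) - mainterm \<tau> y w)) has_contour_integral
        (contour_integral ?l (FF \<tau> ?x \<gamma>) - (4 * of_real pi * \<i> - contour_integral ?l (mainterm \<tau> y)))) ?l"
      by (intro has_contour_integral_diff has_contour_integral_integral ci holomorphic_FF holomorphic_mainterm t0 expE_period_integral)
    have C0: "0 \<le> C * exp (- \<tau> / 2)"
      using order_trans[OF norm_ge_zero CT[OF t0(2), of "of_real eps"]] by simp
    have "norm (contour_integral ?l (FF \<tau> ?x \<gamma>) - (4 * of_real pi * \<i> - contour_integral ?l (mainterm \<tau> y)))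
        \<le> C * exp (- \<tau> / 2) * norm ((of_real eps + 2 * of_real pi * \<i>) - (of_real eps - 2 * of_real pi * \<i>))"
      by (rule has_contour_integral_bound_linepath[OF d C0])
         (use CT[OF t0(2)] path_image_eps_line in \<open>auto simp: path_image_linepath\<close>)
    also have "norm ((of_real eps + 2 * of_real pi * \<i>) - (of_real eps - 2 * of_real pi * \<i>)) = 4 * pi"
      by (simp add: norm_mult)
    finally have n: "norm (contour_integral ?l (FF \<tau> ?x \<gamma>) - (4 * of_real pi * \<i> - contour_integral ?l (mainterm \<tau> y))) \<le> C * exp (- \<tau> / 2) * (4 * pi)" .
    have "F R ?x \<tau> \<gamma> - (1 - contour_integral ?l (mainterm \<tau> y) / (4 * of_real pi * \<i>))
       = (contour_integral ?l (FF \<tau> ?x \<gamma>) - (4 * of_real pi * \<i> - contour_integral ?l (mainterm \<tau> y))) / (4 * of_real pi * \<i>)"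
      unfolding F by (simp add: diff_divide_distrib)
    then have "norm (F R ?x \<tau> \<gamma> - (1 - contour_integral ?l (mainterm \<tau> y) / (4 * of_real pi * \<i>)))
       = norm (contour_integral ?l (FF \<tau> ?x \<gamma>) - (4 * of_real pi * \<i> - contour_integral ?l (mainterm \<tau> y))) / (4 * pi)"
      by (simp add: norm_divide norm_mult)
    also have "\<dots> \<le> C * exp (- \<tau> / 2) * (4 * pi) / (4 * pi)"
      by (rule divide_right_mono[OF n]) simp
    finally show ?thesis by simp
  qed
  show ?thesis
  proof (rule Lim_null_comparison)
    show "\<forall>\<^sub>F \<tau> in at_top. norm (F R (- \<tau> + y * sqrt \<tau>) \<tau> \<gamma> - (1 - contour_integral ?l (mainterm \<tau> y) / (4 * of_real pi * \<i>))) \<le> C * exp (- \<tau> / 2)"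
      using bound by (intro eventually_at_top_linorderI[of "max T 1"])
    have "((\<lambda>\<tau>::real. exp (- \<tau> / 2)) \<longlongrightarrow> 0) at_top" by real_asymp
    then show "((\<lambda>\<tau>. C * exp (- \<tau> / 2)) \<longlongrightarrow> 0) at_top"
      using tendsto_mult_right_zero by blast
  qed
qed

section \<open>Continuation of the polylogarithm of order one half\<close>

lemma has_bochner_integral_FTC_real_line:
  fixes f F :: "real \<Rightarrow> real"
  assumes F: "\<And>x. DERIV F x :> f x" and f: "\<And>x. isCont f x" and nn: "\<And>x. 0 \<le> f x"
    and A: "(F \<longlongrightarrow> l) at_bot" and B: "(F \<longlongrightarrow> u) at_top"
  shows "has_bochner_integral lborel f (u - l)"
proof -
  have A': "((F \<circ> real_of_ereal) \<longlongrightarrow> l) (at_right (- \<infinity>))"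
    and B': "((F \<circ> real_of_ereal) \<longlongrightarrow> u) (at_left \<infinity>)"
    using A B by (simp_all add: ereal_tendsto_simps)
  have e: "einterval (- \<infinity>) \<infinity> = (UNIV :: real set)" by (simp add: einterval_def)
  have "set_integrable lborel (einterval (- \<infinity>) \<infinity>) f" "(LBINT x=- \<infinity>..\<infinity>. f x) = u - l"
    using interval_integral_FTC_nonneg[of "- \<infinity>" \<infinity> F f l u] F f nn A' B' by auto
  then show ?thesis
    unfolding e by (simp add: has_bochner_integral_iff set_integrable_def interval_lebesgue_integral_def set_lebesgue_integral_def e)
qed

lemma has_bochner_integral_inverse_sum_squares:
  assumes "s > 0"
  shows "has_bochner_integral lborel (\<lambda>y. 1 / (s\<^sup>2 + y\<^sup>2)) (pi / s)"
proof -
  have "has_bochner_integral lborel (\<lambda>y. 1 / (s\<^sup>2 + y\<^sup>2)) (pi / 2 / s - - (pi / 2) / s)"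
  proof (rule has_bochner_integral_FTC_real_line[where F="\<lambda>y. arctan (y / s) / s"])
    fix y :: real
    have p: "s\<^sup>2 + y\<^sup>2 > 0" using assms by (simp add: add_pos_nonneg)
    have "((\<lambda>y. arctan (y / s) / s) has_real_derivative (inverse (1 + (y / s)\<^sup>2) * (1 / s)) / s) (at y)"
      by (rule DERIV_cdivide, rule DERIV_chain2[OF DERIV_arctan]) (use assms in \<open>auto intro!: derivative_eq_intros\<close>)
    moreover have "(inverse (1 + (y / s)\<^sup>2) * (1 / s)) / s = 1 / (s\<^sup>2 + y\<^sup>2)"
    proof -
      have "(1 + (y / s)\<^sup>2) * s\<^sup>2 = s\<^sup>2 + y\<^sup>2"
        using assms by (simp add: power_divide distrib_right)
      moreover have "(inverse (1 + (y / s)\<^sup>2) * (1 / s)) / s = 1 / ((1 + (y / s)\<^sup>2) * s\<^sup>2)"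
        by (simp add: inverse_eq_divide power2_eq_square)
      ultimately show ?thesis by (simp only:)
    qed
    ultimately show "((\<lambda>y. arctan (y / s) / s) has_real_derivative 1 / (s\<^sup>2 + y\<^sup>2)) (at y)" by simp
    show "isCont (\<lambda>y. 1 / (s\<^sup>2 + y\<^sup>2)) y" using p by (intro continuous_intros) auto
    show "0 \<le> 1 / (s\<^sup>2 + y\<^sup>2)" using p by simp
  next
    have "filterlim (\<lambda>y. y / s) at_bot at_bot"
      using assms filterlim_tendsto_pos_mult_at_bot[OF tendsto_const[of "1 / s"] _ filterlim_ident] by simp
    then have "((\<lambda>y. arctan (y / s)) \<longlongrightarrow> - (pi / 2)) at_bot" by (rule filterlim_compose[OF tendsto_arctan_at_bot])
    then show "((\<lambda>y. arctan (y / s) / s) \<longlongrightarrow> - (pi / 2) / s) at_bot" by (rule tendsto_divide[OF _ tendsto_const]) (use assms in simp)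
    have "filterlim (\<lambda>y. y / s) at_top at_top"
      using assms filterlim_tendsto_pos_mult_at_top[OF tendsto_const[of "1 / s"] _ filterlim_ident] by simp
    then have "((\<lambda>y. arctan (y / s)) \<longlongrightarrow> pi / 2) at_top" by (rule filterlim_compose[OF tendsto_arctan_at_top])
    then show "((\<lambda>y. arctan (y / s) / s) \<longlongrightarrow> pi / 2 / s) at_top" by (rule tendsto_divide[OF _ tendsto_const]) (use assms in simp)
  qed
  then show ?thesis by (simp add: field_simps)
qed

text \<open>The unnormalised Gaussian moment: the integral of y^(2 j) exp (- y^2 / 2) over the
  line.\<close>

definition gmoment :: "nat \<Rightarrow> real" where
  "gmoment j = sqrt (2 * pi) * (fact (2 * j) / (2 ^ j * fact j))"

lemma gaussian_moment:
  assumes "c > 0"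
  shows "has_bochner_integral lborel (\<lambda>y. y ^ (2 * j) * exp (- (c * y\<^sup>2 / 2))) (gmoment j / c powr (real j + 1 / 2))"
proof -
  have "has_bochner_integral lborel (\<lambda>x. sqrt (2 * pi) * (std_normal_density x * x ^ (2 * j))) (gmoment j)"
    unfolding gmoment_def by (intro has_bochner_integral_mult_right std_normal_moment_even)
  then have "has_bochner_integral lborel (\<lambda>x. x ^ (2 * j) * exp (- (x\<^sup>2 / 2))) (gmoment j)"
    by (simp add: std_normal_density_def mult_ac)
  then have "has_bochner_integral lborel (\<lambda>x. (0 + sqrt c * x) ^ (2 * j) * exp (- ((0 + sqrt c * x)\<^sup>2 / 2))) (gmoment j /\<^sub>R \<bar>sqrt c\<bar>)"
    using assms lborel_has_bochner_integral_real_affine_iff[of "sqrt c" "\<lambda>x. x ^ (2 * j) * exp (- (x\<^sup>2 / 2))" "gmoment j" 0] by simp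
  moreover have "gmoment j /\<^sub>R \<bar>sqrt c\<bar> = gmoment j / sqrt c" using assms by (simp add: divide_inverse)
  ultimately have "has_bochner_integral lborel (\<lambda>x. (sqrt c * x) ^ (2 * j) * exp (- ((sqrt c * x)\<^sup>2 / 2))) (gmoment j / sqrt c)"
    by (simp only: add_0)
  then have "has_bochner_integral lborel (\<lambda>x. (1 / c ^ j) * ((sqrt c * x) ^ (2 * j) * exp (- ((sqrt c * x)\<^sup>2 / 2)))) ((1 / c ^ j) * (gmoment j / sqrt c))"
    by (rule has_bochner_integral_mult_right)
  moreover have "(1 / c ^ j) * ((sqrt c * x) ^ (2 * j) * exp (- ((sqrt c * x)\<^sup>2 / 2))) = x ^ (2 * j) * exp (- (c * x\<^sup>2 / 2))" for x
    using assms by (simp add: power_mult_distrib power_mult)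
  moreover have "(1 / c ^ j) * (gmoment j / sqrt c) = gmoment j / c powr (real j + 1 / 2)"
    using assms by (simp add: powr_add powr_half_sqrt powr_realpow)
  ultimately show ?thesis by (simp only:)
qed

text \<open>Expand the geometric series in z exp (- y^2 / 2) and integrate the Gaussians termwise.
  The case j = 0 serves the continuation of \<open>Lihalf\<close>; j = 1 and j = 2 give the
  phase.\<close>

lemma polylog_integral:
  assumes z: "norm z < 1"
  shows "has_bochner_integral lborel (\<lambda>y. of_real (y ^ (2 * j)) * (z / (of_real (exp (y\<^sup>2 / 2)) - z)))
    (of_real (gmoment j) * polylog (real j + 1 / 2) z)"
proof -
  let ?f = "\<lambda>k y. z ^ Suc k * of_real (y ^ (2 * j) * exp (- (real (Suc k) * y\<^sup>2 / 2)))"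
  let ?I = "\<lambda>k. z ^ Suc k * of_real (gmoment j / real (Suc k) powr (real j + 1 / 2))"
  have i: "has_bochner_integral lborel (?f k) (?I k)" for k
    by (intro has_bochner_integral_mult_right has_bochner_integral_of_real gaussian_moment) simp
  have geo: "(\<lambda>k. z ^ Suc k * of_real (y ^ (2 * j) * exp (- (real (Suc k) * y\<^sup>2 / 2)))) sums
      (of_real (y ^ (2 * j)) * (z / (of_real (exp (y\<^sup>2 / 2)) - z)))"
    and geon: "summable (\<lambda>k. norm (z ^ Suc k * of_real (y ^ (2 * j) * exp (- (real (Suc k) * y\<^sup>2 / 2)))))" for y
  proof -
    let ?q = "z * of_real (exp (- (y\<^sup>2 / 2)))"
    have nq: "norm ?q < 1"
    proof -
      have "norm ?q \<le> norm z * 1" unfolding norm_mult by (intro mult_left_mono) auto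
      then show ?thesis using z by simp
    qed
    have e: "z ^ Suc k * of_real (y ^ (2 * j) * exp (- (real (Suc k) * y\<^sup>2 / 2))) = of_real (y ^ (2 * j)) * ?q ^ Suc k" for k
    proof -
      have "exp (- (real (Suc k) * y\<^sup>2 / 2)) = exp (- (y\<^sup>2 / 2)) ^ Suc k"
        by (subst exp_of_nat_mult[symmetric]) (simp del: of_nat_Suc)
      then show ?thesis by (simp only: power_mult_distrib of_real_mult of_real_power mult_ac)
    qed
    have s1: "(\<lambda>k. of_real (y ^ (2 * j)) * ?q ^ Suc k) sums (of_real (y ^ (2 * j)) * (?q / (1 - ?q)))"
      by (intro sums_mult sums_power_Suc nq)
    have s2: "z / (of_real (exp (y\<^sup>2 / 2)) - z) = ?q / (1 - ?q)"
    proof -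
      have g: "z / (E - z) = (z * (1 / E)) / (1 - z * (1 / E))" if "E \<noteq> 0" for E
      proof -
        have "1 - z * (1 / E) = (E - z) / E" using that by (simp add: diff_divide_distrib)
        then show ?thesis using that by simp
      qed
      have "exp (- (y\<^sup>2 / 2)) = 1 / exp (y\<^sup>2 / 2)" by (simp add: exp_minus inverse_eq_divide)
      then have "complex_of_real (exp (- (y\<^sup>2 / 2))) = 1 / of_real (exp (y\<^sup>2 / 2))" by simp
      then show ?thesis using g[of "of_real (exp (y\<^sup>2 / 2))"] by (simp only: of_real_eq_0_iff exp_not_eq_zero not_False_eq_True simp_thms)
    qed
    show "(\<lambda>k. z ^ Suc k * of_real (y ^ (2 * j) * exp (- (real (Suc k) * y\<^sup>2 / 2)))) sums
      (of_real (y ^ (2 * j)) * (z / (of_real (exp (y\<^sup>2 / 2)) - z)))" unfolding e s2 by (rule s1)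
    have "summable (\<lambda>k. norm (of_real (y ^ (2 * j)) :: complex) * norm ?q ^ Suc k)"
      using sums_power_Suc[of "norm ?q"] nq by (intro summable_mult) (auto intro: sums_summable)
    then show "summable (\<lambda>k. norm (z ^ Suc k * of_real (y ^ (2 * j) * exp (- (real (Suc k) * y\<^sup>2 / 2)))))"
      unfolding e norm_mult[of "of_real (y ^ (2 * j))"] norm_power[of ?q] .
  qed
  have nI: "(\<integral>y. norm (?f k y) \<partial>lborel) = norm z ^ Suc k * (gmoment j / real (Suc k) powr (real j + 1 / 2))" for k
  proof -
    have "has_bochner_integral lborel (\<lambda>y. norm z ^ Suc k * (y ^ (2 * j) * exp (- (real (Suc k) * y\<^sup>2 / 2)))) (norm z ^ Suc k * (gmoment j / real (Suc k) powr (real j + 1 / 2)))"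
      by (intro has_bochner_integral_mult_right gaussian_moment) simp
    moreover have "norm (?f k y) = norm z ^ Suc k * (y ^ (2 * j) * exp (- (real (Suc k) * y\<^sup>2 / 2)))" for y
      unfolding norm_mult norm_power norm_of_real by (simp add: abs_mult power_mult)
    ultimately show ?thesis by (simp only: has_bochner_integral_iff)
  qed
  have g0: "gmoment j \<ge> 0" by (simp add: gmoment_def)
  have sI: "summable (\<lambda>k. \<integral>y. norm (?f k y) \<partial>lborel)"
  proof -
    have "summable (\<lambda>k. gmoment j * norm (z ^ Suc k / complex_of_real (real (Suc k) powr (real j + 1 / 2))))"
      by (intro summable_mult summable_polylog z) simp
    then show ?thesis unfolding nI by (simp add: norm_divide norm_mult norm_power mult_ac del: of_nat_Suc)
  qed
  have ig: "integrable lborel (?f k)" for k using i by (simp add: has_bochner_integral_iff)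
  have ae: "AE y in lborel. summable (\<lambda>k. norm (?f k y))" using geon by simp
  have lim: "(\<lambda>y. \<Sum>k. ?f k y) = (\<lambda>y. of_real (y ^ (2 * j)) * (z / (of_real (exp (y\<^sup>2 / 2)) - z)))"
    using geo by (intro ext) (simp only: sums_iff)
  have "integrable lborel (\<lambda>y. \<Sum>k. ?f k y)" by (rule integrable_suminf[OF ig ae sI])
  moreover have "(\<integral>y. (\<Sum>k. ?f k y) \<partial>lborel) = (\<Sum>k. integral\<^sup>L lborel (?f k))" by (rule integral_suminf[OF ig ae sI])
  moreover have "(\<Sum>k. integral\<^sup>L lborel (?f k)) = of_real (gmoment j) * polylog (real j + 1 / 2) z"
  proof -
    have "integral\<^sup>L lborel (?f k) = of_real (gmoment j) * (z ^ Suc k / of_real (real (Suc k) powr (real j + 1 / 2)))" for k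
      using i[of k] by (simp only: has_bochner_integral_iff) simp
    then show ?thesis
      using sums_mult[OF polylog_sums[OF z, of "real j + 1 / 2"], of "of_real (gmoment j)"] by (simp only: sums_iff)
  qed
  ultimately show ?thesis unfolding lim by (simp add: has_bochner_integral_iff)
qed

section \<open>The even part of the half-order polylogarithm\<close>

definition strip :: "complex set" where "strip = {w. \<bar>Im w\<bar> < 2 * pi}"

text \<open>\<open>1 / (exp w - 1)\<close> with its pole at the origin removed; the value at the origin is the limit.\<close>

definition phiB :: "complex \<Rightarrow> complex" where
  "phiB w = (if w = 0 then Lim (at 0) (\<lambda>w. 1 / (exp w - 1) - 1 / w) else 1 / (exp w - 1) - 1 / w)"

lemma open_strip: "open strip"
  unfolding strip_def by (intro open_Collect_less continuous_intros)

lemma exp_neq_1_strip: "w \<in> strip \<Longrightarrow> w \<noteq> 0 \<Longrightarrow> exp w \<noteq> 1"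
proof
  assume w: "w \<in> strip" "w \<noteq> 0" and "exp w = 1"
  then obtain n :: int where n: "Re w = 0" "Im w = of_int (2 * n) * pi" by (auto simp: exp_eq_1)
  have "n \<noteq> 0" using n w(2) by (auto simp: complex_eq_iff)
  then have "1 \<le> \<bar>real_of_int n\<bar>" by linarith
  then have "2 * pi * 1 \<le> 2 * pi * \<bar>real_of_int n\<bar>" by (intro mult_left_mono) auto
  moreover have "\<bar>Im w\<bar> = 2 * pi * \<bar>real_of_int n\<bar>" unfolding n(2) by (simp add: abs_mult)
  ultimately show False using w(1) by (simp add: strip_def)
qed

text \<open>Two divided differences: (exp w - 1) / w has no zero in the strip, its reciprocal h is
  holomorphic there, and \<open>phiB\<close> is (h w - h 0) / w. The strip ends at the next poles, +
  2 \<pi> i and - 2 \<pi> i.\<close>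

lemma holomorphic_phiB: "phiB holomorphic_on strip"
proof -
  let ?E = "\<lambda>w::complex. if w = 0 then deriv exp 0 else (exp w - exp 0) / (w - 0)"
  have E: "?E holomorphic_on strip" by (rule pole_lemma_open[OF holomorphic_on_exp open_strip])
  have d1: "deriv exp (0::complex) = 1" using DERIV_imp_deriv[OF DERIV_exp[of "0::complex"]] by simp
  have E0: "?E w \<noteq> 0" if "w \<in> strip" for w
    using exp_neq_1_strip[OF that] d1 by auto
  let ?h = "\<lambda>w. 1 / ?E w"
  have h: "?h holomorphic_on strip" by (intro holomorphic_intros E E0)
  let ?g = "\<lambda>w. if w = 0 then deriv ?h 0 else (?h w - ?h 0) / (w - 0)"
  have g: "?g holomorphic_on strip" by (rule pole_lemma_open[OF h open_strip])
  have z0: "(0::complex) \<in> strip" by (simp add: strip_def)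
  have eq: "?g w = 1 / (exp w - 1) - 1 / w" if "w \<noteq> 0" for w
    using that d1 by (cases "exp w = 1") (auto simp: field_simps)
  have "isCont ?g 0"
    using holomorphic_on_imp_continuous_on[OF g] open_strip z0 by (simp only: continuous_on_eq_continuous_at)
  then have "(?g \<longlongrightarrow> ?g 0) (at 0)" by (simp only: isCont_def)
  then have "((\<lambda>w. 1 / (exp w - 1) - 1 / w) \<longlongrightarrow> ?g 0) (at 0)"
  proof (rule Lim_transform_eventually)
    show "\<forall>\<^sub>F w in at 0. ?g w = 1 / (exp w - 1) - 1 / w"
      unfolding eventually_at_filter by (rule always_eventually) (use eq in blast)
  qed
  then have L: "Lim (at 0) (\<lambda>w. 1 / (exp w - 1) - 1 / w) = ?g 0"
    by (intro tendsto_Lim) auto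
  have "phiB w = ?g w" for w
    by (cases "w = 0") (use L eq in \<open>auto simp: phiB_def\<close>)
  then show ?thesis using g by (simp only: ext[of phiB ?g])
qed

text \<open>The subtracted pole leaves decay of order 1 / Re w only. This suffices, as w will be
  (y^2 + s^2) / 2 with y the variable of integration. Up to Re w = 1 compactness is used, beyond it
  each of the two fractions is at most 1 / Re w.\<close>

lemma phiB_decay:
  assumes h: "h < 2 * pi" "h \<ge> 0" and b: "b \<ge> 0"
  obtains C where "C \<ge> 0" "\<And>w. \<bar>Im w\<bar> \<le> h \<Longrightarrow> Re w \<ge> - b \<Longrightarrow> norm (phiB w) \<le> C / (1 + b + Re w)"
proof -
  let ?K = "cbox (Complex (- b) (- h)) (Complex 1 h)"
  have "?K \<subseteq> strip" using h by (auto simp: in_cbox_complex_iff strip_def)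
  then have "continuous_on ?K phiB"
    using holomorphic_on_imp_continuous_on[OF holomorphic_phiB] continuous_on_subset by blast
  then have "bounded (phiB ` ?K)" by (intro compact_imp_bounded compact_continuous_image) auto
  then obtain M where M: "M > 0" "\<And>w. w \<in> ?K \<Longrightarrow> norm (phiB w) \<le> M"
    unfolding bounded_pos by auto
  have bd: "norm (phiB w) * (1 + b + Re w) \<le> M * (2 + b) + 2 * (2 + b)"
    if w: "\<bar>Im w\<bar> \<le> h" "Re w \<ge> - b" for w
  proof (cases "Re w \<le> 1")
    case True
    then have "w \<in> ?K" using w by (auto simp: in_cbox_complex_iff)
    then have "norm (phiB w) * (1 + b + Re w) \<le> M * (2 + b)"
      using M True w b by (intro mult_mono) auto
    then show ?thesis using b by simp
  next
    case False
    then have r: "Re w > 1" by simp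
    then have w0: "w \<noteq> 0" by auto
    have "Re w \<le> exp (Re w) - 1" using exp_ge_add_one_self[of "Re w"] by linarith
    also have "\<dots> \<le> norm (exp w - 1)" using norm_triangle_ineq2[of "exp w" 1] by (simp add: norm_exp_eq_Re)
    finally have 1: "norm (1 / (exp w - 1)) \<le> 1 / Re w" using r by (simp add: norm_divide frac_le)
    have 2: "norm (1 / w) \<le> 1 / Re w" using r complex_Re_le_cmod[of w] by (simp add: norm_divide frac_le)
    have "norm (phiB w) \<le> 2 / Re w"
      using norm_triangle_ineq4[of "1 / (exp w - 1)" "1 / w"] 1 2 w0 by (simp add: phiB_def)
    then have "norm (phiB w) * (1 + b + Re w) \<le> 2 / Re w * (1 + b + Re w)"
      using b r by (intro mult_right_mono) auto
    also have "\<dots> = 2 * ((1 + b) / Re w) + 2" using r by (simp add: field_simps)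
    also have "(1 + b) / Re w \<le> 1 + b" using r b by (simp add: divide_le_eq mult_le_cancel_left1)
    finally have "norm (phiB w) * (1 + b + Re w) \<le> 2 * (2 + b)" by simp
    then show ?thesis using M(1) b by (simp add: add_increasing)
  qed
  show ?thesis
  proof (rule that[of "M * (2 + b) + 2 * (2 + b)"])
    show "M * (2 + b) + 2 * (2 + b) \<ge> 0" using M(1) b by simp
    show "norm (phiB w) \<le> (M * (2 + b) + 2 * (2 + b)) / (1 + b + Re w)" if "\<bar>Im w\<bar> \<le> h" "Re w \<ge> - b" for w
    proof -
      have "1 + b + Re w > 0" using that by simp
      then show ?thesis using bd[OF that] by (simp add: pos_le_divide_eq)
    qed
  qed
qed

text \<open>In terms of \<open>w = s\<^sup>2\<close> the set \<open>Om\<close> is a strip that contains no point \<open>4 \<pi> i k\<close>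
  with \<open>k \<noteq> 0\<close>: the other branch points of the polylogarithms of \<open>exp (- s\<^sup>2 / 2)\<close> stay outside.\<close>

definition Om :: "complex set" where "Om = {s. \<bar>Im (s\<^sup>2)\<bar> < 4 * pi}"

lemma open_Om: "open Om"
  unfolding Om_def by (intro open_Collect_less continuous_intros)

lemma uminus_Om [simp]: "- s \<in> Om \<longleftrightarrow> s \<in> Om" by (simp add: Om_def)

lemma starlike_Om: "starlike Om"
  unfolding starlike_def
proof (intro bexI[of _ 0] ballI subsetI)
  fix x y assume x: "x \<in> Om" and "y \<in> closed_segment 0 x"
  then obtain u where u: "0 \<le> u" "u \<le> 1" "y = of_real u * x"
    by (auto simp: in_segment scaleR_conv_of_real)
  have "\<bar>Im (y\<^sup>2)\<bar> = u\<^sup>2 * \<bar>Im (x\<^sup>2)\<bar>"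
    unfolding u(3) power_mult_distrib by (simp add: abs_mult flip: of_real_power)
  also have "\<dots> \<le> 1 * \<bar>Im (x\<^sup>2)\<bar>" using u by (intro mult_right_mono power_le_one) auto
  finally show "y \<in> Om" using x by (simp add: Om_def)
qed (simp add: Om_def)

text \<open>The even part of \<open>Lihalf\<close>: the latter is \<open>J s + sqrt (2 \<pi>) / s\<close> in the right sector and
  \<open>J s - sqrt (2 \<pi>) / s\<close> in the left one, so \<open>J\<close> connects the two.\<close>

definition J :: "complex \<Rightarrow> complex" where
  "J s = of_real (1 / sqrt (2 * pi)) * integral UNIV (\<lambda>y::real. phiB (((of_real y)\<^sup>2 + s\<^sup>2) / 2))"

lemma J_minus: "J (- s) = J s" by (simp add: J_def)

lemma Om_strip: "s \<in> Om \<Longrightarrow> ((of_real y)\<^sup>2 + s\<^sup>2) / 2 \<in> strip"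
proof -
  assume "s \<in> Om"
  moreover have "Im (((of_real y)\<^sup>2 + s\<^sup>2) / 2) = Im (s\<^sup>2) / 2" by (simp flip: of_real_power)
  ultimately show ?thesis unfolding Om_def strip_def by simp
qed

text \<open>On a closed disc inside \<open>Om\<close> the maximum of |Im (s^2)| is below 4 \<pi> and
  |s^2| is bounded by N, so \<open>phiB_decay\<close> with b = N / 2 gives the majorant 2 C / (1 +
  y^2).\<close>

lemma J_integrable_and_holomorphic:
  shows "J holomorphic_on Om"
    and "s \<in> Om \<Longrightarrow> (\<lambda>y::real. phiB (((of_real y)\<^sup>2 + s\<^sup>2) / 2)) integrable_on UNIV"
proof -
  let ?f = "\<lambda>s y. phiB (((of_real (y::real))\<^sup>2 + s\<^sup>2) / 2)"
  let ?f' = "\<lambda>s y. deriv phiB (((of_real (y::real))\<^sup>2 + s\<^sup>2) / 2) * s"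
  have cm: "continuous_on (Om \<times> UNIV) (\<lambda>(s, y). f (((of_real (y::real))\<^sup>2 + s\<^sup>2) / 2))" if "continuous_on strip f" for f :: "complex \<Rightarrow> complex"
    unfolding case_prod_unfold
    by (rule continuous_on_compose2[OF that]) (auto intro!: continuous_intros intro: Om_strip)
  have der: "((\<lambda>s. ?f s y) has_field_derivative ?f' s y) (at s)" if "s \<in> Om" for s y
  proof -
    have "(phiB has_field_derivative deriv phiB (((of_real y)\<^sup>2 + s\<^sup>2) / 2)) (at (((of_real y)\<^sup>2 + s\<^sup>2) / 2))"
      by (rule holomorphic_derivI[OF holomorphic_phiB open_strip Om_strip[OF that]])
    moreover have "((\<lambda>s. ((of_real y)\<^sup>2 + s\<^sup>2) / 2) has_field_derivative s) (at s)"
      by (auto intro!: derivative_eq_intros)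
    ultimately show ?thesis by (rule DERIV_chain2)
  qed
  have c1: "continuous_on (Om \<times> UNIV) (\<lambda>(s, y). ?f s y)"
    by (rule cm[OF holomorphic_on_imp_continuous_on[OF holomorphic_phiB]])
  have c2: "continuous_on (Om \<times> UNIV) (\<lambda>(s, y). ?f' s y)"
    using continuous_on_mult[OF cm[OF holomorphic_on_imp_continuous_on[OF holomorphic_deriv[OF holomorphic_phiB open_strip]]] continuous_on_fst[OF continuous_on_id]]
    by (simp add: case_prod_unfold)
  have bd: "\<exists>r>0. \<exists>g. g integrable_on UNIV \<and> (\<forall>s'\<in>cball s r \<inter> Om. \<forall>y. norm (?f s' y) \<le> g y)" if s: "s \<in> Om" for s
  proof -
    obtain r where r: "r > 0" "cball s r \<subseteq> Om" using open_Om s open_contains_cball by metis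
    have "compact ((\<lambda>s. \<bar>Im (s\<^sup>2)\<bar>) ` cball s r)" by (intro compact_continuous_image continuous_intros compact_cball)
    moreover have "(\<lambda>s. \<bar>Im (s\<^sup>2)\<bar>) ` cball s r \<noteq> {}" using r by auto
    ultimately obtain h where h: "h \<in> (\<lambda>s. \<bar>Im (s\<^sup>2)\<bar>) ` cball s r" "\<And>t. t \<in> (\<lambda>s. \<bar>Im (s\<^sup>2)\<bar>) ` cball s r \<Longrightarrow> t \<le> h"
      using compact_attains_sup by metis
    have h4: "h / 2 < 2 * pi" "h / 2 \<ge> 0" using h(1) r(2) by (auto simp: Om_def)
    have "bounded ((\<lambda>s. s\<^sup>2) ` cball s r)"
      by (intro compact_imp_bounded compact_continuous_image continuous_intros compact_cball)
    then obtain N where N: "N > 0" "\<And>t. t \<in> cball s r \<Longrightarrow> norm (t\<^sup>2) \<le> N" unfolding bounded_pos by auto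
    obtain C where C: "C \<ge> 0" "\<And>w. \<bar>Im w\<bar> \<le> h / 2 \<Longrightarrow> Re w \<ge> - (N / 2) \<Longrightarrow> norm (phiB w) \<le> C / (1 + N / 2 + Re w)"
      using phiB_decay[OF h4, of "N / 2"] N(1) by (metis divide_nonneg_nonneg less_imp_le zero_le_numeral)
    let ?g = "\<lambda>y::real. 2 * C * (1 / (1\<^sup>2 + y\<^sup>2))"
    have "integrable lborel ?g"
      using has_bochner_integral_inverse_sum_squares[of 1] by (intro integrable_mult_right) (simp add: has_bochner_integral_iff)
    then have "?g integrable_on UNIV" by (rule integrable_on_lborel)
    moreover have "norm (?f t y) \<le> ?g y" if t: "t \<in> cball s r" for t y
    proof -
      let ?w = "((of_real y)\<^sup>2 + t\<^sup>2) / 2 :: complex"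
      have Rw: "Re ?w = (y\<^sup>2 + Re (t\<^sup>2)) / 2" and Iw: "Im ?w = Im (t\<^sup>2) / 2" by (simp_all flip: of_real_power)
      have "\<bar>Im (t\<^sup>2)\<bar> \<le> h" using h(2) t by blast
      then have i: "\<bar>Im ?w\<bar> \<le> h / 2" unfolding Iw by simp
      have "\<bar>Re (t\<^sup>2)\<bar> \<le> N" using N(2)[OF t] abs_Re_le_cmod[of "t\<^sup>2"] by linarith
      then have Rn: "Re (t\<^sup>2) \<ge> - N" by linarith
      have R: "Re ?w \<ge> y\<^sup>2 / 2 - N / 2" unfolding Rw add_divide_distrib using Rn by simp
      then have R': "Re ?w \<ge> - (N / 2)" using zero_le_power2[of y] by linarith
      have "norm (?f t y) \<le> C / (1 + N / 2 + Re ?w)" by (rule C(2)[OF i R'])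
      also have "\<dots> \<le> C / ((1 + y\<^sup>2) / 2)"
      proof (intro divide_left_mono C(1))
        have "(1 + y\<^sup>2) / 2 = 1 / 2 + y\<^sup>2 / 2" by (simp add: add_divide_distrib)
        then show "(1 + y\<^sup>2) / 2 \<le> 1 + N / 2 + Re ?w" using R by linarith
        have "0 < 1 + N / 2 + Re ?w" using R' by linarith
        moreover have "0 < (1 + y\<^sup>2) / 2" by (simp add: add_pos_nonneg)
        ultimately show "0 < (1 + N / 2 + Re ?w) * ((1 + y\<^sup>2) / 2)" by (rule mult_pos_pos)
      qed
      also have "\<dots> = ?g y" by simp
      finally show ?thesis .
    qed
    ultimately show ?thesis using r(1) by blast
  qed
  note main = holomorphic_integral_real_line[OF open_Om der c1 c2 bd]
  show "J holomorphic_on Om" unfolding J_def[abs_def] by (intro holomorphic_intros main(1))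
  show "s \<in> Om \<Longrightarrow> (\<lambda>y::real. phiB (((of_real y)\<^sup>2 + s\<^sup>2) / 2)) integrable_on UNIV" by (rule main(2))
qed

lemma Lihalf_minus: "Lihalf (- s) = Lihalf s" by (simp add: Lihalf_def)

text \<open>The representation with j = 0 has the integrand 1 / (exp w - 1) with w = (y^2 + s^2) /
  2. Removing 1 / w, whose integral is 2 \<pi> / s, leaves \<open>phiB\<close>; after division by
  sqrt (2 \<pi>) the removed part is sqrt (2 \<pi>) / s, and it is the only part that is odd in
  s.\<close>

lemma Lihalf_real:
  assumes "s > 0"
  shows "has_bochner_integral lborel (\<lambda>y. 1 / (exp (((of_real y)\<^sup>2 + (of_real s)\<^sup>2) / 2) - 1))
      (of_real (sqrt (2 * pi)) * Lihalf (of_real s))"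
    and "Lihalf (of_real s) = J (of_real s) + of_real (sqrt (2 * pi) / s)"
proof -
  let ?z = "exp (- ((of_real s)\<^sup>2 / 2)) :: complex"
  let ?w = "\<lambda>y. ((of_real y)\<^sup>2 + (of_real s)\<^sup>2) / 2 :: complex"
  have n: "norm ?z < 1" using assms by (simp add: norm_exp_eq_Re flip: of_real_power)
  have e: "?z / (of_real (exp (y\<^sup>2 / 2)) - ?z) = 1 / (exp (?w y) - 1)" for y
  proof -
    have "of_real (exp (y\<^sup>2 / 2)) = exp ((of_real y)\<^sup>2 / 2 :: complex)" by (simp flip: exp_of_real)
    also have "\<dots> = exp (?w y) * ?z" by (simp add: add_divide_distrib flip: exp_add)
    finally have "of_real (exp (y\<^sup>2 / 2)) - ?z = (exp (?w y) - 1) * ?z" by (simp add: algebra_simps)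
    then show ?thesis by simp
  qed
  have "has_bochner_integral lborel (\<lambda>y. of_real (y ^ (2 * 0)) * (?z / (of_real (exp (y\<^sup>2 / 2)) - ?z)))
     (of_real (gmoment 0) * polylog (real 0 + 1 / 2) ?z)"
    by (rule polylog_integral[OF n])
  then show L: "has_bochner_integral lborel (\<lambda>y. 1 / (exp (?w y) - 1)) (of_real (sqrt (2 * pi)) * Lihalf (of_real s))"
    unfolding e by (simp add: gmoment_def Lihalf_def)
  have "has_bochner_integral lborel (\<lambda>y. complex_of_real (2 * (1 / (s\<^sup>2 + y\<^sup>2)))) (of_real (2 * (pi / s)))"
    by (intro has_bochner_integral_of_real has_bochner_integral_mult_right has_bochner_integral_inverse_sum_squares assms)
  moreover have "complex_of_real (2 * (1 / (s\<^sup>2 + y\<^sup>2))) = 1 / ?w y" for y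
    by (simp add: add.commute)
  ultimately have W: "has_bochner_integral lborel (\<lambda>y. 1 / ?w y) (of_real (2 * (pi / s)))" by (simp only:)
  have wn: "?w y \<noteq> 0" for y
  proof -
    have "s\<^sup>2 + y\<^sup>2 > 0" using assms by (simp add: add_pos_nonneg)
    then have "y\<^sup>2 + s\<^sup>2 \<noteq> 0" by linarith
    then have "complex_of_real (y\<^sup>2 + s\<^sup>2) \<noteq> 0" by (simp only: of_real_eq_0_iff not_False_eq_True)
    then show ?thesis by simp
  qed
  have p: "phiB (?w y) = 1 / (exp (?w y) - 1) - 1 / ?w y" for y
    unfolding phiB_def using wn[of y] by (simp only: if_False)
  have "has_bochner_integral lborel (\<lambda>y. phiB (?w y)) (of_real (sqrt (2 * pi)) * Lihalf (of_real s) - of_real (2 * (pi / s)))"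
    unfolding p by (intro has_bochner_integral_diff L W)
  then have "integral UNIV (\<lambda>y. phiB (?w y)) = of_real (sqrt (2 * pi)) * Lihalf (of_real s) - of_real (2 * (pi / s))"
    by (simp add: has_bochner_integral_iff integral_lborel)
  then have "J (of_real s) = of_real (1 / sqrt (2 * pi)) * (of_real (sqrt (2 * pi)) * Lihalf (of_real s) - of_real (2 * (pi / s)))"
    by (simp only: J_def)
  also have "\<dots> = Lihalf (of_real s) - of_real (1 / sqrt (2 * pi) * (2 * (pi / s)))"
    by (simp add: right_diff_distrib flip: mult.assoc of_real_mult)
  also have "1 / sqrt (2 * pi) * (2 * (pi / s)) = sqrt (2 * pi) / s"
  proof -
    have "sqrt (2 * pi) * sqrt (2 * pi) = 2 * pi" by simp
    then have "2 * pi / sqrt (2 * pi) = sqrt (2 * pi)" by (simp add: real_div_sqrt)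
    then show ?thesis by simp
  qed
  finally show "Lihalf (of_real s) = J (of_real s) + of_real (sqrt (2 * pi) / s)" by simp
qed

section \<open>Identification of the continuation on the two sheets over the unit disc\<close>

lemma holomorphic_eq_pos_reals:
  assumes f: "f holomorphic_on S" and g: "g holomorphic_on S" and S: "open S" "connected S"
    and sub: "of_real ` {0<..} \<subseteq> S" and eq: "\<And>x. x > 0 \<Longrightarrow> f (of_real x) = g (of_real x)" and s: "s \<in> S"
  shows "f s = g s"
proof -
  have lim: "(1::complex) islimpt of_real ` {0<..}"
    unfolding islimpt_sequential
  proof (intro exI conjI allI)
    show "complex_of_real (1 + 1 / real (Suc n)) \<in> of_real ` {0<..} - {1}" for n
    proof -
      have "1 + 1 / real (Suc n) \<noteq> 1" by simp
      then have "complex_of_real (1 + 1 / real (Suc n)) \<noteq> 1" by (metis of_real_eq_1_iff)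
      moreover have "1 + 1 / real (Suc n) \<in> {0<..}" by (simp add: add_pos_nonneg)
      ultimately show ?thesis by blast
    qed
    have "(\<lambda>n. complex_of_real (1 + 1 / real (Suc n))) \<longlonglongrightarrow> of_real (1 + 0)"
      by (intro tendsto_of_real tendsto_add tendsto_const LIMSEQ_Suc[OF lim_1_over_n])
    then show "(\<lambda>n. complex_of_real (1 + 1 / real (Suc n))) \<longlonglongrightarrow> 1" by simp
  qed
  have "f s - g s = 0"
  proof (rule analytic_continuation[of "\<lambda>s. f s - g s" S "of_real ` {0<..}" 1 s])
    have "complex_of_real 1 \<in> S" using sub by auto
    then show "1 \<in> S" by simp
    show "f z - g z = 0" if "z \<in> of_real ` {0<..}" for z using eq that by auto
  qed (use f g S sub lim s in \<open>auto intro!: holomorphic_intros\<close>)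
  then show ?thesis by simp
qed

text \<open>\<open>DR\<close> and \<open>DL\<close> are the parts of \<open>Om\<close> lying over
  |z| < 1, one on each sheet: |exp (- s^2 / 2)| < 1 holds exactly in the two sectors.\<close>

definition DR :: "complex set" where "DR = right_sector \<inter> Om"
definition DL :: "complex set" where "DL = left_sector \<inter> Om"

lemma uminus_DL: "s \<in> DL \<longleftrightarrow> - s \<in> DR"
  by (auto simp: DL_def DR_def uminus_left_sector)

lemma open_DR: "open DR" and open_DL: "open DL"
  by (simp_all add: DR_def DL_def open_right_sector open_left_sector open_Om open_Int)

lemma csqrt_power2_Re_pos: "Re s > 0 \<Longrightarrow> csqrt (s\<^sup>2) = s"
  by (rule csqrt_square) simp

lemma Re_csqrt_pos: "w \<notin> \<real>\<^sub>\<le>\<^sub>0 \<Longrightarrow> Re (csqrt w) > 0"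
proof -
  assume w: "w \<notin> \<real>\<^sub>\<le>\<^sub>0"
  have "Re (csqrt w) \<noteq> 0"
  proof
    assume r: "Re (csqrt w) = 0"
    have "w = (csqrt w)\<^sup>2" by simp
    also have "\<dots> = - of_real ((Im (csqrt w))\<^sup>2)" using r by (simp add: complex_eq_iff power2_eq_square)
    finally have "w \<in> \<real>\<^sub>\<le>\<^sub>0" by (metis nonpos_Reals_of_real_iff of_real_minus neg_le_0_iff_le zero_le_power2)
    then show False using w by blast
  qed
  moreover have "Re (csqrt w) \<ge> 0" using csqrt_principal[of w] by auto
  ultimately show ?thesis by simp
qed

lemma DR_image: "DR = csqrt ` {w. Re w > 0 \<and> \<bar>Im w\<bar> < 4 * pi}"
proof (intro equalityI subsetI)
  fix s assume s: "s \<in> DR"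
  then have "csqrt (s\<^sup>2) = s" "Re (s\<^sup>2) > 0"
    by (auto simp: DR_def right_sector_def Re_power2_pos_iff intro!: csqrt_power2_Re_pos)
  then show "s \<in> csqrt ` {w. Re w > 0 \<and> \<bar>Im w\<bar> < 4 * pi}"
    using s by (intro image_eqI[of _ _ "s\<^sup>2"]) (auto simp: DR_def Om_def)
next
  fix s assume "s \<in> csqrt ` {w. Re w > 0 \<and> \<bar>Im w\<bar> < 4 * pi}"
  then obtain w where w: "s = csqrt w" "Re w > 0" "\<bar>Im w\<bar> < 4 * pi" by auto
  have s2: "s\<^sup>2 = w" by (simp add: w)
  have "Re s > 0" unfolding w(1) using w(2) by (intro Re_csqrt_pos) (auto simp: complex_nonpos_Reals_iff)
  then show "s \<in> DR"
    using Re_power2_pos_iff[of s] w(2,3) unfolding s2 by (auto simp: DR_def Om_def left_sector_def s2)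
qed

lemma connected_DR: "connected DR"
proof -
  have eq: "{w. Re w > 0 \<and> \<bar>Im w\<bar> < 4 * pi} = {w. Re w > 0} \<inter> ({w. Im w < 4 * pi} \<inter> {w. Im w > - (4 * pi)})" by auto
  then have "convex {w. Re w > 0 \<and> \<bar>Im w\<bar> < 4 * pi}"
    unfolding eq by (intro convex_Int convex_halfspace_Re_gt convex_halfspace_Im_lt convex_halfspace_Im_gt)
  then have "connected {w. Re w > 0 \<and> \<bar>Im w\<bar> < 4 * pi}" by (rule convex_connected)
  moreover have "continuous_on {w. Re w > 0 \<and> \<bar>Im w\<bar> < 4 * pi} csqrt"
    by (rule holomorphic_on_imp_continuous_on[OF holomorphic_on_csqrt'[OF holomorphic_on_ident]])
       (auto simp: complex_nonpos_Reals_iff)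
  ultimately show ?thesis unfolding DR_image by (rule connected_continuous_image[rotated])
qed

lemma connected_DL: "connected DL"
proof -
  have "DL = uminus ` DR" using uminus_DL by force
  then show ?thesis using connected_continuous_image[OF _ connected_DR, of uminus] by (simp add: continuous_on_minus)
qed

lemma pos_reals_DR: "of_real ` {0<..} \<subseteq> DR"
  by (auto simp: DR_def right_sector_def Om_def power2_eq_square)

lemma Lihalf_DR:
  assumes "s \<in> DR"
  shows "Lihalf s = J s + of_real (sqrt (2 * pi)) / s"
proof (rule holomorphic_eq_pos_reals[OF _ _ open_DR connected_DR pos_reals_DR _ assms])
  show "Lihalf holomorphic_on DR"
    by (rule holomorphic_on_subset[OF holomorphic_Lihalf]) (auto simp: DR_def)
  show "(\<lambda>s. J s + of_real (sqrt (2 * pi)) / s) holomorphic_on DR"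
    by (intro holomorphic_intros holomorphic_on_subset[OF J_integrable_and_holomorphic(1)]) (auto simp: DR_def right_sector_def)
qed (simp add: Lihalf_real(2))

lemma Lihalf_DL:
  assumes "s \<in> DL"
  shows "Lihalf s = J s - of_real (sqrt (2 * pi)) / s"
  using Lihalf_DR[of "- s"] assms by (simp add: uminus_DL Lihalf_minus J_minus)

lemma DERIV_exp_neg_half_sq: "((\<lambda>s. exp (- (s\<^sup>2 / 2))) has_field_derivative - s * exp (- (s\<^sup>2 / 2))) (at (s::complex))"
  by (auto intro!: derivative_eq_intros)

lemma DERIV_comp_neg_half_sq:
  assumes "s \<in> left_sector \<or> s \<in> right_sector"
  shows "((\<lambda>s. A1 (exp (- (s\<^sup>2 / 2)))) has_field_derivative s * Lihalf s / of_real (sqrt (2 * pi))) (at s)"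
    and "((\<lambda>s. A2 (exp (- (s\<^sup>2 / 2)))) has_field_derivative - s * A1 (exp (- (s\<^sup>2 / 2)))) (at s)"
    and "((\<lambda>s. B (exp (- (s\<^sup>2 / 2)))) has_field_derivative - s * (Lihalf s)\<^sup>2 / of_real (4 * pi)) (at s)"
proof -
  let ?z = "exp (- (s\<^sup>2 / 2))"
  have n: "norm ?z < 1" by (rule norm_exp_neg_half_sq_less[OF assms])
  have p: "((\<lambda>s. polylog \<sigma> (exp (- (s\<^sup>2 / 2)))) has_field_derivative polylog (\<sigma> - 1) ?z / ?z * (- s * ?z)) (at s)" if "\<sigma> \<ge> 0" for \<sigma>
    by (rule DERIV_chain2[OF DERIV_polylog[OF n that] DERIV_exp_neg_half_sq]) simp
  have "((\<lambda>s. - (1 / of_real (sqrt (2 * pi))) * polylog (3 / 2) (exp (- (s\<^sup>2 / 2)))) has_field_derivative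
     - (1 / of_real (sqrt (2 * pi))) * (polylog (3 / 2 - 1) ?z / ?z * (- s * ?z))) (at s)"
    by (intro DERIV_cmult p) simp
  then show "((\<lambda>s. A1 (exp (- (s\<^sup>2 / 2)))) has_field_derivative s * Lihalf s / of_real (sqrt (2 * pi))) (at s)"
    unfolding A1_def Lihalf_def by (simp add: mult.commute)
  have "((\<lambda>s. - (1 / of_real (sqrt (2 * pi))) * polylog (5 / 2) (exp (- (s\<^sup>2 / 2)))) has_field_derivative
     - (1 / of_real (sqrt (2 * pi))) * (polylog (5 / 2 - 1) ?z / ?z * (- s * ?z))) (at s)"
    by (intro DERIV_cmult p) simp
  then show "((\<lambda>s. A2 (exp (- (s\<^sup>2 / 2)))) has_field_derivative - s * A1 (exp (- (s\<^sup>2 / 2)))) (at s)"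
    unfolding A1_def A2_def by (simp add: mult.commute)
  have "((\<lambda>s. B (exp (- (s\<^sup>2 / 2)))) has_field_derivative ((polylog (1 / 2) ?z)\<^sup>2 / (of_real (4 * pi) * ?z)) * (- s * ?z)) (at s)"
    by (rule DERIV_chain2[OF DERIV_B[OF n] DERIV_exp_neg_half_sq])
  then show "((\<lambda>s. B (exp (- (s\<^sup>2 / 2)))) has_field_derivative - s * (Lihalf s)\<^sup>2 / of_real (4 * pi)) (at s)"
    unfolding Lihalf_def by (simp add: mult.commute)
qed

lemma Om_primitive:
  assumes "f holomorphic_on Om"
  obtains g where "\<And>s. s \<in> Om \<Longrightarrow> (g has_field_derivative f s) (at s)"
proof -
  have "f field_differentiable at x" if "x \<in> Om - {}" for x
    using holomorphic_on_imp_differentiable_at[OF assms open_Om] that by simp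
  from holomorphic_starlike_primitive[OF holomorphic_on_imp_continuous_on[OF assms] starlike_Om open_Om finite.emptyI this]
  show ?thesis using that by metis
qed

lemma eq_if_same_derivative:
  fixes f g :: "complex \<Rightarrow> complex"
  assumes "open S" "connected S" "\<And>s. s \<in> S \<Longrightarrow> (f has_field_derivative h s) (at s)"
    "\<And>s. s \<in> S \<Longrightarrow> (g has_field_derivative h s) (at s)" "a \<in> S" "f a = g a" "s \<in> S"
  shows "f s = g s"
proof -
  have "((\<lambda>s. f s - g s) has_field_derivative 0) (at z)" if "z \<in> S" for z
    using DERIV_diff[OF assms(3,4)[OF that]] by simp
  then have "(\<lambda>s. f s - g s) constant_on S"
    by (rule has_field_derivative_0_imp_constant_on[OF _ assms(2,1)])
  then have "f s - g s = f a - g a" using assms(5,7) unfolding constant_on_def by metis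
  then show ?thesis using assms(6) by simp
qed

lemma connected_Om: "connected Om" by (rule starlike_imp_connected[OF starlike_Om])

lemma zero_Om [simp]: "0 \<in> Om" by (simp add: Om_def)

lemma one_DR: "1 \<in> DR" by (simp add: DR_def right_sector_def Om_def)

section \<open>The behaviour of \<open>Q\<close> at the origin\<close>

text \<open>Differentiation in a parameter, in the form of Tonelli's theorem: ln (1 + t^2) is the
  integral over a in [0, 1] of 2 a t^2 / (1 + a^2 t^2), and the inner integral over t is 2 \<pi> /
  (1 + a) by partial fractions. This is the source of the constant ln 2 in the behaviour of
  \<open>Q\<close> at the origin.\<close>

lemma integral_ln_one_plus_square:
  "has_bochner_integral lborel (\<lambda>t::real. ln (1 + t\<^sup>2) / (1 + t\<^sup>2)) (2 * pi * ln 2)"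
proof -
  let ?g = "\<lambda>a t::real. 2 * a * t\<^sup>2 / ((1 + a\<^sup>2 * t\<^sup>2) * (1 + t\<^sup>2))"
  have p1: "1 + a * t\<^sup>2 > 0" if "a \<ge> 0" for a t :: real using that by (simp add: add_pos_nonneg)
  have p2: "1 + a\<^sup>2 * t\<^sup>2 > 0" "1 + t\<^sup>2 > 0" for a t :: real by (simp_all add: add_pos_nonneg)
  have mp[measurable]: "(\<lambda>(a, t). ennreal (?g a t) * indicator {0..1} a) \<in> borel_measurable (lborel \<Otimes>\<^sub>M lborel)"
    by measurable
  have inner_a: "(\<integral>\<^sup>+a. ennreal (?g a t) * indicator {0..1} a \<partial>lborel) = ennreal (ln (1 + t\<^sup>2) / (1 + t\<^sup>2))" for t
  proof -
    have der: "((\<lambda>a. ln (1 + a\<^sup>2 * t\<^sup>2) / (1 + t\<^sup>2)) has_real_derivative ?g a t) (at a)" for a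
    proof -
      have "((\<lambda>a. ln (1 + a\<^sup>2 * t\<^sup>2) / (1 + t\<^sup>2)) has_real_derivative (inverse (1 + a\<^sup>2 * t\<^sup>2) * (2 * a * t\<^sup>2)) / (1 + t\<^sup>2)) (at a)"
        by (rule DERIV_cdivide, rule DERIV_chain2[OF DERIV_ln]) (use p2 in \<open>auto intro!: derivative_eq_intros\<close>)
      moreover have "(inverse (1 + a\<^sup>2 * t\<^sup>2) * (2 * a * t\<^sup>2)) / (1 + t\<^sup>2) = ?g a t"
        by (simp add: divide_inverse mult_ac)
      ultimately show ?thesis by (simp only:)
    qed
    have "(\<integral>\<^sup>+a. ennreal (?g a t) * indicator {0..1} a \<partial>lborel)
        = ennreal (ln (1 + 1\<^sup>2 * t\<^sup>2) / (1 + t\<^sup>2) - ln (1 + 0\<^sup>2 * t\<^sup>2) / (1 + t\<^sup>2))"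
      by (rule nn_integral_FTC_Icc[where F="\<lambda>a. ln (1 + a\<^sup>2 * t\<^sup>2) / (1 + t\<^sup>2)"])
         (use der p2(1)[of _ t] p2(2)[of t] in \<open>auto intro!: divide_nonneg_pos mult_pos_pos\<close>)
    then show ?thesis by simp
  qed
  \<comment> \<open>The partial fractions divide by a and by 1 - a^2; the two excluded values form a
    null set.\<close>
  have inner_t: "(\<integral>\<^sup>+t. ennreal (?g a t) * indicator {0..1} a \<partial>lborel) = ennreal (2 * pi / (1 + a)) * indicator {0..1} a"
    if a: "a \<noteq> 0" "a \<noteq> 1" for a
  proof (cases "a \<in> {0..1}")
    case True
    then have a01: "0 < a" "a < 1" using a by auto
    have "has_bochner_integral lborel (\<lambda>t. 2 * a / (1 - a\<^sup>2) * ((1 / a)\<^sup>2 * (1 / ((1 / a)\<^sup>2 + t\<^sup>2)) - 1 / (1\<^sup>2 + t\<^sup>2)))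
       (2 * a / (1 - a\<^sup>2) * ((1 / a)\<^sup>2 * (pi / (1 / a)) - pi / 1))"
      using a01 by (intro has_bochner_integral_mult_right has_bochner_integral_diff has_bochner_integral_inverse_sum_squares) auto
    moreover have "2 * a / (1 - a\<^sup>2) * ((1 / a)\<^sup>2 * (1 / ((1 / a)\<^sup>2 + t\<^sup>2)) - 1 / (1\<^sup>2 + t\<^sup>2)) = ?g a t" for t
    proof -
      have q: "1 - a\<^sup>2 \<noteq> 0" using a01 by (simp add: power2_eq_1_iff)
      have "(1 / a)\<^sup>2 * (1 / ((1 / a)\<^sup>2 + t\<^sup>2)) = 1 / (a\<^sup>2 * ((1 / a)\<^sup>2 + t\<^sup>2))"
        using a01 by (simp add: power_divide)
      also have "a\<^sup>2 * ((1 / a)\<^sup>2 + t\<^sup>2) = 1 + a\<^sup>2 * t\<^sup>2"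
        using a01 by (simp add: power_divide distrib_left)
      finally have e: "(1 / a)\<^sup>2 * (1 / ((1 / a)\<^sup>2 + t\<^sup>2)) = 1 / (1 + a\<^sup>2 * t\<^sup>2)" .
      have "1 / (1 + a\<^sup>2 * t\<^sup>2) - 1 / (1 + t\<^sup>2) = (1 - a\<^sup>2) * t\<^sup>2 / ((1 + a\<^sup>2 * t\<^sup>2) * (1 + t\<^sup>2))"
        using p2(1)[of a t] p2(2)[of t] by (subst diff_frac_eq) (auto simp: algebra_simps)
      then show ?thesis unfolding e power_one using q by simp
    qed
    moreover have "2 * a / (1 - a\<^sup>2) * ((1 / a)\<^sup>2 * (pi / (1 / a)) - pi / 1) = 2 * pi / (1 + a)"
    proof -
      have f: "1 - a\<^sup>2 = (1 - a) * (1 + a)" by (simp add: power2_eq_square algebra_simps)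
      have "(1 / a)\<^sup>2 * (pi / (1 / a)) - pi / 1 = pi * (1 - a) / a"
        using a01 by (simp add: power2_eq_square field_simps)
      then show ?thesis unfolding f using a01 by simp
    qed
    ultimately have "has_bochner_integral lborel (?g a) (2 * pi / (1 + a))" by simp
    then have "integrable lborel (?g a)" "integral\<^sup>L lborel (?g a) = 2 * pi / (1 + a)"
      by (simp_all add: has_bochner_integral_iff)
    moreover have "(\<integral>\<^sup>+t. ennreal (?g a t) \<partial>lborel) = ennreal (integral\<^sup>L lborel (?g a))"
      by (rule nn_integral_eq_integral[OF \<open>integrable lborel (?g a)\<close>]) (use a01 p2(1)[of a] p2(2) in \<open>auto intro!: AE_I2 divide_nonneg_pos mult_pos_pos\<close>)
    ultimately have "(\<integral>\<^sup>+t. ennreal (?g a t) \<partial>lborel) = ennreal (2 * pi / (1 + a))" by simp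
    then show ?thesis using True by simp
  qed simp
  have "(\<integral>\<^sup>+t. ennreal (ln (1 + t\<^sup>2) / (1 + t\<^sup>2)) \<partial>lborel) = (\<integral>\<^sup>+t. (\<integral>\<^sup>+a. ennreal (?g a t) * indicator {0..1} a \<partial>lborel) \<partial>lborel)"
    unfolding inner_a ..
  also have "\<dots> = (\<integral>\<^sup>+a. (\<integral>\<^sup>+t. ennreal (?g a t) * indicator {0..1} a \<partial>lborel) \<partial>lborel)"
    using lborel_pair.Fubini'[OF mp] by simp
  also have "\<dots> = (\<integral>\<^sup>+a. ennreal (2 * pi / (1 + a)) * indicator {0..1} a \<partial>lborel)"
    using AE_lborel_singleton[of 0] AE_lborel_singleton[of 1]
    by (intro nn_integral_cong_AE) (auto elim!: eventually_elim2 intro!: inner_t)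
  also have "\<dots> = ennreal (2 * pi * ln (1 + 1) - 2 * pi * ln (1 + 0))"
    by (rule nn_integral_FTC_Icc[where F="\<lambda>a. 2 * pi * ln (1 + a)"]) (auto intro!: derivative_eq_intros)
  finally have nn: "(\<integral>\<^sup>+t. ennreal (ln (1 + t\<^sup>2) / (1 + t\<^sup>2)) \<partial>lborel) = ennreal (2 * pi * ln 2)" by simp
  show ?thesis
    by (rule has_bochner_integral_nn_integral[OF _ _ _ nn]) auto
qed

text \<open>Splits r^2 + u^2 as 1 + (r^2 - 1 + u^2) in \<open>norm_Lihalf_le\<close>. The decay in r
  provides the boundary value at infinity when \<open>Q\<close> is recovered from its
  derivative.\<close>

lemma norm_Q_neg_real_le:
  assumes "r \<ge> 1"
  shows "norm (Q (- of_real r)) \<le> exp (- (r\<^sup>2 - 1) / 2) * (sqrt (2 / pi) * (integral UNIV (\<lambda>u::real. exp (- (u\<^sup>2 / 2))) / (1 - exp (- 1 / 2))))"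
proof -
  let ?I = "integral UNIV (\<lambda>u::real. exp (- (u\<^sup>2 / 2)))"
  let ?c = "exp (- (r\<^sup>2 - 1) / 2) / (1 - exp (- 1 / 2))"
  have ls: "- complex_of_real r \<in> left_sector" using assms by (simp add: left_sector_def)
  have c0: "?c \<ge> 0" by simp
  have ai: "(\<lambda>u::real. exp (- (u\<^sup>2 / 2))) absolutely_integrable_on UNIV"
    using integrable_gauss by (intro nonnegative_absolutely_integrable_1) auto
  then have "(\<lambda>u::real. exp (- (u\<^sup>2 / 2))) absolutely_integrable_on {..0}" by (rule set_integrable_subset) auto
  then have g0: "(\<lambda>u::real. exp (- (u\<^sup>2 / 2))) integrable_on {..0}" by (rule set_lebesgue_integral_eq_integral(1))
  have "norm (integral {..0::real} (\<lambda>u. Lihalf (- of_real r + of_real u))) \<le> integral {..0} (\<lambda>u::real. ?c * exp (- (u\<^sup>2 / 2)))"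
  proof (rule integral_norm_bound_integral)
    show "(\<lambda>u. Lihalf (- of_real r + of_real u)) integrable_on {..0::real}" by (rule Lihalf_shift(1)[OF ls])
    show "(\<lambda>u::real. ?c * exp (- (u\<^sup>2 / 2))) integrable_on {..0}"
      using integrable_cmul[OF g0, of ?c] by (simp only: real_scaleR_def)
    fix u :: real assume "u \<in> {..0}"
    then have "Re ((- of_real r + of_real u)\<^sup>2) \<ge> Re ((- complex_of_real r)\<^sup>2) + u\<^sup>2" by (intro Re_shift_sq[OF ls]) simp
    moreover have "Re ((- complex_of_real r)\<^sup>2) = r\<^sup>2" by (simp add: power2_eq_square)
    ultimately have h: "Re ((- of_real r + of_real u)\<^sup>2) \<ge> 1 + (r\<^sup>2 - 1 + u\<^sup>2)" by simp
    have "r\<^sup>2 \<ge> 1" using assms by simp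
    then have v: "r\<^sup>2 - 1 + u\<^sup>2 \<ge> 0" using zero_le_power2[of u] by linarith
    have "norm (Lihalf (- of_real r + of_real u)) \<le> exp (- (r\<^sup>2 - 1 + u\<^sup>2) / 2) / (1 - exp (- 1 / 2))"
      by (rule norm_Lihalf_le[OF h _ v]) simp
    also have "exp (- (r\<^sup>2 - 1 + u\<^sup>2) / 2) = exp (- (r\<^sup>2 - 1) / 2) * exp (- (u\<^sup>2 / 2))"
      by (subst exp_add[symmetric]) (simp add: field_simps)
    finally show "norm (Lihalf (- of_real r + of_real u)) \<le> ?c * exp (- (u\<^sup>2 / 2))" by simp
  qed
  also have "\<dots> = ?c * integral {..0} (\<lambda>u::real. exp (- (u\<^sup>2 / 2)))" by (rule integral_mult_right)
  also have "\<dots> \<le> ?c * ?I"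
    by (intro mult_left_mono c0 integral_subset_le g0 integrable_gauss) auto
  finally have "sqrt (2 / pi) * norm (integral {..0::real} (\<lambda>u. Lihalf (- of_real r + of_real u))) \<le> sqrt (2 / pi) * (?c * ?I)"
    by (rule mult_left_mono) simp
  then show ?thesis unfolding Q_eq norm_mult norm_of_real by (simp add: mult_ac)
qed

lemma Q_neg_real_tendsto_0: "((\<lambda>r. Q (- of_real r)) \<longlongrightarrow> 0) at_top"
proof (rule Lim_null_comparison)
  show "\<forall>\<^sub>F r in at_top. norm (Q (- of_real r)) \<le> exp (- (r\<^sup>2 - 1) / 2) * (sqrt (2 / pi) * (integral UNIV (\<lambda>u::real. exp (- (u\<^sup>2 / 2))) / (1 - exp (- 1 / 2))))"
    by (rule eventually_at_top_linorderI[of 1]) (rule norm_Q_neg_real_le)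
  have "((\<lambda>r::real. exp (- (r\<^sup>2 - 1) / 2)) \<longlongrightarrow> 0) at_top" by real_asymp
  then show "((\<lambda>r. exp (- (r\<^sup>2 - 1) / 2) * (sqrt (2 / pi) * (integral UNIV (\<lambda>u::real. exp (- (u\<^sup>2 / 2))) / (1 - exp (- 1 / 2))))) \<longlongrightarrow> 0) at_top"
    by (rule tendsto_mult_left_zero)
qed

lemma Lihalf_pos_real:
  assumes "r > 0"
  shows "Im (Lihalf (of_real r)) = 0"
    and "has_bochner_integral lborel (\<lambda>y. 1 / (exp ((y\<^sup>2 + r\<^sup>2) / 2) - 1)) (sqrt (2 * pi) * Re (Lihalf (of_real r)))"
proof -
  have e: "1 / (exp (((of_real y)\<^sup>2 + (of_real r)\<^sup>2) / 2) - 1) = complex_of_real (1 / (exp ((y\<^sup>2 + r\<^sup>2) / 2) - 1))" for y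
    by (simp add: exp_of_real[symmetric])
  have h: "has_bochner_integral lborel (\<lambda>y. complex_of_real (1 / (exp ((y\<^sup>2 + r\<^sup>2) / 2) - 1))) (of_real (sqrt (2 * pi)) * Lihalf (of_real r))"
    using Lihalf_real(1)[OF assms] unfolding e .
  have "has_bochner_integral lborel (\<lambda>y. Im (complex_of_real (1 / (exp ((y\<^sup>2 + r\<^sup>2) / 2) - 1)))) (Im (of_real (sqrt (2 * pi)) * Lihalf (of_real r)))"
    by (rule has_bochner_integral_bounded_linear[OF bounded_linear_Im h])
  then have "Im (of_real (sqrt (2 * pi)) * Lihalf (of_real r)) = 0"
    unfolding Im_complex_of_real by (rule has_bochner_integral_eq[OF _ has_bochner_integral_zero])
  then show "Im (Lihalf (of_real r)) = 0" by simp
  have "has_bochner_integral lborel (\<lambda>y. Re (complex_of_real (1 / (exp ((y\<^sup>2 + r\<^sup>2) / 2) - 1)))) (Re (of_real (sqrt (2 * pi)) * Lihalf (of_real r)))"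
    by (rule has_bochner_integral_bounded_linear[OF bounded_linear_Re h])
  moreover have "Re (of_real (sqrt (2 * pi)) * Lihalf (of_real r)) = sqrt (2 * pi) * Re (Lihalf (of_real r))" by simp
  ultimately show "has_bochner_integral lborel (\<lambda>y. 1 / (exp ((y\<^sup>2 + r\<^sup>2) / 2) - 1)) (sqrt (2 * pi) * Re (Lihalf (of_real r)))"
    by (simp only: Re_complex_of_real)
qed

lemma DERIV_Q_neg_real:
  assumes "r > 0"
  shows "((\<lambda>r. Q (- of_real r)) has_vector_derivative - (of_real (sqrt (2 / pi)) * Lihalf (of_real r))) (at r)"
proof -
  have "- complex_of_real r \<in> left_sector" using assms by (simp add: left_sector_def)
  then have "((\<lambda>r. Q (- of_real r)) has_vector_derivative (- 1) * (of_real (sqrt (2 / pi)) * Lihalf (- of_real r))) (at r)"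
    by (intro field_vector_diff_chain_at[where f="\<lambda>r. - complex_of_real r", unfolded o_def] DERIV_Q)
       (auto intro!: derivative_eq_intros)
  then show ?thesis by (simp add: Lihalf_minus)
qed

lemma Q_neg_real_Im: "r > 0 \<Longrightarrow> Im (Q (- of_real r)) = 0"
proof -
  assume r: "r > 0"
  let ?f = "\<lambda>u::real. Lihalf (- of_real r + of_real u)"
  have ls: "- complex_of_real r \<in> left_sector" using r by (simp add: left_sector_def)
  have "integral {..0} (Im \<circ> ?f) = Im (integral {..0} ?f)"
    by (rule integral_linear[OF Lihalf_shift(1)[OF ls] bounded_linear_Im])
  moreover have "integral {..0} (Im \<circ> ?f) = integral {..0} (\<lambda>u::real. 0)"
  proof (rule integral_cong)
    fix u :: real assume "u \<in> {..0}"
    then have p: "r - u > 0" using r by simp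
    have "?f u = Lihalf (of_real (r - u))" using Lihalf_minus[of "of_real (r - u)"] by simp
    then show "(Im \<circ> ?f) u = 0" using Lihalf_pos_real(1)[OF p] by simp
  qed
  ultimately show ?thesis unfolding Q_eq by simp
qed

lemma Re_Lihalf_pos_real_nonneg: "r > 0 \<Longrightarrow> Re (Lihalf (of_real r)) \<ge> 0"
proof -
  assume r: "r > 0"
  have "1 / (exp ((y\<^sup>2 + r\<^sup>2) / 2) - 1) \<ge> 0" for y by (simp add: add_nonneg_nonneg)
  then have "sqrt (2 * pi) * Re (Lihalf (of_real r)) \<ge> 0"
    using Lihalf_pos_real(2)[OF r] Bochner_Integration.integral_nonneg[of lborel "\<lambda>y. 1 / (exp ((y\<^sup>2 + r\<^sup>2) / 2) - 1)"]
    by (simp add: has_bochner_integral_iff)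
  then show ?thesis using pi_gt_zero by (simp add: zero_le_mult_iff)
qed

lemma Re_Q_neg_real_nonneg: "r > 0 \<Longrightarrow> Re (Q (- of_real r)) \<ge> 0"
proof -
  assume r: "r > 0"
  let ?f = "\<lambda>u::real. Lihalf (- of_real r + of_real u)"
  have ls: "- complex_of_real r \<in> left_sector" using r by (simp add: left_sector_def)
  note int = Lihalf_shift(1)[OF ls]
  have "integral {..0} (Re \<circ> ?f) = Re (integral {..0} ?f)"
    by (rule integral_linear[OF int bounded_linear_Re])
  moreover have "integral {..0} (Re \<circ> ?f) \<ge> 0"
  proof (rule integral_nonneg)
    show "Re \<circ> ?f integrable_on {..0}" by (rule integrable_linear[OF int bounded_linear_Re])
    fix u :: real assume "u \<in> {..0}"
    then have p: "r - u > 0" using r by simp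
    have "?f u = Lihalf (of_real (r - u))" using Lihalf_minus[of "of_real (r - u)"] by simp
    then show "0 \<le> (Re \<circ> ?f) u" using Re_Lihalf_pos_real_nonneg[OF p] by simp
  qed
  ultimately show ?thesis unfolding Q_eq by simp
qed

text \<open>Both sides are the integral of \<open>r / (exp (r\<^sup>2 (1 + t\<^sup>2) / 2) - 1)\<close> over \<open>r \<ge> s\<close>
  and real \<open>t\<close>, integrated in the two possible orders.\<close>

lemma Q_neg_real_integral:
  assumes s: "s > 0"
  shows "has_bochner_integral lborel (\<lambda>t. - ln (1 - exp (- (s\<^sup>2 * (1 + t\<^sup>2) / 2))) / (1 + t\<^sup>2)) (pi * Re (Q (- of_real s)))"
proof -
  let ?h = "\<lambda>r t::real. r / (exp (r\<^sup>2 * (1 + t\<^sup>2) / 2) - 1)"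
  let ?F = "\<lambda>t r::real. ln (1 - exp (- (r\<^sup>2 * (1 + t\<^sup>2) / 2))) / (1 + t\<^sup>2)"
  have p1: "1 + t\<^sup>2 > 0" for t :: real by (simp add: add_pos_nonneg)
  have pw: "r\<^sup>2 * (1 + t\<^sup>2) / 2 > 0" if "r > 0" for r t :: real using that p1[of t] by simp
  have inner_r: "(\<integral>\<^sup>+r. ennreal (?h r t) * indicator {s..} r \<partial>lborel) = ennreal (- ?F t s)" for t
  proof -
    have "(\<integral>\<^sup>+r. ennreal (?h r t) * indicator {s..} r \<partial>lborel) = ennreal (0 - ?F t s)"
    proof (rule nn_integral_FTC_atLeast)
      fix r assume "s \<le> r"
      then have r: "r > 0" using s by simp
      let ?E = "exp (r\<^sup>2 * (1 + t\<^sup>2) / 2)"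
      have E: "?E > 1" using pw[OF r, of t] by simp
      have e': "exp (- (r\<^sup>2 * (1 + t\<^sup>2) / 2)) = 1 / ?E" by (simp add: exp_minus inverse_eq_divide)
      have "(?F t has_real_derivative (inverse (1 - exp (- (r\<^sup>2 * (1 + t\<^sup>2) / 2))) * (exp (- (r\<^sup>2 * (1 + t\<^sup>2) / 2)) * (r * (1 + t\<^sup>2)))) / (1 + t\<^sup>2)) (at r)"
        by (rule DERIV_cdivide, rule DERIV_chain2[OF DERIV_ln]) (use pw[OF r, of t] in \<open>auto intro!: derivative_eq_intros\<close>)
      moreover have "(inverse (1 - exp (- (r\<^sup>2 * (1 + t\<^sup>2) / 2))) * (exp (- (r\<^sup>2 * (1 + t\<^sup>2) / 2)) * (r * (1 + t\<^sup>2)))) / (1 + t\<^sup>2) = ?h r t"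
      proof -
        have g: "inverse (1 - 1 / x) * (1 / x * (r * y)) / y = r / (x - 1)" if "x > 1" "y > 0" for x y :: real
        proof -
          have "1 - 1 / x = (x - 1) / x" using that by (simp add: diff_divide_distrib)
          then show ?thesis using that by simp
        qed
        show ?thesis unfolding e' by (rule g[OF E p1])
      qed
      ultimately show "(?F t has_real_derivative ?h r t) (at r)" by (simp only:)
      show "0 \<le> ?h r t" using r E by simp
    next
      have "filterlim (\<lambda>r. (1 + t\<^sup>2) / 2 * r\<^sup>2) at_top at_top"
        by (rule filterlim_tendsto_pos_mult_at_top[OF tendsto_const _ filterlim_pow_at_top[OF _ filterlim_ident]]) (use p1[of t] in auto)
      then have "((\<lambda>r. exp (- ((1 + t\<^sup>2) / 2 * r\<^sup>2))) \<longlongrightarrow> 0) at_top"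
        by (intro filterlim_compose[OF exp_at_bot] filterlim_compose[OF filterlim_uminus_at_bot_at_top])
      then have "((\<lambda>r. ln (1 - exp (- ((1 + t\<^sup>2) / 2 * r\<^sup>2))) / (1 + t\<^sup>2)) \<longlongrightarrow> ln (1 - 0) / (1 + t\<^sup>2)) at_top"
        by (intro tendsto_intros) (use p1[of t] in auto)
      then show "(?F t \<longlongrightarrow> 0) at_top" by (simp add: mult.commute)
    qed simp
    then show ?thesis by simp
  qed
  define f where "f r = (if r \<in> {0<..} then sqrt (2 * pi) * Re (Lihalf (of_real r)) else 0)" for r
  have contf: "continuous_on {0<..} (\<lambda>r. sqrt (2 * pi) * Re (Lihalf (of_real r)))"
    by (intro continuous_intros continuous_on_compose2[OF holomorphic_on_imp_continuous_on[OF holomorphic_Lihalf]])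
       (auto simp: right_sector_def)
  have fm: "f \<in> borel_measurable borel"
    unfolding f_def by (rule borel_measurable_continuous_on_if[OF _ contf]) auto
  have inner_t: "(\<integral>\<^sup>+t. ennreal (?h r t) * indicator {s..} r \<partial>lborel) = ennreal (f r) * indicator {s..} r" for r
  proof (cases "r \<ge> s")
    case True
    then have r: "r > 0" using s by simp
    let ?c = "sqrt (2 * pi) * Re (Lihalf (of_real r))"
    have "has_bochner_integral lborel (\<lambda>t. 1 / (exp (((0 + r * t)\<^sup>2 + r\<^sup>2) / 2) - 1)) (?c /\<^sub>R \<bar>r\<bar>)"
      using Lihalf_pos_real(2)[OF r] lborel_has_bochner_integral_real_affine_iff[of r "\<lambda>y. 1 / (exp ((y\<^sup>2 + r\<^sup>2) / 2) - 1)" ?c 0] r by simp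
    then have "has_bochner_integral lborel (\<lambda>t. r * (1 / (exp (((0 + r * t)\<^sup>2 + r\<^sup>2) / 2) - 1))) (r * (?c /\<^sub>R \<bar>r\<bar>))"
      by (rule has_bochner_integral_mult_right)
    moreover have "r * (1 / (exp (((0 + r * t)\<^sup>2 + r\<^sup>2) / 2) - 1)) = ?h r t" for t
    proof -
      have "(0 + r * t)\<^sup>2 + r\<^sup>2 = r\<^sup>2 * (1 + t\<^sup>2)" by (simp add: power_mult_distrib algebra_simps)
      then show ?thesis by (simp only: times_divide_eq_right mult_1_right)
    qed
    moreover have "r * (?c /\<^sub>R \<bar>r\<bar>) = ?c" using r by simp
    ultimately have hb: "has_bochner_integral lborel (?h r) ?c" by (simp only:)
    have nn: "?h r t \<ge> 0" for t using r pw[OF r, of t] by simp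
    have "(\<integral>\<^sup>+t. ennreal (?h r t) \<partial>lborel) = ennreal (integral\<^sup>L lborel (?h r))"
      by (rule nn_integral_eq_integral) (use hb nn in \<open>auto simp: has_bochner_integral_iff\<close>)
    also have "integral\<^sup>L lborel (?h r) = ?c" using hb by (simp only: has_bochner_integral_iff)
    finally show ?thesis using True r by (simp add: f_def)
  qed simp
  have mp[measurable]: "(\<lambda>(r, t). ennreal (?h r t) * indicator {s..} r) \<in> borel_measurable (lborel \<Otimes>\<^sub>M lborel)"
    by measurable
  have "(\<integral>\<^sup>+t. ennreal (- ?F t s) \<partial>lborel) = (\<integral>\<^sup>+t. (\<integral>\<^sup>+r. ennreal (?h r t) * indicator {s..} r \<partial>lborel) \<partial>lborel)"
    unfolding inner_r ..
  also have "\<dots> = (\<integral>\<^sup>+r. (\<integral>\<^sup>+t. ennreal (?h r t) * indicator {s..} r \<partial>lborel) \<partial>lborel)"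
    using lborel_pair.Fubini'[OF mp] by simp
  also have "\<dots> = (\<integral>\<^sup>+r. ennreal (f r) * indicator {s..} r \<partial>lborel)" unfolding inner_t ..
  also have "\<dots> = ennreal (0 - (- (pi * Re (Q (- of_real s)))))"
  proof (rule nn_integral_FTC_atLeast[OF fm])
    fix r assume "s \<le> r"
    then have r: "r > 0" using s by simp
    have "((\<lambda>r. Re (Q (- of_real r))) has_real_derivative Re (- (of_real (sqrt (2 / pi)) * Lihalf (of_real r)))) (at r)"
      unfolding has_real_derivative_iff_has_vector_derivative
      using bounded_linear.has_vector_derivative[OF bounded_linear_Re DERIV_Q_neg_real[OF r]] .
    then have "((\<lambda>r. - (pi * Re (Q (- of_real r)))) has_real_derivative - (pi * Re (- (of_real (sqrt (2 / pi)) * Lihalf (of_real r))))) (at r)"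
      by (intro DERIV_minus DERIV_cmult)
    moreover have "- (pi * Re (- (of_real (sqrt (2 / pi)) * Lihalf (of_real r)))) = f r"
    proof -
      have "pi * sqrt (2 / pi) = sqrt (2 * pi)"
        by (simp add: real_sqrt_divide real_sqrt_mult field_simps)
      then show ?thesis using r by (simp add: f_def flip: mult.assoc)
    qed
    ultimately show "((\<lambda>r. - (pi * Re (Q (- of_real r)))) has_real_derivative f r) (at r)" by (simp only:)
    show "0 \<le> f r" using Re_Lihalf_pos_real_nonneg[OF r] by (simp add: f_def)
  next
    have "((\<lambda>r. - (pi * Re (Q (- of_real r)))) \<longlongrightarrow> - (pi * Re 0)) at_top"
      by (intro tendsto_intros Q_neg_real_tendsto_0)
    then show "((\<lambda>r. - (pi * Re (Q (- of_real r)))) \<longlongrightarrow> 0) at_top" by simp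
  qed
  finally have nn: "(\<integral>\<^sup>+t. ennreal (- ?F t s) \<partial>lborel) = ennreal (pi * Re (Q (- of_real s)))" by simp
  have nnF: "- ?F t s \<ge> 0" for t
  proof -
    have "ln (1 - exp (- (s\<^sup>2 * (1 + t\<^sup>2) / 2))) \<le> 0"
      using pw[OF s, of t] by (subst ln_le_zero_iff) auto
    then show ?thesis using p1[of t] by (simp add: divide_nonpos_pos)
  qed
  have "has_bochner_integral lborel (\<lambda>t. - ?F t s) (pi * Re (Q (- of_real s)))"
    by (rule has_bochner_integral_nn_integral[OF _ _ _ nn]) (use nnF Re_Q_neg_real_nonneg[OF s] in auto)
  then show ?thesis by simp
qed

text \<open>The quotient (1 - exp (- w)) / w lies between 1 / (1 + w) and 1. The two bounds give
  both the pointwise limit and the domination in \<open>Q_neg_real_limit\<close>.\<close>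

lemma ln_one_minus_exp_bounds:
  fixes w :: real
  assumes "w > 0"
  shows "ln ((1 - exp (- w)) / w) \<le> 0" "- ln (1 + w) \<le> ln ((1 - exp (- w)) / w)"
proof -
  have 1: "1 - exp (- w) \<le> w" using exp_ge_add_one_self[of "- w"] by linarith
  have 2: "1 - exp (- w) > 0" using assms by simp
  show "ln ((1 - exp (- w)) / w) \<le> 0" using 1 2 assms by (subst ln_le_zero_iff) auto
  have "1 + w \<le> exp w" by (rule exp_ge_add_one_self)
  then have "exp (- w) \<le> 1 / (1 + w)" using assms by (simp add: exp_minus field_simps)
  then have "1 - exp (- w) \<ge> 1 - 1 / (1 + w)" by linarith
  also have "1 - 1 / (1 + w) = w / (1 + w)" using assms by (simp add: field_simps)
  finally have "w / (1 + w) \<le> 1 - exp (- w)" .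
  then have "w / (1 + w) / w \<le> (1 - exp (- w)) / w" using assms by (intro divide_right_mono) auto
  then have "1 / (1 + w) \<le> (1 - exp (- w)) / w" using assms by simp
  then have "ln (1 / (1 + w)) \<le> ln ((1 - exp (- w)) / w)" using assms by (intro ln_mono) auto
  then show "- ln (1 + w) \<le> ln ((1 - exp (- w)) / w)" using assms by (simp add: ln_div)
qed

text \<open>In \<open>Q_neg_real_integral\<close> the logarithm behaves like ln (s^2 (1 + t^2) / 2).
  Splitting off ln (s^2) produces the term 2 ln s, and by dominated convergence the rest tends to
  the integral of - ln ((1 + t^2) / 2) / (1 + t^2), which is \<pi> ln 2 - 2 \<pi> ln 2.\<close>

lemma Q_neg_real_limit:
  "(\<lambda>n. Re (Q (- of_real (1 / real (Suc n)))) + 2 * ln (1 / real (Suc n))) \<longlonglongrightarrow> - ln 2"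
proof -
  define s where "s n = 1 / real (Suc n)" for n
  have s0: "s n > 0" "s n \<le> 1" for n by (simp_all add: s_def)
  have slim: "s \<longlonglongrightarrow> 0" unfolding s_def by (rule LIMSEQ_Suc[OF lim_1_over_n])
  have p1: "1 + t\<^sup>2 > 0" "1 + t\<^sup>2 \<ge> 1" for t :: real by (simp_all add: add_pos_nonneg)
  let ?w = "\<lambda>n t. (s n)\<^sup>2 * (1 + t\<^sup>2) / 2"
  have w0: "?w n t > 0" for n t by (intro divide_pos_pos mult_pos_pos zero_less_power s0 p1) simp
  let ?G = "\<lambda>n t. - (ln ((1 - exp (- ?w n t)) / ?w n t) + ln ((1 + t\<^sup>2) / 2)) / (1 + t\<^sup>2)"
  have inv: "has_bochner_integral lborel (\<lambda>t. 1 / (1 + t\<^sup>2)) pi"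
    using has_bochner_integral_inverse_sum_squares[of 1] by simp
  have hG: "has_bochner_integral lborel (?G n) (pi * Re (Q (- of_real (s n))) + 2 * ln (s n) * pi)" for n
  proof -
    have "has_bochner_integral lborel (\<lambda>t. - ln (1 - exp (- ?w n t)) / (1 + t\<^sup>2) + 2 * ln (s n) * (1 / (1 + t\<^sup>2)))
       (pi * Re (Q (- of_real (s n))) + 2 * ln (s n) * pi)"
      by (intro has_bochner_integral_add has_bochner_integral_mult_right inv Q_neg_real_integral s0)
    moreover have "- ln (1 - exp (- ?w n t)) / (1 + t\<^sup>2) + 2 * ln (s n) * (1 / (1 + t\<^sup>2)) = ?G n t" for t
    proof -
      have e: "1 - exp (- ?w n t) > 0" using w0[of n t] by simp
      have "ln ((1 - exp (- ?w n t)) / ?w n t) = ln (1 - exp (- ?w n t)) - ln (?w n t)"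
        using e w0[of n t] by (intro ln_divide_pos) auto
      moreover have "ln (?w n t) = ln ((s n)\<^sup>2 * ((1 + t\<^sup>2) / 2))" by simp
      moreover have "\<dots> = ln ((s n)\<^sup>2) + ln ((1 + t\<^sup>2) / 2)"
        by (intro ln_mult_pos divide_pos_pos zero_less_power s0 p1) simp
      moreover have "ln ((s n)\<^sup>2) = 2 * ln (s n)" using s0[of n] by (simp add: ln_realpow)
      ultimately have "- (ln ((1 - exp (- ?w n t)) / ?w n t) + ln ((1 + t\<^sup>2) / 2)) = - ln (1 - exp (- ?w n t)) + 2 * ln (s n)"
        by linarith
      then show ?thesis by (simp only: add_divide_distrib times_divide_eq_right mult_1_right)
    qed
    ultimately show ?thesis by (simp only:)
  qed
  let ?g = "\<lambda>t::real. - ln ((1 + t\<^sup>2) / 2) / (1 + t\<^sup>2)"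
  have hg: "has_bochner_integral lborel ?g (- (pi * ln 2))"
  proof -
    have "has_bochner_integral lborel (\<lambda>t. ln 2 * (1 / (1 + t\<^sup>2)) - ln (1 + t\<^sup>2) / (1 + t\<^sup>2)) (ln 2 * pi - 2 * pi * ln 2)"
      by (intro has_bochner_integral_diff has_bochner_integral_mult_right inv integral_ln_one_plus_square)
    moreover have "ln 2 * (1 / (1 + t\<^sup>2)) - ln (1 + t\<^sup>2) / (1 + t\<^sup>2) = ?g t" for t :: real
    proof -
      have "ln ((1 + t\<^sup>2) / 2) = ln (1 + t\<^sup>2) - ln 2" using p1(1)[of t] by (intro ln_divide_pos) auto
      then show ?thesis by (simp only: minus_diff_eq diff_divide_distrib times_divide_eq_right mult_1_right)
    qed
    moreover have "ln 2 * pi - 2 * pi * ln 2 = - (pi * ln 2)" by (simp add: algebra_simps)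
    ultimately show ?thesis by (simp only:)
  qed
  have dom: "has_bochner_integral lborel (\<lambda>t. 2 * ln 2 * (1 / (1 + t\<^sup>2)) + 2 * (ln (1 + t\<^sup>2) / (1 + t\<^sup>2))) (2 * ln 2 * pi + 2 * (2 * pi * ln 2))"
    by (intro has_bochner_integral_add has_bochner_integral_mult_right inv integral_ln_one_plus_square)
  have "(\<lambda>n. integral\<^sup>L lborel (?G n)) \<longlonglongrightarrow> integral\<^sup>L lborel ?g"
  proof (rule integral_dominated_convergence)
    show "integrable lborel (\<lambda>t::real. 2 * ln 2 * (1 / (1 + t\<^sup>2)) + 2 * (ln (1 + t\<^sup>2) / (1 + t\<^sup>2)))"
      using dom by (simp only: has_bochner_integral_iff)
    show "?G n \<in> borel_measurable lborel" for n by measurable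
    show "?g \<in> borel_measurable lborel" by measurable
    have "(\<lambda>n. ?G n t) \<longlonglongrightarrow> ?g t" for t
    proof -
      have wl: "(\<lambda>n. ?w n t) \<longlonglongrightarrow> 0\<^sup>2 * (1 + t\<^sup>2) / 2" by (intro tendsto_intros slim) auto
      have "(\<lambda>n. - ln (1 + ?w n t)) \<longlonglongrightarrow> - ln (1 + 0\<^sup>2 * (1 + t\<^sup>2) / 2)" by (intro tendsto_intros wl) auto
      then have l0: "(\<lambda>n. - ln (1 + ?w n t)) \<longlonglongrightarrow> 0" by simp
      have "(\<lambda>n. ln ((1 - exp (- ?w n t)) / ?w n t)) \<longlonglongrightarrow> 0"
        by (rule tendsto_sandwich[OF _ _ l0 tendsto_const]) (use ln_one_minus_exp_bounds[OF w0] in auto)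
      then have "(\<lambda>n. ?G n t) \<longlonglongrightarrow> - (0 + ln ((1 + t\<^sup>2) / 2)) / (1 + t\<^sup>2)"
        by (intro tendsto_intros less_imp_neq[OF p1(1), symmetric])
      then show ?thesis by simp
    qed
    then show "AE t in lborel. (\<lambda>n. ?G n t) \<longlonglongrightarrow> ?g t" by simp
    have "norm (?G n t) \<le> 2 * ln 2 * (1 / (1 + t\<^sup>2)) + 2 * (ln (1 + t\<^sup>2) / (1 + t\<^sup>2))" for n t
    proof -
      have L: "ln (1 + t\<^sup>2) \<ge> 0" "ln 2 \<ge> (0::real)" using p1(2)[of t] by auto
      have "(s n)\<^sup>2 \<le> 1" using s0[of n] by (simp add: power_le_one)
      then have "(s n)\<^sup>2 * (1 + t\<^sup>2) \<le> 1 * (1 + t\<^sup>2)" using p1[of t] by (intro mult_right_mono) auto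
      moreover have "1 + a / 2 \<le> 2 * b" if "a \<le> 1 * b" "1 \<le> b" for a b :: real using that by linarith
      ultimately have "1 + ?w n t \<le> 2 * (1 + t\<^sup>2)" using p1(2)[of t] by blast
      then have "ln (1 + ?w n t) \<le> ln (2 * (1 + t\<^sup>2))" by (intro ln_mono add_pos_pos w0 mult_pos_pos p1) simp_all
      also have "\<dots> = ln 2 + ln (1 + t\<^sup>2)" by (intro ln_mult_pos p1) simp
      finally have a: "\<bar>ln ((1 - exp (- ?w n t)) / ?w n t)\<bar> \<le> ln 2 + ln (1 + t\<^sup>2)"
        using ln_one_minus_exp_bounds[OF w0[of n t]] by linarith
      have "ln ((1 + t\<^sup>2) / 2) = ln (1 + t\<^sup>2) - ln 2" using p1(1)[of t] by (intro ln_divide_pos) auto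
      then have b: "\<bar>ln ((1 + t\<^sup>2) / 2)\<bar> \<le> ln 2 + ln (1 + t\<^sup>2)" using L by linarith
      have "norm (?G n t) = \<bar>ln ((1 - exp (- ?w n t)) / ?w n t) + ln ((1 + t\<^sup>2) / 2)\<bar> / (1 + t\<^sup>2)"
        using p1(1)[of t] by (simp only: real_norm_def abs_divide abs_minus_cancel abs_of_pos)
      also have "\<dots> \<le> (2 * ln 2 + 2 * ln (1 + t\<^sup>2)) / (1 + t\<^sup>2)"
        using a b p1(2)[of t] by (intro divide_right_mono) linarith+
      also have "\<dots> = 2 * ln 2 * (1 / (1 + t\<^sup>2)) + 2 * (ln (1 + t\<^sup>2) / (1 + t\<^sup>2))"
        by (simp add: add_divide_distrib)
      finally show ?thesis .
    qed
    then show "AE t in lborel. norm (?G n t) \<le> 2 * ln 2 * (1 / (1 + t\<^sup>2)) + 2 * (ln (1 + t\<^sup>2) / (1 + t\<^sup>2))" for n by simp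
  qed
  moreover have "integral\<^sup>L lborel (?G n) = pi * Re (Q (- of_real (s n))) + 2 * ln (s n) * pi" for n
    using hG[of n] by (simp only: has_bochner_integral_iff)
  moreover have "integral\<^sup>L lborel ?g = - (pi * ln 2)" using hg by (simp only: has_bochner_integral_iff)
  ultimately have "(\<lambda>n. pi * Re (Q (- of_real (s n))) + 2 * ln (s n) * pi) \<longlonglongrightarrow> - (pi * ln 2)" by (simp only:)
  then have "(\<lambda>n. (pi * Re (Q (- of_real (s n))) + 2 * ln (s n) * pi) / pi) \<longlonglongrightarrow> - (pi * ln 2) / pi"
    by (intro tendsto_divide tendsto_const) auto
  then show ?thesis by (simp add: add_divide_distrib s_def)
qed

section \<open>Continuation of the integrand\<close>

definition prim :: "(complex \<Rightarrow> complex) \<Rightarrow> complex \<Rightarrow> complex" where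
  "prim f s = contour_integral (linepath 0 s) f"

lemma prim_0 [simp]: "prim f 0 = 0" by (simp add: prim_def)

lemma closed_segment_0_Om: "s \<in> Om \<Longrightarrow> closed_segment 0 s \<subseteq> Om"
proof
  fix y assume "s \<in> Om" "y \<in> closed_segment 0 s"
  then obtain u where s: "\<bar>Im (s\<^sup>2)\<bar> < 4 * pi" and u: "0 \<le> u" "u \<le> 1" "y = of_real u * s"
    by (auto simp: Om_def in_segment scaleR_conv_of_real)
  have "Im (y\<^sup>2) = u\<^sup>2 * Im (s\<^sup>2)" unfolding u(3) power_mult_distrib by (simp flip: of_real_power)
  then have "\<bar>Im (y\<^sup>2)\<bar> = u\<^sup>2 * \<bar>Im (s\<^sup>2)\<bar>" by (simp add: abs_mult)
  also have "\<dots> \<le> 1 * \<bar>Im (s\<^sup>2)\<bar>" using u by (intro mult_right_mono) (auto simp: power_le_one)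
  finally show "y \<in> Om" using s by (simp add: Om_def)
qed

lemma DERIV_prim:
  assumes f: "f holomorphic_on Om" and s: "s \<in> Om"
  shows "(prim f has_field_derivative f s) (at s)"
proof -
  from Om_primitive[OF f] obtain g where g: "\<And>s. s \<in> Om \<Longrightarrow> (g has_field_derivative f s) (at s)" by blast
  have e: "prim f x = g x - g 0" if "x \<in> Om" for x
  proof -
    have "(f has_contour_integral (g (pathfinish (linepath 0 x)) - g (pathstart (linepath 0 x)))) (linepath 0 x)"
    proof (rule contour_integral_primitive[where S=Om])
      show "(g has_field_derivative f t) (at t within Om)" if "t \<in> Om" for t
        by (rule has_field_derivative_at_within[OF g[OF that]])
      show "path_image (linepath 0 x) \<subseteq> Om" using closed_segment_0_Om[OF \<open>x \<in> Om\<close>] by simp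
    qed (rule valid_path_linepath)
    then show ?thesis unfolding prim_def by (simp add: contour_integral_unique)
  qed
  have "((\<lambda>x. g x - g 0) has_field_derivative f s) (at s)" using g[OF s] by (auto intro!: derivative_eq_intros)
  then show ?thesis
    by (rule has_field_derivative_transform_within_open[OF _ open_Om s]) (simp add: e)
qed

lemma holomorphic_prim:
  assumes "f holomorphic_on Om"
  shows "prim f holomorphic_on Om"
  using DERIV_prim[OF assms] by (auto simp: holomorphic_on_open[OF open_Om])

lemma DERIV_prim_minus:
  assumes f: "f holomorphic_on Om" and s: "s \<in> Om"
  shows "((\<lambda>s. prim f (- s)) has_field_derivative - f (- s)) (at s)"
proof -
  have "(prim f has_field_derivative f (- s)) (at (- s))" using DERIV_prim[OF f] s by simp
  then have "((\<lambda>s. prim f (- s)) has_field_derivative f (- s) * - 1) (at s)"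
    by (rule DERIV_chain2) (auto intro!: derivative_eq_intros)
  then show ?thesis by simp
qed

text \<open>The part of \<open>Q\<close> that is regular at the origin: on the left sheet the
  derivatives of \<open>OJ\<close> and \<open>Q\<close> differ by 2 / s.\<close>

definition OJ :: "complex \<Rightarrow> complex" where
  "OJ = prim (\<lambda>s. of_real (sqrt (2 / pi)) * J s)"

lemma holomorphic_J: "J holomorphic_on Om" by (rule J_integrable_and_holomorphic(1))

lemma sqrt_pi_facts: "sqrt (2 / pi) * sqrt (2 * pi) = 2" "sqrt (2 * pi) * sqrt (2 * pi) = 2 * pi"
  "2 * sqrt (2 * pi) / (2 * pi) = sqrt (2 / pi)"
proof -
  have "sqrt (2 / pi) * sqrt (2 * pi) = sqrt (2\<^sup>2)" by (simp flip: real_sqrt_mult)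
  then show 1: "sqrt (2 / pi) * sqrt (2 * pi) = 2" by simp
  show 2: "sqrt (2 * pi) * sqrt (2 * pi) = 2 * pi" by simp
  have "2 * sqrt (2 * pi) / (2 * pi) = sqrt (2 / pi) * sqrt (2 * pi) * sqrt (2 * pi) / (2 * pi)" using 1 by simp
  also have "\<dots> = sqrt (2 / pi) * (2 * pi) / (2 * pi)" using 2 by (simp only: mult.assoc)
  finally show "2 * sqrt (2 * pi) / (2 * pi) = sqrt (2 / pi)" by simp
qed

lemma DL_nz: "s \<in> DL \<Longrightarrow> s \<noteq> 0" and DR_nz: "s \<in> DR \<Longrightarrow> s \<noteq> 0"
  by (auto simp: DL_def DR_def left_sector_def right_sector_def)

text \<open>exp (OJ - Q) / s^2 has derivative 0 on the connected set \<open>DL\<close>, and its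
  value 2 is read off along s = - 1 / n with \<open>Q_neg_real_limit\<close>. The value matters: the
  square of 2 s^2 cancels 4 w^2 in the trace term exactly, so that no singularity at s = 0 and no
  spurious factor remains.\<close>

lemma exp_Q_DL:
  assumes s: "s \<in> DL"
  shows "exp (- Q s) = 2 * s\<^sup>2 * exp (- OJ s)"
proof -
  let ?k = "\<lambda>s. exp (OJ s - Q s) / s\<^sup>2"
  have hJ: "(\<lambda>s. of_real (sqrt (2 / pi)) * J s) holomorphic_on Om" by (intro holomorphic_intros holomorphic_J)
  have "(?k has_field_derivative 0) (at t)" if t: "t \<in> DL" for t
  proof -
    have t': "t \<in> Om" "t \<in> left_sector" "t \<noteq> 0" using t DL_nz by (auto simp: DL_def)
    have "of_real (sqrt (2 / pi)) * J t - of_real (sqrt (2 / pi)) * Lihalf t = of_real (sqrt (2 / pi) * sqrt (2 * pi)) / t"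
      unfolding Lihalf_DL[OF t] by (simp add: algebra_simps)
    then have e: "of_real (sqrt (2 / pi)) * J t - of_real (sqrt (2 / pi)) * Lihalf t = 2 / t"
      unfolding sqrt_pi_facts(1) by simp
    have dO: "(OJ has_field_derivative of_real (sqrt (2 / pi)) * J t) (at t)"
      unfolding OJ_def by (rule DERIV_prim[OF hJ t'(1)])
    have dQ: "(Q has_field_derivative of_real (sqrt (2 / pi)) * Lihalf t) (at t)" by (rule DERIV_Q[OF t'(2)])
    have "((\<lambda>s. OJ s - Q s) has_field_derivative 2 / t) (at t)"
      using DERIV_diff[OF dO dQ] unfolding e .
    then have "(?k has_field_derivative (exp (OJ t - Q t) * (2 / t) * t\<^sup>2 - exp (OJ t - Q t) * (2 * t)) / (t\<^sup>2 * t\<^sup>2)) (at t)"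
      by (intro DERIV_divide DERIV_fun_exp) (use t'(3) in \<open>auto intro!: derivative_eq_intros\<close>)
    moreover have "exp (OJ t - Q t) * (2 / t) * t\<^sup>2 - exp (OJ t - Q t) * (2 * t) = 0"
      using t'(3) by (simp add: power2_eq_square)
    ultimately show ?thesis by simp
  qed
  then have "?k constant_on DL"
    by (intro has_field_derivative_0_imp_constant_on[OF _ connected_DL open_DL]) auto
  then obtain c where c: "\<And>s. s \<in> DL \<Longrightarrow> ?k s = c" by (auto simp: constant_on_def)
  define u where "u n = 1 / real (Suc n)" for n
  have u0: "u n > 0" for n by (simp add: u_def)
  have uDL: "- of_real (u n) \<in> DL" for n
    using u0[of n] by (simp add: DL_def left_sector_def Om_def)
  have ul: "(\<lambda>n. - complex_of_real (u n)) \<longlonglongrightarrow> - of_real 0"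
    unfolding u_def by (intro tendsto_intros LIMSEQ_Suc[OF lim_1_over_n])
  have "isCont OJ 0"
    using DERIV_prim[OF hJ zero_Om] unfolding OJ_def by (rule DERIV_isCont)
  then have l1: "(\<lambda>n. OJ (- of_real (u n))) \<longlonglongrightarrow> OJ 0"
    using ul by (intro isCont_tendsto_compose[of 0 OJ]) simp_all
  have l2: "(\<lambda>n. exp (OJ (- of_real (u n))) * of_real (exp (- (Re (Q (- of_real (u n))) + 2 * ln (u n))))) \<longlonglongrightarrow> exp (OJ 0) * of_real (exp (- (- ln 2)))"
    unfolding u_def by (intro tendsto_intros Q_neg_real_limit l1[unfolded u_def])
  have "exp (OJ (- of_real (u n))) * of_real (exp (- (Re (Q (- of_real (u n))) + 2 * ln (u n)))) = c" for n
  proof -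
    have q: "Q (- of_real (u n)) = of_real (Re (Q (- of_real (u n))))"
      using Q_neg_real_Im[OF u0[of n]] by (simp add: complex_eq_iff)
    have q2: "exp (- Q (- of_real (u n))) = of_real (exp (- Re (Q (- of_real (u n)))))"
      using q by (metis exp_of_real of_real_minus)
    have "exp (2 * ln (u n)) = (u n)\<^sup>2" using u0[of n] by (simp add: exp_double)
    then have "exp (- (Re (Q (- of_real (u n))) + 2 * ln (u n))) = exp (- Re (Q (- of_real (u n)))) / (u n)\<^sup>2"
      by (simp add: exp_diff exp_minus)
    then have "complex_of_real (exp (- (Re (Q (- of_real (u n))) + 2 * ln (u n)))) = exp (- Q (- of_real (u n))) / (- of_real (u n))\<^sup>2"
      unfolding q2 by (simp only: of_real_divide of_real_power power2_minus)
    then have "exp (OJ (- of_real (u n))) * of_real (exp (- (Re (Q (- of_real (u n))) + 2 * ln (u n)))) = ?k (- of_real (u n))"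
      by (simp only: exp_diff exp_minus times_divide_eq_right divide_inverse mult.assoc)
    then show ?thesis using c[OF uDL[of n]] by simp
  qed
  then have "c = exp (OJ 0) * of_real (exp (- (- ln 2)))" using l2 by (simp add: LIMSEQ_const_iff)
  then have "c = 2" by (simp add: OJ_def)
  then have "exp (OJ s - Q s) / s\<^sup>2 = 2" using c[OF s] by simp
  then have "exp (OJ s - Q s) = 2 * s\<^sup>2" using DL_nz[OF s] by (simp add: field_simps)
  then have "exp (- OJ s) * exp (OJ s - Q s) = 2 * s\<^sup>2 * exp (- OJ s)" by simp
  then show ?thesis by (simp flip: exp_add)
qed

text \<open>Continuations of \<open>A1\<close>, \<open>A2\<close> and \<open>s * exp (2 * B)\<close>, as functions of \<open>s\<close> with \<open>z = exp (- s\<^sup>2 / 2)\<close>,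
  from the right sector to all of \<open>Om\<close>.\<close>

definition cA1 :: "complex \<Rightarrow> complex" where
  "cA1 s = A1 (exp (- (1 / 2))) + prim (\<lambda>s. 1 + s * J s / of_real (sqrt (2 * pi))) s
     - prim (\<lambda>s. 1 + s * J s / of_real (sqrt (2 * pi))) 1"

definition cA2 :: "complex \<Rightarrow> complex" where
  "cA2 s = A2 (exp (- (1 / 2))) + prim (\<lambda>s. - s * cA1 s) s - prim (\<lambda>s. - s * cA1 s) 1"

definition cH :: "complex \<Rightarrow> complex" where "cH s = cA2 s - cA1 s"

text \<open>The derivative of 2 B on the right sheet is this integrand minus 1 / s, as squaring J +
  sqrt (2 \<pi>) / s shows. The term - 1 / s is what the factor s in s exp (2 B) removes.\<close>

definition cP :: "complex \<Rightarrow> complex" where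
  "cP = prim (\<lambda>s. - s * (J s)\<^sup>2 / of_real (2 * pi) - of_real (sqrt (2 / pi)) * J s)"

definition cG :: "complex \<Rightarrow> complex" where
  "cG s = exp (2 * B (exp (- (1 / 2))) + cP s - cP 1)"

lemma holomorphic_cA1: "cA1 holomorphic_on Om"
  unfolding cA1_def by (intro holomorphic_intros holomorphic_prim holomorphic_J) auto

lemma DERIV_cA1: "s \<in> Om \<Longrightarrow> (cA1 has_field_derivative 1 + s * J s / of_real (sqrt (2 * pi))) (at s)"
  unfolding cA1_def[abs_def]
  by (rule derivative_eq_intros DERIV_prim refl | (intro holomorphic_intros holomorphic_J; simp) | simp)+

lemma holomorphic_cA2: "cA2 holomorphic_on Om"
  unfolding cA2_def by (intro holomorphic_intros holomorphic_prim holomorphic_cA1)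

lemma DERIV_cA2: "s \<in> Om \<Longrightarrow> (cA2 has_field_derivative - s * cA1 s) (at s)"
  unfolding cA2_def[abs_def]
  by (rule derivative_eq_intros DERIV_prim refl | (intro holomorphic_intros holomorphic_cA1; simp) | simp)+

lemma holomorphic_cH: "cH holomorphic_on Om"
  unfolding cH_def by (intro holomorphic_intros holomorphic_cA1 holomorphic_cA2)

lemma holomorphic_cP_deriv: "(\<lambda>s. - s * (J s)\<^sup>2 / of_real (2 * pi) - of_real (sqrt (2 / pi)) * J s) holomorphic_on Om"
  by (intro holomorphic_intros holomorphic_J) auto

lemma holomorphic_cG: "cG holomorphic_on Om"
  unfolding cG_def cP_def by (intro holomorphic_intros holomorphic_prim holomorphic_J) auto

lemma Lihalf_DR_times: "s \<in> DR \<Longrightarrow> s * Lihalf s / of_real (sqrt (2 * pi)) = 1 + s * J s / of_real (sqrt (2 * pi))"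
  using DR_nz[of s] by (simp add: Lihalf_DR field_simps)

lemma DR_Om: "s \<in> DR \<Longrightarrow> s \<in> Om" and DR_right: "s \<in> DR \<Longrightarrow> s \<in> right_sector" by (auto simp: DR_def)

lemma cA1_DR: "s \<in> DR \<Longrightarrow> cA1 s = A1 (exp (- (s\<^sup>2 / 2)))"
proof (rule eq_if_same_derivative[where f=cA1 and g="\<lambda>s. A1 (exp (- (s\<^sup>2 / 2)))", OF open_DR connected_DR _ _ one_DR])
  fix s assume s: "s \<in> DR"
  show "(cA1 has_field_derivative 1 + s * J s / of_real (sqrt (2 * pi))) (at s)" by (rule DERIV_cA1[OF DR_Om[OF s]])
  show "((\<lambda>s. A1 (exp (- (s\<^sup>2 / 2)))) has_field_derivative 1 + s * J s / of_real (sqrt (2 * pi))) (at s)"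
    using DERIV_comp_neg_half_sq(1)[of s] DR_right[OF s] unfolding Lihalf_DR_times[OF s] by blast
qed (simp_all add: cA1_def)

lemma cA2_DR: "s \<in> DR \<Longrightarrow> cA2 s = A2 (exp (- (s\<^sup>2 / 2)))"
proof (rule eq_if_same_derivative[where f=cA2 and g="\<lambda>s. A2 (exp (- (s\<^sup>2 / 2)))", OF open_DR connected_DR _ _ one_DR])
  fix s assume s: "s \<in> DR"
  show "(cA2 has_field_derivative - s * cA1 s) (at s)" by (rule DERIV_cA2[OF DR_Om[OF s]])
  show "((\<lambda>s. A2 (exp (- (s\<^sup>2 / 2)))) has_field_derivative - s * cA1 s) (at s)"
    using DERIV_comp_neg_half_sq(2)[of s] DR_right[OF s] unfolding cA1_DR[OF s] by blast
qed (simp_all add: cA2_def)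

lemma cG_DR: "s \<in> DR \<Longrightarrow> cG s = s * exp (2 * B (exp (- (s\<^sup>2 / 2))))"
proof -
  let ?f = "\<lambda>s. s * exp (2 * B (exp (- (s\<^sup>2 / 2))) - cP s)"
  assume s: "s \<in> DR"
  have "?f s = exp (2 * B (exp (- (1 / 2))) - cP 1)"
  proof (rule eq_if_same_derivative[where f="?f" and g="\<lambda>_. exp (2 * B (exp (- (1 / 2))) - cP 1)", OF open_DR connected_DR _ _ one_DR _ s])
    fix t assume t: "t \<in> DR"
    let ?D = "- t * (J t)\<^sup>2 / of_real (2 * pi) - of_real (sqrt (2 / pi)) * J t"
    let ?E = "2 * (- t * (Lihalf t)\<^sup>2 / of_real (4 * pi))"
    have t0: "t \<noteq> 0" by (rule DR_nz[OF t])
    have dB: "((\<lambda>s. B (exp (- (s\<^sup>2 / 2)))) has_field_derivative - t * (Lihalf t)\<^sup>2 / of_real (4 * pi)) (at t)"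
      using DERIV_comp_neg_half_sq(3)[of t] DR_right[OF t] by blast
    have dP: "(cP has_field_derivative ?D) (at t)"
      unfolding cP_def by (rule DERIV_prim[OF holomorphic_cP_deriv DR_Om[OF t]])
    have d: "((\<lambda>s. 2 * B (exp (- (s\<^sup>2 / 2))) - cP s) has_field_derivative ?E - ?D) (at t)"
      by (rule DERIV_diff[OF DERIV_cmult[OF dB] dP])
    have L: "(Lihalf t)\<^sup>2 = (J t)\<^sup>2 + 2 * of_real (sqrt (2 * pi)) * J t / t + of_real (sqrt (2 * pi) * sqrt (2 * pi)) / t\<^sup>2"
      unfolding Lihalf_DR[OF t] by (simp add: power2_eq_square field_simps t0 flip: of_real_mult)
    have "?E = - t * (Lihalf t)\<^sup>2 / of_real (2 * pi)" by simp
    also have "\<dots> = - t * (J t)\<^sup>2 / of_real (2 * pi) - of_real (2 * sqrt (2 * pi) / (2 * pi)) * J t - 1 / t"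
      unfolding L sqrt_pi_facts(2) using t0 by (simp add: field_simps power2_eq_square)
    finally have "?E = - t * (J t)\<^sup>2 / of_real (2 * pi) - of_real (sqrt (2 / pi)) * J t - 1 / t" unfolding sqrt_pi_facts(3) .
    then have "?E - ?D = - 1 / t" by (simp only:) simp
    then have "((\<lambda>s. 2 * B (exp (- (s\<^sup>2 / 2))) - cP s) has_field_derivative - 1 / t) (at t)" using d by simp
    then have "(?f has_field_derivative 1 * exp (2 * B (exp (- (t\<^sup>2 / 2))) - cP t) + exp (2 * B (exp (- (t\<^sup>2 / 2))) - cP t) * (- 1 / t) * t) (at t)"
      by (intro DERIV_mult DERIV_ident DERIV_fun_exp)
    then show "(?f has_field_derivative 0) (at t)" using t0 by simp
  qed simp_all
  then have "s * exp (2 * B (exp (- (s\<^sup>2 / 2))) - cP s) * exp (cP s) = exp (2 * B (exp (- (1 / 2))) - cP 1) * exp (cP s)" by simp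
  then have "s * exp (2 * B (exp (- (s\<^sup>2 / 2)))) = exp (2 * B (exp (- (1 / 2))) - cP 1 + cP s)"
    by (simp only: mult.assoc flip: exp_add) simp
  then show ?thesis by (simp add: cG_def algebra_simps)
qed

text \<open>Since \<open>J\<close> is even, the contributions of \<open>J\<close> to the derivatives
  of cA1 s and cA1 (- s) cancel in the difference. The sheet differences 2 s and - 2 s^3 / 3 are the
  polynomial part of twice \<open>Phi\<close>: this is where the exponent of the Fredholm kernel
  arises from the weight.\<close>

lemma cA1_minus: "s \<in> Om \<Longrightarrow> cA1 s - cA1 (- s) = 2 * s"
proof (rule eq_if_same_derivative[where f="\<lambda>s. cA1 s - cA1 (- s)" and g="\<lambda>s. 2 * s", OF open_Om connected_Om _ _ zero_Om])
  fix t assume t: "t \<in> Om"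
  have "((\<lambda>s. cA1 (- s)) has_field_derivative (1 + (- t) * J (- t) / of_real (sqrt (2 * pi))) * - 1) (at t)"
    by (rule DERIV_chain2[OF DERIV_cA1]) (use t in \<open>auto intro!: derivative_eq_intros\<close>)
  from DERIV_diff[OF DERIV_cA1[OF t] this]
  show "((\<lambda>s. cA1 s - cA1 (- s)) has_field_derivative 2) (at t)" by (simp add: J_minus)
  show "((\<lambda>s. 2 * s) has_field_derivative 2) (at t)" by (auto intro!: derivative_eq_intros)
qed simp_all

lemma cA2_minus: "s \<in> Om \<Longrightarrow> cA2 s - cA2 (- s) = - (2 * s ^ 3 / 3)"
proof (rule eq_if_same_derivative[where f="\<lambda>s. cA2 s - cA2 (- s)" and g="\<lambda>s. - (2 * s ^ 3 / 3)", OF open_Om connected_Om _ _ zero_Om])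
  fix t assume t: "t \<in> Om"
  have "((\<lambda>s. cA2 (- s)) has_field_derivative (- (- t) * cA1 (- t)) * - 1) (at t)"
    by (rule DERIV_chain2[OF DERIV_cA2]) (use t in \<open>auto intro!: derivative_eq_intros\<close>)
  from DERIV_diff[OF DERIV_cA2[OF t] this]
  have "((\<lambda>s. cA2 s - cA2 (- s)) has_field_derivative - t * (cA1 t - cA1 (- t))) (at t)" by (simp add: algebra_simps)
  then show "((\<lambda>s. cA2 s - cA2 (- s)) has_field_derivative - t * (2 * t)) (at t)" by (simp add: cA1_minus t)
  show "((\<lambda>s. - (2 * s ^ 3 / 3)) has_field_derivative - t * (2 * t)) (at t)"
    by (auto intro!: derivative_eq_intros simp: power2_eq_square)
qed simp_all

text \<open>The odd part of \<open>cP\<close> comes from its linear term in \<open>J\<close> alone,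
  and supplies the - 2 Q in twice \<open>Phi\<close>.\<close>

lemma cP_minus: "s \<in> Om \<Longrightarrow> cP s - cP (- s) = - 2 * OJ s"
proof (rule eq_if_same_derivative[where f="\<lambda>s. cP s - cP (- s)" and g="\<lambda>s. - 2 * OJ s", OF open_Om connected_Om _ _ zero_Om])
  fix t assume t: "t \<in> Om"
  have hJ: "(\<lambda>s. of_real (sqrt (2 / pi)) * J s) holomorphic_on Om" by (intro holomorphic_intros holomorphic_J)
  from DERIV_diff[OF DERIV_prim[OF holomorphic_cP_deriv t] DERIV_prim_minus[OF holomorphic_cP_deriv t]]
  show "((\<lambda>s. cP s - cP (- s)) has_field_derivative - 2 * (of_real (sqrt (2 / pi)) * J t)) (at t)"
    unfolding cP_def[symmetric] by (simp add: J_minus mult_ac)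
  show "((\<lambda>s. - 2 * OJ s) has_field_derivative - 2 * (of_real (sqrt (2 / pi)) * J t)) (at t)"
    unfolding OJ_def by (rule DERIV_cmult[OF DERIV_prim[OF hJ t]])
qed (simp_all add: OJ_def)

lemma DL_Om: "s \<in> DL \<Longrightarrow> s \<in> Om" by (simp add: DL_def)

lemma cA1_DL: "s \<in> DL \<Longrightarrow> cA1 s = A1 (exp (- (s\<^sup>2 / 2))) + 2 * s"
  using cA1_minus[of s] cA1_DR[of "- s"] DL_Om[of s] uminus_DL[of s] by (simp add: algebra_simps)

lemma cA2_DL: "s \<in> DL \<Longrightarrow> cA2 s = A2 (exp (- (s\<^sup>2 / 2))) - 2 * s ^ 3 / 3"
  using cA2_minus[of s] cA2_DR[of "- s"] DL_Om[of s] uminus_DL[of s] by (simp add: algebra_simps)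

text \<open>Pass to - s in \<open>DR\<close>, where \<open>cG\<close> is known; the factor exp (- 2
  OJ) gained from \<open>cP_minus\<close> is rewritten through the square of
  \<open>exp_Q_DL\<close>.\<close>

lemma cG_DL: "s \<in> DL \<Longrightarrow> cG s = - s * exp (2 * B (exp (- (s\<^sup>2 / 2)))) * exp (- 2 * Q s) / (4 * s ^ 4)"
proof -
  assume s: "s \<in> DL"
  have "2 * B (exp (- (1 / 2))) + cP s - cP 1 = (2 * B (exp (- (1 / 2))) + cP (- s) - cP 1) + - 2 * OJ s"
    using cP_minus[OF DL_Om[OF s]] by (simp add: algebra_simps)
  then have "cG s = cG (- s) * exp (- 2 * OJ s)" unfolding cG_def by (simp only: exp_add)
  also have "cG (- s) = - s * exp (2 * B (exp (- (s\<^sup>2 / 2))))" using cG_DR[of "- s"] s uminus_DL[of s] by simp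
  also have "exp (- 2 * OJ s) = exp (- 2 * Q s) / (4 * s ^ 4)"
  proof -
    have "exp (- 2 * Q s) = (exp (- Q s))\<^sup>2" by (simp add: power2_eq_square flip: exp_add)
    also have "\<dots> = 4 * s ^ 4 * (exp (- OJ s))\<^sup>2" unfolding exp_Q_DL[OF s] by (simp add: power_mult_distrib flip: power_mult)
    also have "(exp (- OJ s))\<^sup>2 = exp (- 2 * OJ s)" by (simp add: power2_eq_square flip: exp_add)
    finally show ?thesis using DL_nz[OF s] by simp
  qed
  finally show ?thesis by simp
qed

text \<open>On the right \<open>GG\<close> is the exponential weight of the contour integral, with \<open>ds\<close> in place of \<open>- dz / z\<close>; on the
  left it is the leading term of the Fredholm expansion. Both are one holomorphic function.\<close>

definition GG :: "real \<Rightarrow> real \<Rightarrow> complex \<Rightarrow> complex" where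
  "GG \<tau> y s = exp (of_real \<tau> * cH s + of_real (y * sqrt \<tau>) * cA1 s) * cG s"

definition PP :: "real \<Rightarrow> real \<Rightarrow> complex \<Rightarrow> complex" where "PP \<tau> y = prim (GG \<tau> y)"

lemma holomorphic_GG: "GG \<tau> y holomorphic_on Om"
  unfolding GG_def by (intro holomorphic_intros holomorphic_cH holomorphic_cA1 holomorphic_cG)

lemma DERIV_PP: "s \<in> Om \<Longrightarrow> (PP \<tau> y has_field_derivative GG \<tau> y s) (at s)"
  unfolding PP_def by (rule DERIV_prim[OF holomorphic_GG])

lemma GG_DR:
  assumes s: "s \<in> DR"
  shows "GG \<tau> y s = s * expE \<tau> y (exp (- (s\<^sup>2 / 2)))"
proof -
  have "of_real \<tau> * cH s + of_real (y * sqrt \<tau>) * cA1 s + 2 * B (exp (- (s\<^sup>2 / 2)))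
     = of_real (- \<tau> + y * sqrt \<tau>) * A1 (exp (- (s\<^sup>2 / 2))) + of_real \<tau> * A2 (exp (- (s\<^sup>2 / 2))) + 2 * B (exp (- (s\<^sup>2 / 2)))"
    unfolding cH_def cA1_DR[OF s] cA2_DR[OF s] by (simp add: algebra_simps)
  then have "exp (of_real \<tau> * cH s + of_real (y * sqrt \<tau>) * cA1 s) * exp (2 * B (exp (- (s\<^sup>2 / 2)))) = expE \<tau> y (exp (- (s\<^sup>2 / 2)))"
    unfolding expE_def by (simp only: flip: exp_add)
  then show ?thesis unfolding GG_def cG_DR[OF s] by (simp add: mult.left_commute)
qed

lemma GG_DL:
  assumes s: "s \<in> DL"
  shows "GG \<tau> y s = - s * (expE \<tau> y (exp (- (s\<^sup>2 / 2))) * (exp (2 * Phi \<tau> (- \<tau> + y * sqrt \<tau>) s) / (4 * s ^ 4)))"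
proof -
  have "of_real \<tau> * cH s + of_real (y * sqrt \<tau>) * cA1 s + 2 * B (exp (- (s\<^sup>2 / 2))) + - 2 * Q s
     = of_real (- \<tau> + y * sqrt \<tau>) * A1 (exp (- (s\<^sup>2 / 2))) + of_real \<tau> * A2 (exp (- (s\<^sup>2 / 2))) + 2 * B (exp (- (s\<^sup>2 / 2)))
       + 2 * Phi \<tau> (- \<tau> + y * sqrt \<tau>) s"
    unfolding cH_def cA1_DL[OF s] cA2_DL[OF s] Phi_def by (simp add: algebra_simps)
  then have "exp (of_real \<tau> * cH s + of_real (y * sqrt \<tau>) * cA1 s) * exp (2 * B (exp (- (s\<^sup>2 / 2)))) * exp (- 2 * Q s)
     = expE \<tau> y (exp (- (s\<^sup>2 / 2))) * exp (2 * Phi \<tau> (- \<tau> + y * sqrt \<tau>) s)"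
    unfolding expE_def by (simp only: flip: exp_add)
  then show ?thesis unfolding GG_def cG_DL[OF s] by (simp add: mult.assoc mult.left_commute)
qed

text \<open>Substitution w = s^2 on the left sheet, s = - csqrt w: dw is 2 s ds, which together with
  the factor - s in \<open>GG_DL\<close> gives the primitive - 2 PP (- csqrt w).\<close>

lemma contour_integral_mainterm:
  "contour_integral (linepath (of_real eps - 2 * of_real pi * \<i>) (of_real eps + 2 * of_real pi * \<i>)) (mainterm \<tau> y)
   = 2 * (PP \<tau> y (- csqrt (of_real eps - 2 * of_real pi * \<i>)) - PP \<tau> y (- csqrt (of_real eps + 2 * of_real pi * \<i>)))"
proof -
  let ?a = "of_real eps - 2 * of_real pi * \<i>" and ?b = "of_real eps + 2 * of_real pi * \<i>"
  let ?W = "{w. Re w > 0 \<and> \<bar>Im w\<bar> < 4 * pi}"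
  have "(mainterm \<tau> y has_contour_integral
      (- 2 * PP \<tau> y (- csqrt (pathfinish (linepath ?a ?b)))) - (- 2 * PP \<tau> y (- csqrt (pathstart (linepath ?a ?b))))) (linepath ?a ?b)"
  proof (rule contour_integral_primitive[where S="?W"])
    show "((\<lambda>w. - 2 * PP \<tau> y (- csqrt w)) has_field_derivative mainterm \<tau> y w) (at w within ?W)" if w: "w \<in> ?W" for w
    proof -
      let ?s = "csqrt w"
      have nn: "w \<notin> \<real>\<^sub>\<le>\<^sub>0" using w by (auto simp: complex_nonpos_Reals_iff)
      have "?s \<in> DR" unfolding DR_image using w by (rule imageI)
      then have s: "- ?s \<in> DL" using uminus_DL[of "- ?s"] by simp
      have s0: "?s \<noteq> 0" using DL_nz[OF s] by simp
      have "(csqrt has_field_derivative inverse (2 * ?s)) (at w)" by (rule has_field_derivative_csqrt[OF nn])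
      then have "((\<lambda>w. - csqrt w) has_field_derivative - inverse (2 * ?s)) (at w)" by (rule DERIV_minus)
      then have "((\<lambda>w. PP \<tau> y (- csqrt w)) has_field_derivative GG \<tau> y (- ?s) * - inverse (2 * ?s)) (at w)"
        by (rule DERIV_chain2[where f="PP \<tau> y" and g="\<lambda>w. - csqrt w", OF DERIV_PP[OF DL_Om[OF s]]])
      then have "((\<lambda>w. - 2 * PP \<tau> y (- csqrt w)) has_field_derivative - 2 * (GG \<tau> y (- ?s) * - inverse (2 * ?s))) (at w)"
        by (rule DERIV_cmult)
      moreover have "- 2 * (GG \<tau> y (- ?s) * - inverse (2 * ?s)) = mainterm \<tau> y w"
      proof -
        have "?s ^ 4 = (?s\<^sup>2)\<^sup>2" by (simp only: power4_eq_xxxx power2_eq_square mult.assoc)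
        then have "?s ^ 4 = w\<^sup>2" by simp
        then show ?thesis unfolding GG_DL[OF s] mainterm_def using s0 by simp
      qed
      ultimately have "((\<lambda>w. - 2 * PP \<tau> y (- csqrt w)) has_field_derivative mainterm \<tau> y w) (at w)" by (simp only:)
      then show ?thesis by (rule has_field_derivative_at_within)
    qed
    have "convex ?W"
      using convex_Int[OF convex_halfspace_Re_gt[of 0] convex_Int[OF convex_halfspace_Im_lt[of "4 * pi"] convex_halfspace_Im_gt[of "- 4 * pi"]]]
      by (rule back_subst[of convex]) auto
    then show "path_image (linepath ?a ?b) \<subseteq> ?W"
      unfolding path_image_linepath by (rule closed_segment_subset[rotated 2]) (auto simp: eps_def)
  qed simp
  then show ?thesis by (simp add: contour_integral_unique algebra_simps)
qed

section \<open>The sign of the phase\<close>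

text \<open>\<open>Hpr\<close> is the principal branch of \<open>A2 - A1\<close>, written with the Gaussian moments of order 2 and 4.\<close>

definition hker :: "complex \<Rightarrow> real \<Rightarrow> complex" where
  "hker z y = of_real ((y\<^sup>2 - y ^ 4 / 3) * exp (- (y\<^sup>2 / 2))) * (z / (1 - z * of_real (exp (- (y\<^sup>2 / 2)))))"

definition Hpr :: "complex \<Rightarrow> complex" where
  "Hpr z = of_real (1 / (2 * pi)) * integral UNIV (hker z)"

definition slit :: "complex set" where "slit = of_real ` {1..}"

text \<open>Compactness of [0, 1], where exp (- y^2 / 2) takes its values: the denominator of
  \<open>hker\<close> stays away from 0 uniformly in y and locally uniformly in z.\<close>

lemma one_minus_lower_bound:
  assumes "z \<notin> slit"
  obtains r \<delta> where "r > 0" "\<delta> > 0" "\<And>z' u. z' \<in> cball z r \<Longrightarrow> u \<in> {0..1::real} \<Longrightarrow> \<delta> \<le> norm (1 - z' * of_real u)"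
proof -
  have "\<exists>u\<in>{0..1::real}. \<forall>v\<in>{0..1}. norm (1 - z * of_real u) \<le> norm (1 - z * of_real v)"
    by (intro continuous_attains_inf continuous_intros) auto
  then obtain u where u: "u \<in> {0..1::real}" "\<forall>v\<in>{0..1}. norm (1 - z * of_real u) \<le> norm (1 - z * of_real v)" by blast
  have "1 - z * of_real u \<noteq> 0"
  proof
    assume h: "1 - z * of_real u = 0"
    then have "u \<noteq> 0" by auto
    then have "z = of_real (1 / u)" "1 / u \<ge> 1" using h u(1) by (auto simp: field_simps)
    then show False using assms unfolding slit_def by blast
  qed
  then have p: "norm (1 - z * of_real u) > 0" by simp
  let ?d = "norm (1 - z * of_real u) / 2"
  show ?thesis
  proof (rule that[of ?d ?d])
    fix z' and v :: real assume z': "z' \<in> cball z ?d" and v: "v \<in> {0..1}"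
    have "1 - z * of_real v = (1 - z' * of_real v) + (z' - z) * of_real v" by (simp add: algebra_simps)
    then have "norm (1 - z * of_real v) \<le> norm (1 - z' * of_real v) + norm ((z' - z) * of_real v)" by (metis norm_triangle_ineq)
    moreover have "norm ((z' - z) * of_real v) \<le> ?d * 1"
      unfolding norm_mult using z' v by (intro mult_mono) (auto simp: dist_norm norm_minus_commute)
    ultimately show "?d \<le> norm (1 - z' * of_real v)" using u(2) v by fastforce
  qed (use p in auto)
qed

lemma has_bochner_integral_gaussian_powers:
  "has_bochner_integral lborel (\<lambda>y::real. (y\<^sup>2 + y ^ 4) * exp (- (y\<^sup>2 / 2))) (gmoment 1 + gmoment 2)"
proof -
  have "has_bochner_integral lborel (\<lambda>y. y ^ (2 * 1) * exp (- (1 * y\<^sup>2 / 2)) + y ^ (2 * 2) * exp (- (1 * y\<^sup>2 / 2)))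
    (gmoment 1 / 1 powr (real 1 + 1 / 2) + gmoment 2 / 1 powr (real 2 + 1 / 2))"
    by (intro has_bochner_integral_add gaussian_moment) simp_all
  then show ?thesis by (simp add: distrib_right)
qed

lemma norm_hker_le:
  assumes "\<delta> > 0" "\<delta> \<le> norm (1 - z * of_real (exp (- (y\<^sup>2 / 2))))"
  shows "norm (hker z y) \<le> norm z / \<delta> * ((y\<^sup>2 + y ^ 4) * exp (- (y\<^sup>2 / 2)))"
proof -
  have "0 \<le> y\<^sup>2" "0 \<le> y ^ 4" by simp_all
  then have "\<bar>y\<^sup>2 - y ^ 4 / 3\<bar> \<le> y\<^sup>2 + y ^ 4" by linarith
  then have "norm (of_real ((y\<^sup>2 - y ^ 4 / 3) * exp (- (y\<^sup>2 / 2))) :: complex) \<le> (y\<^sup>2 + y ^ 4) * exp (- (y\<^sup>2 / 2))"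
    unfolding norm_of_real abs_mult by (simp add: mult_right_mono)
  moreover have "norm (z / (1 - z * of_real (exp (- (y\<^sup>2 / 2))))) \<le> norm z / \<delta>"
    unfolding norm_divide using assms by (intro divide_left_mono mult_pos_pos) auto
  ultimately have "norm (hker z y) \<le> ((y\<^sup>2 + y ^ 4) * exp (- (y\<^sup>2 / 2))) * (norm z / \<delta>)"
    unfolding hker_def norm_mult using zero_le_even_power[of 4 y] by (intro mult_mono) auto
  then show ?thesis by (simp only: mult.commute)
qed

lemma integrable_hker:
  assumes "z \<notin> slit"
  shows "integrable lborel (hker z)"
proof -
  from one_minus_lower_bound[OF assms] obtain r \<delta> where r: "r > 0" "\<delta> > 0" "\<And>z' u. z' \<in> cball z r \<Longrightarrow> u \<in> {0..1::real} \<Longrightarrow> \<delta> \<le> norm (1 - z' * of_real u)"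
    by blast
  show ?thesis
  proof (rule Bochner_Integration.integrable_bound)
    show "integrable lborel (\<lambda>y::real. norm z / \<delta> * ((y\<^sup>2 + y ^ 4) * exp (- (y\<^sup>2 / 2))))"
      using has_bochner_integral_gaussian_powers by (intro integrable_mult_right) (simp add: has_bochner_integral_iff)
    show "hker z \<in> borel_measurable lborel" unfolding hker_def by measurable
    have "norm (hker z y) \<le> norm (norm z / \<delta> * ((y\<^sup>2 + y ^ 4) * exp (- (y\<^sup>2 / 2))))" for y
      proof -
      have "\<delta> \<le> norm (1 - z * of_real (exp (- (y\<^sup>2 / 2))))" using r(1) by (intro r(3)) auto
      from norm_hker_le[OF r(2) this] show ?thesis unfolding real_norm_def by (rule order.trans[OF _ abs_ge_self])
    qed
    then show "AE y in lborel. norm (hker z y) \<le> norm (norm z / \<delta> * ((y\<^sup>2 + y ^ 4) * exp (- (y\<^sup>2 / 2))))" by simp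
  qed
qed

lemma Re_Hpr:
  assumes "z \<notin> slit"
  shows "Re (Hpr z) = 1 / (2 * pi) * (\<integral>y. Re (hker z y) \<partial>lborel)"
proof -
  have "Hpr z = of_real (1 / (2 * pi)) * (\<integral>y. hker z y \<partial>lborel)"
    unfolding Hpr_def using integral_lborel[OF integrable_hker[OF assms]] by simp
  then show ?thesis using integral_Re[OF integrable_hker[OF assms]] by simp
qed

lemma closed_slit: "closed slit"
proof -
  have eq: "slit = {z. Im z = 0 \<and> Re z \<ge> 1}" by (auto simp: slit_def complex_eq_iff image_iff)
  show ?thesis unfolding eq by (intro closed_Collect_conj closed_Collect_eq closed_Collect_le continuous_intros)
qed

lemma holomorphic_Hpr: "Hpr holomorphic_on - slit"
proof -
  let ?u = "\<lambda>y::real. exp (- (y\<^sup>2 / 2))"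
  have nz: "1 - z * of_real (?u y) \<noteq> 0" if z: "z \<in> - slit" for z y
  proof -
    from one_minus_lower_bound[of z] z obtain r \<delta> where "r > 0" "\<delta> > 0" "\<And>z' u. z' \<in> cball z r \<Longrightarrow> u \<in> {0..1::real} \<Longrightarrow> \<delta> \<le> norm (1 - z' * of_real u)"
      by blast
    then have "\<delta> \<le> norm (1 - z * of_real (?u y))" by simp
    then show ?thesis using \<open>\<delta> > 0\<close> by auto
  qed
  have "(\<lambda>z. integral UNIV (hker z)) holomorphic_on - slit"
  proof (rule holomorphic_integral_real_line(1))
    show "open (- slit)" using closed_slit by (simp add: open_Compl)
    show "((\<lambda>z. hker z y) has_field_derivative of_real ((y\<^sup>2 - y ^ 4 / 3) * ?u y) * (1 / (1 - z * of_real (?u y))\<^sup>2)) (at z)"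
      if z: "z \<in> - slit" for z y
    proof -
      have "((\<lambda>z. z / (1 - z * of_real (?u y))) has_field_derivative (1 * (1 - z * of_real (?u y)) - z * (0 - 1 * of_real (?u y))) / ((1 - z * of_real (?u y)) * (1 - z * of_real (?u y)))) (at z)"
        by (intro DERIV_divide nz[OF z]) (auto intro!: derivative_eq_intros)
      moreover have "(1 * (1 - z * of_real (?u y)) - z * (0 - 1 * of_real (?u y))) / ((1 - z * of_real (?u y)) * (1 - z * of_real (?u y))) = 1 / (1 - z * of_real (?u y))\<^sup>2"
        by (simp add: power2_eq_square)
      ultimately show ?thesis unfolding hker_def by (intro DERIV_cmult) simp
    qed
    have cu: "continuous_on ((- slit) \<times> UNIV) (\<lambda>p. complex_of_real (?u (snd p)))" by (intro continuous_intros) simp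
    show "continuous_on ((- slit) \<times> UNIV) (\<lambda>(z, y). hker z y)"
      unfolding hker_def case_prod_beta by (intro continuous_intros cu) (use nz in auto)
    show "continuous_on ((- slit) \<times> UNIV) (\<lambda>(z, y). of_real ((y\<^sup>2 - y ^ 4 / 3) * ?u y) * (1 / (1 - z * of_real (?u y))\<^sup>2))"
      unfolding case_prod_beta by (intro continuous_intros cu) (use nz in auto)
    show "\<exists>r>0. \<exists>g. g integrable_on UNIV \<and> (\<forall>z'\<in>cball z r \<inter> - slit. \<forall>y. norm (hker z' y) \<le> g y)" if z: "z \<in> - slit" for z
    proof -
      from one_minus_lower_bound[of z] z obtain r \<delta> where r: "r > 0" "\<delta> > 0" "\<And>z' u. z' \<in> cball z r \<Longrightarrow> u \<in> {0..1::real} \<Longrightarrow> \<delta> \<le> norm (1 - z' * of_real u)"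
        by blast
      let ?g = "\<lambda>y::real. (norm z + r) / \<delta> * ((y\<^sup>2 + y ^ 4) * ?u y)"
      have "integrable lborel ?g"
        using has_bochner_integral_gaussian_powers by (intro integrable_mult_right) (simp add: has_bochner_integral_iff)
      then have "?g integrable_on UNIV" by (rule integrable_on_lborel)
      moreover have "norm (hker z' y) \<le> ?g y" if z': "z' \<in> cball z r \<inter> - slit" for z' y
      proof -
        have "norm (hker z' y) \<le> norm z' / \<delta> * ((y\<^sup>2 + y ^ 4) * ?u y)"
          by (rule norm_hker_le[OF r(2)]) (use r(3)[of z' "?u y"] z' in simp)
        also have "norm z' \<le> norm z + r"
          using z' norm_triangle_ineq2[of z' z] by (simp add: dist_norm norm_minus_commute)
        then have "norm z' / \<delta> * ((y\<^sup>2 + y ^ 4) * ?u y) \<le> ?g y"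
          using r(2) zero_le_even_power[of 4 y] by (intro mult_right_mono divide_right_mono) auto
        finally show ?thesis .
      qed
      ultimately show ?thesis using r(1) by blast
    qed
  qed
  then show ?thesis unfolding Hpr_def by (intro holomorphic_intros)
qed

lemma gmoment_values: "gmoment 1 = sqrt (2 * pi)" "gmoment 2 = 3 * sqrt (2 * pi)" "gmoment 3 = 15 * sqrt (2 * pi)"
  by (simp_all add: gmoment_def fact_numeral)

text \<open>\<open>polylog_integral\<close> for j = 1 minus one third of it for j = 2. The fourth
  moment is three times the second, so the weight y^2 - y^4 / 3 gives Li_{3/2} and Li_{5/2} equal
  factors.\<close>

lemma Hpr_disc:
  assumes z: "norm z < 1"
  shows "Hpr z = A2 z - A1 z"
proof -
  have z': "z \<notin> slit" using z by (auto simp: slit_def)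
  let ?e = "\<lambda>y::real. complex_of_real (exp (y\<^sup>2 / 2))"
  have "has_bochner_integral lborel (\<lambda>y. of_real (y ^ (2 * 1)) * (z / (?e y - z)) - of_real (1 / 3) * (of_real (y ^ (2 * 2)) * (z / (?e y - z))))
    (of_real (gmoment 1) * polylog (real 1 + 1 / 2) z - of_real (1 / 3) * (of_real (gmoment 2) * polylog (real 2 + 1 / 2) z))"
    by (intro has_bochner_integral_diff has_bochner_integral_mult_right polylog_integral z)
  moreover have "of_real (y ^ (2 * 1)) * (z / (?e y - z)) - of_real (1 / 3) * (of_real (y ^ (2 * 2)) * (z / (?e y - z))) = hker z y" for y
  proof -
    have u: "complex_of_real (exp (- (y\<^sup>2 / 2))) = 1 / ?e y" by (simp add: exp_minus inverse_eq_divide)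
    have g: "1 / E * (z / (1 - z * (1 / E))) = z / (E - z)" if "E \<noteq> 0" for E
    proof -
      have "1 - z * (1 / E) = (E - z) / E" using that by (simp add: diff_divide_distrib)
      then show ?thesis using that by simp
    qed
    have "hker z y = of_real (y\<^sup>2 - y ^ 4 / 3) * (of_real (exp (- (y\<^sup>2 / 2))) * (z / (1 - z * of_real (exp (- (y\<^sup>2 / 2))))))"
      unfolding hker_def by (simp only: of_real_mult mult.assoc)
    also have "\<dots> = of_real (y\<^sup>2 - y ^ 4 / 3) * (z / (?e y - z))" unfolding u by (subst g) simp_all
    also have "\<dots> = of_real (y ^ (2 * 1)) * (z / (?e y - z)) - of_real (1 / 3) * (of_real (y ^ (2 * 2)) * (z / (?e y - z)))"
    proof -
      have "complex_of_real (y\<^sup>2 - y ^ 4 / 3) * X = of_real (y ^ (2 * 1)) * X - of_real (1 / 3) * (of_real (y ^ (2 * 2)) * X)" for X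
        by (simp add: left_diff_distrib)
      then show ?thesis .
    qed
    finally show ?thesis by (rule sym)
  qed
  ultimately have h: "has_bochner_integral lborel (hker z) (of_real (gmoment 1) * polylog (real 1 + 1 / 2) z - of_real (1 / 3) * (of_real (gmoment 2) * polylog (real 2 + 1 / 2) z))"
    by (simp only:)
  have "integral UNIV (hker z) = integral\<^sup>L lborel (hker z)" by (rule integral_lborel[OF integrable_hker[OF z']])
  also have "\<dots> = of_real (gmoment 1) * polylog (real 1 + 1 / 2) z - of_real (1 / 3) * (of_real (gmoment 2) * polylog (real 2 + 1 / 2) z)"
    using h by (simp only: has_bochner_integral_iff)
  also have "\<dots> = of_real (sqrt (2 * pi)) * (polylog (3 / 2) z - polylog (5 / 2) z)"
    unfolding gmoment_values by (simp add: algebra_simps)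
  finally have "Hpr z = of_real (1 / (2 * pi) * sqrt (2 * pi)) * (polylog (3 / 2) z - polylog (5 / 2) z)"
    unfolding Hpr_def by simp
  also have "1 / (2 * pi) * sqrt (2 * pi) = 1 / sqrt (2 * pi)"
    using sqrt_pi_facts(2) by (simp add: field_simps)
  finally show ?thesis unfolding A1_def A2_def by (simp add: algebra_simps)
qed

text \<open>The half of \<open>Om\<close> on which the continued functions still agree with the
  principal branch: by \<open>RH_not_slit\<close> it never meets the cut of z, which would require
  s^2 to be real and nonpositive.\<close>

definition RH :: "complex set" where "RH = {s \<in> Om. Re s > 0}"

lemma RH_image: "RH = csqrt ` ({w. \<bar>Im w\<bar> < 4 * pi} - \<real>\<^sub>\<le>\<^sub>0)"
proof (intro equalityI subsetI)
  fix s assume "s \<in> RH"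
  then have s: "Re s > 0" "\<bar>Im (s\<^sup>2)\<bar> < 4 * pi" by (auto simp: RH_def Om_def)
  have "s\<^sup>2 \<notin> \<real>\<^sub>\<le>\<^sub>0"
  proof
    assume "s\<^sup>2 \<in> \<real>\<^sub>\<le>\<^sub>0"
    then have h: "Im (s\<^sup>2) = 0" "Re (s\<^sup>2) \<le> 0" by (auto simp: complex_nonpos_Reals_iff)
    then have "Im s = 0" using s(1) by (simp add: Im_power2)
    then show False using h(2) mult_pos_pos[OF s(1) s(1)] by (simp add: Re_power2 power2_eq_square)
  qed
  then show "s \<in> csqrt ` ({w. \<bar>Im w\<bar> < 4 * pi} - \<real>\<^sub>\<le>\<^sub>0)"
    using s csqrt_power2_Re_pos[OF s(1)] by (intro image_eqI[of _ _ "s\<^sup>2"]) auto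
next
  fix s assume "s \<in> csqrt ` ({w. \<bar>Im w\<bar> < 4 * pi} - \<real>\<^sub>\<le>\<^sub>0)"
  then obtain w where w: "s = csqrt w" "w \<notin> \<real>\<^sub>\<le>\<^sub>0" "\<bar>Im w\<bar> < 4 * pi" by auto
  then show "s \<in> RH" using Re_csqrt_pos[OF w(2)] by (simp add: RH_def Om_def)
qed

lemma connected_RH: "connected RH"
proof -
  have "starlike ({w. \<bar>Im w\<bar> < 4 * pi} - \<real>\<^sub>\<le>\<^sub>0)"
    unfolding starlike_def
  proof (intro bexI[of _ 1] ballI subsetI)
    fix x y assume x: "x \<in> {w. \<bar>Im w\<bar> < 4 * pi} - \<real>\<^sub>\<le>\<^sub>0" and "y \<in> closed_segment 1 x"
    then obtain u where u: "0 \<le> u" "u \<le> 1" "y = (1 - u) *\<^sub>R 1 + u *\<^sub>R x" by (auto simp: in_segment)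
    have Im: "Im y = u * Im x" and Re: "Re y = (1 - u) + u * Re x" unfolding u(3) by simp_all
    have "\<bar>Im y\<bar> \<le> 1 * \<bar>Im x\<bar>" unfolding Im abs_mult using u by (intro mult_right_mono) auto
    moreover have "y \<notin> \<real>\<^sub>\<le>\<^sub>0"
    proof
      assume y: "y \<in> \<real>\<^sub>\<le>\<^sub>0"
      have "u \<noteq> 0" using y u by (auto simp: complex_nonpos_Reals_iff)
      then have "Im x = 0" using y Im by (auto simp: complex_nonpos_Reals_iff)
      then have "Re x > 0" using x by (auto simp: complex_nonpos_Reals_iff)
      then have "u * Re x > 0" using u \<open>u \<noteq> 0\<close> by (intro mult_pos_pos) auto
      then have "Re y > 0" unfolding Re using u by linarith
      then show False using y by (auto simp: complex_nonpos_Reals_iff)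
    qed
    ultimately show "y \<in> {w. \<bar>Im w\<bar> < 4 * pi} - \<real>\<^sub>\<le>\<^sub>0" using x by auto
  qed (auto simp: complex_nonpos_Reals_iff)
  then have "connected ({w. \<bar>Im w\<bar> < 4 * pi} - \<real>\<^sub>\<le>\<^sub>0)" by (rule starlike_imp_connected)
  moreover have "continuous_on ({w. \<bar>Im w\<bar> < 4 * pi} - \<real>\<^sub>\<le>\<^sub>0) csqrt"
    by (rule holomorphic_on_imp_continuous_on[OF holomorphic_on_csqrt'[OF holomorphic_on_ident]]) auto
  ultimately show ?thesis unfolding RH_image by (rule connected_continuous_image[rotated])
qed

lemma open_RH: "open RH"
proof -
  have "RH = Om \<inter> {s. Re s > 0}" by (auto simp: RH_def)
  then show ?thesis using open_Int[OF open_Om open_halfspace_Re_gt[of 0]] by (simp only:)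
qed

lemma RH_not_slit:
  assumes "s \<in> RH"
  shows "exp (- (s\<^sup>2 / 2)) \<notin> slit"
proof
  assume "exp (- (s\<^sup>2 / 2)) \<in> slit"
  then obtain r where r: "r \<ge> 1" "exp (- (s\<^sup>2 / 2)) = complex_of_real r" by (auto simp: slit_def)
  then have "exp (- (s\<^sup>2 / 2)) = exp (complex_of_real (ln r))" by (simp add: exp_of_real)
  then obtain n :: int where n: "- (s\<^sup>2 / 2) = of_real (ln r) + of_real (of_int (2 * n) * pi) * \<i>"
    unfolding exp_eq by blast
  have im: "Im (s\<^sup>2) = - (4 * pi * n)" and re: "Re (s\<^sup>2) = - 2 * ln r"
    using arg_cong[OF n, of Im] arg_cong[OF n, of Re] by (auto simp: field_simps)
  have "\<bar>4 * pi * n\<bar> < 4 * pi" using assms im by (simp add: RH_def Om_def)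
  then have "4 * pi * \<bar>real_of_int n\<bar> < 4 * pi * 1" by (simp add: abs_mult)
  then have "\<bar>real_of_int n\<bar> < 1" by (subst (asm) mult_less_cancel_left_pos) simp_all
  then have "n = 0" by linarith
  then have "Im (s\<^sup>2) = 0" using im by simp
  then have "Im s = 0" using assms by (simp add: Im_power2 RH_def)
  then have "Re (s\<^sup>2) > 0" using assms by (simp add: Re_power2 RH_def)
  then show False using re r(1) by simp
qed

lemma cH_RH:
  assumes "s \<in> RH"
  shows "cH s = Hpr (exp (- (s\<^sup>2 / 2)))"
proof (rule holomorphic_eq_pos_reals[OF _ _ open_RH connected_RH _ _ assms])
  show "cH holomorphic_on RH" by (rule holomorphic_on_subset[OF holomorphic_cH]) (auto simp: RH_def)
  have "(Hpr \<circ> (\<lambda>s. exp (- (s\<^sup>2 / 2)))) holomorphic_on RH"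
    by (rule holomorphic_on_compose_gen[OF _ holomorphic_Hpr]) (use RH_not_slit in \<open>auto intro!: holomorphic_intros\<close>)
  then show "(\<lambda>s. Hpr (exp (- (s\<^sup>2 / 2)))) holomorphic_on RH" by (simp add: o_def)
  show "of_real ` {0<..} \<subseteq> RH" by (auto simp: RH_def Om_def)
  fix x :: real assume x: "x > 0"
  have "complex_of_real x \<in> DR" using pos_reals_DR x by blast
  moreover have "norm (exp (- ((complex_of_real x)\<^sup>2 / 2))) < 1" using x by (simp add: Re_power2)
  ultimately show "cH (of_real x) = Hpr (exp (- ((of_real x)\<^sup>2 / 2)))"
    by (simp add: cH_def cA1_DR cA2_DR Hpr_disc)
qed

lemma cH_left:
  assumes "- s \<in> RH"
  shows "cH s = Hpr (exp (- (s\<^sup>2 / 2))) - 2 * (s + s ^ 3 / 3)"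
proof -
  have s: "s \<in> Om" using assms by (simp add: RH_def)
  have "cH s = cH (- s) + (cA2 s - cA2 (- s)) - (cA1 s - cA1 (- s))" by (simp add: cH_def)
  also have "\<dots> = cH (- s) - 2 * s ^ 3 / 3 - 2 * s" unfolding cA1_minus[OF s] cA2_minus[OF s] by simp
  finally show ?thesis using cH_RH[OF assms] by (simp add: algebra_simps)
qed

lemma Re_hker:
  assumes z: "z \<noteq> 0" "z \<notin> slit"
  shows "Re (hker z y) = (y\<^sup>2 - y ^ 4 / 3) * exp (- (y\<^sup>2 / 2)) * ((Re (1 / z) - exp (- (y\<^sup>2 / 2))) / ((Re (1 / z) - exp (- (y\<^sup>2 / 2)))\<^sup>2 + (Im (1 / z))\<^sup>2))"
proof -
  let ?u = "exp (- (y\<^sup>2 / 2))"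
  have g: "z / (1 - z * v) = 1 / (1 / z - v)" for v
  proof -
    have "1 / z - v = (1 - z * v) / z" using z(1) by (simp add: diff_divide_distrib)
    then show ?thesis by simp
  qed
  show ?thesis unfolding hker_def g by (simp add: Re_divide power2_eq_square)
qed

text \<open>On the curve \<open>Re (1 / z) = exp (- 3 / 2)\<close> the kernel \<open>hker z\<close> has real part of constant sign: both of its
  factors change sign at \<open>y\<^sup>2 = 3\<close>.\<close>

lemma sign_change:
  fixes y :: real
  shows "(y\<^sup>2 - y ^ 4 / 3) * (exp (- (3 / 2)) - exp (- (y\<^sup>2 / 2))) \<le> 0"
    and "y \<noteq> 0 \<Longrightarrow> y\<^sup>2 \<noteq> 3 \<Longrightarrow> (y\<^sup>2 - y ^ 4 / 3) * (exp (- (3 / 2)) - exp (- (y\<^sup>2 / 2))) < 0"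
proof -
  have e: "y\<^sup>2 - y ^ 4 / 3 = y\<^sup>2 * (3 - y\<^sup>2) / 3" by (simp add: power2_eq_square power4_eq_xxxx algebra_simps)
  show 2: "(y\<^sup>2 - y ^ 4 / 3) * (exp (- (3 / 2)) - exp (- (y\<^sup>2 / 2))) < 0" if "y \<noteq> 0" "y\<^sup>2 \<noteq> 3"
  proof (cases "y\<^sup>2 < 3")
    case True
    then have "exp (- (3 / 2)) - exp (- (y\<^sup>2 / 2)) < 0" "y\<^sup>2 * (3 - y\<^sup>2) / 3 > 0" using that by auto
    then show ?thesis unfolding e by (rule mult_pos_neg[rotated])
  next
    case False
    then have "exp (- (3 / 2)) - exp (- (y\<^sup>2 / 2)) > 0" "y\<^sup>2 * (3 - y\<^sup>2) / 3 < 0"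
      using that by (auto simp: mult_less_0_iff)
    then show ?thesis unfolding e by (rule mult_neg_pos[rotated])
  qed
  show "(y\<^sup>2 - y ^ 4 / 3) * (exp (- (3 / 2)) - exp (- (y\<^sup>2 / 2))) \<le> 0"
  proof (cases "y = 0 \<or> y\<^sup>2 = 3")
    case True
    then show ?thesis unfolding e by auto
  next
    case False
    then show ?thesis using 2 by (simp add: less_imp_le)
  qed
qed

definition zC :: "real \<Rightarrow> complex" where "zC \<eta> = 1 / Complex (exp (- (3 / 2))) \<eta>"

lemma zC_facts: "zC \<eta> \<noteq> 0" "1 / zC \<eta> = Complex (exp (- (3 / 2))) \<eta>" "\<eta> \<noteq> 0 \<Longrightarrow> zC \<eta> \<notin> slit"
proof -
  have "Complex (exp (- (3 / 2))) \<eta> \<noteq> 0" by (simp add: complex_eq_iff)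
  then show nz: "zC \<eta> \<noteq> 0" by (simp add: zC_def)
  show e: "1 / zC \<eta> = Complex (exp (- (3 / 2))) \<eta>" by (simp add: zC_def)
  show "zC \<eta> \<notin> slit" if "\<eta> \<noteq> 0"
  proof
    assume "zC \<eta> \<in> slit"
    then obtain r where "zC \<eta> = complex_of_real r" by (auto simp: slit_def)
    then have "Im (1 / zC \<eta>) = 0" by simp
    then show False unfolding e using that by simp
  qed
qed

text \<open>Along the curve only the summand \<eta>^2 in the denominator varies, and the numerator
  has constant sign by \<open>sign_change\<close>. The bound survives the passage \<eta> to 0, where
  the curve meets the cut.\<close>

lemma Re_Hpr_zC_mono:
  assumes "0 < \<bar>\<eta>\<bar>" "\<bar>\<eta>\<bar> \<le> \<bar>\<eta>'\<bar>"
  shows "Re (Hpr (zC \<eta>)) \<le> Re (Hpr (zC \<eta>'))"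
proof -
  have n: "\<eta> \<noteq> 0" "\<eta>' \<noteq> 0" using assms by auto
  note c = zC_facts(3)[OF n(1)] zC_facts(3)[OF n(2)]
  have "(\<integral>y. Re (hker (zC \<eta>) y) \<partial>lborel) \<le> (\<integral>y. Re (hker (zC \<eta>') y) \<partial>lborel)"
  proof (rule integral_mono)
    show "integrable lborel (\<lambda>y. Re (hker (zC \<eta>) y))" "integrable lborel (\<lambda>y. Re (hker (zC \<eta>') y))"
      using integrable_hker[OF c(1)] integrable_hker[OF c(2)] by simp_all
    fix y :: real
    let ?u = "exp (- (y\<^sup>2 / 2))" and ?a = "exp (- (3 / 2)) :: real"
    let ?N = "(y\<^sup>2 - y ^ 4 / 3) * (?a - ?u)"
    have f: "Re (hker (zC t) y) = ?u * (?N / ((?a - ?u)\<^sup>2 + t\<^sup>2))" if "t \<noteq> 0" for t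
      using Re_hker[OF zC_facts(1) zC_facts(3)[OF that], of y] unfolding zC_facts(2) by simp
    have "\<eta>\<^sup>2 \<le> \<eta>'\<^sup>2" using assms(2) by (simp add: abs_le_square_iff)
    moreover have "0 < \<eta>\<^sup>2" using n by simp
    ultimately have "?N / ((?a - ?u)\<^sup>2 + \<eta>\<^sup>2) \<le> ?N / ((?a - ?u)\<^sup>2 + \<eta>'\<^sup>2)"
      using sign_change(1)[of y] by (intro divide_left_mono_neg mult_pos_pos add_nonneg_pos) auto
    then show "Re (hker (zC \<eta>) y) \<le> Re (hker (zC \<eta>') y)" unfolding f[OF n(1)] f[OF n(2)] by (rule mult_left_mono) simp
  qed
  then show ?thesis unfolding Re_Hpr[OF c(1)] Re_Hpr[OF c(2)] by (intro mult_left_mono) auto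
qed

lemma Re_Hpr_zC_neg:
  assumes "\<eta> \<noteq> 0"
  shows "Re (Hpr (zC \<eta>)) < 0"
proof -
  note c = zC_facts(3)[OF assms]
  let ?u = "\<lambda>y::real. exp (- (y\<^sup>2 / 2))" and ?a = "exp (- (3 / 2)) :: real"
  let ?N = "\<lambda>y. (y\<^sup>2 - y ^ 4 / 3) * (?a - ?u y)"
  have f: "Re (hker (zC \<eta>) y) = ?u y * (?N y / ((?a - ?u y)\<^sup>2 + \<eta>\<^sup>2))" for y
    using Re_hker[OF zC_facts(1) c, of y] unfolding zC_facts(2) by simp
  have d: "(?a - ?u y)\<^sup>2 + \<eta>\<^sup>2 > 0" for y using assms by (intro add_nonneg_pos) auto
  have i: "integrable lborel (\<lambda>y. - Re (hker (zC \<eta>) y))" using integrable_hker[OF c] by simp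
  have nn: "- Re (hker (zC \<eta>) y) \<ge> 0" for y
  proof -
    have "?N y / ((?a - ?u y)\<^sup>2 + \<eta>\<^sup>2) \<le> 0" using sign_change(1)[of y] d[of y] by (rule divide_nonpos_pos)
    then have "Re (hker (zC \<eta>) y) \<le> 0" unfolding f by (rule mult_nonneg_nonpos[rotated]) simp
    then show ?thesis by simp
  qed
  have "(\<integral>y. - Re (hker (zC \<eta>) y) \<partial>lborel) \<noteq> 0"
  proof
    assume "(\<integral>y. - Re (hker (zC \<eta>) y) \<partial>lborel) = 0"
    then have "AE y in lborel. - Re (hker (zC \<eta>) y) = 0"
      by (subst (asm) integral_nonneg_eq_0_iff_AE[OF i]) (use nn in auto)
    \<comment> \<open>An interval of positive length that avoids the zeros y = 0 and y^2 = 3 of the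
      kernel contradicts vanishing almost everywhere.\<close>
    moreover have "Re (hker (zC \<eta>) y) \<noteq> 0" if "y \<in> {1..1 + 1 / 10}" for y
    proof -
      have "y\<^sup>2 \<le> (1 + 1 / 10)\<^sup>2" using that by (intro power_mono) auto
      then have y3: "y\<^sup>2 \<noteq> 3" by (auto simp: power2_eq_square)
      have y0: "y \<noteq> 0" using that by auto
      have "?N y / ((?a - ?u y)\<^sup>2 + \<eta>\<^sup>2) < 0" using sign_change(2)[OF y0 y3] d[of y] by (rule divide_neg_pos)
      then have "Re (hker (zC \<eta>) y) < 0" unfolding f by (rule mult_pos_neg[rotated]) simp
      then show ?thesis by simp
    qed
    ultimately have "AE y in lborel. y \<notin> {1..1 + 1 / 10 :: real}" by (auto elim!: eventually_mono)
    then have "{1..1 + 1 / 10 :: real} \<in> null_sets lborel" by (subst AE_iff_null_sets) auto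
    then show False by (simp add: null_sets_def)
  qed
  moreover have "(\<integral>y. - Re (hker (zC \<eta>) y) \<partial>lborel) \<ge> 0" by (rule Bochner_Integration.integral_nonneg[OF nn])
  ultimately have "(\<integral>y. Re (hker (zC \<eta>) y) \<partial>lborel) < 0" by simp
  then show ?thesis unfolding Re_Hpr[OF c] by (intro mult_pos_neg) auto
qed

text \<open>A cruder bound away from the curve. For y^2 < 3 the integrand is nonpositive. For y^2
  \<ge> 3 the fraction is at most |z| in absolute value on its positive side, and y^4 / 3 - y^2
  \<le> y^6 / 36, so the sixth moment 15 sqrt (2 \<pi>) bounds the integral; the constant is (15 /
  36) / (5 / 2) = 1 / 6.\<close>

lemma Re_Hpr_le:
  assumes z: "z \<noteq> 0" "z \<notin> slit" "norm z \<le> exp (3 / 2)" "Re (1 / z) \<le> exp (- (3 / 2))"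
  shows "Re (Hpr z) \<le> norm z / 6"
proof -
  have pw: "Re (hker z y) \<le> norm z / 36 * (y ^ (2 * 3) * exp (- (1 * y\<^sup>2 / 2)))" for y
  proof -
    let ?u = "exp (- (y\<^sup>2 / 2))"
    let ?x = "Re (1 / z)" and ?\<rho> = "norm (1 / z)"
    let ?d = "(?x - ?u)\<^sup>2 + (Im (1 / z))\<^sup>2"
    have e: "y\<^sup>2 - y ^ 4 / 3 = y\<^sup>2 * (3 - y\<^sup>2) / 3" by (simp add: power2_eq_square power4_eq_xxxx algebra_simps)
    have R: "Re (hker z y) = ?u * ((y\<^sup>2 - y ^ 4 / 3) * ((?x - ?u) / ?d))"
      unfolding Re_hker[OF z(1,2), of y] by (simp only: mult_ac)
    have rhs: "norm z / 36 * (y ^ (2 * 3) * exp (- (1 * y\<^sup>2 / 2))) = ?u * (y ^ 6 / 36 * norm z)" by simp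
    have "(y\<^sup>2 - y ^ 4 / 3) * ((?x - ?u) / ?d) \<le> y ^ 6 / 36 * norm z"
    proof (cases "y\<^sup>2 < 3")
      case True
      then have "exp (- (3 / 2)) \<le> ?u" by simp
      then have "?x \<le> ?u" using z(4) by (rule order.trans[rotated])
      then have "(?x - ?u) / ?d \<le> 0" by (intro divide_nonpos_nonneg) auto
      moreover have "y\<^sup>2 - y ^ 4 / 3 \<ge> 0" unfolding e using True by simp
      ultimately have "(y\<^sup>2 - y ^ 4 / 3) * ((?x - ?u) / ?d) \<le> 0" by (rule mult_nonneg_nonpos[rotated])
      also have "0 \<le> y ^ 6 / 36 * norm z" by (intro mult_nonneg_nonneg divide_nonneg_nonneg zero_le_even_power) auto
      finally show ?thesis .
    next
      case False
      have \<rho>0: "?\<rho> > 0" using z(1) by simp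
      have ux: "?u \<le> ?\<rho>"
      proof -
        have "?u \<le> exp (- (3 / 2))" using False by simp
        also have "\<dots> = 1 / exp (3 / 2)" by (simp add: exp_minus inverse_eq_divide)
        also have "\<dots> \<le> 1 / norm z" using z(1,3) by (intro divide_left_mono) auto
        finally show ?thesis by (simp add: norm_divide)
      qed
      have xr: "\<bar>?x\<bar> \<le> ?\<rho>" by (rule abs_Re_le_cmod)
      have dd: "?d = ?\<rho>\<^sup>2 - 2 * ?u * ?x + ?u\<^sup>2"
        unfolding cmod_power2 by (simp add: power2_eq_square algebra_simps)
      \<comment> \<open>For r = |1 / z|, x = Re (1 / z) and u \<le> r this says that (u - x) / |1 /
        z - u|^2 is at most 1 / r. The difference of the two sides, times 2 r, is written as a sum
        of products of nonnegative factors.\<close>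
      have key: "(u - x) * r \<le> r\<^sup>2 - 2 * u * x + u\<^sup>2" if "\<bar>x\<bar> \<le> r" "0 \<le> u" "u \<le> r" "0 < r" for u x r :: real
      proof -
        have h: "0 \<le> r + x" "0 \<le> 2 * r - u" "0 \<le> r - u" "0 \<le> r - x" "0 \<le> u + r" using that by linarith+
        have "0 \<le> (r + x) * ((2 * r - u) * (r - u)) + (r - x) * (u * (u + r))"
          by (rule add_nonneg_nonneg[OF mult_nonneg_nonneg[OF h(1) mult_nonneg_nonneg[OF h(2,3)]] mult_nonneg_nonneg[OF h(4) mult_nonneg_nonneg[OF that(2) h(5)]]])
        also have "\<dots> = (2 * r) * (r\<^sup>2 - 2 * u * x + u\<^sup>2 - (u - x) * r)" by (simp add: power2_eq_square algebra_simps)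
        finally have "0 \<le> r\<^sup>2 - 2 * u * x + u\<^sup>2 - (u - x) * r" using that(4) by (simp add: zero_le_mult_iff)
        then show ?thesis by simp
      qed
      have "(?u - ?x) * ?\<rho> \<le> ?d" unfolding dd by (rule key[OF xr _ ux \<rho>0]) simp
      have le: "(?u - ?x) / ?d \<le> norm z"
      proof (cases "?d = 0")
        case False
        then have "?d > 0" using sum_power2_ge_zero[of "?x - ?u" "Im (1 / z)"] by linarith
        have "(?u - ?x) / ?d * ?\<rho> \<le> 1"
          using \<open>(?u - ?x) * ?\<rho> \<le> ?d\<close> \<open>?d > 0\<close> by (simp add: divide_le_eq)
        then have "(?u - ?x) / ?d \<le> 1 / ?\<rho>" using \<rho>0 by (simp add: le_divide_eq)
        then show ?thesis by (simp add: norm_divide)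
      qed simp
      have "y\<^sup>2 * (3 - y\<^sup>2) / 3 \<le> 0" using False by (intro divide_nonpos_pos mult_nonneg_nonpos) auto
      then have c0: "y ^ 4 / 3 - y\<^sup>2 \<ge> 0" using e by linarith
      have "(y\<^sup>2 - y ^ 4 / 3) * ((?x - ?u) / ?d) = (y ^ 4 / 3 - y\<^sup>2) * ((?u - ?x) / ?d)"
      proof -
        have "(a - b) * ((c - d) / q) = (b - a) * ((d - c) / q)" for a b c d q :: real
          by (simp add: left_diff_distrib right_diff_distrib diff_divide_distrib)
        then show ?thesis .
      qed
      also have "\<dots> \<le> (y ^ 4 / 3 - y\<^sup>2) * norm z" by (rule mult_left_mono[OF le c0])
      also have "\<dots> \<le> y ^ 6 / 36 * norm z"
      proof (rule mult_right_mono)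
        have "0 \<le> y\<^sup>2 * (y\<^sup>2 / 6 - 1)\<^sup>2" by simp
        also have "\<dots> = y ^ 6 / 36 - (y ^ 4 / 3 - y\<^sup>2)" by (simp add: power2_eq_square algebra_simps eval_nat_numeral)
        finally show "y ^ 4 / 3 - y\<^sup>2 \<le> y ^ 6 / 36" by simp
      qed simp
      finally show ?thesis .
    qed
    then show ?thesis unfolding R rhs by (rule mult_left_mono) simp
  qed
  have m: "has_bochner_integral lborel (\<lambda>y. norm z / 36 * (y ^ (2 * 3) * exp (- (1 * y\<^sup>2 / 2)))) (norm z / 36 * (gmoment 3 / 1 powr (real 3 + 1 / 2)))"
    by (intro has_bochner_integral_mult_right gaussian_moment) simp
  have "(\<integral>y. Re (hker z y) \<partial>lborel) \<le> (\<integral>y. norm z / 36 * (y ^ (2 * 3) * exp (- (1 * y\<^sup>2 / 2))) \<partial>lborel)"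
    using integrable_hker[OF z(2)] m by (intro integral_mono pw) (simp_all add: has_bochner_integral_iff)
  also have "\<dots> = norm z / 36 * (15 * sqrt (2 * pi))" using m by (simp only: has_bochner_integral_iff gmoment_values) simp
  finally have "Re (Hpr z) \<le> 1 / (2 * pi) * (norm z / 36 * (15 * sqrt (2 * pi)))"
    unfolding Re_Hpr[OF z(2)] by (intro mult_left_mono) auto
  also have "\<dots> = norm z * (15 / 36) * (sqrt (2 * pi) / (2 * pi))" by simp
  also have "sqrt (2 * pi) / (2 * pi) = 1 / sqrt (2 * pi)" using sqrt_pi_facts(2) by (simp add: field_simps)
  also have "norm z * (15 / 36) * (1 / sqrt (2 * pi)) \<le> norm z * (15 / 36) * (1 / (5 / 2))"
  proof (intro mult_left_mono divide_left_mono)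
    have "(5 / 2)\<^sup>2 \<le> 2 * pi" using pi_approx by (simp add: power2_eq_square)
    then show "5 / 2 \<le> sqrt (2 * pi)" by (rule real_le_rsqrt)
  qed auto
  finally show ?thesis by simp
qed

section \<open>Deformation of the contour\<close>

text \<open>On a small disc Re cH stays below some - k, so \<open>GG\<close> is at most a constant
  times exp (d sqrt \<tau> - k \<tau>) there. "The difference tends to 0" is an equivalence relation
  that holds locally, hence on all of the connected set; no parametrised path is integrated
  over.\<close>

lemma PP_diff_tendsto_0:
  assumes K: "connected K" "K \<subseteq> Om" "\<And>s. s \<in> K \<Longrightarrow> Re (cH s) < 0" and ab: "a \<in> K" "b \<in> K"
  shows "((\<lambda>\<tau>. PP \<tau> y b - PP \<tau> y a) \<longlongrightarrow> 0) at_top"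
proof -
  let ?R = "\<lambda>a b. ((\<lambda>\<tau>. PP \<tau> y b - PP \<tau> y a) \<longlongrightarrow> 0) at_top"
  have loc: "\<exists>r>0. \<forall>x\<in>ball a r. ?R a x" if a: "a \<in> K" for a
  proof -
    have "continuous_on Om (\<lambda>s. Re (cH s))"
      by (intro continuous_intros holomorphic_on_imp_continuous_on holomorphic_cH)
    then have "open (Om \<inter> (\<lambda>s. Re (cH s)) -` {..<0})"
      by (rule continuous_open_preimage[OF _ open_Om]) simp
    moreover have "a \<in> Om \<inter> (\<lambda>s. Re (cH s)) -` {..<0}" using K(2,3) a by auto
    ultimately obtain r where r: "r > 0" "cball a r \<subseteq> Om \<inter> (\<lambda>s. Re (cH s)) -` {..<0}"
      using open_contains_cball by meson
    have sub: "cball a r \<subseteq> Om" using r(2) by auto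
    have ne: "cball a r \<noteq> {}" using r(1) by simp
    have c: "continuous_on (cball a r) (\<lambda>s. Re (cH s))" "continuous_on (cball a r) (\<lambda>s. norm (cA1 s))" "continuous_on (cball a r) (\<lambda>s. norm (cG s))"
      by (intro continuous_intros holomorphic_on_imp_continuous_on holomorphic_on_subset[OF holomorphic_cH sub]
           holomorphic_on_subset[OF holomorphic_cA1 sub] holomorphic_on_subset[OF holomorphic_cG sub])+
    obtain s1 where s1: "s1 \<in> cball a r" "\<And>s. s \<in> cball a r \<Longrightarrow> Re (cH s) \<le> Re (cH s1)"
      using continuous_attains_sup[OF compact_cball ne c(1)] by blast
    obtain s2 where s2: "\<And>s. s \<in> cball a r \<Longrightarrow> norm (cA1 s) \<le> norm (cA1 s2)"
      using continuous_attains_sup[OF compact_cball ne c(2)] by blast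
    obtain s3 where s3: "\<And>s. s \<in> cball a r \<Longrightarrow> norm (cG s) \<le> norm (cG s3)"
      using continuous_attains_sup[OF compact_cball ne c(3)] by blast
    define k where "k = - Re (cH s1)"
    define d where "d = \<bar>y\<bar> * norm (cA1 s2)"
    have k0: "k > 0" using s1(1) r(2) unfolding k_def by auto
    have "?R a x" if x: "x \<in> ball a r" for x
    proof (rule Lim_null_comparison)
      have "norm (PP \<tau> y x - PP \<tau> y a) \<le> exp (d * sqrt \<tau> - k * \<tau>) * norm (cG s3) * norm (x - a)" if \<tau>: "\<tau> \<ge> 0" for \<tau>
      proof (rule field_differentiable_bound[where S="cball a r" and f'="GG \<tau> y"])
        show "(PP \<tau> y has_field_derivative GG \<tau> y z) (at z within cball a r)" if "z \<in> cball a r" for z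
          by (rule has_field_derivative_at_within[OF DERIV_PP]) (use that sub in blast)
        show "norm (GG \<tau> y z) \<le> exp (d * sqrt \<tau> - k * \<tau>) * norm (cG s3)" if z: "z \<in> cball a r" for z
        proof -
          have "\<tau> * Re (cH z) \<le> \<tau> * (- k)" using s1(2)[OF z] \<tau> by (intro mult_left_mono) (auto simp: k_def)
          moreover have "y * sqrt \<tau> * Re (cA1 z) \<le> d * sqrt \<tau>"
          proof -
            have "y * sqrt \<tau> * Re (cA1 z) \<le> \<bar>y * sqrt \<tau> * Re (cA1 z)\<bar>" by simp
            also have "\<dots> = \<bar>y\<bar> * sqrt \<tau> * \<bar>Re (cA1 z)\<bar>" using \<tau> by (simp add: abs_mult)
            also have "\<dots> \<le> \<bar>y\<bar> * sqrt \<tau> * norm (cA1 s2)"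
              using \<tau> order.trans[OF abs_Re_le_cmod s2[OF z]] by (intro mult_left_mono) auto
            finally show ?thesis by (simp add: d_def mult_ac)
          qed
          ultimately have "Re (of_real \<tau> * cH z + of_real (y * sqrt \<tau>) * cA1 z) \<le> d * sqrt \<tau> - k * \<tau>" by (simp add: algebra_simps)
          then show ?thesis unfolding GG_def norm_mult norm_exp_eq_Re using s3[OF z] by (intro mult_mono) auto
        qed
      qed (use x r(1) in auto)
      then show "\<forall>\<^sub>F \<tau> in at_top. norm (PP \<tau> y x - PP \<tau> y a) \<le> exp (d * sqrt \<tau> - k * \<tau>) * norm (cG s3) * norm (x - a)"
        using eventually_ge_at_top[of 0] by (rule eventually_mono[rotated])
      have "((\<lambda>\<tau>. exp (d * sqrt \<tau> - k * \<tau>)) \<longlongrightarrow> 0) at_top" using k0 by real_asymp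
      then show "((\<lambda>\<tau>. exp (d * sqrt \<tau> - k * \<tau>) * norm (cG s3) * norm (x - a)) \<longlongrightarrow> 0) at_top"
        by (intro tendsto_mult_left_zero)
    qed
    then show ?thesis using r(1) by blast
  qed
  show ?thesis
  proof (rule connected_equivalence_relation[of K a b ?R, OF K(1) ab])
    show "?R v u" if "?R u v" for u v using tendsto_minus[OF that] by simp
    show "?R u w" if "?R u v" "?R v w" for u v w using tendsto_add[OF that] by simp
    show "\<exists>T. openin (top_of_set K) T \<and> u \<in> T \<and> (\<forall>x\<in>T. ?R u x)" if uK: "u \<in> K" for u
    proof -
      obtain r where "r > 0" "\<forall>x\<in>ball u r. ?R u x" using loc[OF uK] by blast
      then show ?thesis using uK by (intro exI[of _ "K \<inter> ball u r"]) (auto simp: openin_open_Int)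
    qed
  qed
qed

section \<open>Reflection symmetry and the set where the phase has negative real part\<close>

lemma cnj_Om: "cnj s \<in> Om \<longleftrightarrow> s \<in> Om" by (simp add: Om_def flip: complex_cnj_power)

text \<open>Reflection principle: the coefficients \<open>cdiff\<close> are real, so
  \<open>cH\<close> is real on the positive axis. The lower path is then the mirror image of the
  upper one.\<close>

lemma cH_cnj:
  assumes "s \<in> Om"
  shows "cH (cnj s) = cnj (cH s)"
proof -
  have "(cnj \<circ> cH \<circ> cnj) s = cH s"
  proof (rule holomorphic_eq_pos_reals[OF _ holomorphic_cH open_Om connected_Om _ _ assms])
    have "cnj ` Om = Om" using cnj_Om by (force intro: image_eqI[of _ cnj "cnj x" for x])
    then show "cnj \<circ> cH \<circ> cnj holomorphic_on Om" by (intro holomorphic_on_compose_cnj_cnj open_Om) (simp add: holomorphic_cH)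
    show "of_real ` {0<..} \<subseteq> Om" using pos_reals_DR by (auto simp: DR_def)
    fix x :: real assume x: "x > 0"
    define q where "q = exp (- (x\<^sup>2 / 2))"
    have z: "exp (- ((complex_of_real x)\<^sup>2 / 2)) = of_real q" by (simp add: q_def flip: exp_of_real)
    have q1: "norm (complex_of_real q) < 1" using x by (simp add: q_def)
    have "complex_of_real x \<in> DR" using pos_reals_DR x by blast
    then have e: "cH (of_real x) = A2 (of_real q) - A1 (of_real q)" by (simp add: cH_def cA1_DR cA2_DR z)
    have "(\<lambda>k. Im (of_real (cdiff k) * of_real q ^ Suc k)) sums Im (of_real (sqrt (2 * pi)) * (A2 (of_real q) - A1 (of_real q)))"
      by (rule sums_Im[OF cdiff_sums[OF q1]])
    then have "(\<lambda>k. 0) sums Im (of_real (sqrt (2 * pi)) * (A2 (of_real q) - A1 (of_real q)))"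
      by (simp del: power_Suc flip: of_real_power of_real_mult)
    then have "Im (of_real (sqrt (2 * pi)) * (A2 (of_real q) - A1 (of_real q))) = 0" using sums_unique2 sums_zero by blast
    then have "Im (cH (of_real x)) = 0" unfolding e by simp
    then show "(cnj \<circ> cH \<circ> cnj) (of_real x) = cH (of_real x)" by (simp add: complex_eq_iff)
  qed
  then show ?thesis by (metis comp_apply complex_cnj_cnj)
qed

text \<open>With u = - Re s and v = Im s the left side is u (3 v^2 - u^2 - 3) / 3, and 2 u |v| \<le>
  u^2 + v^2 turns it into a bound in terms of w = s^2. This is the extra term that distinguishes
  \<open>cH\<close> on the left sheet from the principal branch.\<close>

lemma Re_cubic:
  assumes "Re s \<le> 0"
  shows "Re (s + s ^ 3 / 3) \<ge> - Re s * ((\<bar>Im (s\<^sup>2)\<bar> - 2 * Re (s\<^sup>2) - 3) / 3)"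
    and "(Re s)\<^sup>2 \<ge> (Re (s\<^sup>2) + \<bar>Im (s\<^sup>2)\<bar>) / 2"
proof -
  define u v where "u = - Re s" and "v = Im s"
  have s: "s = Complex (- u) v" by (simp add: u_def v_def complex_eq_iff)
  have u0: "u \<ge> 0" using assms by (simp add: u_def)
  have e: "Re (s\<^sup>2) = u\<^sup>2 - v\<^sup>2" unfolding s by (simp add: Re_power2)
  have t: "\<bar>Im (s\<^sup>2)\<bar> = 2 * (u * \<bar>v\<bar>)" unfolding s using u0 by (simp add: Im_power2 abs_mult)
  have tD: "2 * (u * \<bar>v\<bar>) \<le> u\<^sup>2 + v\<^sup>2"
    using sum_squares_bound[of u "\<bar>v\<bar>"] by (simp add: mult.assoc)
  show "(Re s)\<^sup>2 \<ge> (Re (s\<^sup>2) + \<bar>Im (s\<^sup>2)\<bar>) / 2" unfolding e t using tD by (simp add: u_def)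
  have "Re (s + s ^ 3 / 3) = u * ((3 * v\<^sup>2 - u\<^sup>2 - 3) / 3)"
  proof -
    have "Re (s ^ 3) = 3 * u * v\<^sup>2 - u ^ 3" unfolding s by (simp add: power3_eq_cube power2_eq_square algebra_simps)
    then have "Re (s + s ^ 3 / 3) = - u + (3 * u * v\<^sup>2 - u ^ 3) / 3" by (simp add: u_def)
    also have "\<dots> = u * ((3 * v\<^sup>2 - u\<^sup>2 - 3) / 3)" by (simp add: power3_eq_cube power2_eq_square field_simps)
    finally show ?thesis .
  qed
  also have "\<dots> \<ge> u * ((2 * (u * \<bar>v\<bar>) - 2 * (u\<^sup>2 - v\<^sup>2) - 3) / 3)"
    using tD by (intro mult_left_mono u0 divide_right_mono) auto
  finally show "Re (s + s ^ 3 / 3) \<ge> - Re s * ((\<bar>Im (s\<^sup>2)\<bar> - 2 * Re (s\<^sup>2) - 3) / 3)"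
    unfolding e t by (simp add: u_def)
qed

definition aC :: real where "aC = exp (- (3 / 2))"

lemma aC: "0 < aC" "aC \<le> 1" by (simp_all add: aC_def)

text \<open>The curve \<open>Re (1 / z) = exp (- 3 / 2)\<close> lifted to the variable \<open>s\<close>: it crosses from the left half plane
  to the right one at \<open>s = i sqrt 3\<close>, for \<open>\<eta> = 0\<close>.\<close>

definition gam :: "real \<Rightarrow> complex" where "gam \<eta> = \<i> * csqrt (- (2 * Ln (Complex aC \<eta>)))"

lemma Complex_aC: "Complex aC \<eta> \<notin> \<real>\<^sub>\<le>\<^sub>0" "Complex aC \<eta> \<noteq> 0" "exp (Ln (Complex aC \<eta>)) = Complex aC \<eta>"
  using aC(1) by (auto simp: complex_nonpos_Reals_iff complex_eq_iff)

lemma Ln_aC: "\<bar>Im (Ln (Complex aC \<eta>))\<bar> < pi / 2" "0 < \<eta> \<Longrightarrow> 0 < Im (Ln (Complex aC \<eta>))" "\<eta> < 0 \<Longrightarrow> Im (Ln (Complex aC \<eta>)) < 0"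
  "Ln (Complex aC 0) = - (3 / 2)"
proof -
  show 1: "\<bar>Im (Ln (Complex aC \<eta>))\<bar> < pi / 2" using Re_Ln_pos_lt[OF Complex_aC(2)] aC by simp
  show 2: "0 < Im (Ln (Complex aC \<eta>))" if "0 < \<eta>" for \<eta> using Im_Ln_pos_lt_imp[of "Complex aC \<eta>"] that by simp
  show "Im (Ln (Complex aC \<eta>)) < 0" if "\<eta> < 0"
  proof -
    have "Ln (Complex aC (- \<eta>)) = cnj (Ln (Complex aC \<eta>))"
      using cnj_Ln[OF Complex_aC(1)[of \<eta>]] by (simp add: complex_cnj)
    then show ?thesis using 2[of "- \<eta>"] that by simp
  qed
  have "Complex aC 0 = of_real (exp (- (3 / 2)))" by (simp add: aC_def complex_eq_iff)
  then have "Ln (Complex aC 0) = of_real (ln (exp (- (3 / 2))))" by (simp only: Ln_of_real exp_gt_zero)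
  then show "Ln (Complex aC 0) = - (3 / 2)" by simp
qed

lemma gam_power2: "(gam \<eta>)\<^sup>2 = 2 * Ln (Complex aC \<eta>)"
  by (simp add: gam_def power_mult_distrib)

lemma exp_gam: "exp (- ((gam \<eta>)\<^sup>2 / 2)) = zC \<eta>"
  by (simp add: gam_power2 exp_minus Complex_aC(3) zC_def[folded aC_def] inverse_eq_divide)

lemma gam_Om: "gam \<eta> \<in> Om"
  using Ln_aC(1)[of \<eta>] pi_gt_zero unfolding Om_def by (simp add: gam_power2)

text \<open>The branch i csqrt (- q) is smooth across the negative axis, where csqrt jumps. It
  equals csqrt q above the axis and - csqrt q below it, which lets the curve change sheets at \<eta>
  = 0.\<close>

lemma gam_pos: "\<eta> > 0 \<Longrightarrow> gam \<eta> = csqrt (2 * Ln (Complex aC \<eta>))"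
  using csqrt_minus[of "- (2 * Ln (Complex aC \<eta>))"] Ln_aC(2)[of \<eta>] by (simp add: gam_def)

lemma gam_neg: "\<eta> < 0 \<Longrightarrow> gam \<eta> = - csqrt (2 * Ln (Complex aC \<eta>))"
  using csqrt_minus[of "2 * Ln (Complex aC \<eta>)"] Ln_aC(3)[of \<eta>] by (simp add: gam_def flip: mult.assoc)

lemma Re_csqrt_Ln_aC: "\<eta> \<noteq> 0 \<Longrightarrow> Re (csqrt (2 * Ln (Complex aC \<eta>))) > 0"
  using Ln_aC(2,3)[of \<eta>] by (intro Re_csqrt_pos) (auto simp: complex_nonpos_Reals_iff neq_iff)

lemma continuous_gam: "continuous_on UNIV gam"
proof -
  have "continuous_on UNIV (\<lambda>\<eta>. Complex aC \<eta>)" unfolding Complex_eq by (intro continuous_intros)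
  then have "continuous_on UNIV (\<lambda>\<eta>. - (2 * Ln (Complex aC \<eta>)))"
    by (intro continuous_intros) (use Complex_aC(1) in auto)
  moreover have "continuous_on (- \<real>\<^sub>\<le>\<^sub>0) csqrt"
    by (rule holomorphic_on_imp_continuous_on[OF holomorphic_on_csqrt'[OF holomorphic_on_ident]]) auto
  moreover have "- (2 * Ln (Complex aC \<eta>)) \<notin> \<real>\<^sub>\<le>\<^sub>0" for \<eta>
    using Ln_aC(2,3)[of \<eta>] Ln_aC(4) by (cases "\<eta> = 0") (auto simp: complex_nonpos_Reals_iff neq_iff)
  ultimately show ?thesis unfolding gam_def
    by (intro continuous_on_mult continuous_on_const continuous_on_compose2[of "- \<real>\<^sub>\<le>\<^sub>0" csqrt UNIV]) auto
qed

lemma Re_cH_gam_pos: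
  assumes "\<eta> > 0"
  shows "cH (gam \<eta>) = Hpr (zC \<eta>)" "Re (cH (gam \<eta>)) < 0"
proof -
  have "gam \<eta> \<in> RH" using Re_csqrt_Ln_aC[of \<eta>] assms gam_Om[of \<eta>] unfolding RH_def by (simp add: gam_pos)
  from cH_RH[OF this] show "cH (gam \<eta>) = Hpr (zC \<eta>)" by (simp add: exp_gam)
  then show "Re (cH (gam \<eta>)) < 0" using Re_Hpr_zC_neg[of \<eta>] assms by simp
qed

lemma Re_cH_gam_0: "Re (cH (gam 0)) < 0"
proof -
  have "continuous_on UNIV (\<lambda>\<eta>. Re (cH (gam \<eta>)))"
    by (intro continuous_intros continuous_on_compose2[OF holomorphic_on_imp_continuous_on[OF holomorphic_cH] continuous_gam])
       (use gam_Om in auto)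
  then have "isCont (\<lambda>\<eta>. Re (cH (gam \<eta>))) 0" by (simp add: continuous_on_eq_continuous_at)
  then have "((\<lambda>\<eta>. Re (cH (gam \<eta>))) \<longlongrightarrow> Re (cH (gam 0))) (at_right 0)"
    unfolding isCont_def by (rule filterlim_mono[OF _ order.refl at_le]) simp
  moreover have "\<forall>\<^sub>F \<eta> in at_right 0. Re (cH (gam \<eta>)) \<le> Re (Hpr (zC 1))"
    using eventually_at_right_real[of 0 1]
    by (auto elim!: eventually_mono simp: Re_cH_gam_pos(1) intro!: Re_Hpr_zC_mono)
  ultimately have "Re (cH (gam 0)) \<le> Re (Hpr (zC 1))" by (rule tendsto_upperbound) simp
  then show ?thesis using Re_Hpr_zC_neg[of 1] by simp
qed

lemma norm_Complex_aC_le: "\<bar>\<eta>\<bar> \<le> aC * sqrt 3 \<Longrightarrow> norm (Complex aC \<eta>) \<le> 2 * aC"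
proof -
  assume h: "\<bar>\<eta>\<bar> \<le> aC * sqrt 3"
  have "\<bar>\<eta>\<bar>\<^sup>2 \<le> (aC * sqrt 3)\<^sup>2" by (rule power_mono[OF h]) simp
  then have "aC\<^sup>2 + \<eta>\<^sup>2 \<le> (2 * aC)\<^sup>2" by (simp add: power_mult_distrib)
  then have "sqrt (aC\<^sup>2 + \<eta>\<^sup>2) \<le> 2 * aC" using aC(1) by (intro real_le_lsqrt) auto
  then show ?thesis by (simp add: cmod_def)
qed

lemma ln_2aC: "ln (2 * aC) = ln 2 - 3 / 2" by (simp add: aC_def ln_mult)

text \<open>On the left sheet the sign is settled if the cubic term helps. For these \<eta> the
  modulus of 1 / z is at most 2 exp (- 3 / 2), so 2 Re (s^2) \<le> 4 (ln 2 - 3 / 2) \<le> - 3, and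
  the bracket in \<open>Re_cubic\<close> is nonnegative.\<close>

lemma Re_cH_gam_neg:
  assumes "- (aC * sqrt 3) \<le> \<eta>" "\<eta> < 0"
  shows "Re (cH (gam \<eta>)) < 0"
proof -
  have g: "gam \<eta> = - csqrt (2 * Ln (Complex aC \<eta>))" using assms by (simp add: gam_neg)
  have rh: "- gam \<eta> \<in> RH" using Re_csqrt_Ln_aC[of \<eta>] assms gam_Om[of \<eta>] uminus_Om[of "gam \<eta>"] unfolding RH_def g by simp
  have "Re (gam \<eta> + gam \<eta> ^ 3 / 3) \<ge> - Re (gam \<eta>) * ((\<bar>Im ((gam \<eta>)\<^sup>2)\<bar> - 2 * Re ((gam \<eta>)\<^sup>2) - 3) / 3)"
    by (rule Re_cubic(1)) (use rh in \<open>simp add: RH_def\<close>)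
  moreover have "- Re (gam \<eta>) * ((\<bar>Im ((gam \<eta>)\<^sup>2)\<bar> - 2 * Re ((gam \<eta>)\<^sup>2) - 3) / 3) \<ge> 0"
  proof (rule mult_nonneg_nonneg)
    show "0 \<le> - Re (gam \<eta>)" using rh by (simp add: RH_def)
    have "norm (Complex aC \<eta>) \<le> 2 * aC" using assms by (intro norm_Complex_aC_le) auto
    then have "ln (norm (Complex aC \<eta>)) \<le> ln (2 * aC)" using Complex_aC(2)[of \<eta>] aC by (intro ln_mono) auto
    then have "Re ((gam \<eta>)\<^sup>2) \<le> 2 * (ln 2 - 3 / 2)"
      unfolding gam_power2 using Re_Ln[OF Complex_aC(2)[of \<eta>]] by (simp add: ln_2aC)
    then have "2 * Re ((gam \<eta>)\<^sup>2) \<le> - 3" using ln2_le_25_over_36 by simp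
    then show "0 \<le> (\<bar>Im ((gam \<eta>)\<^sup>2)\<bar> - 2 * Re ((gam \<eta>)\<^sup>2) - 3) / 3" by simp
  qed
  ultimately have "Re (gam \<eta> + gam \<eta> ^ 3 / 3) \<ge> 0" by linarith
  moreover have "Re (cH (gam \<eta>)) = Re (Hpr (zC \<eta>)) - 2 * Re (gam \<eta> + gam \<eta> ^ 3 / 3)"
    unfolding cH_left[OF rh] exp_gam by simp
  ultimately show ?thesis using Re_Hpr_zC_neg[of \<eta>] assms by simp
qed

text \<open>Here the principal branch may be positive and the cubic term has to win. |z| \<le> exp
  (5 / 6) \<le> 12 / 5 gives Re Hpr \<le> 2 / 5, while - Re s \<ge> 2 / 5 and a bracket of at least
  3 / 4 make the cubic term at least 3 / 10, which is subtracted twice.\<close>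

lemma Re_cH_left_neg:
  assumes w: "Im w < 0" "- (2 * pi) \<le> Im w" "- (5 / 3) \<le> Re w" "9 / 4 \<le> - Im w - 2 * Re w - 3" "2 / 5 \<le> Re w - Im w"
    and c: "Re (exp (w / 2)) \<le> exp (- (3 / 2))"
    and nc: "exp (- (w / 2)) \<notin> slit"
  shows "- csqrt w \<in> Om" "Re (cH (- csqrt w)) < 0"
proof -
  let ?s = "- csqrt w"
  show om: "?s \<in> Om" using w pi_gt_zero by (simp add: Om_def)
  have "w \<notin> \<real>\<^sub>\<le>\<^sub>0" using w by (auto simp: complex_nonpos_Reals_iff)
  then have re: "Re (csqrt w) > 0" by (rule Re_csqrt_pos)
  then have rh: "- ?s \<in> RH" using om uminus_Om[of ?s] by (simp add: RH_def)
  have s2: "?s\<^sup>2 = w" by simp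
  let ?z = "exp (- (w / 2))"
  have nz: "norm ?z \<le> 12 / 5"
  proof -
    have "norm ?z = exp (- Re w / 2)" by (simp add: norm_exp_eq_Re)
    also have "\<dots> \<le> exp (1 + - (1 / 6))" using w(3) by simp
    also have "\<dots> = exp 1 * (1 / exp (1 / 6 :: real))" unfolding exp_add exp_minus inverse_eq_divide ..
    also have "\<dots> \<le> (272 / 100) * (1 / (1 + 1 / 6))"
      using e_less_272 exp_ge_add_one_self[of "1 / 6 :: real"] by (intro mult_mono divide_left_mono) auto
    finally show ?thesis by simp
  qed
  have n32: "norm ?z \<le> exp (3 / 2)"
    using nz exp_ge_add_one_self[of "3 / 2 :: real"] by linarith
  have "1 / ?z = exp (w / 2)" by (simp add: exp_minus inverse_eq_divide)
  then have "Re (Hpr ?z) \<le> norm ?z / 6" using c by (intro Re_Hpr_le nc n32) auto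
  then have h1: "Re (Hpr ?z) \<le> 2 / 5" using nz by linarith
  have s0: "Re ?s \<le> 0" using less_imp_le[OF re] by (simp only: uminus_complex.sel neg_le_0_iff_le)
  have "(2 / 5)\<^sup>2 \<le> (Re w + \<bar>Im w\<bar>) / 2" using w(1,5) by (simp add: power2_eq_square)
  also have "\<dots> \<le> (Re ?s)\<^sup>2" using Re_cubic(2)[OF s0] unfolding s2 .
  finally have "(2 / 5)\<^sup>2 \<le> (Re (csqrt w))\<^sup>2" by (simp only: uminus_complex.sel power2_minus)
  then have "2 / 5 \<le> Re (csqrt w)" by (rule power2_le_imp_le[OF _ less_imp_le[OF re]])
  then have "(2 / 5) * ((9 / 4) / 3) \<le> Re (csqrt w) * ((\<bar>Im w\<bar> - 2 * Re w - 3) / 3)"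
  proof (intro mult_mono divide_right_mono)
    show "9 / 4 \<le> \<bar>Im w\<bar> - 2 * Re w - 3" using w by linarith
    show "2 / 5 \<le> Re (csqrt w)" "0 \<le> Re (csqrt w)" by fact (rule less_imp_le[OF re])
  qed simp_all
  also have "\<dots> \<le> Re (?s + ?s ^ 3 / 3)" using Re_cubic(1)[OF s0] unfolding s2 by (simp only: uminus_complex.sel minus_minus)
  finally have "Re (?s + ?s ^ 3 / 3) \<ge> 3 / 10" by simp
  moreover have "Re (cH ?s) = Re (Hpr ?z) - 2 * Re (?s + ?s ^ 3 / 3)"
    unfolding cH_left[OF rh] s2 by simp
  ultimately show "Re (cH ?s) < 0" using h1 by linarith
qed


text \<open>Since 1 / z = exp (w / 2), \<open>w1\<close> is the end of the curve, where 1 / z has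
  modulus 2 exp (- 3 / 2) and argument - \<pi> / 3. From there to \<open>w2\<close> only the
  argument changes, down to - \<pi> / 2; \<open>w3\<close> is the lower end of the line Re w =
  eps.\<close>

definition w1 :: complex where "w1 = Complex (2 * (ln 2 - 3 / 2)) (- (2 * pi / 3))"
definition w2 :: complex where "w2 = Complex (2 * (ln 2 - 3 / 2)) (- pi)"
definition w3 :: complex where "w3 = Complex eps (- (2 * pi))"

lemma gam_w1: "gam (- (aC * sqrt 3)) = - csqrt w1"
proof -
  have c: "exp (Complex (ln 2 - 3 / 2) (- (pi / 3))) = Complex aC (- (aC * sqrt 3))"
  proof -
    have "exp (ln 2 - 3 / 2) = 2 * aC" unfolding ln_2aC[symmetric] using aC by simp
    then show ?thesis by (simp add: complex_eq_iff Re_exp Im_exp cos_60 sin_60)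
  qed
  have "Ln (Complex aC (- (aC * sqrt 3))) = Complex (ln 2 - 3 / 2) (- (pi / 3))"
    proof (rule Ln_unique[OF c])
    have "- (pi / 3) \<le> pi" using pi_gt_zero by linarith
    then show "Im (Complex (ln 2 - 3 / 2) (- (pi / 3))) \<le> pi" by simp
  qed simp
  then have "2 * Ln (Complex aC (- (aC * sqrt 3))) = w1" by (simp add: w1_def complex_eq_iff)
  then show ?thesis using gam_neg[of "- (aC * sqrt 3)"] aC by simp
qed

lemma not_slit_Re_le:
  assumes "Re (exp (w / 2)) \<le> exp (- (3 / 2))" "Im w < 0" "- (2 * pi) \<le> Im w"
  shows "exp (- (w / 2)) \<notin> slit"
proof
  assume "exp (- (w / 2)) \<in> slit"
  then obtain q where q: "q \<ge> 1" "exp (- (w / 2)) = complex_of_real q" by (auto simp: slit_def)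
  have "exp (w / 2) = 1 / of_real q" using q by (simp add: exp_minus field_simps)
  then have i: "Im (exp (w / 2)) = 0" and r: "Re (exp (w / 2)) > 0" using q by (simp_all flip: of_real_divide add: Re_divide Im_divide)
  have "sin (Im w / 2) = 0" using i by (simp add: Im_exp)
  then have s0: "sin (- (Im w / 2)) = 0" by simp
  show False
  proof (cases "Im w = - (2 * pi)")
    case True
    then show False using r by (simp add: Re_exp)
  next
    case False
    then have "sin (- (Im w / 2)) > 0" using assms by (intro sin_gt_zero) auto
    then show False using s0 by simp
  qed
qed

text \<open>The numerical conditions of \<open>Re_cH_left_neg\<close> are linear in w, so they cut
  out a convex set and need checking at the three corners only. The bound 21 / 4 is 9 / 4 +
  3.\<close>

definition Wreg :: "complex set" where
  "Wreg = {w. Im w < 0} \<inter> {w. Im w \<ge> - (2 * pi)} \<inter> {w. Re w \<ge> - (5 / 3)} \<inter> {w. inner (Complex (-2) (-1)) w \<ge> 21 / 4} \<inter> {w. inner (Complex 1 (-1)) w \<ge> 2 / 5}"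

lemma convex_Wreg: "convex Wreg"
  unfolding Wreg_def by (intro convex_Int convex_halfspace_Im_lt convex_halfspace_Im_ge convex_halfspace_Re_ge convex_halfspace_ge)

lemma w_in_Wreg: "w1 \<in> Wreg" "w2 \<in> Wreg" "w3 \<in> Wreg"
  using pi_approx ln2_ge_two_thirds ln2_le_25_over_36 unfolding Wreg_def
  by (simp_all add: inner_complex_def w1_def w2_def w3_def eps_def)

text \<open>It remains to bound Re (1 / z) by exp (- 3 / 2). On the first segment |1 / z| is
  constantly 2 exp (- 3 / 2) and the cosine of the argument is at most 1 / 2; on the second segment
  the cosine is nonpositive.\<close>

lemma left_segments:
  assumes "w \<in> closed_segment w1 w2 \<union> closed_segment w2 w3"
  shows "- csqrt w \<in> Om" "Re (cH (- csqrt w)) < 0" "Im w < 0"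
proof -
  have W: "w \<in> Wreg" using assms closed_segment_subset[OF w_in_Wreg(1,2) convex_Wreg] closed_segment_subset[OF w_in_Wreg(2,3) convex_Wreg] by blast
  have c: "Re (exp (w / 2)) \<le> exp (- (3 / 2))"
    using assms
  proof
    assume "w \<in> closed_segment w1 w2"
    then obtain u where u: "0 \<le> u" "u \<le> 1" "w = (1 - u) *\<^sub>R w1 + u *\<^sub>R w2" by (auto simp: in_segment)
    have re: "Re w = 2 * (ln 2 - 3 / 2)" unfolding u(3) by (simp add: w1_def w2_def algebra_simps)
    have im: "- (Im w / 2) = pi / 3 + u * (pi / 6)" unfolding u(3) by (simp add: w1_def w2_def field_simps)
    have "u * (pi / 6) \<le> 1 * (pi / 6)" using u by (intro mult_right_mono) auto
    then have "pi / 3 + u * (pi / 6) \<le> pi" using pi_gt_zero by linarith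
    then have "cos (pi / 3 + u * (pi / 6)) \<le> cos (pi / 3)" using u by (intro cos_monotone_0_pi_le) (assumption | simp)+
    then have "cos (Im w / 2) \<le> 1 / 2" using im cos_minus[of "Im w / 2"] by (simp add: cos_60)
    moreover have "exp (Re w / 2) = 2 * aC" unfolding re using ln_2aC aC by (metis exp_ln mult_pos_pos nonzero_mult_div_cancel_left zero_less_numeral zero_neq_numeral)
    ultimately have "Re (exp (w / 2)) \<le> 2 * aC * (1 / 2)" unfolding Re_exp using aC by (simp add: mult_left_mono)
    then show ?thesis by (simp add: aC_def)
  next
    assume "w \<in> closed_segment w2 w3"
    then obtain u where u: "0 \<le> u" "u \<le> 1" "w = (1 - u) *\<^sub>R w2 + u *\<^sub>R w3" by (auto simp: in_segment)
    have im: "- (Im w / 2) = pi / 2 + u * (pi / 2)" unfolding u(3) by (simp add: w3_def w2_def field_simps)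
    have "u * (pi / 2) \<le> 1 * (pi / 2)" using u by (intro mult_right_mono) auto
    then have "pi / 2 + u * (pi / 2) \<le> pi" by linarith
    then have "cos (pi / 2 + u * (pi / 2)) \<le> cos (pi / 2)" using u by (intro cos_monotone_0_pi_le) (assumption | simp)+
    then have "cos (Im w / 2) \<le> 0" using im cos_minus[of "Im w / 2"] by simp
    then have "Re (exp (w / 2)) \<le> 0" unfolding Re_exp by (simp add: mult_nonneg_nonpos)
    then show ?thesis using exp_gt_zero[of "- (3 / 2)::real"] by linarith
  qed
  have i: "Im w < 0" "- (2 * pi) \<le> Im w" "- (5 / 3) \<le> Re w" "9 / 4 \<le> - Im w - 2 * Re w - 3" "2 / 5 \<le> Re w - Im w"
    using W by (auto simp: Wreg_def inner_complex_def)
  show "Im w < 0" by (rule i(1))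
  show "- csqrt w \<in> Om" "Re (cH (- csqrt w)) < 0"
    using Re_cH_left_neg[OF i c not_slit_Re_le[OF c i(1,2)]] by auto
qed

text \<open>In the series of \<open>cdiff_sums\<close> the quadratic coefficient 1 / (4 sqrt 2)
  \<ge> 17 / 100 contributes at most - (3 / 20) |z|^2, and the remainder at most |z|^2 / 15; then
  sqrt (2 \<pi>) \<le> 13 / 5 is divided out. The number 15 / 17 is the worst case in
  \<open>right_segment\<close>; on the imaginary axis Re (z^2) = - |z|^2 is even better.\<close>

lemma Re_A2_minus_A1_le:
  assumes z: "norm z \<le> 1 / 4" and z2: "Re (z\<^sup>2) \<le> - (15 / 17) * (norm z)\<^sup>2"
  shows "Re (A2 z - A1 z) \<le> - (norm z)\<^sup>2 / 50"
proof -
  have z1: "norm z < 1" using z by simp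
  let ?f = "\<lambda>k. of_real (cdiff k) * z ^ Suc k"
  have s: "(\<lambda>k. ?f (k + 2)) sums (of_real (sqrt (2 * pi)) * (A2 z - A1 z) - (\<Sum>k<2. ?f k))"
    by (rule sums_split_initial_segment[OF cdiff_sums[OF z1]])
  have c1: "cdiff 1 \<ge> 17 / 100"
  proof -
    have a: "(2::real) powr (3 / 2) = 2 * sqrt 2" "(2::real) powr (5 / 2) = 4 * sqrt 2"
      using powr_add[of "2::real" 1 "1 / 2"] powr_add[of "2::real" 2 "1 / 2"] by (simp_all add: powr_half_sqrt)
    have "sqrt 2 \<le> (283 / 200 :: real)" by (rule real_le_lsqrt) (simp_all add: power2_eq_square)
    then have "1 / (4 * (283 / 200)) \<le> 1 / (4 * sqrt (2::real))" by (intro divide_left_mono) auto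
    moreover have "cdiff 1 = 1 / (4 * sqrt 2)" by (simp add: cdiff_def a)
    ultimately show ?thesis by simp
  qed
  have bk: "norm (?f (k + 2)) \<le> (norm z)\<^sup>2 * (1 / 20) * (1 / 4) ^ k" for k
  proof -
    have "cdiff (k + 2) \<le> 1 / real (Suc (k + 2)) powr (3 / 2)" by (rule cdiff_bounds(2))
    also have "\<dots> \<le> 1 / 5"
    proof (rule divide_left_mono)
      have "5 \<le> 3 * (5 / 3 :: real)" by simp
      also have "\<dots> \<le> 3 * sqrt 3" by (intro mult_left_mono real_le_rsqrt) (simp_all add: power2_eq_square)
      also have "\<dots> = 3 powr (3 / 2)" using powr_add[of "3::real" 1 "1 / 2"] by (simp add: powr_half_sqrt)
      also have "\<dots> \<le> real (Suc (k + 2)) powr (3 / 2)" by (intro powr_mono2) auto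
      finally show "5 \<le> real (Suc (k + 2)) powr (3 / 2)" .
    qed auto
    finally have "cdiff (k + 2) \<le> 1 / 5" .
    moreover have "norm z ^ Suc (k + 2) \<le> (norm z)\<^sup>2 * (1 / 4) * (1 / 4) ^ k"
    proof -
      have "norm z ^ Suc (k + 2) = (norm z)\<^sup>2 * (norm z) ^ Suc k" by (simp add: power2_eq_square)
      also have "\<dots> \<le> (norm z)\<^sup>2 * (1 / 4) ^ Suc k" using z by (intro mult_left_mono power_mono) auto
      finally show ?thesis by simp
    qed
    ultimately have "cdiff (k + 2) * norm z ^ Suc (k + 2) \<le> 1 / 5 * ((norm z)\<^sup>2 * (1 / 4) * (1 / 4) ^ k)"
      using cdiff_bounds(1)[of "k + 2"] by (intro mult_mono) auto
    then show ?thesis unfolding norm_mult norm_power norm_of_real using cdiff_bounds(1)[of "k + 2"] by simp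
  qed
  have g: "(\<lambda>k. (norm z)\<^sup>2 * (1 / 20) * (1 / 4) ^ k) sums ((norm z)\<^sup>2 * (1 / 20) * (1 / (1 - 1 / 4)))"
    by (intro sums_mult geometric_sums) simp
  have "norm (\<Sum>k. ?f (k + 2)) \<le> (\<Sum>k. (norm z)\<^sup>2 * (1 / 20) * (1 / 4) ^ k)"
    by (rule norm_suminf_le[OF bk sums_summable[OF g]])
  also have "\<dots> = (norm z)\<^sup>2 * (1 / 20) * (1 / (1 - 1 / 4))" using g by (simp only: sums_iff)
  finally have "norm (of_real (sqrt (2 * pi)) * (A2 z - A1 z) - (\<Sum>k<2. ?f k)) \<le> (norm z)\<^sup>2 / 15"
    using s by (simp add: sums_iff)
  moreover have "(\<Sum>k<2. ?f k) = of_real (cdiff 1) * z\<^sup>2" by (simp add: numeral_2_eq_2)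
  ultimately have "Re (of_real (sqrt (2 * pi)) * (A2 z - A1 z) - of_real (cdiff 1) * z\<^sup>2) \<le> (norm z)\<^sup>2 / 15"
    using complex_Re_le_cmod order.trans by metis
  then have a: "sqrt (2 * pi) * Re (A2 z - A1 z) \<le> cdiff 1 * Re (z\<^sup>2) + (norm z)\<^sup>2 / 15" by simp
  have "cdiff 1 * Re (z\<^sup>2) \<le> cdiff 1 * (- (15 / 17) * (norm z)\<^sup>2)" using z2 c1 by (intro mult_left_mono) auto
  also have "\<dots> \<le> (17 / 100) * (- (15 / 17) * (norm z)\<^sup>2)" using c1 by (intro mult_right_mono_neg) auto
  also have "\<dots> = - (3 / 20) * (norm z)\<^sup>2" by simp
  finally have "cdiff 1 * Re (z\<^sup>2) \<le> - (3 / 20) * (norm z)\<^sup>2" .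
  then have b: "sqrt (2 * pi) * Re (A2 z - A1 z) \<le> - (norm z)\<^sup>2 / 13" using a zero_le_power2[of "norm z"] by linarith
  have sq: "sqrt (2 * pi) \<le> 13 / 5" using pi_approx by (intro real_le_lsqrt) (simp_all add: power2_eq_square)
  show ?thesis
  proof (rule ccontr)
    assume "\<not> ?thesis"
    then have h: "- (norm z)\<^sup>2 / 50 < Re (A2 z - A1 z)" by simp
    have "(13 / 5) * (- (norm z)\<^sup>2 / 50) \<le> sqrt (2 * pi) * (- (norm z)\<^sup>2 / 50)"
      using sq by (intro mult_right_mono_neg) auto
    also have "\<dots> < sqrt (2 * pi) * Re (A2 z - A1 z)" using h by (intro mult_strict_left_mono) auto
    finally have "(13 / 5) * (- (norm z)\<^sup>2 / 50) < - (norm z)\<^sup>2 / 13" using b by linarith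
    then show False using zero_le_power2[of "norm z"] by simp
  qed
qed

definition sE :: complex where "sE = csqrt (2 * Ln (4 * \<i>))"
definition sS :: complex where "sS = - csqrt w3"

text \<open>\<open>Complex \<alpha> 4\<close> is the value of 1 / z. This last piece leads from the
  curve, at \<eta> = 4, to 1 / z = 4 i inside |z| \<le> 1 / 4, where the power series decides;
  \<alpha> \<le> 1 yields the ratio (16 - \<alpha>^2) / (16 + \<alpha>^2) \<ge> 15 / 17.\<close>

lemma right_segment:
  assumes "0 \<le> \<alpha>" "\<alpha> \<le> 1"
  shows "csqrt (2 * Ln (Complex \<alpha> 4)) \<in> Om" "Re (cH (csqrt (2 * Ln (Complex \<alpha> 4)))) < 0"
proof -
  let ?\<zeta> = "Complex \<alpha> 4" and ?s = "csqrt (2 * Ln (Complex \<alpha> 4))"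
  have z0: "?\<zeta> \<noteq> 0" by (simp add: complex_eq_iff)
  have n4: "norm ?\<zeta> \<ge> 4" using abs_Im_le_cmod[of ?\<zeta>] by simp
  have "Re (2 * Ln ?\<zeta>) > 0" proof -
    have "ln (norm ?\<zeta>) > 0" using n4 by (intro ln_gt_zero) linarith
    then show ?thesis using Re_Ln[OF z0] by simp
  qed
  moreover have "\<bar>Im (2 * Ln ?\<zeta>)\<bar> < 4 * pi" using mpi_less_Im_Ln[OF z0] Im_Ln_le_pi[OF z0] pi_gt_zero by simp
  ultimately have dr: "?s \<in> DR" unfolding DR_image by blast
  then show "?s \<in> Om" by (rule DR_Om)
  have e: "exp (- (?s\<^sup>2 / 2)) = 1 / ?\<zeta>" by (simp add: exp_minus exp_Ln[OF z0] inverse_eq_divide)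
  have nz: "norm (1 / ?\<zeta>) \<le> 1 / 4" using n4 z0 by (simp add: norm_divide divide_le_eq)
  let ?N = "\<alpha>\<^sup>2 + 16"
  have N: "(norm ?\<zeta>)\<^sup>2 = ?N" by (simp add: cmod_power2)
  have N0: "?N > 0" by (simp add: add_nonneg_pos)
  have "(1 / ?\<zeta>)\<^sup>2 = cnj (?\<zeta>\<^sup>2) / of_real (?N\<^sup>2)"
  proof -
    have "1 / ?\<zeta> = cnj ?\<zeta> / of_real ?N" using complex_div_cnj[of 1 ?\<zeta>] unfolding N by simp
    then show ?thesis by (simp add: power_divide)
  qed
  then have "Re ((1 / ?\<zeta>)\<^sup>2) = (\<alpha>\<^sup>2 - 16) / ?N\<^sup>2" by (simp only: Re_divide_of_real) (simp add: Re_power2)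
  also have "\<dots> \<le> - (15 / 17) * (1 / ?N)"
  proof -
    have "\<alpha>\<^sup>2 \<le> 1" using assms by (simp add: power_le_one)
    then have "(\<alpha>\<^sup>2 - 16) \<le> - (15 / 17) * ?N" by (simp add: field_simps)
    then have "(\<alpha>\<^sup>2 - 16) / ?N\<^sup>2 \<le> - (15 / 17) * ?N / ?N\<^sup>2" by (intro divide_right_mono) auto
    moreover have "c * n / n\<^sup>2 = c * (1 / n)" if "n > 0" for c n :: real using that by (simp add: power2_eq_square)
    ultimately show ?thesis using N0 by metis
  qed
  also have "1 / ?N = (norm (1 / ?\<zeta>))\<^sup>2" unfolding N[symmetric] by (simp add: norm_divide power_divide)
  finally have "Re (A2 (1 / ?\<zeta>) - A1 (1 / ?\<zeta>)) \<le> - (norm (1 / ?\<zeta>))\<^sup>2 / 50" by (rule Re_A2_minus_A1_le[OF nz])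
  moreover have "(norm (1 / ?\<zeta>))\<^sup>2 > 0" using z0 by simp
  ultimately show "Re (cH ?s) < 0" unfolding cH_def cA1_DR[OF dr] cA2_DR[OF dr] e by linarith
qed

text \<open>A connected set in the region where \<open>Re cH\<close> is negative. It joins an end point of the vertical line of integration,
  lifted to the left sheet, to the point over \<open>z = - i / 4\<close> on the right sheet.\<close>

definition Kpath :: "complex set" where
  "Kpath = gam ` {- (aC * sqrt 3)..4} \<union> (\<lambda>w. - csqrt w) ` (closed_segment w1 w2 \<union> closed_segment w2 w3)
     \<union> (\<lambda>\<alpha>. csqrt (2 * Ln (Complex \<alpha> 4))) ` {0..aC}"

lemma Kpath: "connected Kpath" "sS \<in> Kpath" "sE \<in> Kpath" "s \<in> Kpath \<Longrightarrow> s \<in> Om" "s \<in> Kpath \<Longrightarrow> Re (cH s) < 0"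
proof -
  let ?A = "gam ` {- (aC * sqrt 3)..4}" and ?B = "(\<lambda>w. - csqrt w) ` (closed_segment w1 w2 \<union> closed_segment w2 w3)"
  let ?C = "(\<lambda>\<alpha>. csqrt (2 * Ln (Complex \<alpha> 4))) ` {0..aC}"
  have ab: "- (aC * sqrt 3) \<le> 4" using aC by (simp add: add_nonneg_nonneg order.trans[of _ 0])
  have cs: "continuous_on (- \<real>\<^sub>\<le>\<^sub>0) csqrt"
    by (rule holomorphic_on_imp_continuous_on[OF holomorphic_on_csqrt'[OF holomorphic_on_ident]]) auto
  have "connected ?A"
    by (rule connected_continuous_image[OF continuous_on_subset[OF continuous_gam]]) auto
  moreover have "connected ?B"
  proof (rule connected_continuous_image)
    show "connected (closed_segment w1 w2 \<union> closed_segment w2 w3)" by (rule connected_Un) auto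
    show "continuous_on (closed_segment w1 w2 \<union> closed_segment w2 w3) (\<lambda>w. - csqrt w)"
      by (intro continuous_on_minus continuous_on_subset[OF cs]) (use left_segments(3) in \<open>fastforce simp: complex_nonpos_Reals_iff\<close>)
  qed
  moreover have "connected ?C"
  proof (rule connected_continuous_image)
    have nn: "Complex \<alpha> 4 \<notin> \<real>\<^sub>\<le>\<^sub>0" "Complex \<alpha> 4 \<noteq> 0" for \<alpha> by (auto simp: complex_nonpos_Reals_iff complex_eq_iff)
    have "2 * Ln (Complex \<alpha> 4) \<notin> \<real>\<^sub>\<le>\<^sub>0" for \<alpha>
      using Im_Ln_pos_lt_imp[of "Complex \<alpha> 4"] by (auto simp: complex_nonpos_Reals_iff)
    moreover have "continuous_on {0..aC} (\<lambda>\<alpha>. 2 * Ln (Complex \<alpha> 4))"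
      unfolding Complex_eq by (intro continuous_intros) (use nn in \<open>auto simp: Complex_eq\<close>)
    ultimately show "continuous_on {0..aC} (\<lambda>\<alpha>. csqrt (2 * Ln (Complex \<alpha> 4)))"
      by (intro continuous_on_compose2[OF cs]) auto
  qed auto
  moreover have "- csqrt w1 \<in> ?A \<inter> ?B"
    using gam_w1 ab by (auto intro!: image_eqI[of _ gam "- (aC * sqrt 3)"] image_eqI[of _ "\<lambda>w. - csqrt w" w1])
  moreover have "gam 4 \<in> ?A \<inter> ?C"
  proof
    show "gam 4 \<in> ?A" by (rule imageI) (use ab in simp)
    show "gam 4 \<in> ?C" by (rule image_eqI[of _ _ aC]) (use gam_pos[of 4] aC in auto)
  qed
  ultimately show "connected Kpath" unfolding Kpath_def by (intro connected_Un) blast+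
  show "sS \<in> Kpath" unfolding Kpath_def sS_def by blast
  have "4 * \<i> = Complex 0 4" by (simp add: complex_eq_iff)
  then have "sE = csqrt (2 * Ln (Complex 0 4))" by (simp only: sE_def)
  then show "sE \<in> Kpath" unfolding Kpath_def using aC by auto
  show "s \<in> Kpath \<Longrightarrow> s \<in> Om"
    unfolding Kpath_def using gam_Om left_segments(1) right_segment(1) aC by (auto intro: order.trans)
  have "Re (cH (gam \<eta>)) < 0" if "- (aC * sqrt 3) \<le> \<eta>" for \<eta>
    using that Re_cH_gam_pos(2)[of \<eta>] Re_cH_gam_0 Re_cH_gam_neg[of \<eta>] by (cases \<eta> "0::real" rule: linorder_cases) auto
  then show "s \<in> Kpath \<Longrightarrow> Re (cH s) < 0"
    unfolding Kpath_def using left_segments(2) right_segment(2) aC by (auto intro: order.trans)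
qed

lemma PP_upper: "((\<lambda>\<tau>. PP \<tau> y sE - PP \<tau> y sS) \<longlongrightarrow> 0) at_top"
  by (rule PP_diff_tendsto_0[OF Kpath(1) _ Kpath(5,2,3)]) (use Kpath(4) in auto)

lemma PP_lower: "((\<lambda>\<tau>. PP \<tau> y (cnj sE) - PP \<tau> y (cnj sS)) \<longlongrightarrow> 0) at_top"
proof (rule PP_diff_tendsto_0[of "cnj ` Kpath"])
  show "connected (cnj ` Kpath)" by (intro connected_continuous_image Kpath(1) continuous_intros)
  show "cnj ` Kpath \<subseteq> Om" using Kpath(4) cnj_Om by auto
  show "Re (cH s) < 0" if "s \<in> cnj ` Kpath" for s using that Kpath(4,5) by (auto simp: cH_cnj)
qed (use Kpath(2,3) in auto)

section \<open>The saddle point\<close>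

text \<open>On the disc cut along the nonpositive axis the derivative of \<open>PP\<close> in the
  variable z is - \<open>expE\<close> / z. Adding \<open>P\<close> for the regular part and
  \<open>Ln\<close> for the pole gives a constant. The two end points see the pole at 0 under half a
  turn, so the logarithms differ by \<pi> i: half a residue.\<close>

lemma PP_sE_diff:
  obtains P where "\<And>z. norm z < 1 \<Longrightarrow> P field_differentiable (at z)"
    "\<And>z. norm z < 1 \<Longrightarrow> z \<noteq> 0 \<Longrightarrow> (P has_field_derivative (expE \<tau> y z - 1) / z) (at z)"
    "PP \<tau> y sE - PP \<tau> y (cnj sE) = P (\<i> / 4) - P (- \<i> / 4) + \<i> * of_real pi"
proof -
  obtain P where P: "\<And>z. norm z < 1 \<Longrightarrow> P field_differentiable (at z)"
    "\<And>z. norm z < 1 \<Longrightarrow> z \<noteq> 0 \<Longrightarrow> (P has_field_derivative (expE \<tau> y z - expE \<tau> y 0) / z) (at z)"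
    by (rule divided_difference_primitive[OF holomorphic_expE[of \<tau> y]]) (rule that; (assumption | simp))
  let ?D = "{z. Re z > 0 \<or> Im z \<noteq> 0} \<inter> ball 0 1"
  let ?f = "\<lambda>z. PP \<tau> y (csqrt (- 2 * Ln z)) + P z + Ln z"
  have nn: "z \<notin> \<real>\<^sub>\<le>\<^sub>0" "z \<noteq> 0" "norm z < 1" if "z \<in> ?D" for z
    using that by (auto simp: complex_nonpos_Reals_iff)
  have d: "(?f has_field_derivative 0) (at z)" if z: "z \<in> ?D" for z
  proof -
    let ?s = "csqrt (- 2 * Ln z)"
    have "Re (- 2 * Ln z) > 0" using nn[OF z] by (simp add: ln_less_zero)
    moreover have "\<bar>Im (- 2 * Ln z)\<bar> < 4 * pi"
      using mpi_less_Im_Ln[OF nn(2)[OF z]] Im_Ln_le_pi[OF nn(2)[OF z]] pi_gt_zero by simp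
    ultimately have dr: "?s \<in> DR" unfolding DR_image by blast
    have e: "exp (- (?s\<^sup>2 / 2)) = z" using nn(2)[OF z] by simp
    have s0: "?s \<noteq> 0" by (rule DR_nz[OF dr])
    have dl: "(Ln has_field_derivative inverse z) (at z)" by (rule has_field_derivative_Ln[OF nn(1)[OF z]])
    have "- 2 * Ln z \<notin> \<real>\<^sub>\<le>\<^sub>0" using \<open>Re (- 2 * Ln z) > 0\<close> unfolding complex_nonpos_Reals_iff by linarith
    then have "(csqrt has_field_derivative inverse (2 * ?s)) (at (- 2 * Ln z))" by (rule has_field_derivative_csqrt)
    then have "((\<lambda>z. csqrt (- 2 * Ln z)) has_field_derivative inverse (2 * ?s) * (- 2 * inverse z)) (at z)"
      by (rule DERIV_chain2[where f=csqrt and g="\<lambda>z. - 2 * Ln z", OF _ DERIV_cmult[OF dl]])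
    then have "((\<lambda>z. PP \<tau> y (csqrt (- 2 * Ln z))) has_field_derivative GG \<tau> y ?s * (inverse (2 * ?s) * (- 2 * inverse z))) (at z)"
      by (rule DERIV_chain2[where f="PP \<tau> y" and g="\<lambda>z. csqrt (- 2 * Ln z)", OF DERIV_PP[OF DR_Om[OF dr]]])
    moreover have "GG \<tau> y ?s * (inverse (2 * ?s) * (- 2 * inverse z)) = - expE \<tau> y z / z"
    proof -
      have "s * E * (inverse (2 * s) * (- 2 * inverse z)) = - E / z" if "s \<noteq> 0" for s E :: complex
        using that nn(2)[OF z] by (simp add: field_simps)
      from this[OF s0] show ?thesis unfolding GG_DR[OF dr] e .
    qed
    ultimately have "(?f has_field_derivative - expE \<tau> y z / z + (expE \<tau> y z - expE \<tau> y 0) / z + inverse z) (at z)"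
      using P(2)[OF nn(3,2)[OF z]] dl by (intro DERIV_add) (simp_all only:)
    moreover have "- expE \<tau> y z / z + (expE \<tau> y z - expE \<tau> y 0) / z + inverse z = 0"
      using nn(2)[OF z] by (simp add: diff_divide_distrib inverse_eq_divide)
    ultimately show ?thesis by (simp only:)
  qed
  have "{z. Re z > 0 \<or> Im z \<noteq> 0} = - \<real>\<^sub>\<le>\<^sub>0" by (auto simp: complex_nonpos_Reals_iff)
  then have op: "open ?D" by (simp add: open_Int open_Compl)
  have "starlike ?D"
    unfolding starlike_def
  proof (intro bexI[of _ "1 / 2"] ballI subsetI)
    fix x v assume x: "x \<in> ?D" and "v \<in> closed_segment (1 / 2) x"
    then have "v \<in> ball 0 1" using closed_segment_subset[OF _ _ convex_ball, of "1 / 2" 0 1 x] by (auto simp: norm_divide)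
    moreover obtain u where u: "0 \<le> u" "u \<le> 1" "v = (1 - u) *\<^sub>R (1 / 2) + u *\<^sub>R x"
      using \<open>v \<in> closed_segment (1 / 2) x\<close> by (auto simp: in_segment)
    have "Re v > 0 \<or> Im v \<noteq> 0"
    proof (cases "u = 0 \<or> Im x = 0")
      case True
      then consider "u = 0" | "Re x > 0" using x by auto
      then show ?thesis
      proof cases
        case 2
        have "Re v = (1 - u) * (1 / 2) + u * Re x" unfolding u(3) by simp
        also have "\<dots> > 0"
        proof (cases "u = 1")
          case False
          then have "(1 - u) * (1 / 2) > 0" "u * Re x \<ge> 0" using u 2 by auto
          then show ?thesis by linarith
        qed (use 2 in simp)
        finally show ?thesis by simp
      qed (simp add: u(3))
    next
      case False
      then show ?thesis unfolding u(3) by simp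
    qed
    ultimately show "v \<in> ?D" by blast
  qed (auto simp: norm_divide)
  then have con: "connected ?D" by (rule starlike_imp_connected)
  have eq: "?f (- \<i> / 4) = ?f (\<i> / 4)"
  proof -
    have "?f constant_on ?D" by (rule has_field_derivative_0_imp_constant_on[OF d con op])
    then obtain c where c: "\<And>z. z \<in> ?D \<Longrightarrow> ?f z = c" unfolding constant_on_def by blast
    have m: "- \<i> / 4 \<in> ?D" "\<i> / 4 \<in> ?D" by (auto simp: norm_divide)
    show ?thesis by (rule trans[OF c[OF m(1)] c[OF m(2), symmetric]])
  qed
  have ln: "Ln (\<i> / 4) = - of_real (ln 4) + \<i> * of_real (pi / 2)" "Ln (- \<i> / 4) = - of_real (ln 4) - \<i> * of_real (pi / 2)"
    "Ln (4 * \<i>) = of_real (ln 4) + \<i> * of_real (pi / 2)"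
  proof -
    have e1: "exp (complex_of_real (ln 4)) = 4" by (simp add: exp_of_real)
    have e2: "exp (- complex_of_real (ln 4)) = 1 / 4" unfolding exp_minus e1 by (simp add: inverse_eq_divide)
    have e3: "exp (\<i> * complex_of_real (pi / 2)) = \<i>" by (metis cis_conv_exp cis_pi_half)
    have e4: "exp (- (\<i> * complex_of_real (pi / 2))) = - \<i>" unfolding exp_minus e3 by simp
    show "Ln (\<i> / 4) = - of_real (ln 4) + \<i> * of_real (pi / 2)"
    proof (rule Ln_unique)
      show "exp (- complex_of_real (ln 4) + \<i> * of_real (pi / 2)) = \<i> / 4" unfolding exp_add e2 e3 by simp
    qed (use pi_gt_zero in simp_all)
    show "Ln (- \<i> / 4) = - of_real (ln 4) - \<i> * of_real (pi / 2)"
    proof (rule Ln_unique)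
      show "exp (- complex_of_real (ln 4) - \<i> * of_real (pi / 2)) = - \<i> / 4"
        unfolding diff_conv_add_uminus exp_add e2 e4 by simp
      have "- (pi / 2) \<le> pi" using pi_gt_zero by linarith
      then show "Im (- complex_of_real (ln 4) - \<i> * of_real (pi / 2)) \<le> pi" by simp
    qed (use pi_gt_zero in simp_all)
    show "Ln (4 * \<i>) = of_real (ln 4) + \<i> * of_real (pi / 2)"
    proof (rule Ln_unique)
      show "exp (complex_of_real (ln 4) + \<i> * of_real (pi / 2)) = 4 * \<i>" unfolding exp_add e1 e3 by simp
    qed (use pi_gt_zero in simp_all)
  qed
  have "- 2 * Ln (- \<i> / 4) = 2 * Ln (4 * \<i>)" unfolding ln by (simp add: ring_distribs)
  then have s1: "csqrt (- 2 * Ln (- \<i> / 4)) = sE" unfolding sE_def by (simp only:)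
  have s2: "csqrt (- 2 * Ln (\<i> / 4)) = cnj sE"
  proof -
    have "2 * Ln (4 * \<i>) \<notin> \<real>\<^sub>\<le>\<^sub>0" unfolding ln complex_nonpos_Reals_iff using pi_gt_zero by simp
    then have "cnj sE = csqrt (cnj (2 * Ln (4 * \<i>)))" unfolding sE_def by (rule cnj_csqrt)
    also have "cnj (2 * Ln (4 * \<i>)) = - 2 * Ln (\<i> / 4)" unfolding ln by (simp add: algebra_simps)
    finally show ?thesis ..
  qed
  have "PP \<tau> y sE + P (- \<i> / 4) + Ln (- \<i> / 4) = PP \<tau> y (cnj sE) + P (\<i> / 4) + Ln (\<i> / 4)"
    using eq unfolding s1 s2 .
  then have "PP \<tau> y sE - PP \<tau> y (cnj sE) = P (\<i> / 4) - P (- \<i> / 4) + (Ln (\<i> / 4) - Ln (- \<i> / 4))"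
    by (simp add: algebra_simps)
  also have "Ln (\<i> / 4) - Ln (- \<i> / 4) = \<i> * of_real pi" unfolding ln by (simp add: algebra_simps)
  finally have "PP \<tau> y sE - PP \<tau> y (cnj sE) = P (\<i> / 4) - P (- \<i> / 4) + \<i> * of_real pi" .
  then show ?thesis using P by (intro that[of P]) auto
qed

section \<open>Expansions at the saddle and the rescaled integral\<close>

lemma series_remainder:
  fixes z :: complex
  assumes c: "\<And>k. \<bar>c k\<bar> \<le> (1::real)" and s: "(\<lambda>k. of_real (c k) * z ^ Suc k) sums f" and z: "norm z \<le> 1 / 4"
  shows "norm (f - (\<Sum>k<n. of_real (c k) * z ^ Suc k)) \<le> 2 * norm z ^ Suc n"
proof -
  let ?f = "\<lambda>k. of_real (c k) * z ^ Suc k"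
  have s': "(\<lambda>k. ?f (k + n)) sums (f - (\<Sum>k<n. ?f k))" by (rule sums_split_initial_segment[OF s])
  have bk: "norm (?f (k + n)) \<le> norm z ^ Suc n * (1 / 4) ^ k" for k
  proof -
    have "norm (?f (k + n)) = \<bar>c (k + n)\<bar> * (norm z ^ Suc n * norm z ^ k)"
      by (simp add: norm_mult norm_power power_add)
    also have "\<dots> \<le> 1 * (norm z ^ Suc n * (1 / 4) ^ k)"
      using c z by (intro mult_mono power_mono) auto
    finally show ?thesis by simp
  qed
  have g: "(\<lambda>k. norm z ^ Suc n * (1 / 4) ^ k) sums (norm z ^ Suc n * (1 / (1 - 1 / 4)))"
    by (intro sums_mult geometric_sums) simp
  have "norm (\<Sum>k. ?f (k + n)) \<le> (\<Sum>k. norm z ^ Suc n * (1 / 4) ^ k)"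
    by (rule norm_suminf_le[OF bk sums_summable[OF g]])
  also have "\<dots> = norm z ^ Suc n * (1 / (1 - 1 / 4))" using g by (simp only: sums_iff)
  also have "\<dots> \<le> norm z ^ Suc n * 2" by (intro mult_left_mono) auto
  finally show ?thesis using s' by (simp add: sums_iff mult.commute del: power_Suc)
qed

definition q2pi :: real where "q2pi = sqrt (2 * pi)"

lemma q2pi: "q2pi \<ge> 1" "q2pi > 0"
proof -
  show "q2pi \<ge> 1" unfolding q2pi_def using pi_gt3 by (intro real_le_rsqrt) simp
  then show "q2pi > 0" by linarith
qed

text \<open>\<open>series_remainder\<close> with n = 0, 1, 2. As the first coefficient of the
  difference vanishes, A2 - A1 is already of second order with n = 1.\<close>

lemma A_expansions:
  assumes z: "norm z \<le> 1 / 4"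
  shows "norm (of_real q2pi * A1 z + z) \<le> 2 * (norm z)\<^sup>2" "norm (A1 z) \<le> 2 * norm z"
    and "norm (of_real q2pi * (A2 z - A1 z) - of_real (cdiff 1) * z\<^sup>2) \<le> 2 * norm z ^ 3" "norm (A2 z - A1 z) \<le> 2 * (norm z)\<^sup>2"
proof -
  have z1: "norm z < 1" using z by simp
  have div_q: "norm w \<le> r" if "norm (of_real q2pi * w) \<le> r" for w :: complex and r
  proof -
    have "1 * norm w \<le> q2pi * norm w" using q2pi by (intro mult_right_mono) auto
    then show ?thesis using that q2pi by (simp add: norm_mult)
  qed
  have s1: "(\<lambda>k. of_real (- (1 / real (Suc k) powr (3 / 2))) * z ^ Suc k) sums (of_real q2pi * A1 z)"
  proof -
    have "(\<lambda>k. - (z ^ Suc k / complex_of_real (real (Suc k) powr (3 / 2)))) sums (- polylog (3 / 2) z)"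
      by (intro sums_minus polylog_sums z1) simp
    moreover have "- polylog (3 / 2) z = of_real q2pi * A1 z" using q2pi(2) by (simp add: A1_def q2pi_def)
    ultimately show ?thesis by simp
  qed
  have c1: "\<bar>- (1 / real (Suc k) powr (3 / 2))\<bar> \<le> 1" for k
    using ge_one_powr_ge_zero[of "real (Suc k)" "3 / 2"] by simp
  have c2: "\<bar>cdiff k\<bar> \<le> 1" for k using cdiff_bounds[of k] c1[of k] by linarith
  note s2 = cdiff_sums[OF z1, folded q2pi_def]
  show "norm (of_real q2pi * A1 z + z) \<le> 2 * (norm z)\<^sup>2"
    using series_remainder[OF c1 s1 z, of 1] by (simp add: power2_eq_square)
  show "norm (A1 z) \<le> 2 * norm z"
    using series_remainder[OF c1 s1 z, of 0] by - (rule div_q, simp)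
  show "norm (of_real q2pi * (A2 z - A1 z) - of_real (cdiff 1) * z\<^sup>2) \<le> 2 * norm z ^ 3"
  proof -
    have "(\<Sum>k<2. of_real (cdiff k) * z ^ Suc k) = of_real (cdiff 1) * z\<^sup>2" by (simp add: numeral_2_eq_2)
    moreover have "Suc 2 = 3" by simp
    ultimately show ?thesis using series_remainder[OF c2 s2 z, of 2] by (simp only:)
  qed
  show "norm (A2 z - A1 z) \<le> 2 * (norm z)\<^sup>2"
    using series_remainder[OF c2 s2 z, of 1] by - (rule div_q, simp add: power2_eq_square)
qed

lemma B_Lipschitz:
  obtains K where "K \<ge> 0" "\<And>z. norm z \<le> 1 / 4 \<Longrightarrow> norm (B z) \<le> K * norm z"
proof -
  have "deriv B holomorphic_on ball 0 1" by (rule holomorphic_deriv[OF holomorphic_B open_ball])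
  then obtain K where K: "K \<ge> 0" "\<And>z. norm z \<le> 1 / 4 \<Longrightarrow> norm (deriv B z) \<le> K"
    using bounded_on_cball_unit[of "deriv B" "1 / 4"] by auto
  have "norm (B z - B 0) \<le> K * norm (z - 0)" if "norm z \<le> 1 / 4" for z
  proof (rule field_differentiable_bound[where S="cball 0 (1 / 4)" and f'="deriv B"])
    show "(B has_field_derivative deriv B z) (at z within cball 0 (1 / 4))" if "z \<in> cball 0 (1 / 4)" for z
      by (rule has_field_derivative_at_within[OF holomorphic_derivI[OF holomorphic_B open_ball]]) (use that in auto)
  qed (use that K in auto)
  then show ?thesis using that[OF K(1)] by simp
qed

text \<open>The mean value bound on a half plane. It turns a difference of exponentials into a
  difference of exponents, which vanishes at the saddle and so compensates the factor 1 / t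
  there.\<close>

lemma norm_exp_diff_le:
  assumes "Re p \<le> m" "Re q \<le> m"
  shows "norm (exp p - exp q) \<le> exp m * norm (p - q)"
proof (rule field_differentiable_bound[where S="{z. Re z \<le> m}" and f'=exp])
  show "convex {z. Re z \<le> m}" by (rule convex_halfspace_Re_le)
  show "(exp has_field_derivative exp z) (at z within {z. Re z \<le> m})" for z
    by (rule has_field_derivative_at_within[OF DERIV_exp])
qed (use assms in auto)

text \<open>The exponent of \<open>expE\<close>, arranged by powers of \<open>\<tau>\<close>: near 0 it is about
  \<open>\<tau> cdiff 1 z\<^sup>2 - y sqrt \<tau> z\<close>, up to the factor \<open>1 / sqrt (2 \<pi>)\<close>, so \<open>z\<close> has scale \<open>1 / sqrt \<tau>\<close>.\<close>

definition expo :: "real \<Rightarrow> real \<Rightarrow> complex \<Rightarrow> complex" where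
  "expo \<tau> y z = of_real \<tau> * (A2 z - A1 z) + of_real (y * sqrt \<tau>) * A1 z + 2 * B z"

lemma expE_expo: "expE \<tau> y z = exp (expo \<tau> y z)"
  by (simp add: expE_def expo_def algebra_simps)

text \<open>On the rescaled imaginary axis the first bound provides the Gaussian majorant, the
  second the vanishing of the exponent at T = 0, and the third the pointwise limit with rate 1 /
  sqrt \<tau>.\<close>

lemma expo_scaled:
  assumes K: "K \<ge> 0" "\<And>z. norm z \<le> 1 / 4 \<Longrightarrow> norm (B z) \<le> K * norm z"
    and \<tau>: "\<tau> \<ge> 1" "sqrt \<tau> \<ge> 400 * \<bar>y\<bar>" and T: "\<bar>T\<bar> / sqrt \<tau> \<le> 1 / 4"
  defines "z \<equiv> \<i> * of_real (T / sqrt \<tau>)"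
  shows "Re (expo \<tau> y z) \<le> K - T\<^sup>2 / 100"
    and "norm (expo \<tau> y z) \<le> 2 * T\<^sup>2 + 2 * \<bar>y\<bar> * \<bar>T\<bar> + 2 * K * \<bar>T\<bar>"
    and "norm (expo \<tau> y z - (of_real (- (cdiff 1 / q2pi * T\<^sup>2)) - \<i> * of_real (y * T / q2pi)))
      \<le> (2 * \<bar>T\<bar> ^ 3 + 2 * \<bar>y\<bar> * T\<^sup>2 + 2 * K * \<bar>T\<bar>) / sqrt \<tau>"
proof -
  let ?r = "sqrt \<tau>"
  have r: "?r \<ge> 1" "?r > 0" "?r * ?r = \<tau>" using \<tau> by auto
  have nz: "norm z = \<bar>T\<bar> / ?r" unfolding z_def norm_mult norm_of_real using r(2) by simp
  have z4: "norm z \<le> 1 / 4" unfolding nz by (rule T)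
  have nz2: "(norm z)\<^sup>2 = T\<^sup>2 / \<tau>" unfolding nz using r \<tau> by (simp add: power_divide)
  have nz3: "norm z ^ 3 = \<bar>T\<bar> ^ 3 / (\<tau> * ?r)"
    unfolding nz using r(3) by (simp add: power_divide power3_eq_cube)
  have z2: "z\<^sup>2 = - of_real (T\<^sup>2 / \<tau>)"
    unfolding z_def using \<tau> by (simp add: power_mult_distrib power_divide flip: of_real_power)
  note E = A_expansions[OF z4]
  have \<tau>2: "\<tau> * (T\<^sup>2 / \<tau>) = T\<^sup>2" using \<tau> by simp
  have B': "norm (2 * B z) \<le> 2 * K * \<bar>T\<bar> / ?r" using K(2)[OF z4] unfolding nz by (simp add: norm_mult)
  have B'': "norm (2 * B z) \<le> 2 * K * \<bar>T\<bar>"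
    using B' r K(1) by (smt (verit) divide_le_eq_1_pos frac_le mult_nonneg_nonneg abs_ge_zero div_by_1 zero_le_mult_iff)
  have n1: "norm (of_real \<tau> * (A2 z - A1 z)) \<le> 2 * T\<^sup>2"
  proof -
    have "norm (of_real \<tau> * (A2 z - A1 z)) \<le> \<tau> * (2 * (norm z)\<^sup>2)"
      unfolding norm_mult norm_of_real using E(4) \<tau> by (intro mult_mono) auto
    also have "\<dots> = 2 * T\<^sup>2" unfolding nz2 using \<tau> by simp
    finally show ?thesis .
  qed
  have n2: "norm (of_real (y * ?r) * A1 z) \<le> 2 * \<bar>y\<bar> * \<bar>T\<bar>"
  proof -
    have "norm (of_real (y * ?r) * A1 z) \<le> \<bar>y * ?r\<bar> * (2 * norm z)"
      unfolding norm_mult norm_of_real using E(2) by (intro mult_left_mono) auto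
    also have "\<dots> = 2 * \<bar>y\<bar> * \<bar>T\<bar>" unfolding nz using r by (simp add: abs_mult)
    finally show ?thesis .
  qed
  show "norm (expo \<tau> y z) \<le> 2 * T\<^sup>2 + 2 * \<bar>y\<bar> * \<bar>T\<bar> + 2 * K * \<bar>T\<bar>"
    unfolding expo_def by (intro norm_triangle_le add_mono n1 n2 B'')
  show "Re (expo \<tau> y z) \<le> K - T\<^sup>2 / 100"
  proof -
    have "T\<^sup>2 / \<tau> \<ge> 0" using \<tau> by simp
    moreover have "Re (z\<^sup>2) = - (T\<^sup>2 / \<tau>)" unfolding z2 by simp
    ultimately have "Re (z\<^sup>2) \<le> - (15 / 17) * (norm z)\<^sup>2" unfolding nz2 by linarith
    then have "Re (A2 z - A1 z) \<le> - (norm z)\<^sup>2 / 50" by (rule Re_A2_minus_A1_le[OF z4])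
    then have "\<tau> * Re (A2 z - A1 z) \<le> \<tau> * (- (norm z)\<^sup>2 / 50)" using \<tau> by (intro mult_left_mono) auto
    then have a: "\<tau> * Re (A2 z - A1 z) \<le> - (T\<^sup>2 / 50)" unfolding nz2 using \<tau> by simp
    \<comment> \<open>As z is purely imaginary, the linear term of \<open>A1\<close> has no real
      part, so Re A1 is of order |z|^2. With sqrt \<tau> \<ge> 400 |y| its contribution is at most
      T^2 / 200, which the Gaussian term - T^2 / 50 absorbs.\<close>
    have "\<bar>Re (of_real q2pi * A1 z + z)\<bar> \<le> 2 * (norm z)\<^sup>2" using abs_Re_le_cmod E(1) by (rule order.trans)
    then have "\<bar>q2pi * Re (A1 z)\<bar> \<le> 2 * (norm z)\<^sup>2" by (simp add: z_def)
    moreover have "1 * \<bar>Re (A1 z)\<bar> \<le> q2pi * \<bar>Re (A1 z)\<bar>" using q2pi by (intro mult_right_mono) auto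
    ultimately have "\<bar>Re (A1 z)\<bar> \<le> 2 * (norm z)\<^sup>2" using q2pi by (simp add: abs_mult)
    then have "\<bar>y\<bar> * ?r * \<bar>Re (A1 z)\<bar> \<le> \<bar>y\<bar> * ?r * (2 * (norm z)\<^sup>2)" using r by (intro mult_left_mono) auto
    also have "\<dots> \<le> (?r / 400) * ?r * (2 * (norm z)\<^sup>2)" using \<tau>(2) r by (intro mult_right_mono) auto
    also have "\<dots> = \<tau> * (norm z)\<^sup>2 / 200" using r(3) by (simp add: field_simps)
    also have "\<dots> = T\<^sup>2 / 200" unfolding nz2 using \<tau> by simp
    finally have "\<bar>y\<bar> * ?r * \<bar>Re (A1 z)\<bar> \<le> T\<^sup>2 / 200" .
    moreover have "\<bar>y * ?r * Re (A1 z)\<bar> = \<bar>y\<bar> * ?r * \<bar>Re (A1 z)\<bar>" unfolding abs_mult using r by simp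
    ultimately have "y * ?r * Re (A1 z) \<le> T\<^sup>2 / 200" by linarith
    moreover have "2 * Re (B z) \<le> K"
    proof -
      have "Re (B z) \<le> K * norm z" using complex_Re_le_cmod K(2)[OF z4] by (rule order.trans)
      also have "\<dots> \<le> K * (1 / 4)" using z4 K(1) by (rule mult_left_mono)
      finally show ?thesis using K(1) by simp
    qed
    moreover have "Re (expo \<tau> y z) = \<tau> * Re (A2 z - A1 z) + y * ?r * Re (A1 z) + 2 * Re (B z)"
      by (simp add: expo_def)
    ultimately show ?thesis using a zero_le_power2[of T] by linarith
  qed
  have e1: "norm (of_real \<tau> * (A2 z - A1 z) - of_real (- (cdiff 1 / q2pi * T\<^sup>2))) \<le> 2 * \<bar>T\<bar> ^ 3 / ?r"
  proof -
    have "of_real \<tau> * (A2 z - A1 z) - of_real (- (cdiff 1 / q2pi * T\<^sup>2)) = of_real (\<tau> / q2pi) * (of_real q2pi * (A2 z - A1 z) - of_real (cdiff 1) * z\<^sup>2)"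
      unfolding z2 using q2pi(2) \<tau> by (simp add: field_simps)
    then have "norm (of_real \<tau> * (A2 z - A1 z) - of_real (- (cdiff 1 / q2pi * T\<^sup>2))) = \<bar>\<tau> / q2pi\<bar> * norm (of_real q2pi * (A2 z - A1 z) - of_real (cdiff 1) * z\<^sup>2)"
      by (simp only: norm_mult norm_of_real)
    also have "\<dots> \<le> \<bar>\<tau> / q2pi\<bar> * (2 * norm z ^ 3)" by (rule mult_left_mono[OF E(3)]) simp
    also have "\<dots> \<le> \<tau> * (2 * norm z ^ 3)"
      using q2pi \<tau> by (intro mult_right_mono) (auto simp: abs_divide divide_le_eq mult_le_cancel_left1 intro!: mult_nonneg_nonneg)
    also have "\<dots> = 2 * \<bar>T\<bar> ^ 3 / ?r" unfolding nz3 using \<tau> by simp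
    finally show ?thesis .
  qed
  have e2: "norm (of_real (y * ?r) * A1 z - (- (\<i> * of_real (y * T / q2pi)))) \<le> 2 * \<bar>y\<bar> * T\<^sup>2 / ?r"
  proof -
    have "of_real (y * ?r) * A1 z - (- (\<i> * of_real (y * T / q2pi))) = of_real (y * ?r / q2pi) * (of_real q2pi * A1 z + z)"
      unfolding z_def using q2pi(2) r by (simp add: field_simps)
    then have "norm (of_real (y * ?r) * A1 z - (- (\<i> * of_real (y * T / q2pi)))) = \<bar>y * ?r / q2pi\<bar> * norm (of_real q2pi * A1 z + z)"
      by (simp only: norm_mult norm_of_real)
    also have "\<dots> \<le> \<bar>y * ?r / q2pi\<bar> * (2 * (norm z)\<^sup>2)" by (rule mult_left_mono[OF E(1)]) simp
    also have "\<dots> \<le> (\<bar>y\<bar> * ?r) * (2 * (norm z)\<^sup>2)"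
    proof (rule mult_right_mono)
      have "\<bar>y\<bar> * ?r / q2pi \<le> \<bar>y\<bar> * ?r / 1" using q2pi r by (intro divide_left_mono) auto
      then show "\<bar>y * ?r / q2pi\<bar> \<le> \<bar>y\<bar> * ?r" using q2pi r by (simp add: abs_mult abs_divide)
    qed simp
    also have "\<dots> = 2 * \<bar>y\<bar> * T\<^sup>2 / ?r"
    proof -
      have "?r / \<tau> = 1 / ?r" using r by (metis divide_divide_eq_left divide_self_if less_irrefl)
      then have "\<bar>y\<bar> * ?r * (2 * (T\<^sup>2 / \<tau>)) = 2 * \<bar>y\<bar> * T\<^sup>2 * (1 / ?r)" by (metis (no_types, opaque_lifting) mult.commute mult.assoc times_divide_eq_right)
      then show ?thesis unfolding nz2 by simp
    qed
    finally show ?thesis .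
  qed
  have "expo \<tau> y z - (of_real (- (cdiff 1 / q2pi * T\<^sup>2)) - \<i> * of_real (y * T / q2pi))
    = (of_real \<tau> * (A2 z - A1 z) - of_real (- (cdiff 1 / q2pi * T\<^sup>2))) + (of_real (y * ?r) * A1 z - (- (\<i> * of_real (y * T / q2pi)))) + 2 * B z"
    by (simp add: expo_def)
  also have "norm \<dots> \<le> 2 * \<bar>T\<bar> ^ 3 / ?r + 2 * \<bar>y\<bar> * T\<^sup>2 / ?r + 2 * K * \<bar>T\<bar> / ?r"
    by (intro norm_triangle_le add_mono e1 e2 B')
  finally show "norm (expo \<tau> y z - (of_real (- (cdiff 1 / q2pi * T\<^sup>2)) - \<i> * of_real (y * T / q2pi)))
      \<le> (2 * \<bar>T\<bar> ^ 3 + 2 * \<bar>y\<bar> * T\<^sup>2 + 2 * K * \<bar>T\<bar>) / ?r"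
    by (simp only: add_divide_distrib)
qed

text \<open>P (i / 4) - P (- i / 4) is written as an integral over both halves of the segment,
  folded onto t > 0. In the fold the subtracted 1 cancels, which realises the principal value. At t
  = 0 only continuity of the primitive is used, by the interior form of the fundamental
  theorem.\<close>

lemma saddle_integral:
  assumes "\<tau> > 0" "\<kappa> > 0"
  shows "((\<lambda>t. (expE \<tau> y (\<i> * of_real (\<kappa> * t / sqrt \<tau>)) - expE \<tau> y (\<i> * of_real (- (\<kappa> * t) / sqrt \<tau>))) / of_real t)
      has_integral (PP \<tau> y sE - PP \<tau> y (cnj sE) - \<i> * of_real pi)) {0..sqrt \<tau> / (4 * \<kappa>)}"
proof -
  obtain P where P: "\<And>z. norm z < 1 \<Longrightarrow> P field_differentiable (at z)"
    "\<And>z. norm z < 1 \<Longrightarrow> z \<noteq> 0 \<Longrightarrow> (P has_field_derivative (expE \<tau> y z - 1) / z) (at z)"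
    "PP \<tau> y sE - PP \<tau> y (cnj sE) = P (\<i> / 4) - P (- \<i> / 4) + \<i> * of_real pi"
    by (rule PP_sE_diff) (rule that; (assumption | simp))
  define k where "k = \<kappa> / sqrt \<tau>"
  define c where "c = sqrt \<tau> / (4 * \<kappa>)"
  have k0: "k > 0" and c0: "c > 0" and kc: "k * c = 1 / 4" using assms by (simp_all add: k_def c_def)
  let ?z = "\<lambda>\<sigma> t. \<i> * of_real (\<sigma> * k * t)"
  let ?T = "\<lambda>t. P (?z 1 t) - P (?z (- 1) t)"
  have nz: "norm (?z \<sigma> t) < 1" if "\<bar>\<sigma>\<bar> = 1" "t \<in> {0..c}" for \<sigma> t
  proof -
    have "\<bar>\<sigma> * k * t\<bar> = k * t" using that k0 by (simp add: abs_mult)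
    also have "\<dots> \<le> k * c" using that k0 by (intro mult_left_mono) auto
    finally show ?thesis using kc unfolding norm_mult norm_of_real by simp
  qed
  have "((\<lambda>t. (expE \<tau> y (?z 1 t) - 1) / of_real t - (expE \<tau> y (?z (- 1) t) - 1) / of_real t) has_integral ?T c - ?T 0) {0..c}"
  proof (rule fundamental_theorem_of_calculus_interior)
    have cP: "continuous_on (ball 0 1) P"
      using P(1) by (intro continuous_at_imp_continuous_on ballI field_differentiable_imp_continuous_at) auto
    show "continuous_on {0..c} ?T"
      by (intro continuous_intros continuous_on_compose2[OF cP]) (use nz[of 1] nz[of "- 1"] in auto)
    fix t assume t: "t \<in> {0<..<c}"
    have d: "((\<lambda>t. P (?z \<sigma> t)) has_vector_derivative (expE \<tau> y (?z \<sigma> t) - 1) / of_real t) (at t)" if \<sigma>: "\<bar>\<sigma>\<bar> = 1" for \<sigma>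
    proof -
      have z0: "?z \<sigma> t \<noteq> 0" using t k0 \<sigma> by auto
      have "(?z \<sigma> has_vector_derivative \<i> * of_real (\<sigma> * k)) (at t)"
        by (intro has_vector_derivative_mult_right has_vector_derivative_of_real) (auto intro!: derivative_eq_intros)
      from field_vector_diff_chain_at[OF this P(2)[OF nz[OF \<sigma>] z0]] t
      have "((\<lambda>t. P (?z \<sigma> t)) has_vector_derivative \<i> * of_real (\<sigma> * k) * ((expE \<tau> y (?z \<sigma> t) - 1) / ?z \<sigma> t)) (at t)"
        by (simp add: o_def)
      moreover have "\<i> * of_real (\<sigma> * k) * ((expE \<tau> y (?z \<sigma> t) - 1) / ?z \<sigma> t) = (expE \<tau> y (?z \<sigma> t) - 1) / of_real t"
      proof -
        have "complex_of_real (\<sigma> * k) \<noteq> 0" using \<sigma> k0 by auto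
        then show ?thesis unfolding of_real_mult[of "\<sigma> * k" t] by simp
      qed
      ultimately show ?thesis by (simp only:)
    qed
    show "(?T has_vector_derivative (expE \<tau> y (?z 1 t) - 1) / of_real t - (expE \<tau> y (?z (- 1) t) - 1) / of_real t) (at t)"
      by (intro has_vector_derivative_diff d) auto
  qed (use c0 in simp)
  moreover have "?T c - ?T 0 = PP \<tau> y sE - PP \<tau> y (cnj sE) - \<i> * of_real pi"
  proof -
    have a: "1 * k * c = 1 / 4" "- 1 * k * c = - (1 / 4)" using kc by simp_all
    show ?thesis unfolding P(3) a by simp
  qed
  moreover have "(expE \<tau> y (?z 1 t) - 1) / of_real t - (expE \<tau> y (?z (- 1) t) - 1) / of_real t
     = (expE \<tau> y (\<i> * of_real (\<kappa> * t / sqrt \<tau>)) - expE \<tau> y (\<i> * of_real (- (\<kappa> * t) / sqrt \<tau>))) / of_real t" for t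
    by (simp add: k_def diff_divide_distrib)
  ultimately show ?thesis unfolding c_def by (simp only:)
qed

text \<open>The first condition on \<kappa> normalises the quadratic term to - t^2 / 2, and
  \<open>b\<close> is the resulting slope of the oscillating term. Dominated convergence applies on
  the whole line: an indicator hides the growing interval, and the majorant is integrable near 0
  because the two exponents agree at t = 0.\<close>

lemma saddle_limit:
  assumes \<kappa>: "\<kappa> > 0" "cdiff 1 / q2pi * \<kappa>\<^sup>2 = 1 / 2" and b: "b = y * \<kappa> / q2pi"
  defines "f \<equiv> \<lambda>t::real. sin (b * t) * exp (- (t\<^sup>2 / 2)) / t"
  shows "integrable lborel (\<lambda>t. indicator {0<..} t *\<^sub>R f t)"
    and "((\<lambda>\<tau>. PP \<tau> y sE - PP \<tau> y (cnj sE) - \<i> * of_real pi) \<longlongrightarrow> - 2 * \<i> * of_real (\<integral>t. indicator {0<..} t *\<^sub>R f t \<partial>lborel)) at_top"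
proof -
  obtain K where K: "K \<ge> 0" "\<And>z. norm z \<le> 1 / 4 \<Longrightarrow> norm (B z) \<le> K * norm z" by (rule B_Lipschitz) blast
  let ?z = "\<lambda>\<tau> T. \<i> * of_real (T / sqrt \<tau>)"
  let ?h = "\<lambda>\<tau> t. (expE \<tau> y (?z \<tau> (\<kappa> * t)) - expE \<tau> y (?z \<tau> (- (\<kappa> * t)))) / of_real t"
  let ?c = "\<lambda>\<tau>. sqrt \<tau> / (4 * \<kappa>)"
  let ?s = "\<lambda>\<tau> t. indicator {0<..?c \<tau>} t *\<^sub>R ?h \<tau> t"
  let ?f = "\<lambda>t. - 2 * \<i> * of_real (indicator {0<..} t *\<^sub>R f t)"
  define C where "C = 4 * exp K * (\<kappa>\<^sup>2 + \<bar>y\<bar> * \<kappa> + K * \<kappa>)"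
  let ?w = "\<lambda>t. C * (t ^ (2 * 0) * exp (- (\<kappa>\<^sup>2 / 50 * t\<^sup>2 / 2)) + t ^ (2 * 1) * exp (- (\<kappa>\<^sup>2 / 50 * t\<^sup>2 / 2)))"
  have C0: "C \<ge> 0" using \<kappa> K unfolding C_def by (intro mult_nonneg_nonneg add_nonneg_nonneg) auto
  have w: "integrable lborel ?w"
  proof -
    have "has_bochner_integral lborel ?w (C * (gmoment 0 / (\<kappa>\<^sup>2 / 50) powr (real 0 + 1 / 2) + gmoment 1 / (\<kappa>\<^sup>2 / 50) powr (real 1 + 1 / 2)))"
      using \<kappa> by (intro has_bochner_integral_mult_right has_bochner_integral_add gaussian_moment) auto
    then show ?thesis by (simp only: has_bochner_integral_iff)
  qed
  have inside: "\<bar>\<sigma> * (\<kappa> * t)\<bar> / sqrt \<tau> \<le> 1 / 4" if "t \<in> {0<..?c \<tau>}" "\<tau> \<ge> 1" "\<bar>\<sigma>\<bar> = 1" for \<sigma> t \<tau>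
  proof -
    have "\<bar>\<sigma> * (\<kappa> * t)\<bar> = \<kappa> * t" using that \<kappa> by (simp add: abs_mult)
    also have "\<dots> \<le> \<kappa> * ?c \<tau>" using that \<kappa> by (intro mult_left_mono) auto
    also have "\<dots> = sqrt \<tau> / 4" using \<kappa> by simp
    finally have "\<bar>\<sigma> * (\<kappa> * t)\<bar> / sqrt \<tau> \<le> sqrt \<tau> / 4 / sqrt \<tau>" using that by (intro divide_right_mono) auto
    then show ?thesis using that by simp
  qed
  have bound: "norm (?s \<tau> t) \<le> ?w t" if \<tau>: "\<tau> \<ge> 1" "sqrt \<tau> \<ge> 400 * \<bar>y\<bar>" for \<tau> t
  proof (cases "t \<in> {0<..?c \<tau>}")
    case True
    let ?T = "\<kappa> * t"
    have t0: "t > 0" using True by simp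
    have T0: "?T > 0" using t0 \<kappa> by simp
    have T1: "\<bar>?T\<bar> / sqrt \<tau> \<le> 1 / 4" "\<bar>- ?T\<bar> / sqrt \<tau> \<le> 1 / 4" using inside[OF True \<tau>(1), of 1] by simp_all
    note e1 = expo_scaled[OF K \<tau> T1(1)] and e2 = expo_scaled[OF K \<tau> T1(2)]
    have m: "Re (expo \<tau> y (?z \<tau> (- ?T))) \<le> K - ?T\<^sup>2 / 100" using e2(1) by simp
    have "norm (expo \<tau> y (?z \<tau> ?T) - expo \<tau> y (?z \<tau> (- ?T))) \<le> 2 * (2 * ?T\<^sup>2 + 2 * \<bar>y\<bar> * ?T + 2 * K * ?T)"
      using norm_triangle_ineq4[of "expo \<tau> y (?z \<tau> ?T)" "expo \<tau> y (?z \<tau> (- ?T))"] e1(2) e2(2) T0 by simp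
    then have "norm (exp (expo \<tau> y (?z \<tau> ?T)) - exp (expo \<tau> y (?z \<tau> (- ?T)))) \<le> exp (K - ?T\<^sup>2 / 100) * (2 * (2 * ?T\<^sup>2 + 2 * \<bar>y\<bar> * ?T + 2 * K * ?T))"
      using norm_exp_diff_le[OF e1(1) m] by (meson exp_ge_zero mult_left_mono order.trans)
    then have "norm (?h \<tau> t) \<le> exp (K - ?T\<^sup>2 / 100) * (2 * (2 * ?T\<^sup>2 + 2 * \<bar>y\<bar> * ?T + 2 * K * ?T)) / t"
      unfolding expE_expo norm_divide norm_of_real using t0 by (simp add: divide_right_mono)
    also have "\<dots> = exp (K - ?T\<^sup>2 / 100) * (4 * (\<kappa>\<^sup>2 * t + \<bar>y\<bar> * \<kappa> + K * \<kappa>))"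
      using t0 by (simp add: power2_eq_square field_simps)
    also have "\<dots> \<le> exp (K - ?T\<^sup>2 / 100) * (4 * ((\<kappa>\<^sup>2 + \<bar>y\<bar> * \<kappa> + K * \<kappa>) * (1 + t\<^sup>2)))"
    proof (intro mult_left_mono)
      have "0 \<le> (2 * t - 1)\<^sup>2" by simp
      then have tt: "t \<le> 1 + t\<^sup>2" by (simp add: power2_eq_square algebra_simps)
      have "\<kappa>\<^sup>2 * t \<le> \<kappa>\<^sup>2 * (1 + t\<^sup>2)" using tt by (intro mult_left_mono) auto
      moreover have "(\<bar>y\<bar> * \<kappa> + K * \<kappa>) * 1 \<le> (\<bar>y\<bar> * \<kappa> + K * \<kappa>) * (1 + t\<^sup>2)"
        using \<kappa> K by (intro mult_left_mono add_nonneg_nonneg mult_nonneg_nonneg) auto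
      ultimately show "\<kappa>\<^sup>2 * t + \<bar>y\<bar> * \<kappa> + K * \<kappa> \<le> (\<kappa>\<^sup>2 + \<bar>y\<bar> * \<kappa> + K * \<kappa>) * (1 + t\<^sup>2)" by (simp add: algebra_simps)
    qed auto
    also have "exp (K - ?T\<^sup>2 / 100) = exp K * exp (- (\<kappa>\<^sup>2 / 50 * t\<^sup>2 / 2))"
      unfolding exp_add[symmetric] by (simp add: power_mult_distrib)
    also have "exp K * exp (- (\<kappa>\<^sup>2 / 50 * t\<^sup>2 / 2)) * (4 * ((\<kappa>\<^sup>2 + \<bar>y\<bar> * \<kappa> + K * \<kappa>) * (1 + t\<^sup>2))) = ?w t"
      unfolding C_def by (simp add: algebra_simps power2_eq_square)
    finally show ?thesis using True by simp
  next
    case False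
    have "0 \<le> ?w t" using C0 by (intro mult_nonneg_nonneg add_nonneg_nonneg) auto
    then show ?thesis using False by simp
  qed
  have meas: "?s \<tau> \<in> borel_measurable lborel" if \<tau>: "\<tau> \<ge> 1" for \<tau>
  proof -
    have cE: "continuous_on (ball 0 1) (expE \<tau> y)" by (rule holomorphic_on_imp_continuous_on[OF holomorphic_expE])
    have n: "norm (?z \<tau> (\<sigma> * (\<kappa> * t))) < 1" if "t \<in> {0<..?c \<tau>}" "\<bar>\<sigma>\<bar> = 1" for \<sigma> t
    proof -
      have "norm (?z \<tau> (\<sigma> * (\<kappa> * t))) = \<bar>\<sigma> * (\<kappa> * t)\<bar> / sqrt \<tau>"
        unfolding norm_mult[of \<i>] norm_of_real abs_divide[of "\<sigma> * (\<kappa> * t)"] using \<tau> by simp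
      then show ?thesis using inside[OF that(1) \<tau> that(2)] by linarith
    qed
    have "continuous_on {0<..?c \<tau>} (?h \<tau>)"
      using n[of _ 1] n[of _ "- 1"] \<tau> by (intro continuous_intros continuous_on_compose2[OF cE]) auto
    then show ?thesis by (simp add: borel_measurable_continuous_on_indicator)
  qed
  have lim: "((\<lambda>\<tau>. ?s \<tau> t) \<longlongrightarrow> ?f t) at_top" for t
  proof (cases "t > 0")
    case True
    have ev: "\<forall>\<^sub>F \<tau> in at_top. \<tau> \<ge> 1 \<and> sqrt \<tau> \<ge> 400 * \<bar>y\<bar> \<and> t \<le> ?c \<tau>"
    proof -
      have s: "filterlim sqrt at_top at_top" by (rule sqrt_at_top)
      have "\<forall>\<^sub>F \<tau> in at_top. sqrt \<tau> \<ge> 400 * \<bar>y\<bar>" "\<forall>\<^sub>F \<tau> in at_top. sqrt \<tau> \<ge> t * (4 * \<kappa>)"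
        using s unfolding filterlim_at_top by blast+
      then show ?thesis using eventually_ge_at_top[of "1::real"]
        by eventually_elim (use \<kappa> in \<open>simp add: le_divide_eq\<close>)
    qed
    have ex: "((\<lambda>\<tau>. expE \<tau> y (?z \<tau> (\<sigma> * (\<kappa> * t)))) \<longlongrightarrow> exp (of_real (- (t\<^sup>2 / 2)) - \<i> * of_real (\<sigma> * (b * t)))) at_top" if \<sigma>: "\<bar>\<sigma>\<bar> = 1" for \<sigma>
      unfolding expE_expo
    proof (rule tendsto_exp)
      let ?T = "\<sigma> * (\<kappa> * t)"
      let ?L = "of_real (- (cdiff 1 / q2pi * ?T\<^sup>2)) - \<i> * of_real (y * ?T / q2pi)"
      have "((\<lambda>\<tau>. expo \<tau> y (?z \<tau> ?T) - ?L) \<longlongrightarrow> 0) at_top"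
      proof (rule Lim_null_comparison)
        show "\<forall>\<^sub>F \<tau> in at_top. norm (expo \<tau> y (?z \<tau> ?T) - ?L) \<le> (2 * \<bar>?T\<bar> ^ 3 + 2 * \<bar>y\<bar> * ?T\<^sup>2 + 2 * K * \<bar>?T\<bar>) / sqrt \<tau>"
          using ev
        proof eventually_elim
          case (elim \<tau>)
          then show ?case using expo_scaled(3)[OF K, of \<tau> y ?T] inside[of t \<tau> \<sigma>] \<sigma> True by simp
        qed
        show "((\<lambda>\<tau>. (2 * \<bar>?T\<bar> ^ 3 + 2 * \<bar>y\<bar> * ?T\<^sup>2 + 2 * K * \<bar>?T\<bar>) / sqrt \<tau>) \<longlongrightarrow> 0) at_top"
          by (rule tendsto_divide_0[OF tendsto_const filterlim_at_top_imp_at_infinity[OF sqrt_at_top]])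
      qed
      then have "((\<lambda>\<tau>. expo \<tau> y (?z \<tau> ?T)) \<longlongrightarrow> ?L) at_top" by (simp add: LIM_zero_iff)
      moreover have "?L = of_real (- (t\<^sup>2 / 2)) - \<i> * of_real (\<sigma> * (b * t))"
      proof -
        have "\<sigma>\<^sup>2 = 1" using \<sigma> by (metis power2_abs one_power2)
        then have "cdiff 1 / q2pi * ?T\<^sup>2 = (cdiff 1 / q2pi * \<kappa>\<^sup>2) * t\<^sup>2" by (simp add: power_mult_distrib)
        then have e1: "cdiff 1 / q2pi * ?T\<^sup>2 = t\<^sup>2 / 2" unfolding \<kappa>(2) by simp
        have e2: "y * ?T / q2pi = \<sigma> * (b * t)" unfolding b by simp
        show ?thesis unfolding e1 e2 ..
      qed
      ultimately show "((\<lambda>\<tau>. expo \<tau> y (?z \<tau> ?T)) \<longlongrightarrow> of_real (- (t\<^sup>2 / 2)) - \<i> * of_real (\<sigma> * (b * t))) at_top" by (simp only:)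
    qed
    have "((\<lambda>\<tau>. ?h \<tau> t) \<longlongrightarrow> (exp (of_real (- (t\<^sup>2 / 2)) - \<i> * of_real (1 * (b * t))) - exp (of_real (- (t\<^sup>2 / 2)) - \<i> * of_real (- 1 * (b * t)))) / of_real t) at_top"
      using ex[of 1] ex[of "- 1"] True by (intro tendsto_intros) simp_all
    moreover have "(exp (of_real (- (t\<^sup>2 / 2)) - \<i> * of_real (1 * (b * t))) - exp (of_real (- (t\<^sup>2 / 2)) - \<i> * of_real (- 1 * (b * t)))) / of_real t = ?f t"
    proof -
      have "exp (of_real (- (t\<^sup>2 / 2)) - \<i> * of_real (1 * (b * t))) - exp (of_real (- (t\<^sup>2 / 2)) - \<i> * of_real (- 1 * (b * t)))
        = - 2 * \<i> * of_real (sin (b * t) * exp (- (t\<^sup>2 / 2)))"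
        by (simp add: complex_eq_iff Re_exp Im_exp)
      then show ?thesis using True by (simp add: f_def)
    qed
    ultimately have l: "((\<lambda>\<tau>. ?h \<tau> t) \<longlongrightarrow> ?f t) at_top" by (simp only:)
    show ?thesis
      by (rule Lim_transform_eventually[OF l]) (use ev True in \<open>auto elim!: eventually_mono\<close>)
  qed simp
  have fm: "?f \<in> borel_measurable lborel" unfolding f_def by measurable
  have evb: "\<forall>\<^sub>F \<tau> in at_top. \<tau> \<ge> 1 \<and> sqrt \<tau> \<ge> 400 * \<bar>y\<bar>"
  proof -
    have "\<forall>\<^sub>F \<tau> in at_top. sqrt \<tau> \<ge> 400 * \<bar>y\<bar>" using sqrt_at_top unfolding filterlim_at_top by blast
    then show ?thesis using eventually_ge_at_top[of "1::real"] by eventually_elim simp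
  qed
  \<comment> \<open>Dominated convergence asks for measurability at every \<tau>, which
    \<open>meas\<close> gives only for \<tau> \<ge> 1; smaller values are replaced by 0.\<close>
  define s' where "s' \<tau> = (if \<tau> \<ge> 1 then ?s \<tau> else (\<lambda>_. 0))" for \<tau>
  have lim': "((\<lambda>\<tau>. s' \<tau> t) \<longlongrightarrow> ?f t) at_top" for t
    by (rule Lim_transform_eventually[OF lim]) (use evb in \<open>auto elim!: eventually_mono simp: s'_def\<close>)
  have bd': "\<forall>\<^sub>F \<tau> in at_top. AE t in lborel. norm (s' \<tau> t) \<le> ?w t"
    using evb by eventually_elim (use bound in \<open>simp add: s'_def\<close>)
  have ms': "s' \<tau> \<in> borel_measurable lborel" for \<tau> using meas[of \<tau>] by (simp add: s'_def)
  have L: "((\<lambda>\<tau>. integral\<^sup>L lborel (s' \<tau>)) \<longlongrightarrow> integral\<^sup>L lborel ?f) at_top"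
    by (rule integral_dominated_convergence_at_top[OF _ _ w]) (use fm ms' lim' bd' in auto)
  have fi: "integrable lborel ?f"
    by (rule integrable_dominated_convergence_at_top[OF _ _ w]) (use fm ms' lim' bd' in auto)
  have "integrable lborel (\<lambda>t. (- 1 / 2) * Im (?f t))" by (rule integrable_mult_right[OF integrable_Im[OF fi]])
  moreover have "(- 1 / 2) * Im (?f t) = indicator {0<..} t *\<^sub>R f t" for t by simp
  ultimately show fi': "integrable lborel (\<lambda>t. indicator {0<..} t *\<^sub>R f t)" by (simp only:)
  have "\<forall>\<^sub>F \<tau> in at_top. integral\<^sup>L lborel (s' \<tau>) = PP \<tau> y sE - PP \<tau> y (cnj sE) - \<i> * of_real pi"
    using evb
  proof eventually_elim
    case (elim \<tau>)
    have "integrable lborel (s' \<tau>)"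
      by (rule Bochner_Integration.integrable_bound[OF w ms']) (use elim bound[of \<tau>] in \<open>auto simp: s'_def intro: order.trans[OF _ abs_ge_self]\<close>)
    then have "(s' \<tau> has_integral integral\<^sup>L lborel (s' \<tau>)) UNIV" by (rule has_integral_integral_lborel)
    moreover have "s' \<tau> = (\<lambda>t. if t \<in> {0..?c \<tau>} then ?h \<tau> t else 0)"
      using elim by (auto simp: s'_def indicator_def)
    moreover have "((\<lambda>t. if t \<in> {0..?c \<tau>} then ?h \<tau> t else 0) has_integral (PP \<tau> y sE - PP \<tau> y (cnj sE) - \<i> * of_real pi)) UNIV"
      unfolding has_integral_restrict_UNIV using saddle_integral[of \<tau> \<kappa> y] elim \<kappa> by simp
    ultimately show ?case by (metis has_integral_unique)
  qed
  from Lim_transform_eventually[OF L this]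
  have "((\<lambda>\<tau>. PP \<tau> y sE - PP \<tau> y (cnj sE) - \<i> * of_real pi) \<longlongrightarrow> integral\<^sup>L lborel ?f) at_top" .
  moreover have "integral\<^sup>L lborel ?f = - 2 * \<i> * of_real (\<integral>t. indicator {0<..} t *\<^sub>R f t \<partial>lborel)" by (simp only: integral_mult_right_zero integral_complex_of_real)
  ultimately show "((\<lambda>\<tau>. PP \<tau> y sE - PP \<tau> y (cnj sE) - \<i> * of_real pi) \<longlongrightarrow> - 2 * \<i> * of_real (\<integral>t. indicator {0<..} t *\<^sub>R f t \<partial>lborel)) at_top"
    by (simp only:)
qed

section \<open>The Gaussian distribution function\<close>

definition cumul :: "real \<Rightarrow> real" where "cumul x = integral {..x} (\<lambda>y. exp (- (y\<^sup>2 / 2)))"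

lemma gauss_half: "has_bochner_integral lborel (\<lambda>y::real. exp (- (y\<^sup>2 / 2))) (sqrt (2 * pi))"
  using gaussian_moment[of 1 0] by (simp add: gmoment_def)

lemma gauss_integrable_on: "S \<in> sets lborel \<Longrightarrow> (\<lambda>y::real. exp (- (y\<^sup>2 / 2))) integrable_on S"
proof -
  assume "S \<in> sets lborel"
  then have "set_integrable lborel S (\<lambda>y::real. exp (- (y\<^sup>2 / 2)))"
    unfolding set_integrable_def using gauss_half by (intro integrable_mult_indicator) (simp_all add: has_bochner_integral_iff)
  then show ?thesis by (rule set_borel_integral_eq_integral(1))
qed

lemma cumul_0: "cumul 0 = sqrt (2 * pi) / 2"
proof -
  let ?g = "\<lambda>y::real. exp (- (y\<^sup>2 / 2))"
  have si: "set_integrable lborel {0..} ?g"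
    unfolding set_integrable_def using gauss_half by (intro integrable_mult_indicator) (simp_all add: has_bochner_integral_iff)
  have "has_bochner_integral lborel (\<lambda>x. indicator {0..} x *\<^sub>R ?g x) (integral {0..} ?g)"
    using si set_borel_integral_eq_integral(2)[OF si] unfolding set_integrable_def set_lebesgue_integral_def
    by (simp add: has_bochner_integral_iff)
  then have "has_bochner_integral lborel ?g (2 *\<^sub>R integral {0..} ?g)" by (rule has_bochner_integral_even_function) simp
  then have h: "integral {0..} ?g = sqrt (2 * pi) / 2" using gauss_half has_bochner_integral_eq by fastforce
  have "(?g has_integral (cumul 0 + integral {0..} ?g)) ({..0} \<union> {0..})"
  proof (rule has_integral_Un)
    show "(?g has_integral cumul 0) {..0}" unfolding cumul_def by (intro integrable_integral gauss_integrable_on) simp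
    show "(?g has_integral integral {0..} ?g) {0..}" by (intro integrable_integral gauss_integrable_on) simp
    have "{..0} \<inter> {0..} = {0::real}" by auto
    then show "negligible ({..0} \<inter> {0::real..})" by simp
  qed
  moreover have "{..0} \<union> {0..} = (UNIV :: real set)" by auto
  moreover have "(?g has_integral sqrt (2 * pi)) UNIV"
    using gauss_half has_integral_integral_lborel[of ?g] by (simp add: has_bochner_integral_iff)
  ultimately have "cumul 0 + integral {0..} ?g = sqrt (2 * pi)" by (metis has_integral_unique)
  then show ?thesis using h by simp
qed

lemma DERIV_cumul: "(cumul has_real_derivative exp (- (x\<^sup>2 / 2))) (at x)"
proof -
  let ?g = "\<lambda>y::real. exp (- (y\<^sup>2 / 2))"
  have e: "cumul t = cumul (x - 1) + integral {x - 1..t} ?g" if "t \<in> {x - 1<..}" for t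
  proof -
    have "(?g has_integral (cumul (x - 1) + integral {x - 1..t} ?g)) ({..x - 1} \<union> {x - 1..t})"
    proof (rule has_integral_Un)
      show "(?g has_integral cumul (x - 1)) {..x - 1}" unfolding cumul_def by (intro integrable_integral gauss_integrable_on) simp
      show "(?g has_integral integral {x - 1..t} ?g) {x - 1..t}" by (intro integrable_integral gauss_integrable_on) simp
      have "{..x - 1} \<inter> {x - 1..t} = {x - 1}" using that by auto
      then show "negligible ({..x - 1} \<inter> {x - 1..t})" by simp
    qed
    moreover have "{..x - 1} \<union> {x - 1..t} = {..t}" using that by auto
    ultimately show ?thesis unfolding cumul_def[of t] by (metis integral_unique)
  qed
  have "((\<lambda>t. integral {x - 1..t} ?g) has_real_derivative ?g x) (at x within {x - 1..x + 1})"
    by (rule integral_has_real_derivative) (auto intro!: continuous_intros)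
  then have "((\<lambda>t. integral {x - 1..t} ?g) has_real_derivative ?g x) (at x)" by (simp add: at_within_Icc_at)
  then have "((\<lambda>t. cumul (x - 1) + integral {x - 1..t} ?g) has_real_derivative ?g x) (at x)"
    by (auto intro!: derivative_eq_intros)
  then show ?thesis
    by (rule has_field_derivative_transform_within_open[where S="{x - 1<..}"]) (simp_all add: e)
qed

text \<open>The real part of the characteristic function of the standard normal
  distribution.\<close>

lemma gauss_cos_transform:
  "(\<integral>t. exp (- (t\<^sup>2 / 2)) * cos (s * t) \<partial>lborel) = sqrt (2 * pi) * exp (- (s\<^sup>2 / 2))"
proof -
  have "char std_normal_distribution s = (\<integral>t. std_normal_density t *\<^sub>R iexp (s * t) \<partial>lborel)"
    unfolding char_def by (subst integral_density) auto
  then have c: "(\<integral>t. std_normal_density t *\<^sub>R iexp (s * t) \<partial>lborel) = of_real (exp (- s\<^sup>2 / 2))"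
    by (simp add: char_std_normal_distribution)
  have i: "integrable lborel (\<lambda>t. std_normal_density t *\<^sub>R iexp (s * t))"
  proof (rule Bochner_Integration.integrable_bound)
    show "integrable lborel std_normal_density" by simp
    show "AE t in lborel. norm (std_normal_density t *\<^sub>R iexp (s * t)) \<le> norm (std_normal_density t)" by simp
  qed measurable
  have "(\<integral>t. Re (std_normal_density t *\<^sub>R iexp (s * t)) \<partial>lborel) = exp (- s\<^sup>2 / 2)"
    using integral_Re[OF i] c by simp
  moreover have "Re (std_normal_density t *\<^sub>R iexp (s * t)) = 1 / sqrt (2 * pi) * (exp (- (t\<^sup>2 / 2)) * cos (s * t))" for t
    by (simp add: std_normal_density_def Re_exp)
  ultimately have "1 / sqrt (2 * pi) * (\<integral>t. exp (- (t\<^sup>2 / 2)) * cos (s * t) \<partial>lborel) = exp (- s\<^sup>2 / 2)" by simp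
  then show ?thesis by (simp add: field_simps)
qed

text \<open>Write sin (b t) / t as the integral of b cos (u b t) over u in [0, 1] and exchange the
  integrals; the cosine transform of the Gaussian is again a Gaussian, at u b, and its integral over
  u is an increment of \<open>cumul\<close>.\<close>

lemma gauss_sine_integral:
  fixes b :: real
  defines "f \<equiv> \<lambda>t::real. sin (b * t) * exp (- (t\<^sup>2 / 2)) / t"
  assumes "integrable lborel (\<lambda>t. indicator {0<..} t *\<^sub>R f t)"
  shows "(\<integral>t. indicator {0<..} t *\<^sub>R f t \<partial>lborel) = sqrt (2 * pi) / 2 * (cumul b - cumul 0)"
proof -
  let ?S = "\<integral>t. indicator {0<..} t *\<^sub>R f t \<partial>lborel"
  let ?g = "\<lambda>t::real. exp (- (t\<^sup>2 / 2))"
  let ?k = "\<lambda>u t. indicator {0..1} u * (b * (?g t * cos (u * b * t)))"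
  \<comment> \<open>At t = 0 the two indicators differ, but \<open>f\<close> is 0 there because of
    the division by zero.\<close>
  have "indicator {0<..} t *\<^sub>R f t = indicator {0..} t *\<^sub>R f t" for t
    by (cases "t = 0") (auto simp: f_def indicator_def)
  then have "has_bochner_integral lborel (\<lambda>t. indicator {0..} t *\<^sub>R f t) ?S"
    using assms(2) unfolding has_bochner_integral_iff by (simp only: simp_thms)
  then have "has_bochner_integral lborel f (2 *\<^sub>R ?S)" by (rule has_bochner_integral_even_function) (simp add: f_def)
  then have "2 * ?S = integral\<^sup>L lborel f" by (simp add: has_bochner_integral_iff)
  also have "\<dots> = (\<integral>t. (\<integral>u. ?k u t \<partial>lborel) \<partial>lborel)"
  proof (rule integral_cong_AE)
    have "f t = (\<integral>u. ?k u t \<partial>lborel)" if t: "t \<noteq> 0" for t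
    proof -
      have "(\<integral>u. indicator {0..1} u *\<^sub>R (b * (?g t * cos (u * b * t))) \<partial>lborel) = ?g t * sin (1 * b * t) / t - ?g t * sin (0 * b * t) / t"
      proof (rule integral_FTC_Icc)
        fix u :: real
        show "((\<lambda>u. ?g t * sin (u * b * t) / t) has_vector_derivative b * (?g t * cos (u * b * t))) (at u within {0..1})"
          unfolding has_real_derivative_iff_has_vector_derivative[symmetric]
          using t by (auto intro!: derivative_eq_intros)
      qed (auto intro!: continuous_intros)
      then show ?thesis by (simp add: f_def mult.commute)
    qed
    moreover have "AE t in lborel. t \<noteq> (0::real)" by (rule AE_lborel_singleton)
    ultimately show "AE t in lborel. f t = (\<integral>u. ?k u t \<partial>lborel)" by (auto elim!: eventually_mono)
    show "f \<in> borel_measurable lborel" unfolding f_def by measurable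
    show "(\<lambda>t. \<integral>u. ?k u t \<partial>lborel) \<in> borel_measurable lborel" by measurable
  qed
  also have "\<dots> = (\<integral>u. (\<integral>t. ?k u t \<partial>lborel) \<partial>lborel)"
  proof (rule lborel_pair.Fubini_integral)
    have "integrable (lborel \<Otimes>\<^sub>M lborel) (\<lambda>(u, t). indicator {0..1::real} u * (\<bar>b\<bar> * ?g t))"
    proof (rule lborel_pair.Fubini_integrable)
      show "(\<lambda>(u, t). indicator {0..1::real} u * (\<bar>b\<bar> * ?g t)) \<in> borel_measurable (lborel \<Otimes>\<^sub>M lborel)" by measurable
      have g: "integrable lborel ?g" using gauss_half by (simp add: has_bochner_integral_iff)
      then show "AE u in lborel. integrable lborel (\<lambda>t. case (u, t) of (u, t) \<Rightarrow> indicator {0..1::real} u * (\<bar>b\<bar> * ?g t))" by simp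
      have "(\<integral>t. norm (case (u, t) of (u, t) \<Rightarrow> indicator {0..1::real} u * (\<bar>b\<bar> * ?g t)) \<partial>lborel) = (\<bar>b\<bar> * (\<integral>t. ?g t \<partial>lborel)) * indicator {0..1} u" for u
        by (simp add: abs_mult)
      then show "integrable lborel (\<lambda>u. \<integral>t. norm (case (u, t) of (u, t) \<Rightarrow> indicator {0..1::real} u * (\<bar>b\<bar> * ?g t)) \<partial>lborel)"
        by simp
    qed
    then show "integrable (lborel \<Otimes>\<^sub>M lborel) (\<lambda>(u, t). ?k u t)"
    proof (rule Bochner_Integration.integrable_bound)
      show "(\<lambda>(u, t). ?k u t) \<in> borel_measurable (lborel \<Otimes>\<^sub>M lborel)" by measurable
      have "norm (?k u t) \<le> norm (indicator {0..1::real} u * (\<bar>b\<bar> * ?g t))" for u t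
      proof -
        have "\<bar>b\<bar> * (?g t * \<bar>cos (u * b * t)\<bar>) \<le> \<bar>b\<bar> * (?g t * 1)" by (intro mult_left_mono) auto
        then show ?thesis by (simp add: abs_mult indicator_def)
      qed
      then show "AE p in lborel \<Otimes>\<^sub>M lborel. norm (case p of (u, t) \<Rightarrow> ?k u t) \<le> norm (case p of (u, t) \<Rightarrow> indicator {0..1::real} u * (\<bar>b\<bar> * ?g t))"
        by (auto simp: case_prod_beta)
    qed
  qed
  also have "\<dots> = (\<integral>u. indicator {0..1} u *\<^sub>R (sqrt (2 * pi) * (b * ?g (u * b))) \<partial>lborel)"
    using gauss_cos_transform[of "u * b" for u] by (simp add: mult_ac)
  also have "\<dots> = sqrt (2 * pi) * cumul (1 * b) - sqrt (2 * pi) * cumul (0 * b)"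
  proof (rule integral_FTC_Icc)
    fix u :: real
    have "((\<lambda>u. cumul (u * b)) has_real_derivative ?g (u * b) * b) (at u)"
      by (rule DERIV_chain2[OF DERIV_cumul]) (auto intro!: derivative_eq_intros)
    then have "((\<lambda>u. sqrt (2 * pi) * cumul (u * b)) has_real_derivative sqrt (2 * pi) * (?g (u * b) * b)) (at u within {0..1})"
      by (intro DERIV_cmult) (rule has_field_derivative_at_within)
    then show "((\<lambda>u. sqrt (2 * pi) * cumul (u * b)) has_vector_derivative sqrt (2 * pi) * (b * ?g (u * b))) (at u within {0..1})"
      unfolding has_real_derivative_iff_has_vector_derivative by (simp add: mult.commute)
  qed (auto intro!: continuous_intros)
  finally show ?thesis by (simp add: right_diff_distrib)
qed

text \<open>The origin of the constant in the theorem: cdiff 1 = 1 / (4 sqrt 2) fixes \<kappa>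
  through the quadratic term. Then \<kappa> / sqrt (2 \<pi>) equals sqrt 2 / \<pi>^(1/4), so that
  the scale \<pi>^(1/4) / sqrt 2 makes the slope \<open>b\<close> of \<open>saddle_limit\<close>
  equal to x.\<close>

lemma scale_constant:
  defines "\<kappa> \<equiv> sqrt (q2pi / (2 * cdiff 1))"
  shows "\<kappa> > 0" "cdiff 1 / q2pi * \<kappa>\<^sup>2 = 1 / 2" "pi powr (1 / 4) / sqrt 2 * \<kappa> / q2pi = 1"
proof -
  have c1: "cdiff 1 = 1 / (4 * sqrt 2)"
  proof -
    have a: "(2::real) powr (3 / 2) = 2 * sqrt 2" "(2::real) powr (5 / 2) = 4 * sqrt 2"
      using powr_add[of "2::real" 1 "1 / 2"] powr_add[of "2::real" 2 "1 / 2"] by (simp_all add: powr_half_sqrt)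
    show ?thesis by (simp add: cdiff_def a)
  qed
  have c0: "cdiff 1 > 0" unfolding c1 by simp
  show k0: "\<kappa> > 0" unfolding \<kappa>_def using c0 q2pi by (intro real_sqrt_gt_zero divide_pos_pos) auto
  have k2: "\<kappa>\<^sup>2 = q2pi / (2 * cdiff 1)" unfolding \<kappa>_def using c0 q2pi by (intro real_sqrt_pow2 divide_nonneg_pos) auto
  show "cdiff 1 / q2pi * \<kappa>\<^sup>2 = 1 / 2" unfolding k2 using c0 q2pi by simp
  have p4: "(pi powr (1 / 4))\<^sup>2 = sqrt pi"
  proof -
    have "(pi powr (1 / 4))\<^sup>2 = pi powr (1 / 4 + 1 / 4)" unfolding powr_add power2_eq_square ..
    then show ?thesis by (simp add: powr_half_sqrt)
  qed
  have "(pi powr (1 / 4) / sqrt 2 * \<kappa> / q2pi)\<^sup>2 = sqrt pi / 2 * (q2pi / (2 * cdiff 1)) / q2pi\<^sup>2"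
    by (simp add: power_mult_distrib power_divide p4 k2)
  also have "\<dots> = sqrt pi / 2 * (2 * sqrt 2) / q2pi" unfolding c1 using q2pi by (simp add: power2_eq_square)
  also have "\<dots> = 1" by (simp add: q2pi_def real_sqrt_mult)
  finally have "(pi powr (1 / 4) / sqrt 2 * \<kappa> / q2pi)\<^sup>2 = 1" .
  moreover have "pi powr (1 / 4) / sqrt 2 * \<kappa> / q2pi > 0" using k0 q2pi by simp
  ultimately show "pi powr (1 / 4) / sqrt 2 * \<kappa> / q2pi = 1" by (auto simp: power2_eq_1_iff)
qed

lemma w3_eq: "of_real eps - 2 * of_real pi * \<i> = w3" "of_real eps + 2 * of_real pi * \<i> = cnj w3"
  by (simp_all add: w3_def complex_eq_iff)

theorem theorem1p5:
  fixes x \<gamma> R :: real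
  assumes "0 < R" and "R < 1"
  shows "((\<lambda>\<tau>. F R (- \<tau> + pi powr (1 / 4) / sqrt 2 * x * \<tau> powr (1 / 2)) \<tau> \<gamma>)
           \<longlongrightarrow> of_real (1 / sqrt (2 * pi) * integral {..x} (\<lambda>y. exp (- (y\<^sup>2 / 2))))) at_top"
proof -
  define y where "y = pi powr (1 / 4) / sqrt 2 * x"
  define \<kappa> where "\<kappa> = sqrt (q2pi / (2 * cdiff 1))"
  note k = scale_constant[folded \<kappa>_def]
  have "y * \<kappa> / q2pi = x * (pi powr (1 / 4) / sqrt 2 * \<kappa> / q2pi)" by (simp add: y_def)
  then have b: "x = y * \<kappa> / q2pi" unfolding k(3) by simp
  let ?S = "sqrt (2 * pi) / 2 * (cumul x - cumul 0)"
  let ?I = "\<lambda>\<tau>. contour_integral (linepath (of_real eps - 2 * of_real pi * \<i>) (of_real eps + 2 * of_real pi * \<i>)) (mainterm \<tau> y) / (4 * of_real pi * \<i>)"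
  note S = saddle_limit[OF k(1,2) b]
  have s1: "((\<lambda>\<tau>. PP \<tau> y sE - PP \<tau> y (cnj sE) - \<i> * of_real pi) \<longlongrightarrow> - 2 * \<i> * of_real ?S) at_top"
    using S(2) unfolding gauss_sine_integral[OF S(1)] .
  have "w3 \<notin> \<real>\<^sub>\<le>\<^sub>0" by (simp add: complex_nonpos_Reals_iff w3_def eps_def)
  then have cs: "cnj sS = - csqrt (cnj w3)" unfolding sS_def by (simp add: cnj_csqrt)
  have I: "?I \<tau> = (PP \<tau> y sS - PP \<tau> y (cnj sS)) / (2 * of_real pi * \<i>)" for \<tau>
  proof -
    have "2 * u / (4 * of_real pi * \<i>) = u / (2 * of_real pi * \<i>)" for u :: complex
      using mult_divide_mult_cancel_left[of 2 u "2 * of_real pi * \<i>"] by simp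
    then show ?thesis unfolding contour_integral_mainterm unfolding w3_eq cs unfolding sS_def .
  qed
  \<comment> \<open>A telescoping identity: the increment of \<open>PP\<close> between the ends of
    the line is the increment between \<open>cnj sE\<close> and \<open>sE\<close>, up to the two
    differences that vanish in the limit.\<close>
  have "((\<lambda>\<tau>. ((PP \<tau> y sE - PP \<tau> y (cnj sE) - \<i> * of_real pi) - (PP \<tau> y sE - PP \<tau> y sS) + (PP \<tau> y (cnj sE) - PP \<tau> y (cnj sS)) + \<i> * of_real pi) / (2 * of_real pi * \<i>))
     \<longlongrightarrow> (- 2 * \<i> * of_real ?S - 0 + 0 + \<i> * of_real pi) / (2 * of_real pi * \<i>)) at_top"
    by (intro tendsto_intros s1 PP_upper PP_lower) simp
  then have I_lim: "(?I \<longlongrightarrow> (- 2 * \<i> * of_real ?S - 0 + 0 + \<i> * of_real pi) / (2 * of_real pi * \<i>)) at_top"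
    unfolding I by (simp add: algebra_simps)
  \<comment> \<open>The half residue contributes 1 / 2. It cancels against the value of
    \<open>cumul\<close> at 0, which is half of the total Gaussian mass.\<close>
  have val: "1 - (- 2 * \<i> * of_real ?S - 0 + 0 + \<i> * of_real pi) / (2 * of_real pi * \<i>) = of_real (1 / sqrt (2 * pi) * cumul x)"
  proof -
    have "(- 2 * \<i> * of_real ?S - 0 + 0 + \<i> * of_real pi) / (2 * of_real pi * \<i>) = of_real (1 / 2 - ?S / pi)"
      by (simp add: divide_simps) (simp add: algebra_simps)
    moreover have "1 - (1 / 2 - ?S / pi) = 1 / sqrt (2 * pi) * cumul x"
    proof -
      define q where "q = sqrt (2 * pi)"
      have q: "q > 0" "pi = q * q / 2" by (simp_all add: q_def)
      show ?thesis unfolding cumul_0 q_def[symmetric] unfolding q(2) using q(1) by (simp add: field_simps)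
    qed
    ultimately show ?thesis by (metis of_real_1 of_real_diff)
  qed
  have "((\<lambda>\<tau>. (F R (- \<tau> + y * sqrt \<tau>) \<tau> \<gamma> - (1 - ?I \<tau>)) + (1 - ?I \<tau>)) \<longlongrightarrow> 0 + (1 - (- 2 * \<i> * of_real ?S - 0 + 0 + \<i> * of_real pi) / (2 * of_real pi * \<i>))) at_top"
    by (intro tendsto_add[OF F_minus_mainterm_tendsto_0[OF assms]] tendsto_diff tendsto_const I_lim)
  then have L: "((\<lambda>\<tau>. F R (- \<tau> + y * sqrt \<tau>) \<tau> \<gamma>) \<longlongrightarrow> of_real (1 / sqrt (2 * pi) * cumul x)) at_top"
    unfolding val by simp
  have "\<forall>\<^sub>F \<tau> in at_top. F R (- \<tau> + y * sqrt \<tau>) \<tau> \<gamma> = F R (- \<tau> + pi powr (1 / 4) / sqrt 2 * x * \<tau> powr (1 / 2)) \<tau> \<gamma>"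
    using eventually_ge_at_top[of 0] by eventually_elim (simp add: y_def powr_half_sqrt)
  from Lim_transform_eventually[OF L this] show ?thesis unfolding cumul_def .
qed

end
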